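(* Let $X=(X_1,\dots,X_n)$ be a sample from a time series, with $S_k=\sum_{j=1}^kX_j$ and $S^*_{n-k}=\sum_{j=k+1}^nX_j$, and let $\mathcal T=[\underline\tau,\overline\tau]\subset(0,1)$. (i) Let there exist $0\le\upsilon_0<\upsilon_1\le1$ and normalizations $\gamma_{ni}\to\infty$ and $A_{ni}$, $i=1,2$, such that $$\Big(\gamma_{n1}^{-1}\big(S_{\lfloor n\tau_1\rfloor}-\lfloor n\tau_1\rfloor A_{n1}\big),\ \gamma_{n2}^{-1}\big(S^*_{\lfloor n\tau_2\rfloor}-\lfloor n\tau_2\rfloor A_{n2}\big)\Big)\longrightarrow_{D[0,\upsilon_1]\times D[0,1-\upsilon_0]}\big(Z_1(\tau_1),Z_2(\tau_2)\big),$$ where $(Z_1(\tau_1),Z_2(\tau_2))$ is a two-dimensional random process having a.s. continuous trajectories on $[\upsilon_0,\upsilon_1]\times[1-\upsilon_1,1-\upsilon_0]$. Then $$\Big(\frac n{\gamma_{n1}^2}V_{\lfloor n\tau_1\rfloor}(X),\ \frac n{\gamma_{n2}^2}V^*_{n-\lfloor n\tau_2\rfloor}(X)\Big)\longrightarrow_{D(0,\upsilon_1]\times D[\upsilon_0,1)}\big(Q_{\tau_1}(Z_1),\,Q_{1-\tau_2}(Z_2)\big).$$ Moreover, the limit process $(Q_{\tau_1}(Z_1),Q_{1-\tau_2}(Z_2))$ is a.s. continuous on $(\upsilon_0,\upsilon_1]\times[\upsilon_0,\upsilon_1)$. (ii) Assume, in addition to the assumptions of (i), that $\mathcal T\subset[\upsilon_0,\upsilon_1]$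 and that $Q_\tau(Z_1)>0$ a.s. for any $\tau\in\mathcal T$. Then, as $n\to\infty$, $$(\gamma_{n1}/\gamma_{n2})^2W_n(X)\to_{\rm law}\sup_{\tau\in\mathcal T}\frac{Q_{1-\tau}(Z_2)}{Q_\tau(Z_1)},\qquad(\gamma_{n1}/\gamma_{n2})^2I_n(X)\to_{\rm law}\int_{\mathcal T}\frac{Q_{1-\tau}(Z_2)}{Q_\tau(Z_1)}\,d\tau,$$ $$(\gamma_{n1}/\gamma_{n2})^2R_n(X)\to_{\rm law}\frac{\inf_{\tau\in\mathcal T}Q_{1-\tau}(Z_2)}{\inf_{\tau\in\mathcal T}Q_\tau(Z_1)}.$$ (iii) Assume, in addition to the assumptions of (i), that $\mathcal T\subset[\upsilon_0,\upsilon_1]$, $Z_1(\tau)\equiv0$ for $\tau\in\mathcal T$, and the process $\{Q_{1-\tau}(Z_2),\tau\in\mathcal T\}$ is nondegenerate. Then each of $(\gamma_{n1}/\gamma_{n2})^2W_n(X)$, $(\gamma_{n1}/\gamma_{n2})^2I_n(X)$ and $(\gamma_{n1}/\gamma_{n2})^2R_n(X)$ tends to $\infty$ in probability.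
   Context: $D[a,b]$ is the space of real-valued cadlag functions on $[a,b]$; it and the products $D[a_1,b_1]\times D[a_2,b_2]$ are endowed with the uniform topology and the $\sigma$-field generated by the open balls. $\longrightarrow_{D[a,b]}$, $\longrightarrow_{D[a_1,b_1]\times D[a_2,b_2]}$ denote weak convergence of random elements as $n\to\infty$; convergence in $D(0,\upsilon_1]\times D[\upsilon_0,1)$ means convergence in $D[\upsilon,\upsilon_1]\times D[\upsilon_0,\upsilon']$ for all $0<\upsilon<\upsilon_1$, $\upsilon_0<\upsilon'<1$. $\to_{\rm law}$ is convergence in law. A random process $Z$ on an interval is nondegenerate if $P(Z(u)=0\text{ for all }u\text{ in the interval})=0$. Statistics: for $1\le k<n$, $$V_k(X):=\frac1{k^2}\sum_{j=1}^k\Big(S_j-\frac jkS_k\Big)^2-\Big(\frac1{k^{3/2}}\sum_{j=1}^k\big(S_j-\frac jkS_k\big)\Big)^2,$$ $$V^*_{n-k}(X):=\frac1{(n-k)^2}\sum_{j=k+1}^n\Big(S^*_{n-j+1}-\frac{n-j+1}{n-k}S^*_{n-k}\Big)^2-\Big(\frac1{(n-k)^{3/2}}\sum_{j=k+1}^n\big(S^*_{n-j+1}-\frac{n-j+1}{n-k}S^*_{n-k}\big)\Big)^2.$$ With $\mathcal L_n(\tau):=V^*_{n-\lfloor n\tau\rfloor}(X)/V_{\lfloor n\tau\rfloor}(X)$, $$W_n(X):=\sup_{\tau\in\mathcal T}\mathcal L_n(\tau),\quad I_n(X):=\int_{\mathcal T}\mathcal L_n(\tau)\,d\tau,\quad R_n(X):=\frac{\inf_{\tau\in\mathcal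 T}V^*_{n-\lfloor n\tau\rfloor}(X)}{\inf_{\tau\in\mathcal T}V_{\lfloor n\tau\rfloor}(X)}.$$ For a process $Z$ and $\tau>0$, $$Q_\tau(Z):=\frac1{\tau^2}\Big[\int_0^\tau\big(Z(u)-\frac u\tau Z(\tau)\big)^2du-\frac1\tau\Big(\int_0^\tau\big(Z(u)-\frac u\tau Z(\tau)\big)du\Big)^2\Big].$$
   Formalization: As printed, (i) and R_n in (iii) can fail. Added: if υ0>0 and Z2 is a.s. linear on [0,1-υ0], (X_{⌊nυ0⌋+1}-A_{n2})/γ_{n2}→0 in probability; for R_n in (iii), Q_{1-τ}(Z2)>0 a.s. for each τ in T. X is one fixed sequence and T has more than one point. *)

theory Defs
  imports "HOL-Probability.Probability"
begin

section \<open>Weak convergence for the uniform metric and the ball \<open>\<sigma>\<close>-field\<close>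

definition cadlag_on :: "real \<Rightarrow> real \<Rightarrow> (real \<Rightarrow> real) \<Rightarrow> bool" where
  "cadlag_on a b x \<longleftrightarrow>
     (\<forall>t\<in>{a..<b}. (x \<longlongrightarrow> x t) (at_right t)) \<and>
     (\<forall>t\<in>{a<..b}. \<exists>l. (x \<longlongrightarrow> l) (at_left t))"

text \<open>
  The space \<open>D[a,b]\<close> with the uniform metric. Members of \<^const>\<open>funspace\<close> are bounded, which every
  cadlag function on a compact interval is, and are \<^const>\<open>undefined\<close> outside \<open>[a,b]\<close>; paths
  therefore have to be restricted to \<open>[a,b]\<close>.
\<close>

definition D_metric :: "real \<Rightarrow> real \<Rightarrow> (real \<Rightarrow> real) metric" where
  "D_metric a b = submetric (funspace {a..b} euclidean_metric) {x. cadlag_on a b x}"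

text \<open>
  Products carry the maximum metric, not the Euclidean \<^const>\<open>prod_metric\<close>: both induce the same
  topology, but here the open balls are the products of open balls, so that the ball
  \<open>\<sigma>\<close>-field of the product is the product of the ball \<open>\<sigma>\<close>-fields.
\<close>

definition max_metric :: "'a metric \<Rightarrow> 'b metric \<Rightarrow> ('a \<times> 'b) metric" where
  "max_metric m1 m2 =
     metric (mspace m1 \<times> mspace m2,
             \<lambda>p q. max (mdist m1 (fst p) (fst q)) (mdist m2 (snd p) (snd q)))"

lemma Metric_space_max:
  "Metric_space (mspace m1 \<times> mspace m2)
     (\<lambda>p q. max (mdist m1 (fst p) (fst q)) (mdist m2 (snd p) (snd q)))"
proof
  fix p q r
  show "0 \<le> max (mdist m1 (fst p) (fst q)) (mdist m2 (snd p) (snd q))"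
    by (simp add: le_max_iff_disj)
  show "max (mdist m1 (fst p) (fst q)) (mdist m2 (snd p) (snd q)) =
        max (mdist m1 (fst q) (fst p)) (mdist m2 (snd q) (snd p))"
    by (simp add: mdist_commute)
  assume p: "p \<in> mspace m1 \<times> mspace m2" and q: "q \<in> mspace m1 \<times> mspace m2"
  show "max (mdist m1 (fst p) (fst q)) (mdist m2 (snd p) (snd q)) = 0 \<longleftrightarrow> p = q"
  proof
    assume "max (mdist m1 (fst p) (fst q)) (mdist m2 (snd p) (snd q)) = 0"
    then have "mdist m1 (fst p) (fst q) \<le> 0" "mdist m2 (snd p) (snd q) \<le> 0"
      by (metis max.cobounded1, metis max.cobounded2)
    then have "mdist m1 (fst p) (fst q) = 0" "mdist m2 (snd p) (snd q) = 0"
      by (simp_all add: antisym)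
    then show "p = q"
      using p q by (auto simp: prod_eq_iff mem_Times_iff)
  next
    assume "p = q"
    with p have "mdist m1 (fst p) (fst q) = 0" "mdist m2 (snd p) (snd q) = 0"
      by (auto simp: mem_Times_iff)
    then show "max (mdist m1 (fst p) (fst q)) (mdist m2 (snd p) (snd q)) = 0"
      by simp
  qed
  assume r: "r \<in> mspace m1 \<times> mspace m2"
  have "mdist m1 (fst p) (fst r) \<le> mdist m1 (fst p) (fst q) + mdist m1 (fst q) (fst r)"
    using p q r by (auto intro: mdist_triangle)
  moreover have "mdist m2 (snd p) (snd r) \<le> mdist m2 (snd p) (snd q) + mdist m2 (snd q) (snd r)"
    using p q r by (auto intro: mdist_triangle)
  ultimately show "max (mdist m1 (fst p) (fst r)) (mdist m2 (snd p) (snd r)) \<le>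
      max (mdist m1 (fst p) (fst q)) (mdist m2 (snd p) (snd q)) +
      max (mdist m1 (fst q) (fst r)) (mdist m2 (snd q) (snd r))"
    by linarith
qed

lemma mspace_max_metric [simp]: "mspace (max_metric m1 m2) = mspace m1 \<times> mspace m2"
  unfolding max_metric_def by (rule Metric_space.mspace_metric[OF Metric_space_max])

lemma mdist_max_metric:
  "mdist (max_metric m1 m2) =
     (\<lambda>p q. max (mdist m1 (fst p) (fst q)) (mdist m2 (snd p) (snd q)))"
  unfolding max_metric_def by (rule Metric_space.mdist_metric[OF Metric_space_max])

definition ball_sigma :: "'s metric \<Rightarrow> 's measure" where
  "ball_sigma m =
     sigma (mspace m) {Metric_space.mball (mspace m) (mdist m) x r | x r. x \<in> mspace m}"

text \<open>
  Convergence in distribution of random elements for the ball \<open>\<sigma>\<close>-field (Dudley, Pollard,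
  Billingsley): the test functions are bounded, continuous and ball-measurable. The limit
  \<open>Y\<close> may be defined on another probability space and need only be almost surely equal to a
  random element of \<open>m\<close>, as its paths may be irregular on a null set.
\<close>

definition converges_weakly ::
  "'s metric \<Rightarrow> 'a measure \<Rightarrow> (nat \<Rightarrow> 'a \<Rightarrow> 's) \<Rightarrow> 'b measure \<Rightarrow> ('b \<Rightarrow> 's) \<Rightarrow> bool" where
  "converges_weakly m M Xs N Y \<longleftrightarrow>
     (\<forall>n. Xs n \<in> M \<rightarrow>\<^sub>M ball_sigma m) \<and>
     (\<exists>Y'. Y' \<in> N \<rightarrow>\<^sub>M ball_sigma m \<and> (AE \<omega> in N. Y \<omega> = Y' \<omega>) \<and>
       (\<forall>f :: 's \<Rightarrow> real.
          f \<in> borel_measurable (ball_sigma m) \<and>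
          continuous_map (mtopology_of m) euclideanreal f \<and>
          bounded (f ` mspace m) \<longrightarrow>
          (\<lambda>n. \<integral>\<omega>. f (Xs n \<omega>) \<partial>M) \<longlonglongrightarrow> (\<integral>\<omega>. f (Y' \<omega>) \<partial>N)))"

definition converges_weakly_D2 ::
  "real \<Rightarrow> real \<Rightarrow> real \<Rightarrow> real \<Rightarrow> 'a measure \<Rightarrow>
   (nat \<Rightarrow> 'a \<Rightarrow> real \<Rightarrow> real) \<Rightarrow> (nat \<Rightarrow> 'a \<Rightarrow> real \<Rightarrow> real) \<Rightarrow>
   'b measure \<Rightarrow> ('b \<Rightarrow> real \<Rightarrow> real) \<Rightarrow> ('b \<Rightarrow> real \<Rightarrow> real) \<Rightarrow> bool" where
  "converges_weakly_D2 a1 b1 a2 b2 M X1 X2 N Y1 Y2 \<longleftrightarrow>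
     converges_weakly (max_metric (D_metric a1 b1) (D_metric a2 b2))
       M (\<lambda>n \<omega>. (restrict (X1 n \<omega>) {a1..b1}, restrict (X2 n \<omega>) {a2..b2}))
       N (\<lambda>\<omega>. (restrict (Y1 \<omega>) {a1..b1}, restrict (Y2 \<omega>) {a2..b2}))"

definition converges_in_law ::
  "'a measure \<Rightarrow> (nat \<Rightarrow> 'a \<Rightarrow> real) \<Rightarrow> 'b measure \<Rightarrow> ('b \<Rightarrow> real) \<Rightarrow> bool" where
  "converges_in_law M T N Y \<longleftrightarrow>
     (\<forall>n. T n \<in> borel_measurable M) \<and>
     (\<exists>Y'. Y' \<in> borel_measurable N \<and> (AE \<omega> in N. Y \<omega> = Y' \<omega>) \<and>
        weak_conv_m (\<lambda>n. distr M borel (T n)) (distr N borel Y'))"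

definition tends_to_zero_in_prob :: "'a measure \<Rightarrow> (nat \<Rightarrow> 'a \<Rightarrow> real) \<Rightarrow> bool" where
  "tends_to_zero_in_prob M T \<longleftrightarrow>
     (\<forall>n. T n \<in> borel_measurable M) \<and>
     (\<forall>\<epsilon>>0. (\<lambda>n. measure M {\<omega> \<in> space M. \<bar>T n \<omega>\<bar> > \<epsilon>}) \<longlonglongrightarrow> 0)"

definition tends_to_infinity_in_prob :: "'a measure \<Rightarrow> (nat \<Rightarrow> 'a \<Rightarrow> real) \<Rightarrow> bool" where
  "tends_to_infinity_in_prob M T \<longleftrightarrow>
     (\<forall>n. T n \<in> borel_measurable M) \<and>
     (\<forall>K. (\<lambda>n. measure M {\<omega> \<in> space M. T n \<omega> > K}) \<longlonglongrightarrow> 1)"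

definition nondegenerate_on ::
  "'b measure \<Rightarrow> real set \<Rightarrow> ('b \<Rightarrow> real \<Rightarrow> real) \<Rightarrow> bool" where
  "nondegenerate_on N J Z \<longleftrightarrow> (AE \<omega> in N. \<not> (\<forall>u\<in>J. Z \<omega> u = 0))"

section \<open>The statistics\<close>

text \<open>A sample \<open>x\<^sub>1, \<dots>, x\<^sub>n\<close> is given by \<open>x :: nat \<Rightarrow> real\<close>; the value \<open>x 0\<close> is never used.\<close>

definition psum :: "(nat \<Rightarrow> real) \<Rightarrow> nat \<Rightarrow> real" where
  "psum x k = (\<Sum>j=1..k. x j)"

text \<open>\<open>psum_star n x m\<close> is \<open>S\<^sup>*\<^sub>m\<close>, the sum of the last \<open>m\<close> of \<open>n\<close> observations
  (\<open>m = n - k\<close> gives the sum over \<open>k+1..n\<close>).\<close>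

definition psum_star :: "nat \<Rightarrow> (nat \<Rightarrow> real) \<Rightarrow> nat \<Rightarrow> real" where
  "psum_star n x m = (\<Sum>j=n-m+1..n. x j)"

definition V_stat :: "(nat \<Rightarrow> real) \<Rightarrow> nat \<Rightarrow> real" where
  "V_stat x k =
     1 / real k ^ 2 * (\<Sum>j=1..k. (psum x j - real j / real k * psum x k)^2)
     - (1 / real k powr (3/2) * (\<Sum>j=1..k. (psum x j - real j / real k * psum x k)))^2"

text \<open>\<open>V_star_stat n x m\<close> is \<open>V\<^sup>*\<^sub>m\<close>, where \<open>m = n - k\<close>.\<close>

definition V_star_stat :: "nat \<Rightarrow> (nat \<Rightarrow> real) \<Rightarrow> nat \<Rightarrow> real" where
  "V_star_stat n x m =
     1 / real m ^ 2 * (\<Sum>j=n-m+1..n.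
        (psum_star n x (n - j + 1) - real (n - j + 1) / real m * psum_star n x m)^2)
     - (1 / real m powr (3/2) * (\<Sum>j=n-m+1..n.
        (psum_star n x (n - j + 1) - real (n - j + 1) / real m * psum_star n x m)))^2"

definition fl :: "nat \<Rightarrow> real \<Rightarrow> nat" where
  "fl n \<tau> = nat \<lfloor>real n * \<tau>\<rfloor>"

definition L_ratio :: "nat \<Rightarrow> (nat \<Rightarrow> real) \<Rightarrow> real \<Rightarrow> real" where
  "L_ratio n x \<tau> = V_star_stat n x (n - fl n \<tau>) / V_stat x (fl n \<tau>)"

definition W_stat :: "real set \<Rightarrow> nat \<Rightarrow> (nat \<Rightarrow> real) \<Rightarrow> real" where
  "W_stat T n x = (SUP \<tau>\<in>T. L_ratio n x \<tau>)"

definition I_stat :: "real set \<Rightarrow> nat \<Rightarrow> (nat \<Rightarrow> real) \<Rightarrow> real" where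
  "I_stat T n x = (LBINT \<tau>:T. L_ratio n x \<tau>)"

definition R_stat :: "real set \<Rightarrow> nat \<Rightarrow> (nat \<Rightarrow> real) \<Rightarrow> real" where
  "R_stat T n x =
     (INF \<tau>\<in>T. V_star_stat n x (n - fl n \<tau>)) / (INF \<tau>\<in>T. V_stat x (fl n \<tau>))"

definition Q_fun :: "real \<Rightarrow> (real \<Rightarrow> real) \<Rightarrow> real" where
  "Q_fun \<tau> z =
     1 / \<tau>^2 * ((LBINT u:{0..\<tau>}. (z u - u / \<tau> * z \<tau>)^2)
                - 1 / \<tau> * (LBINT u:{0..\<tau>}. (z u - u / \<tau> * z \<tau>))^2)"

end

theory Submission
  imports Defs
begin

text \<open>
  Along \<open>n = 2\<^sup>k\<close> the normalized partial sum paths jump at dyadic times only, along \<open>n = 3\<^sup>k\<close> at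
  triadic times only. In the uniform topology a path without dyadic jumps stays away from one that jumps
  at a dyadic time, so the limit has almost surely neither kind of jump: it is continuous and
  separably supported. For such limits an extended continuous mapping theorem holds for the ball
  \<open>\<sigma>\<close>-field: a functional that converges along convergent paths is squeezed between Lipschitz functions
  built from distances to countably many centres, and these are ball measurable.
  The statistics are Riemann sums for \<open>Q\<close> of the paths, so parts (i) and (ii) follow.

  At \<open>\<tau> = \<upsilon>0\<close> the statistic \<open>V\<^sup>*\<close> may use one observation outside the range of the backward paths.
  Comparing the sample sizes \<open>n\<close> and \<open>n + l\<close> puts it inside that range; the two normalizations are comparable
  by convergence of types unless the limit is linear.

  In part (iii), comparing the sample sizes \<open>n\<close> and \<open>n / q\<close> shows that a first limit vanishing on \<open>T\<close>
  vanishes from time 0 on, so the denominators tend to 0. They are exactly 0 only for a sequence that is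
  constant so far, and such sequences carry no mass in the limit because they would make the backward limit
  degenerate.
\<close>

subsection \<open>Weak convergence for the ball \<open>\<sigma>\<close>-field\<close>

text \<open>The rescue is that partial sum paths are steps on the grid of multiples of
  \<open>1/n\<close>: countably many rational step functions approximate the paths of all sample
  sizes. The statement grants continuity of the limit on a part of the time interval only, whereas
  \<open>Q\<close> integrates from time 0. The bases 2 and 3 matter through coprimality alone: their
  grids share no time strictly between 0 and 1. Convergence of types is needed because centring and
  scaling are arbitrary sequences, related at different sample sizes by nothing but the convergence
  itself; it fails for linear limits, since a change of centring can produce or remove any linear
  function and leaves the scale undetermined.\<close>

lemma space_ball_sigma [simp]: "space (ball_sigma m) = mspace m"
  by (simp add: ball_sigma_def space_measure_of_conv)

lemma ball_in_ball_sigma: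
  assumes "x \<in> mspace m"
  shows "{y \<in> mspace m. mdist m x y < r} \<in> sets (ball_sigma m)"
proof -
  have "Metric_space.mball (mspace m) (mdist m) x r = {y \<in> mspace m. mdist m x y < r}"
    using assms by (auto simp: Metric_space.mball_def[OF Metric_space_mspace_mdist])
  moreover have "Metric_space.mball (mspace m) (mdist m) x r \<in> sets (ball_sigma m)"
    unfolding ball_sigma_def using assms
    by (auto intro!: in_measure_of simp: Metric_space.mball_def[OF Metric_space_mspace_mdist])
  ultimately show ?thesis by simp
qed

lemma mdist_ball_measurable:
  assumes "x \<in> mspace m"
  shows "mdist m x \<in> borel_measurable (ball_sigma m)"
  unfolding borel_measurable_iff_less
  using ball_in_ball_sigma[OF assms] by simp

text \<open>\<open>Y\<close> stands for the ball-measurable version of the limit, not for the limit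
  process itself; the two are exchanged off a null set at the very end.\<close>

locale weak_limit =
  fixes m :: "'s metric" and M :: "'a measure" and N :: "'b measure"
    and Xs :: "nat \<Rightarrow> 'a \<Rightarrow> 's" and Y :: "'b \<Rightarrow> 's"
  assumes M: "prob_space M" and N: "prob_space N"
    and Xs: "\<And>n. Xs n \<in> M \<rightarrow>\<^sub>M ball_sigma m" and Y: "Y \<in> N \<rightarrow>\<^sub>M ball_sigma m"
    and test: "\<And>f :: 's \<Rightarrow> real. f \<in> borel_measurable (ball_sigma m) \<Longrightarrow>
      continuous_map (mtopology_of m) euclideanreal f \<Longrightarrow> bounded (f ` mspace m) \<Longrightarrow>
      (\<lambda>n. \<integral>\<omega>. f (Xs n \<omega>) \<partial>M) \<longlonglongrightarrow> (\<integral>\<omega>. f (Y \<omega>) \<partial>N)"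
begin

sublocale M: prob_space M by (rule M)
sublocale N: prob_space N by (rule N)

lemma Xs_in: "\<omega> \<in> space M \<Longrightarrow> Xs n \<omega> \<in> mspace m"
  using measurable_space[OF Xs] by simp

lemma Y_in: "\<omega> \<in> space N \<Longrightarrow> Y \<omega> \<in> mspace m"
  using measurable_space[OF Y] by simp

lemma mdist_Xs_measurable: "x \<in> mspace m \<Longrightarrow> (\<lambda>\<omega>. mdist m x (Xs n \<omega>)) \<in> borel_measurable M"
  using measurable_compose[OF Xs mdist_ball_measurable] by simp

lemma mdist_Y_measurable: "x \<in> mspace m \<Longrightarrow> (\<lambda>\<omega>. mdist m x (Y \<omega>)) \<in> borel_measurable N"
  using measurable_compose[OF Y mdist_ball_measurable] by simp

text \<open>A supremum of functions with a common Lipschitz constant has the same constant, and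
  countability of the family preserves ball measurability. The supremum is thus an admissible test
  function although the space is not separable.\<close>

lemma SUP_test:
  fixes h :: "'i \<Rightarrow> 's \<Rightarrow> real"
  assumes I: "countable I" "I \<noteq> {}"
    and h: "\<And>i. i \<in> I \<Longrightarrow> h i \<in> borel_measurable (ball_sigma m)"
    and bd: "\<And>i y. i \<in> I \<Longrightarrow> y \<in> mspace m \<Longrightarrow> \<bar>h i y\<bar> \<le> B"
    and lip: "\<And>i y z. i \<in> I \<Longrightarrow> y \<in> mspace m \<Longrightarrow> z \<in> mspace m \<Longrightarrow> h i y \<le> h i z + k * mdist m y z"
  defines "g \<equiv> \<lambda>y. SUP i\<in>I. h i y"
  shows "g \<in> borel_measurable (ball_sigma m)"
    and "\<And>y. y \<in> mspace m \<Longrightarrow> \<bar>g y\<bar> \<le> B"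
    and "(\<lambda>n. \<integral>\<omega>. g (Xs n \<omega>) \<partial>M) \<longlonglongrightarrow> (\<integral>\<omega>. g (Y \<omega>) \<partial>N)"
proof -
  have bdd: "bdd_above ((\<lambda>i. h i y) ` I)" if "y \<in> mspace m" for y
    using bd[OF _ that] by (intro bdd_aboveI2[of _ _ B]) (fastforce simp: abs_le_iff)
  show meas: "g \<in> borel_measurable (ball_sigma m)"
    unfolding g_def using I h bdd by (intro borel_measurable_cSUP) auto
  show bdg: "\<bar>g y\<bar> \<le> B" if y: "y \<in> mspace m" for y
  proof -
    obtain i where i: "i \<in> I" using I by auto
    have "g y \<le> B" unfolding g_def using bd[OF _ y] I by (intro cSUP_least) (auto simp: abs_le_iff)
    moreover have "h i y \<le> g y" unfolding g_def using bdd[OF y] i by (intro cSUP_upper)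
    ultimately show ?thesis using bd[OF i y] by (auto simp: abs_le_iff)
  qed
  have le: "g y \<le> g z + k * mdist m y z" if "y \<in> mspace m" "z \<in> mspace m" for y z
    unfolding g_def
  proof (rule cSUP_least[OF I(2)])
    fix i assume i: "i \<in> I"
    have "h i z \<le> (SUP i\<in>I. h i z)" using bdd[OF that(2)] i by (intro cSUP_upper)
    with lip[OF i that] show "h i y \<le> (SUP i\<in>I. h i z) + k * mdist m y z" by linarith
  qed
  have "dist (g y) (g z) \<le> k * mdist m y z" if "y \<in> mspace m" "z \<in> mspace m" for y z
    using le[OF that] le[OF that(2,1)] by (simp add: dist_real_def abs_le_iff mdist_commute)
  then have "Lipschitz_continuous_map m euclidean_metric g"
    unfolding Lipschitz_continuous_map_def by auto
  from Lipschitz_continuous_imp_continuous_map[OF this]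
  have "continuous_map (mtopology_of m) euclideanreal g" by simp
  moreover have "bounded (g ` mspace m)"
    using bdg by (auto simp: bounded_iff)
  ultimately show "(\<lambda>n. \<integral>\<omega>. g (Xs n \<omega>) \<partial>M) \<longlonglongrightarrow> (\<integral>\<omega>. g (Y \<omega>) \<partial>N)"
    using meas by (intro test)
qed

text \<open>The test function is minus the truncated distance to \<open>C\<close>. It is 0 along the
  subsequence \<open>r\<close>, so its limit expectation is 0, and being nonpositive it vanishes at
  \<open>Y\<close> almost surely. Closures obtained from different subsequences therefore all carry
  the limit.\<close>

lemma limit_in_closure:
  fixes r :: "nat \<Rightarrow> nat"
  assumes C: "countable C" "C \<subseteq> mspace m" and r: "strict_mono r"
    and cl: "\<And>k \<omega> e. \<omega> \<in> space M \<Longrightarrow> 0 < e \<Longrightarrow> \<exists>c\<in>C. mdist m c (Xs (r k) \<omega>) < e"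
  shows "AE \<omega> in N. \<forall>e>0. \<exists>c\<in>C. mdist m c (Y \<omega>) < e"
proof -
  have ne: "C \<noteq> {}"
    using cl[of _ 1 0] M.not_empty by (metis all_not_in_conv bex_empty zero_less_one)
  let ?h = "\<lambda>c y. - min 1 (mdist m c y)"
  let ?g = "\<lambda>y. SUP c\<in>C. ?h c y"
  have h: "?h c \<in> borel_measurable (ball_sigma m)" if "c \<in> C" for c
    using mdist_ball_measurable[of c m] C that by auto
  have lip: "?h c y \<le> ?h c z + 1 * mdist m y z" if "c \<in> C" "y \<in> mspace m" "z \<in> mspace m" for c y z
  proof -
    have "mdist m c z \<le> mdist m c y + mdist m y z" using that C by (intro mdist_triangle) auto
    moreover have "0 \<le> mdist m y z" by simp
    ultimately show ?thesis by linarith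
  qed
  have bd: "\<bar>?h c y\<bar> \<le> 1" for c y by simp
  have bdd: "bdd_above ((\<lambda>c. ?h c y) ` C)" for y by (intro bdd_aboveI2[of _ _ 0]) simp
  note g = SUP_test[of C ?h 1 1, OF C(1) ne h bd lip]
  have gX: "?g (Xs (r k) \<omega>) = 0" if \<omega>: "\<omega> \<in> space M" for k \<omega>
  proof (rule antisym)
    show "?g (Xs (r k) \<omega>) \<le> 0" by (intro cSUP_least ne) simp
    show "0 \<le> ?g (Xs (r k) \<omega>)"
    proof (rule field_le_epsilon)
      fix e :: real assume "0 < e"
      from cl[OF \<omega> this, of k] obtain c where c: "c \<in> C" "mdist m c (Xs (r k) \<omega>) < e" by auto
      have "?h c (Xs (r k) \<omega>) \<le> ?g (Xs (r k) \<omega>)" by (intro cSUP_upper c bdd)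
      with c show "0 \<le> ?g (Xs (r k) \<omega>) + e" by (simp add: min_def split: if_splits)
    qed
  qed
  have "(\<lambda>k. \<integral>\<omega>. ?g (Xs (r k) \<omega>) \<partial>M) \<longlonglongrightarrow> (\<integral>\<omega>. ?g (Y \<omega>) \<partial>N)"
    using LIMSEQ_subseq_LIMSEQ[OF g(3) r] by (simp add: o_def)
  moreover have "(\<integral>\<omega>. ?g (Xs (r k) \<omega>) \<partial>M) = 0" for k
    using gX by (simp cong: Bochner_Integration.integral_cong)
  ultimately have int0: "(\<integral>\<omega>. ?g (Y \<omega>) \<partial>N) = 0"
    using LIMSEQ_unique[OF tendsto_const] by fastforce
  have meas: "(\<lambda>\<omega>. ?g (Y \<omega>)) \<in> borel_measurable N"
    using measurable_compose[OF Y g(1)] .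
  have int: "integrable N (\<lambda>\<omega>. ?g (Y \<omega>))"
    using meas g(2) Y_in by (intro N.integrable_const_bound[of _ 1]) (auto intro!: AE_I2)
  have le0: "?g y \<le> 0" for y by (intro cSUP_least ne) simp
  have "AE \<omega> in N. - ?g (Y \<omega>) = 0"
    using int int0 le0
    by (subst integral_nonneg_eq_0_iff_AE[symmetric]) (auto intro!: AE_I2 simp: le_minus_iff)
  then show ?thesis
  proof (rule AE_mp, intro AE_I2 impI allI)
    fix \<omega> and e :: real assume z: "- ?g (Y \<omega>) = 0" and e: "0 < e"
    have "\<exists>c\<in>C. - min e 1 < ?h c (Y \<omega>)"
      using less_cSUP_iff[OF ne bdd, of "- min e 1" "Y \<omega>"] z e by simp
    then show "\<exists>c\<in>C. mdist m c (Y \<omega>) < e" by (fastforce simp: min_def split: if_splits)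
  qed
qed

end

text \<open>\<open>C\<close> replaces separability of the space: only the values of the
  \<open>Xs n\<close> have to lie in the closure of a countable set.\<close>

locale separable_weak_limit = weak_limit m M N Xs Y
  for m :: "'s metric" and M :: "'a measure" and N :: "'b measure" and Xs Y +
  fixes C :: "'s set"
  assumes C: "countable C" "C \<subseteq> mspace m"
    and closure_C: "\<And>n \<omega> e. \<omega> \<in> space M \<Longrightarrow> 0 < e \<Longrightarrow> \<exists>c\<in>C. mdist m c (Xs n \<omega>) < e"
begin

text \<open>Upper half of the sandwich. \<open>U\<close> is the decreasing limit of the envelopes
  \<open>g k\<close> along \<open>Y\<close>. Each \<open>g k\<close> is Lipschitz and built from
  countably many distances, hence testable; it dominates \<open>T n\<close> up to a small error once
  \<open>n\<close> is at least \<open>k\<close>. Letting \<open>k\<close> grow localizes the suprema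
  at \<open>Y \<omega>\<close>, where \<open>lim\<close> forces the value
  \<open>f (Y \<omega>)\<close>. The variable \<eta> is a disturbance that need not be a function of
  the path.\<close>

lemma upper_mapping:
  fixes T :: "nat \<Rightarrow> 'a \<Rightarrow> real" and f :: "'s \<Rightarrow> real"
  assumes T: "\<And>n. T n \<in> borel_measurable M" and B: "\<And>n \<omega>. \<omega> \<in> space M \<Longrightarrow> \<bar>T n \<omega>\<bar> \<le> B"
    and \<eta>: "tends_to_zero_in_prob M \<eta>"
    and G: "AE \<omega> in N. Y \<omega> \<in> G" and fB: "\<And>y. y \<in> G \<Longrightarrow> \<bar>f y\<bar> \<le> B"
    and lim: "\<And>y n w. y \<in> G \<Longrightarrow> y \<in> mspace m \<Longrightarrow> filterlim n at_top sequentially \<Longrightarrow>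
       (\<And>i. w i \<in> space M) \<Longrightarrow> (\<lambda>i. mdist m (Xs (n i) (w i)) y) \<longlonglongrightarrow> 0 \<Longrightarrow>
       (\<lambda>i. \<eta> (n i) (w i)) \<longlonglongrightarrow> 0 \<Longrightarrow> (\<lambda>i::nat. T (n i) (w i)) \<longlonglongrightarrow> f y"
  obtains U where "U \<in> borel_measurable N" "\<And>\<omega>. \<omega> \<in> space N \<Longrightarrow> \<bar>U \<omega>\<bar> \<le> B"
    "AE \<omega> in N. U \<omega> \<le> f (Y \<omega>)"
    "\<And>e. 0 < e \<Longrightarrow> eventually (\<lambda>n. (\<integral>\<omega>. T n \<omega> \<partial>M) \<le> (\<integral>\<omega>. U \<omega> \<partial>N) + e) sequentially"
proof -
  obtain \<omega>0 where \<omega>0: "\<omega>0 \<in> space M" using M.not_empty by auto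
  have B0: "0 \<le> B" using B[OF \<omega>0, of 0] by linarith
  have ne: "C \<noteq> {}" using closure_C[OF \<omega>0, of 1] by force
  define \<epsilon> :: "nat \<Rightarrow> real" where "\<epsilon> k = 1 / real (Suc k)" for k
  have \<epsilon>0: "0 < \<epsilon> k" for k by (simp add: \<epsilon>_def)
  have \<epsilon>_anti: "\<epsilon> (Suc k) \<le> \<epsilon> k" for k by (simp add: \<epsilon>_def divide_simps)
  have \<epsilon>_lim: "\<epsilon> \<longlonglongrightarrow> 0" unfolding \<epsilon>_def using LIMSEQ_inverse_real_of_nat by (simp add: inverse_eq_divide)
  \<comment> \<open>The radius is a square because the penalty in \<open>?h\<close> has slope
    \<open>Suc k\<close>, the reciprocal of \<open>\<epsilon> k\<close>: over this radius it costs
    only \<open>\<epsilon> k\<close>.\<close>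
  define A where "A k n c = {\<omega> \<in> space M. mdist m c (Xs n \<omega>) < \<epsilon> k ^ 2 \<and> \<bar>\<eta> n \<omega>\<bar> \<le> \<epsilon> k}" for k n c
  \<comment> \<open>The element \<open>- B\<close> keeps the supremum defined when no sample point
    lies near \<open>c\<close>.\<close>
  define s where "s k n c = Sup (insert (- B) (T n ` A k n c))" for k n c
  have bddA: "bdd_above (insert (- B) (T n ` A k n c))" for k n c
    using B B0 by (intro bdd_aboveI[of _ B]) (auto simp: A_def abs_le_iff)
  have sB: "\<bar>s k n c\<bar> \<le> B" for k n c
  proof -
    have "s k n c \<le> B" unfolding s_def using B B0 by (intro cSup_least) (auto simp: A_def abs_le_iff)
    moreover have "- B \<le> s k n c" unfolding s_def by (intro cSup_upper bddA) simp
    ultimately show ?thesis by auto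
  qed
  have A_anti: "A (Suc k) n c \<subseteq> A k n c" for k n c
    using \<epsilon>_anti[of k] power_mono[OF \<epsilon>_anti[of k], of 2] \<epsilon>0[of "Suc k"]
    by (auto simp: A_def intro: less_le_trans)
  have s_anti: "s (Suc k) n c \<le> s k n c" for k n c
    unfolding s_def using A_anti[of k n c] by (intro cSup_subset_mono bddA) blast+
  let ?I = "\<lambda>k::nat. {k..} \<times> C"
  let ?h = "\<lambda>(k::nat) (n, c) y. max (- B) (s k n c - real (Suc k) * mdist m c y)"
  define g where "g k y = (SUP i\<in>?I k. ?h k i y)" for k y
  have I: "countable (?I k)" "?I k \<noteq> {}" for k
  proof -
    show "countable (?I k)" by (intro countable_SIGMA C(1)) simp
    from ne obtain c where "c \<in> C" by auto
    then have "(k, c) \<in> ?I k" by simp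
    then show "?I k \<noteq> {}" by blast
  qed
  have hm: "?h k i \<in> borel_measurable (ball_sigma m)" if "i \<in> ?I k" for k i
    using mdist_ball_measurable[of "snd i" m] C(2) that by (auto simp: split_beta)
  have hb: "\<bar>?h k i y\<bar> \<le> B" if "i \<in> ?I k" "y \<in> mspace m" for k i y
  proof -
    have "0 \<le> real (Suc k) * mdist m (snd i) y" by (intro mult_nonneg_nonneg) auto
    then have "s k (fst i) (snd i) - real (Suc k) * mdist m (snd i) y \<le> B"
      using sB[of k "fst i" "snd i"] by linarith
    then show ?thesis using B0 by (auto simp: split_beta abs_le_iff)
  qed
  have hl: "?h k i y \<le> ?h k i z + real (Suc k) * mdist m y z"
    if "i \<in> ?I k" "y \<in> mspace m" "z \<in> mspace m" for k i y z
  proof -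
    have "mdist m (snd i) z \<le> mdist m (snd i) y + mdist m y z"
      using mdist_triangle[of "snd i" m y z] that C(2) by auto
    from mult_left_mono[OF this, of "real (Suc k)"]
    have "real (Suc k) * mdist m (snd i) z \<le> real (Suc k) * mdist m (snd i) y + real (Suc k) * mdist m y z"
      by (simp add: distrib_left)
    moreover have "0 \<le> real (Suc k) * mdist m y z" by simp
    ultimately show ?thesis unfolding split_beta by linarith
  qed
  have gt: "g k \<in> borel_measurable (ball_sigma m)" "y \<in> mspace m \<Longrightarrow> \<bar>g k y\<bar> \<le> B"
    "(\<lambda>n. \<integral>\<omega>. g k (Xs n \<omega>) \<partial>M) \<longlonglongrightarrow> (\<integral>\<omega>. g k (Y \<omega>) \<partial>N)" for k y
    unfolding g_def
    by (rule SUP_test[where k = "real (Suc k)" and B = B]; (intro I hm hb hl)?; assumption)+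
  have bddh: "bdd_above ((\<lambda>i. ?h k i y) ` ?I k)" if "y \<in> mspace m" for k y
    using hb[OF _ that] by (intro bdd_aboveI2[of _ _ B]) (fastforce simp: abs_le_iff)
  have g_anti: "g (Suc k) y \<le> g k y" if y: "y \<in> mspace m" for k y
    unfolding g_def
  proof (rule cSUP_mono[OF I(2) bddh[OF y]])
    fix i assume i: "i \<in> ?I (Suc k)"
    have "real (Suc k) * mdist m (snd i) y \<le> real (Suc (Suc k)) * mdist m (snd i) y"
      by (intro mult_right_mono) auto
    with s_anti[of k "fst i" "snd i"]
    have "?h (Suc k) i y \<le> ?h k i y" unfolding split_beta by linarith
    then show "\<exists>j\<in>?I k. ?h (Suc k) i y \<le> ?h k j y" using i by (intro bexI[of _ i]) auto
  qed
  define U where "U \<omega> = (INF k. g k (Y \<omega>))" for \<omega>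
  have bddg: "bdd_below (range (\<lambda>k. g k y))" if "y \<in> mspace m" for y
  proof (rule bdd_belowI2)
    show "- B \<le> g k y" for k using gt(2)[OF that, of k] by linarith
  qed
  have gU: "(\<lambda>k. g k (Y \<omega>)) \<longlonglongrightarrow> U \<omega>" if "\<omega> \<in> space N" for \<omega>
    unfolding U_def using g_anti[OF Y_in[OF that]]
    by (intro LIMSEQ_decseq_INF bddg Y_in that) (auto intro: decseq_SucI)
  have gYm: "(\<lambda>\<omega>. g k (Y \<omega>)) \<in> borel_measurable N" for k
    using measurable_compose[OF Y gt(1)] .
  have Um: "U \<in> borel_measurable N" by (rule borel_measurable_LIMSEQ_real[OF gU gYm])
  have UB: "\<bar>U \<omega>\<bar> \<le> B" if "\<omega> \<in> space N" for \<omega>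
    by (rule LIMSEQ_le_const2[OF tendsto_rabs[OF gU[OF that]]]) (use gt(2)[OF Y_in[OF that]] in auto)
  \<comment> \<open>If \<open>U\<close> exceeded \<open>f (Y \<omega>)\<close>, near-maximizers of
    the envelopes would give sample points whose paths converge to \<open>Y \<omega>\<close> with
    vanishing disturbance, while the values of \<open>T\<close> stay near or above
    \<open>U \<omega>\<close>; this contradicts \<open>lim\<close>.\<close>
  have Ule: "U \<omega> \<le> f (Y \<omega>)" if \<omega>: "\<omega> \<in> space N" and G: "Y \<omega> \<in> G" for \<omega>
  proof (rule ccontr)
    assume "\<not> ?thesis"
    then have less: "f (Y \<omega>) < U \<omega>" by simp
    with fB[OF G] have BU: "- B < U \<omega>" by (auto simp: abs_le_iff)
    have yin: "Y \<omega> \<in> mspace m" by (rule Y_in[OF \<omega>])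
    \<comment> \<open>From \<open>k0\<close> on the near-maximal value exceeds \<open>- B\<close>,
      so it comes neither from the truncation in \<open>?h\<close> nor from the default element in
      \<open>s\<close>, but from a sample point.\<close>
    obtain k0 where k0: "\<And>k. k \<ge> k0 \<Longrightarrow> - B < U \<omega> - \<epsilon> k"
    proof -
      have "eventually (\<lambda>k. \<epsilon> k < U \<omega> + B) sequentially"
        by (rule order_tendstoD(2)[OF \<epsilon>_lim]) (use BU in simp)
      then obtain k1 where "\<And>k. k \<ge> k1 \<Longrightarrow> \<epsilon> k < U \<omega> + B" unfolding eventually_sequentially by blast
      then show ?thesis by (intro that[of k1]) (simp add: algebra_simps)
    qed
    have ex: "\<exists>n w c. c \<in> C \<and> n \<ge> k \<and> w \<in> A k n c \<and> U \<omega> - 2 * \<epsilon> k < T n w - real (Suc k) * mdist m c (Y \<omega>)"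
      if k: "k \<ge> k0" for k
    proof -
      have "U \<omega> \<le> g k (Y \<omega>)" unfolding U_def by (intro cINF_lower bddg yin) simp
      with \<epsilon>0[of k] have "U \<omega> - \<epsilon> k < g k (Y \<omega>)" by linarith
      then obtain i where i: "i \<in> ?I k" "U \<omega> - \<epsilon> k < ?h k i (Y \<omega>)"
        unfolding g_def using less_cSUP_iff[OF I(2) bddh[OF yin]] by blast
      obtain n c where nc: "i = (n, c)" by (cases i)
      have 1: "U \<omega> - \<epsilon> k < s k n c - real (Suc k) * mdist m c (Y \<omega>)"
        using i(2) k0[OF k] nc by (simp add: less_max_iff_disj)
      then have "U \<omega> - \<epsilon> k + real (Suc k) * mdist m c (Y \<omega>) < s k n c" by linarith
      then obtain t where t: "t \<in> insert (- B) (T n ` A k n c)"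
         "U \<omega> - \<epsilon> k + real (Suc k) * mdist m c (Y \<omega>) < t"
        unfolding s_def less_cSup_iff[OF insert_not_empty bddA] by blast
      have "t \<noteq> - B"
      proof
        assume "t = - B"
        moreover have "0 \<le> real (Suc k) * mdist m c (Y \<omega>)" by simp
        ultimately show False using t(2) k0[OF k] by linarith
      qed
      then obtain w where "w \<in> A k n c" "t = T n w" using t by auto
      moreover from t(2) \<epsilon>0[of k] have "U \<omega> - 2 * \<epsilon> k < t - real (Suc k) * mdist m c (Y \<omega>)" by linarith
      ultimately show ?thesis using i(1) nc by (intro exI[of _ n] exI[of _ w] exI[of _ c]) simp
    qed
    define P where "P k nwc = (case nwc of (n, w, c) \<Rightarrow> c \<in> C \<and> n \<ge> k \<and> w \<in> A k n c \<and>
        U \<omega> - 2 * \<epsilon> k < T n w - real (Suc k) * mdist m c (Y \<omega>))" for k nwc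
    have "\<exists>nwc. P (i + k0) nwc" for i
      using ex[of "i + k0"] by (auto simp: P_def)
    then have "\<exists>q. \<forall>i. P (i + k0) (q i)" by (intro choice allI)
    then obtain q where q: "\<And>i. P (i + k0) (q i)" by blast
    define n w c where "n i = fst (q i)" and "w i = fst (snd (q i))" and "c i = snd (snd (q i))" for i
    define k where "k i = i + k0" for i
    have q': "c i \<in> C" "n i \<ge> k i" "w i \<in> A (k i) (n i) (c i)"
      "U \<omega> - 2 * \<epsilon> (k i) < T (n i) (w i) - real (Suc (k i)) * mdist m (c i) (Y \<omega>)" for i
      using q[of i] by (auto simp: P_def n_def w_def c_def k_def split_beta)
    have klim: "filterlim k at_top sequentially" unfolding k_def by (rule filterlim_add_const_nat_at_top)
    have nlim: "filterlim n at_top sequentially"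
      by (rule filterlim_at_top_mono[OF klim]) (intro always_eventually allI q'(2))
    have ek: "(\<lambda>i. \<epsilon> (k i)) \<longlonglongrightarrow> 0" by (rule filterlim_compose[OF \<epsilon>_lim klim])
    have win: "w i \<in> space M" for i using q'(3)[of i] by (simp add: A_def)
    have cin: "c i \<in> mspace m" for i using q'(1) C(2) by auto
    \<comment> \<open>The penalty stays bounded while its slope \<open>Suc (k i)\<close> grows, so
      the centre approaches \<open>Y \<omega>\<close> at the rate
      \<open>\<epsilon> (k i)\<close>.\<close>
    have dc: "mdist m (c i) (Y \<omega>) \<le> \<epsilon> (k i) * (B - U \<omega> + 2 * \<epsilon> (k i))" for i
    proof -
      have "real (Suc (k i)) * mdist m (c i) (Y \<omega>) \<le> B - U \<omega> + 2 * \<epsilon> (k i)"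
        using q'(4)[of i] B[OF win, of "n i" i] by (auto simp: abs_le_iff)
      from mult_left_mono[OF this, of "\<epsilon> (k i)"] show ?thesis using \<epsilon>0[of "k i"] by (simp add: \<epsilon>_def)
    qed
    have dX: "mdist m (Xs (n i) (w i)) (Y \<omega>) \<le> \<epsilon> (k i) ^ 2 + \<epsilon> (k i) * (B - U \<omega> + 2 * \<epsilon> (k i))" for i
    proof -
      have "mdist m (Xs (n i) (w i)) (Y \<omega>) \<le> mdist m (Xs (n i) (w i)) (c i) + mdist m (c i) (Y \<omega>)"
        by (intro mdist_triangle Xs_in win cin yin)
      moreover have "mdist m (Xs (n i) (w i)) (c i) < \<epsilon> (k i) ^ 2"
        using q'(3)[of i] by (simp add: A_def mdist_commute)
      ultimately show ?thesis using dc[of i] by linarith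
    qed
    have "(\<lambda>i. \<epsilon> (k i) ^ 2 + \<epsilon> (k i) * (B - U \<omega> + 2 * \<epsilon> (k i))) \<longlonglongrightarrow> 0 ^ 2 + 0 * (B - U \<omega> + 2 * 0)"
      by (rule tendsto_add[OF tendsto_power[OF ek] tendsto_mult[OF ek
            tendsto_add[OF tendsto_const tendsto_mult[OF tendsto_const ek]]]])
    then have bound: "(\<lambda>i. \<epsilon> (k i) ^ 2 + \<epsilon> (k i) * (B - U \<omega> + 2 * \<epsilon> (k i))) \<longlonglongrightarrow> 0" by simp
    have dlim: "(\<lambda>i. mdist m (Xs (n i) (w i)) (Y \<omega>)) \<longlonglongrightarrow> 0"
    proof (rule Lim_null_comparison[OF always_eventually bound], intro allI)
      show "norm (mdist m (Xs (n i) (w i)) (Y \<omega>)) \<le> \<epsilon> (k i) ^ 2 + \<epsilon> (k i) * (B - U \<omega> + 2 * \<epsilon> (k i))" for i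
        using dX[of i] by (simp only: real_norm_def abs_of_nonneg mdist_nonneg)
    qed
    have \<eta>lim: "(\<lambda>i. \<eta> (n i) (w i)) \<longlonglongrightarrow> 0"
    proof (rule Lim_null_comparison[OF always_eventually ek], intro allI)
      show "norm (\<eta> (n i) (w i)) \<le> \<epsilon> (k i)" for i using q'(3)[of i] by (simp add: A_def)
    qed
    have Tlim: "(\<lambda>i. T (n i) (w i)) \<longlonglongrightarrow> f (Y \<omega>)"
      by (rule lim[OF G yin nlim win dlim \<eta>lim])
    have "(\<lambda>i. U \<omega> - 2 * \<epsilon> (k i)) \<longlonglongrightarrow> U \<omega> - 2 * 0"
      by (rule tendsto_diff[OF tendsto_const tendsto_mult[OF tendsto_const ek]])
    then have Ulim: "(\<lambda>i. U \<omega> - 2 * \<epsilon> (k i)) \<longlonglongrightarrow> U \<omega>" by simp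
    have "U \<omega> - 2 * \<epsilon> (k i) \<le> T (n i) (w i)" for i
    proof -
      have "0 \<le> real (Suc (k i)) * mdist m (c i) (Y \<omega>)" by simp
      then show ?thesis using q'(4)[of i] by linarith
    qed
    then have "U \<omega> \<le> f (Y \<omega>)"
      by (intro LIMSEQ_le[OF Ulim Tlim]) simp
    with less show False by simp
  qed
  have ev: "eventually (\<lambda>n. (\<integral>\<omega>. T n \<omega> \<partial>M) \<le> (\<integral>\<omega>. U \<omega> \<partial>N) + e) sequentially" if e: "0 < e" for e
  proof -
    have "(\<lambda>k. \<integral>\<omega>. g k (Y \<omega>) \<partial>N) \<longlonglongrightarrow> (\<integral>\<omega>. U \<omega> \<partial>N)"
      using gU gt(2) Y_in by (intro integral_dominated_convergence[where w="\<lambda>_. B"] Um gYm) (auto intro!: AE_I2)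
    then have "(\<lambda>k. (\<integral>\<omega>. g k (Y \<omega>) \<partial>N) + \<epsilon> k) \<longlonglongrightarrow> (\<integral>\<omega>. U \<omega> \<partial>N) + 0"
      by (rule tendsto_add[OF _ \<epsilon>_lim])
    then have "eventually (\<lambda>k. (\<integral>\<omega>. g k (Y \<omega>) \<partial>N) + \<epsilon> k < (\<integral>\<omega>. U \<omega> \<partial>N) + e) sequentially"
      by (rule order_tendstoD) (use e in simp)
    then obtain k where k: "(\<integral>\<omega>. g k (Y \<omega>) \<partial>N) + \<epsilon> k < (\<integral>\<omega>. U \<omega> \<partial>N) + e"
      unfolding eventually_sequentially by blast
    define E where "E n = {\<omega> \<in> space M. \<bar>\<eta> n \<omega>\<bar> > \<epsilon> k}" for n
    have [measurable]: "\<eta> n \<in> borel_measurable M" for n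
      using \<eta> by (simp add: tends_to_zero_in_prob_def)
    have Em: "E n \<in> sets M" for n unfolding E_def by measurable
    have E0: "(\<lambda>n. measure M (E n)) \<longlonglongrightarrow> 0"
    proof -
      have "\<forall>\<epsilon>>0. (\<lambda>n. measure M {\<omega> \<in> space M. \<bar>\<eta> n \<omega>\<bar> > \<epsilon>}) \<longlonglongrightarrow> 0"
        using \<eta> unfolding tends_to_zero_in_prob_def by (rule conjunct2)
      then show ?thesis using \<epsilon>0[of k] unfolding E_def by (elim allE impE)
    qed
    have gXm: "(\<lambda>\<omega>. g k (Xs n \<omega>)) \<in> borel_measurable M" for n
      using measurable_compose[OF Xs gt(1)] .
    have gXi: "integrable M (\<lambda>\<omega>. g k (Xs n \<omega>))" for n
      using gt(2) Xs_in by (intro M.integrable_const_bound[of _ B] gXm) (auto intro!: AE_I2)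
    have le: "(\<integral>\<omega>. T n \<omega> \<partial>M) \<le> (\<integral>\<omega>. g k (Xs n \<omega>) \<partial>M) + \<epsilon> k + 2 * B * measure M (E n)"
      if n: "n \<ge> k" for n
    proof -
      \<comment> \<open>Off \<open>E n\<close> the sample point lies in \<open>A k n c\<close> for a
        centre \<open>c\<close> near its own path, so the envelope sees its value of
        \<open>T n\<close>; on \<open>E n\<close> the crude bound \<open>2 * B\<close> pays for the
        error.\<close>
      have Tle: "T n \<omega> \<le> g k (Xs n \<omega>) + \<epsilon> k + 2 * B * indicator (E n) \<omega>" if \<omega>: "\<omega> \<in> space M" for \<omega>
      proof (cases "\<omega> \<in> E n")
        case True
        then show ?thesis using B[OF \<omega>, of n] gt(2)[OF Xs_in[OF \<omega>], of k n] \<epsilon>0[of k] by (auto simp: abs_le_iff)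
      next
        case False
        obtain c where c: "c \<in> C" "mdist m c (Xs n \<omega>) < \<epsilon> k ^ 2"
          using closure_C[OF \<omega>, of "\<epsilon> k ^ 2" n] \<epsilon>0[of k] by auto
        have "\<omega> \<in> A k n c" using c \<omega> False by (auto simp: A_def E_def)
        then have "T n \<omega> \<le> s k n c" unfolding s_def by (intro cSup_upper bddA) auto
        moreover have "?h k (n, c) (Xs n \<omega>) \<le> g k (Xs n \<omega>)"
          unfolding g_def using c n
          by (intro cSUP_upper[of "(n, c)" "?I k" "\<lambda>i. ?h k i (Xs n \<omega>)"] bddh Xs_in \<omega>) simp
        moreover have "real (Suc k) * mdist m c (Xs n \<omega>) \<le> \<epsilon> k"
        proof -
          have "real (Suc k) * mdist m c (Xs n \<omega>) \<le> real (Suc k) * \<epsilon> k ^ 2"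
            using c by (intro mult_left_mono) auto
          also have "\<dots> = \<epsilon> k" by (simp add: \<epsilon>_def power2_eq_square)
          finally show ?thesis .
        qed
        ultimately show ?thesis using False by auto
      qed
      have iE: "integrable M (indicator (E n) :: _ \<Rightarrow> real)"
        using Em by (intro integrable_real_indicator) (simp_all add: M.emeasure_eq_measure)
      have iT: "integrable M (T n)"
        using B by (intro M.integrable_const_bound[of _ B] T) (auto intro!: AE_I2)
      have "(\<integral>\<omega>. T n \<omega> \<partial>M) \<le> (\<integral>\<omega>. g k (Xs n \<omega>) + \<epsilon> k + 2 * B * indicator (E n) \<omega> \<partial>M)"
        by (intro integral_mono iT Bochner_Integration.integrable_add gXi
            integrable_mult_right iE M.integrable_const Tle)
      also have "\<dots> = (\<integral>\<omega>. g k (Xs n \<omega>) + \<epsilon> k \<partial>M) + (\<integral>\<omega>. 2 * B * indicator (E n) \<omega> \<partial>M)"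
        by (intro Bochner_Integration.integral_add Bochner_Integration.integrable_add gXi
            integrable_mult_right iE M.integrable_const)
      also have "(\<integral>\<omega>. g k (Xs n \<omega>) + \<epsilon> k \<partial>M) = (\<integral>\<omega>. g k (Xs n \<omega>) \<partial>M) + \<epsilon> k"
        by (subst Bochner_Integration.integral_add[OF gXi M.integrable_const]) (simp add: M.prob_space)
      also have "(\<integral>\<omega>. 2 * B * indicator (E n) \<omega> \<partial>M) = 2 * B * measure M (E n)"
        using sets.sets_into_space[OF Em] by (simp add: Int_absorb2)
      finally show ?thesis .
    qed
    have "(\<lambda>n. (\<integral>\<omega>. g k (Xs n \<omega>) \<partial>M) + \<epsilon> k + 2 * B * measure M (E n)) \<longlonglongrightarrow>
        (\<integral>\<omega>. g k (Y \<omega>) \<partial>N) + \<epsilon> k + 2 * B * 0"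
      by (rule tendsto_add[OF tendsto_add[OF gt(3) tendsto_const] tendsto_mult[OF tendsto_const E0]])
    then have "eventually (\<lambda>n. (\<integral>\<omega>. g k (Xs n \<omega>) \<partial>M) + \<epsilon> k + 2 * B * measure M (E n) < (\<integral>\<omega>. U \<omega> \<partial>N) + e) sequentially"
      by (rule order_tendstoD) (use k in simp)
    then show ?thesis using eventually_ge_at_top[of k]
      by eventually_elim (use le in fastforce)
  qed
  show ?thesis
  proof (rule that[OF Um UB _ ev])
    show "AE \<omega> in N. U \<omega> \<le> f (Y \<omega>)"
      using G by (rule AE_mp) (intro AE_I2 impI Ule)
  qed
qed

text \<open>
  An upper and a lower bound of this kind sandwich \<open>f \<circ> Y\<close>, which is why it need not be assumed
  measurable.
\<close>

theorem extended_continuous_mapping: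
  fixes T :: "nat \<Rightarrow> 'a \<Rightarrow> real" and f :: "'s \<Rightarrow> real"
  assumes T: "\<And>n. T n \<in> borel_measurable M" and B: "\<And>n \<omega>. \<omega> \<in> space M \<Longrightarrow> \<bar>T n \<omega>\<bar> \<le> B"
    and \<eta>: "tends_to_zero_in_prob M \<eta>"
    and G: "AE \<omega> in N. Y \<omega> \<in> G" and fB: "\<And>y. y \<in> G \<Longrightarrow> \<bar>f y\<bar> \<le> B"
    and lim: "\<And>y n w. y \<in> G \<Longrightarrow> y \<in> mspace m \<Longrightarrow> filterlim n at_top sequentially \<Longrightarrow>
       (\<And>i. w i \<in> space M) \<Longrightarrow> (\<lambda>i. mdist m (Xs (n i) (w i)) y) \<longlonglongrightarrow> 0 \<Longrightarrow>
       (\<lambda>i. \<eta> (n i) (w i)) \<longlonglongrightarrow> 0 \<Longrightarrow> (\<lambda>i::nat. T (n i) (w i)) \<longlonglongrightarrow> f y"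
  obtains F where "F \<in> borel_measurable N" "AE \<omega> in N. f (Y \<omega>) = F \<omega>"
    "(\<lambda>n. \<integral>\<omega>. T n \<omega> \<partial>M) \<longlonglongrightarrow> (\<integral>\<omega>. F \<omega> \<partial>N)"
proof -
  obtain U where U: "U \<in> borel_measurable N" "\<And>\<omega>. \<omega> \<in> space N \<Longrightarrow> \<bar>U \<omega>\<bar> \<le> B"
    "AE \<omega> in N. U \<omega> \<le> f (Y \<omega>)"
    "\<And>e. 0 < e \<Longrightarrow> eventually (\<lambda>n. (\<integral>\<omega>. T n \<omega> \<partial>M) \<le> (\<integral>\<omega>. U \<omega> \<partial>N) + e) sequentially"
    using upper_mapping[of T B \<eta> G f, OF T B \<eta> G fB lim] by blast
  obtain L where L: "L \<in> borel_measurable N" "\<And>\<omega>. \<omega> \<in> space N \<Longrightarrow> \<bar>L \<omega>\<bar> \<le> B"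
    "AE \<omega> in N. L \<omega> \<le> - f (Y \<omega>)"
    "\<And>e. 0 < e \<Longrightarrow> eventually (\<lambda>n. (\<integral>\<omega>. - T n \<omega> \<partial>M) \<le> (\<integral>\<omega>. L \<omega> \<partial>N) + e) sequentially"
    by (rule upper_mapping[of "\<lambda>n \<omega>. - T n \<omega>" B \<eta> G "\<lambda>y. - f y"])
       (use T B \<eta> G fB lim in \<open>auto intro!: tendsto_minus lim\<close>)
  have iU: "integrable N U" using U by (intro N.integrable_const_bound[of _ B]) (auto intro!: AE_I2)
  have iL: "integrable N L" using L by (intro N.integrable_const_bound[of _ B]) (auto intro!: AE_I2)
  have le: "AE \<omega> in N. 0 \<le> - L \<omega> - U \<omega>" using U(3) L(3) by eventually_elim linarith
  have ge: "0 \<le> (\<integral>\<omega>. U \<omega> \<partial>N) + (\<integral>\<omega>. L \<omega> \<partial>N) + 2 * e" if "0 < e" for e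
  proof -
    have "eventually (\<lambda>n. 0 \<le> (\<integral>\<omega>. U \<omega> \<partial>N) + (\<integral>\<omega>. L \<omega> \<partial>N) + 2 * e) sequentially"
      using U(4)[OF that] L(4)[OF that] by eventually_elim simp
    then show ?thesis by simp
  qed
  \<comment> \<open>\<open>U + L\<close> is nonpositive almost everywhere, yet its integral is
    nonnegative since the integrals of \<open>T n\<close> and \<open>- T n\<close> cancel. Hence the
    two bounds coincide almost everywhere.\<close>
  have "0 \<le> (\<integral>\<omega>. U \<omega> \<partial>N) + (\<integral>\<omega>. L \<omega> \<partial>N)"
    by (rule field_le_epsilon) (use ge[of "e / 2" for e] in fastforce)
  moreover have "0 \<le> (\<integral>\<omega>. - L \<omega> - U \<omega> \<partial>N)" using le by (rule integral_nonneg_AE)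
  ultimately have eq: "(\<integral>\<omega>. - L \<omega> - U \<omega> \<partial>N) = 0" and eq': "(\<integral>\<omega>. L \<omega> \<partial>N) = - (\<integral>\<omega>. U \<omega> \<partial>N)"
    using iU iL by auto
  have "AE \<omega> in N. - L \<omega> - U \<omega> = 0"
    using integral_nonneg_eq_0_iff_AE[OF _ le] iU iL eq by auto
  then have "AE \<omega> in N. f (Y \<omega>) = U \<omega>" using U(3) L(3) by eventually_elim linarith
  moreover have "(\<lambda>n. \<integral>\<omega>. T n \<omega> \<partial>M) \<longlonglongrightarrow> (\<integral>\<omega>. U \<omega> \<partial>N)"
  proof (rule tendstoI)
    fix e :: real assume "0 < e"
    then have e: "0 < e / 2" by simp
    show "eventually (\<lambda>n. dist (\<integral>\<omega>. T n \<omega> \<partial>M) (\<integral>\<omega>. U \<omega> \<partial>N) < e) sequentially"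
      using U(4)[OF e] L(4)[OF e]
      by eventually_elim (use \<open>0 < e\<close> eq' in \<open>simp add: dist_real_def abs_less_iff\<close>)
  qed
  ultimately show ?thesis using that U(1) by blast
qed

end

section \<open>Integer parts of scaled times\<close>

lemma fl_le: "0 \<le> \<tau> \<Longrightarrow> real (fl n \<tau>) \<le> real n * \<tau>"
  unfolding fl_def by (subst of_nat_nat) (auto simp: zero_le_floor)

lemma fl_gt: "real n * \<tau> - 1 < real (fl n \<tau>)"
  unfolding fl_def by linarith

lemma fl_mono: "\<sigma> \<le> \<tau> \<Longrightarrow> fl n \<sigma> \<le> fl n \<tau>"
  unfolding fl_def by (intro nat_mono floor_mono mult_left_mono) auto

lemma fl_0 [simp]: "fl n 0 = 0" by (simp add: fl_def)

lemma fl_divide: "0 < n \<Longrightarrow> fl n (real j / real n) = j"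
  by (simp add: fl_def)

lemma fl_divide_le: "0 \<le> \<tau> \<Longrightarrow> real (fl n \<tau>) / real n \<le> \<tau>"
  using fl_le[of \<tau> n] by (cases "n = 0") (auto simp: divide_simps mult.commute)

lemma tendsto_inverse_of_nat:
  assumes "filterlim n at_top F"
  shows "((\<lambda>i. 1 / real (n i)) \<longlongrightarrow> 0) F"
  using filterlim_compose[OF lim_1_over_n assms] .

lemma fl_tendsto:
  assumes n: "filterlim n at_top F" and \<tau>: "(\<tau> \<longlongrightarrow> t) F" and nn: "\<And>i. 0 \<le> \<tau> i"
  shows "((\<lambda>i. real (fl (n i) (\<tau> i)) / real (n i)) \<longlongrightarrow> t) F"
proof (rule tendsto_sandwich[OF _ _ _ \<tau>])
  show "\<forall>\<^sub>F i in F. \<tau> i - 1 / real (n i) \<le> real (fl (n i) (\<tau> i)) / real (n i)"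
    using eventually_compose_filterlim[OF eventually_gt_at_top[of 0] n]
  proof eventually_elim
    case (elim i)
    have "(real (n i) * \<tau> i - 1) / real (n i) \<le> real (fl (n i) (\<tau> i)) / real (n i)"
      using fl_gt[of "n i" "\<tau> i"] by (intro divide_right_mono) auto
    then show ?case using elim by (simp add: diff_divide_distrib)
  qed
  show "\<forall>\<^sub>F i in F. real (fl (n i) (\<tau> i)) / real (n i) \<le> \<tau> i"
    using fl_divide_le nn by simp
  show "((\<lambda>i. \<tau> i - 1 / real (n i)) \<longlongrightarrow> t) F"
    using tendsto_diff[OF \<tau> tendsto_inverse_of_nat[OF n]] by simp
qed

subsection \<open>Riemann sums\<close>

lemma Riemann_sum_error:
  fixes g :: "real \<Rightarrow> real"
  assumes g: "continuous_on UNIV g" and n: "0 < n"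
    and close: "\<And>j u. j \<in> {1..m} \<Longrightarrow> u \<in> {(real j - 1) / real n..real j / real n} \<Longrightarrow> \<bar>s j - g u\<bar> \<le> e"
  shows "\<bar>(\<Sum>j=1..m. s j) / real n - integral {0..real m / real n} g\<bar> \<le> e * (real m / real n)"
  using close
proof (induction m)
  case 0
  then show ?case by simp
next
  case (Suc m)
  have int: "g integrable_on {a..b}" for a b
    using g by (intro integrable_continuous_real) (auto intro: continuous_on_subset)
  have 1: "integral {0..real m / real n} g + integral {real m / real n..real (Suc m) / real n} g
      = integral {0..real (Suc m) / real n} g"
    using n by (intro Henstock_Kurzweil_Integration.integral_combine int) (auto simp: divide_simps)
  have IH: "\<bar>(\<Sum>j=1..m. s j) / real n - integral {0..real m / real n} g\<bar> \<le> e * (real m / real n)"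
    by (rule Suc.IH) (use Suc.prems in auto)
  have "integral {real m / real n..real (Suc m) / real n} (\<lambda>u. s (Suc m) - g u)
      = s (Suc m) * (1 / real n) - integral {real m / real n..real (Suc m) / real n} g"
    using n by (subst Henstock_Kurzweil_Integration.integral_diff[OF integrable_const_ivl int])
               (simp_all add: field_simps)
  moreover have "norm (integral {real m / real n..real (Suc m) / real n} (\<lambda>u. s (Suc m) - g u))
      \<le> e * (real (Suc m) / real n - real m / real n)"
    using n Suc.prems[of "Suc m"]
    by (intro integral_bound continuous_intros continuous_on_subset[OF g]) (auto simp: divide_simps)
  moreover have "real (Suc m) / real n = real m / real n + 1 / real n"
    using n by (simp add: field_simps)
  moreover have "(\<Sum>j=1..Suc m. s j) / real n = (\<Sum>j=1..m. s j) / real n + s (Suc m) * (1 / real n)"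
    by (simp add: add_divide_distrib)
  ultimately show ?case using IH 1 by (simp add: distrib_left)
qed

text \<open>The number of summands moves with \<open>i\<close>, and \<open>s\<close> is only assumed
  near \<open>g\<close> at the right end points, uniformly in \<open>j\<close>; uniform continuity
  of \<open>g\<close> on a compact interval spreads this over the cells.\<close>

lemma Riemann_sum_tendsto:
  fixes g :: "real \<Rightarrow> real"
  assumes g: "continuous_on UNIV g" and n: "filterlim n at_top sequentially"
    and mn: "(\<lambda>i. real (m i) / real (n i)) \<longlonglongrightarrow> t" and t: "0 \<le> t"
    and close: "\<And>e. 0 < e \<Longrightarrow> eventually (\<lambda>i. \<forall>j\<in>{1..m i}. \<bar>s i j - g (real j / real (n i))\<bar> \<le> e) sequentially"
  shows "(\<lambda>i. (\<Sum>j=1..m i. s i j) / real (n i)) \<longlonglongrightarrow> integral {0..t} g"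
proof -
  have gc: "continuous_on {a..b} g" for a b using g by (rule continuous_on_subset) simp
  have ev_m: "eventually (\<lambda>i. real (m i) / real (n i) < t + 1) sequentially"
    by (rule order_tendstoD[OF mn]) simp
  have ev_n: "eventually (\<lambda>i. 0 < n i) sequentially"
    using eventually_compose_filterlim[OF eventually_gt_at_top[of 0] n] .
  have "(\<lambda>i. integral {0..real (m i) / real (n i)} g) \<longlonglongrightarrow> integral {0..t} g"
  proof (rule continuous_on_tendsto_compose[OF indefinite_integral_continuous_1[of g 0 "t + 1"] mn])
    show "g integrable_on {0..t + 1}" by (rule integrable_continuous_real[OF gc])
    show "t \<in> {0..t + 1}" using t by simp
    show "\<forall>\<^sub>F i in sequentially. real (m i) / real (n i) \<in> {0..t + 1}"
      using ev_m by eventually_elim simp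
  qed
  moreover have "(\<lambda>i. (\<Sum>j=1..m i. s i j) / real (n i) - integral {0..real (m i) / real (n i)} g) \<longlonglongrightarrow> 0"
  proof (rule tendstoI)
    fix e :: real assume e: "0 < e"
    \<comment> \<open>Inaccuracy of the samples and oscillation of \<open>g\<close> within a cell
      contribute \<open>d\<close> each; over a total length below \<open>t + 1\<close> this makes
      \<open>2 * e / 3\<close>.\<close>
    define d where "d = e / 3 / (t + 1)"
    have "t + 1 \<noteq> 0" using t by linarith
    then have "d * (t + 1) = e / 3"
      unfolding d_def by (subst times_divide_eq_left) (rule nonzero_mult_div_cancel_right)
    moreover have "0 < d" using e t by (simp add: d_def)
    ultimately have d: "0 < d" "d * (t + 1) = e / 3" by simp_all
    have "uniformly_continuous_on {-1..t + 1} g"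
      by (rule compact_uniformly_continuous[OF gc]) simp
    then obtain \<delta> where \<delta>: "0 < \<delta>"
      "\<And>x x'. x \<in> {-1..t + 1} \<Longrightarrow> x' \<in> {-1..t + 1} \<Longrightarrow> dist x' x < \<delta> \<Longrightarrow> dist (g x') (g x) < d"
      unfolding uniformly_continuous_on_def using d(1) by metis
    have "eventually (\<lambda>i. 1 / real (n i) < min \<delta> 1) sequentially"
      by (rule order_tendstoD[OF tendsto_inverse_of_nat[OF n]]) (use \<delta> in simp)
    then show "eventually (\<lambda>i. dist ((\<Sum>j=1..m i. s i j) / real (n i)
        - integral {0..real (m i) / real (n i)} g) 0 < e) sequentially"
      using close[OF d(1)] ev_m ev_n
    proof eventually_elim
      case (elim i)
      have cells: "\<bar>s i j - g u\<bar> \<le> 2 * d" if j: "j \<in> {1..m i}"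
        and u: "u \<in> {(real j - 1) / real (n i)..real j / real (n i)}" for j u
      proof -
        have 1: "real j / real (n i) \<le> real (m i) / real (n i)"
          using j by (intro divide_right_mono) auto
        have 2: "(real j - 1) / real (n i) = real j / real (n i) - 1 / real (n i)"
          by (simp add: diff_divide_distrib)
        have 3: "0 \<le> real j / real (n i)" by simp
        have 4: "1 / real (n i) < \<delta>" "1 / real (n i) < 1" using elim(1) by (simp_all only: min_less_iff_conj)
        have 5: "real j / real (n i) - 1 / real (n i) \<le> u" "u \<le> real j / real (n i)"
          using u by (simp_all only: 2 atLeastAtMost_iff)
        have "u \<in> {-1..t + 1}" "real j / real (n i) \<in> {-1..t + 1}"
          unfolding atLeastAtMost_iff using 1 3 4 5 elim(3) by linarith+
        moreover have "dist (real j / real (n i)) u < \<delta>"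
          unfolding dist_real_def using 4 5 by linarith
        ultimately have "dist (g (real j / real (n i))) (g u) < d" by (intro \<delta>(2))
        moreover have "\<bar>s i j - g (real j / real (n i))\<bar> \<le> d" using elim j by blast
        ultimately show ?thesis unfolding dist_real_def by linarith
      qed
      have "\<bar>(\<Sum>j=1..m i. s i j) / real (n i) - integral {0..real (m i) / real (n i)} g\<bar>
        \<le> 2 * d * (real (m i) / real (n i))"
        by (rule Riemann_sum_error[OF g \<open>0 < n i\<close>]) (rule cells)
      also have "\<dots> \<le> 2 * d * (t + 1)"
        using elim d by (intro mult_left_mono) auto
      also have "\<dots> < e" using e d by simp
      finally show ?case by (simp only: dist_real_def diff_0_right)
    qed
  qed
  ultimately have "(\<lambda>i. ((\<Sum>j=1..m i. s i j) / real (n i) - integral {0..real (m i) / real (n i)} g)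
      + integral {0..real (m i) / real (n i)} g) \<longlonglongrightarrow> 0 + integral {0..t} g"
    by (intro tendsto_add)
  then show ?thesis by simp
qed

subsection \<open>The functional \<open>Q\<close> as a limit of discrete functionals\<close>

text \<open>This is \<open>Q_fun\<close> at time \<open>m/n\<close> with both integrals replaced by
  Riemann sums of mesh \<open>1/n\<close>: the prefactors are \<open>(n/m)^2 / n\<close> and
  \<open>(n/m)^3 / n^2\<close>. For \<open>m = 0\<close> division by zero makes the value 0.\<close>

definition quad_stat :: "nat \<Rightarrow> (nat \<Rightarrow> real) \<Rightarrow> nat \<Rightarrow> real" where
  "quad_stat n S m =
     real n / real m ^ 2 * (\<Sum>j=1..m. (S j - real j / real m * S m) ^ 2)
     - real n / real m ^ 3 * (\<Sum>j=1..m. S j - real j / real m * S m) ^ 2"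

text \<open>Cauchy-Schwarz: up to a factor the value is the variance of the bridge over the indices
  \<open>1..m\<close>.\<close>

lemma quad_stat_nonneg: "0 \<le> quad_stat n S m"
proof (cases "m = 0")
  case False
  let ?b = "\<lambda>j. S j - real j / real m * S m"
  have "(\<Sum>j=1..m. ?b j) ^ 2 \<le> (\<Sum>j=1..m. ?b j ^ 2) * real m"
    using sum_squared_le_sum_of_squares[of ?b "{1..m}"] by simp
  then have "real n / real m ^ 3 * (\<Sum>j=1..m. ?b j) ^ 2 \<le> real n / real m ^ 3 * ((\<Sum>j=1..m. ?b j ^ 2) * real m)"
    by (intro mult_left_mono) auto
  also have "\<dots> = real n / real m ^ 2 * (\<Sum>j=1..m. ?b j ^ 2)"
    using False by (simp add: power2_eq_square power3_eq_cube)
  finally show ?thesis by (simp add: quad_stat_def)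
qed (simp add: quad_stat_def)

lemma Q_fun_cong:
  assumes "\<And>u. u \<in> {0..\<tau>} \<Longrightarrow> z u = z' u" "0 < \<tau>"
  shows "Q_fun \<tau> z = Q_fun \<tau> z'"
proof -
  have "z \<tau> = z' \<tau>" using assms by simp
  then have "(LBINT u:{0..\<tau>}. z u - u / \<tau> * z \<tau>) = (LBINT u:{0..\<tau>}. z' u - u / \<tau> * z' \<tau>)"
    "(LBINT u:{0..\<tau>}. (z u - u / \<tau> * z \<tau>)^2) = (LBINT u:{0..\<tau>}. (z' u - u / \<tau> * z' \<tau>)^2)"
    using assms by (auto intro!: set_lebesgue_integral_cong)
  then show ?thesis by (simp add: Q_fun_def)
qed

lemma Q_fun_eq_integral:
  assumes "continuous_on {0..\<tau>} z" "0 < \<tau>"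
  shows "Q_fun \<tau> z = 1 / \<tau>^2 * (integral {0..\<tau>} (\<lambda>u. (z u - u / \<tau> * z \<tau>)^2)
     - 1 / \<tau> * (integral {0..\<tau>} (\<lambda>u. z u - u / \<tau> * z \<tau>))^2)"
proof -
  have c: "continuous_on {0..\<tau>} (\<lambda>u. z u - u / \<tau> * z \<tau>)"
    "continuous_on {0..\<tau>} (\<lambda>u. (z u - u / \<tau> * z \<tau>)^2)"
    using assms by (auto intro!: continuous_intros)
  show ?thesis
    unfolding Q_fun_def
    by (simp only: set_borel_integral_eq_integral(2)[OF borel_integrable_atLeastAtMost'[OF c(1)]]
      set_borel_integral_eq_integral(2)[OF borel_integrable_atLeastAtMost'[OF c(2)]])
qed

text \<open>The samples are compared with \<open>y\<close> stopped at \<open>c\<close>, because the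
  backward sums may run one grid point past the end of the interval on which the limit path lives.
  The index \<open>m i\<close> may vary with \<open>i\<close>, which later yields uniformity in
  time.\<close>

theorem quad_stat_tendsto:
  assumes y: "continuous_on {0..c} y" and t: "0 < t" "t \<le> c"
    and n: "filterlim n at_top sequentially" and mn: "(\<lambda>i. real (m i) / real (n i)) \<longlonglongrightarrow> t"
    and close: "\<And>e. 0 < e \<Longrightarrow>
      eventually (\<lambda>i. \<forall>j\<in>{1..m i}. \<bar>S i j - y (min c (real j / real (n i)))\<bar> \<le> e) sequentially"
  shows "(\<lambda>i. quad_stat (n i) (S i) (m i)) \<longlonglongrightarrow> Q_fun t y"
proof -
  \<comment> \<open>Extending \<open>y\<close> by constants on both sides gives a function
    continuous on the whole line, as the Riemann sum lemmas require.\<close>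
  define y' where "y' u = y (max 0 (min c u))" for u
  have c: "0 < c" using t by simp
  have y'c: "continuous_on A y'" for A
    unfolding y'_def using c by (intro continuous_on_compose2[OF y] continuous_intros) auto
  have y'_eq: "y' u = y (min c u)" if "0 \<le> u" for u using that c by (simp add: y'_def max_def)
  define g where "g u = y' u - u / t * y' t" for u
  have gc: "continuous_on A g" for A
    unfolding g_def using t by (intro continuous_intros y'c) simp
  have close': "eventually (\<lambda>i. \<forall>j\<in>{1..m i}. \<bar>S i j - y' (real j / real (n i))\<bar> \<le> e) sequentially" if "0 < e" for e
    using close[OF that] by (simp add: y'_eq)
  have ev_m: "eventually (\<lambda>i. real (m i) / real (n i) < t + 1) sequentially"
    by (rule order_tendstoD[OF mn]) simp
  have "eventually (\<lambda>i. 0 < real (m i) / real (n i)) sequentially"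
    by (rule order_tendstoD[OF mn]) (rule t)
  then have pos: "eventually (\<lambda>i. 0 < m i \<and> 0 < n i) sequentially"
    by eventually_elim (auto simp: zero_less_divide_iff)
  have "(\<lambda>i. S i (m i) - y' (real (m i) / real (n i))) \<longlonglongrightarrow> 0"
  proof (rule tendstoI)
    fix e :: real assume "0 < e"
    then have "0 < e / 2" by simp
    show "eventually (\<lambda>i. dist (S i (m i) - y' (real (m i) / real (n i))) 0 < e) sequentially"
      using close'[OF \<open>0 < e / 2\<close>] pos
    proof eventually_elim
      case (elim i)
      then have "\<bar>S i (m i) - y' (real (m i) / real (n i))\<bar> \<le> e / 2" by auto
      then show ?case using \<open>0 < e\<close> by (simp add: dist_real_def)
    qed
  qed
  moreover have "(\<lambda>i. y' (real (m i) / real (n i))) \<longlonglongrightarrow> y' t"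
    by (rule continuous_on_tendsto_compose[OF y'c[of UNIV] mn]) auto
  ultimately have "(\<lambda>i. (S i (m i) - y' (real (m i) / real (n i))) + y' (real (m i) / real (n i))) \<longlonglongrightarrow> 0 + y' t"
    by (rule tendsto_add)
  then have Sm: "(\<lambda>i. S i (m i)) \<longlonglongrightarrow> y' t" by simp
  \<comment> \<open>The slope of the chord: the discrete bridge at \<open>j\<close> is
    \<open>S i j\<close> minus \<open>r i\<close> times the grid time of \<open>j\<close>.\<close>
  define r where "r i = S i (m i) / (real (m i) / real (n i))" for i
  have r: "(\<lambda>i. r i) \<longlonglongrightarrow> y' t / t"
    unfolding r_def by (rule tendsto_divide[OF Sm mn]) (use t in simp)
  define s where "s i j = S i j - real j / real (m i) * S i (m i)" for i j
  have close_s: "eventually (\<lambda>i. \<forall>j\<in>{1..m i}. \<bar>s i j - g (real j / real (n i))\<bar> \<le> e) sequentially" if e: "0 < e" for e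
  proof -
    define d where "d = e / 2 / (t + 1)"
    have "t + 1 \<noteq> 0" using t by linarith
    then have dt: "d * (t + 1) = e / 2"
      unfolding d_def by (subst times_divide_eq_left) (rule nonzero_mult_div_cancel_right)
    have d: "0 < d" using e t by (simp add: d_def)
    have rd: "eventually (\<lambda>i. dist (r i) (y' t / t) < d) sequentially" using r d by (rule tendstoD)
    from e have "0 < e / 2" by simp
    from rd close'[OF this] ev_m pos show ?thesis
    proof eventually_elim
      case (elim i)
      show ?case
      proof
        fix j assume j: "j \<in> {1..m i}"
        have jm: "real j / real (n i) \<le> real (m i) / real (n i)"
          using j by (intro divide_right_mono) auto
        have "s i j - g (real j / real (n i))
          = (S i j - y' (real j / real (n i))) - real j / real (n i) * (r i - y' t / t)"
          using elim t by (simp add: s_def g_def r_def field_simps)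
        also have "\<bar>\<dots>\<bar> \<le> e / 2 + (t + 1) * d"
        proof -
          have "\<bar>real j / real (n i) * (r i - y' t / t)\<bar> = real j / real (n i) * \<bar>r i - y' t / t\<bar>"
            by (simp only: abs_mult) simp
          also have "\<dots> \<le> (t + 1) * d"
            using elim jm t by (intro mult_mono) (auto simp: dist_real_def)
          finally show ?thesis using elim j abs_triangle_ineq4[of "S i j - y' (real j / real (n i))"
              "real j / real (n i) * (r i - y' t / t)"] by fastforce
        qed
        also have "\<dots> = e" using dt by (simp add: mult.commute)
        finally show "\<bar>s i j - g (real j / real (n i))\<bar> \<le> e" .
      qed
    qed
  qed
  obtain G where G: "\<And>u. u \<in> {0..t + 1} \<Longrightarrow> \<bar>g u\<bar> \<le> G"
  proof -
    have "compact (g ` {0..t + 1})" by (intro compact_continuous_image gc) simp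
    then obtain G where "\<forall>x\<in>g ` {0..t + 1}. norm x \<le> G" using compact_imp_bounded bounded_iff by blast
    then show ?thesis by (intro that[of G]) auto
  qed
  have G0: "0 \<le> G" using G[of 0] t by simp
  have close_s2: "eventually (\<lambda>i. \<forall>j\<in>{1..m i}. \<bar>s i j ^ 2 - g (real j / real (n i)) ^ 2\<bar> \<le> e) sequentially"
    if e: "0 < e" for e
  proof -
    \<comment> \<open>At most 1, so that in the factored difference of squares the sum of
      \<open>s i j\<close> and the value of \<open>g\<close> is bounded by
      \<open>1 + 2 * G\<close>.\<close>
    define d where "d = min 1 (e / (1 + 2 * G))"
    have d: "0 < d" "d \<le> 1" using e G0 by (auto simp: d_def)
    have "d \<le> e / (1 + 2 * G)" unfolding d_def by (rule min.cobounded2)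
    moreover have "0 < 1 + 2 * G" using G0 by simp
    ultimately have dG: "d * (1 + 2 * G) \<le> e" by (simp only: pos_le_divide_eq)
    show ?thesis using close_s[OF d(1)] ev_m
    proof eventually_elim
      case (elim i)
      show ?case
      proof
        fix j assume j: "j \<in> {1..m i}"
        have jm: "real j / real (n i) \<le> real (m i) / real (n i)"
          using j by (intro divide_right_mono) auto
        let ?x = "real j / real (n i)"
        have x: "\<bar>g ?x\<bar> \<le> G" using jm elim by (intro G) auto
        have d': "\<bar>s i j - g ?x\<bar> \<le> d" using elim j by blast
        have "\<bar>s i j ^ 2 - g ?x ^ 2\<bar> = \<bar>s i j - g ?x\<bar> * \<bar>s i j + g ?x\<bar>"
          by (simp add: power2_eq_square square_diff_square_factored abs_mult mult.commute)
        also have "\<dots> \<le> d * (1 + 2 * G)"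
          using d' x d G0 by (intro mult_mono) auto
        finally show "\<bar>s i j ^ 2 - g ?x ^ 2\<bar> \<le> e" using dG by linarith
      qed
    qed
  qed
  have sum1: "(\<lambda>i. (\<Sum>j=1..m i. s i j) / real (n i)) \<longlonglongrightarrow> integral {0..t} g"
    by (rule Riemann_sum_tendsto[OF gc n mn _ close_s]) (use t in simp_all)
  have sum2: "(\<lambda>i. (\<Sum>j=1..m i. s i j ^ 2) / real (n i)) \<longlonglongrightarrow> integral {0..t} (\<lambda>u. g u ^ 2)"
    by (rule Riemann_sum_tendsto[OF _ n mn _ close_s2]) (use t gc in \<open>auto intro: continuous_on_power\<close>)
  have im: "(\<lambda>i. inverse (real (m i) / real (n i))) \<longlonglongrightarrow> inverse t"
    by (rule tendsto_inverse[OF mn]) (use t in simp)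
  have "(\<lambda>i. inverse (real (m i) / real (n i)) ^ 2 * ((\<Sum>j=1..m i. s i j ^ 2) / real (n i))
      - inverse (real (m i) / real (n i)) ^ 3 * ((\<Sum>j=1..m i. s i j) / real (n i)) ^ 2)
    \<longlonglongrightarrow> inverse t ^ 2 * integral {0..t} (\<lambda>u. g u ^ 2) - inverse t ^ 3 * (integral {0..t} g) ^ 2"
    by (intro tendsto_diff tendsto_mult tendsto_power im sum1 sum2)
  also have "inverse t ^ 2 * integral {0..t} (\<lambda>u. g u ^ 2) - inverse t ^ 3 * (integral {0..t} g) ^ 2
      = Q_fun t y"
  proof -
    have eq: "g u = y u - u / t * y t" if "u \<in> {0..t}" for u
      using that t by (simp add: g_def y'_eq)
    have i1: "integral {0..t} g = integral {0..t} (\<lambda>u. y u - u / t * y t)"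
      by (rule Henstock_Kurzweil_Integration.integral_cong) (rule eq)
    have i2: "integral {0..t} (\<lambda>u. g u ^ 2) = integral {0..t} (\<lambda>u. (y u - u / t * y t) ^ 2)"
      by (rule Henstock_Kurzweil_Integration.integral_cong) (simp add: eq)
    have "continuous_on {0..t} y" using y by (rule continuous_on_subset) (use t in auto)
    then show ?thesis
      unfolding i1 i2 using t
      by (simp add: Q_fun_eq_integral field_simps power2_eq_square power3_eq_cube)
  qed
  finally show ?thesis
  proof (rule Lim_transform_eventually)
    show "\<forall>\<^sub>F i in sequentially. inverse (real (m i) / real (n i)) ^ 2 * ((\<Sum>j=1..m i. s i j ^ 2) / real (n i))
      - inverse (real (m i) / real (n i)) ^ 3 * ((\<Sum>j=1..m i. s i j) / real (n i)) ^ 2 = quad_stat (n i) (S i) (m i)"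
      using pos
      by eventually_elim (simp add: quad_stat_def s_def power2_eq_square power3_eq_cube)
  qed
qed

text \<open>Exact samples of \<open>y\<close> leave no approximation error. Nonnegativity and
  continuity in time of \<open>Q_fun\<close> are inherited from the discrete functional in this
  way.\<close>

lemma quad_stat_grid_tendsto:
  assumes y: "continuous_on {0..c} y" and t: "0 < t" "t \<le> c"
  shows "(\<lambda>n. quad_stat n (\<lambda>j. y (real j / real n)) (fl n t)) \<longlonglongrightarrow> Q_fun t y"
proof (rule quad_stat_tendsto[OF y t filterlim_ident])
  show "(\<lambda>i. real (fl i t) / real i) \<longlonglongrightarrow> t"
    by (rule fl_tendsto[OF filterlim_ident tendsto_const]) (use t in simp)
  fix e :: real assume e: "0 < e"
  have "min c (real j / real n) = real j / real n" if "j \<in> {1..fl n t}" for j n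
  proof -
    have "real j / real n \<le> real (fl n t) / real n" using that by (intro divide_right_mono) auto
    also have "\<dots> \<le> t" by (rule fl_divide_le) (use t in simp)
    finally show ?thesis using t by simp
  qed
  then show "\<forall>\<^sub>F i in sequentially. \<forall>j\<in>{1..fl i t}. \<bar>y (real j / real i) - y (min c (real j / real i))\<bar> \<le> e"
    using e by simp
qed

lemma Q_fun_nonneg:
  assumes "continuous_on {0..c} y" "0 < t" "t \<le> c"
  shows "0 \<le> Q_fun t y"
  by (rule LIMSEQ_le_const[OF quad_stat_grid_tendsto[OF assms]]) (auto intro: quad_stat_nonneg)

text \<open>Diagonal argument: for each \<open>i\<close> the grid is so fine that the discrete
  functional at \<open>u i\<close> is within \<open>1 / Suc i\<close> of
  \<open>Q_fun (u i) y\<close>. Along these grids the discrete functionals converge to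
  \<open>Q_fun t y\<close>, as the index is free to vary.\<close>

lemma continuous_on_Q_fun:
  assumes y: "continuous_on {0..c} y"
  shows "continuous_on {0<..c} (\<lambda>t. Q_fun t y)"
proof (rule continuous_on_sequentiallyI)
  fix u :: "nat \<Rightarrow> real" and t assume u: "\<forall>n. u n \<in> {0<..c}" and t: "t \<in> {0<..c}" and lim: "u \<longlonglongrightarrow> t"
  have "\<exists>N. \<forall>n\<ge>N. dist (quad_stat n (\<lambda>j. y (real j / real n)) (fl n (u i))) (Q_fun (u i) y) < 1 / real (Suc i)" for i
  proof -
    have "eventually (\<lambda>n. dist (quad_stat n (\<lambda>j. y (real j / real n)) (fl n (u i))) (Q_fun (u i) y) < 1 / real (Suc i)) sequentially"
      using u by (intro tendstoD[OF quad_stat_grid_tendsto[OF y]]) auto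
    then show ?thesis by (simp only: eventually_sequentially)
  qed
  then have "\<exists>N. \<forall>i. \<forall>n\<ge>N i. dist (quad_stat n (\<lambda>j. y (real j / real n)) (fl n (u i))) (Q_fun (u i) y) < 1 / real (Suc i)"
    by (intro choice allI)
  then obtain N where N: "\<And>i n. n \<ge> N i \<Longrightarrow> dist (quad_stat n (\<lambda>j. y (real j / real n)) (fl n (u i))) (Q_fun (u i) y) < 1 / real (Suc i)"
    by blast
  define n where "n i = max i (N i)" for i
  have n: "filterlim n at_top sequentially"
    by (rule filterlim_at_top_mono[OF filterlim_ident]) (auto simp: n_def)
  have 1: "(\<lambda>i. quad_stat (n i) (\<lambda>j. y (real j / real (n i))) (fl (n i) (u i))) \<longlonglongrightarrow> Q_fun t y"
  proof (rule quad_stat_tendsto[OF y _ _ n])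
    show "0 < t" "t \<le> c" using t by auto
    show "(\<lambda>i. real (fl (n i) (u i)) / real (n i)) \<longlonglongrightarrow> t"
      by (rule fl_tendsto[OF n lim]) (use u in \<open>auto intro: less_imp_le\<close>)
    fix e :: real assume e: "0 < e"
    have "min c (real j / real (n i)) = real j / real (n i)" if "j \<in> {1..fl (n i) (u i)}" for j i
    proof -
      have "real j / real (n i) \<le> real (fl (n i) (u i)) / real (n i)" using that by (intro divide_right_mono) auto
      also have "\<dots> \<le> u i" by (rule fl_divide_le) (use u in \<open>auto intro: less_imp_le\<close>)
      finally show ?thesis using spec[OF u, of i] by simp
    qed
    then show "\<forall>\<^sub>F i in sequentially. \<forall>j\<in>{1..fl (n i) (u i)}.
        \<bar>y (real j / real (n i)) - y (min c (real j / real (n i)))\<bar> \<le> e"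
      using e by simp
  qed
  have "(\<lambda>i. Q_fun (u i) y - quad_stat (n i) (\<lambda>j. y (real j / real (n i))) (fl (n i) (u i))) \<longlonglongrightarrow> 0"
  proof (rule Lim_null_comparison[OF always_eventually LIMSEQ_Suc[OF lim_1_over_n]], intro allI)
    fix i
    have "n i \<ge> N i" by (simp add: n_def)
    from N[OF this] show "norm (Q_fun (u i) y - quad_stat (n i) (\<lambda>j. y (real j / real (n i))) (fl (n i) (u i)))
        \<le> 1 / real (Suc i)" by (simp add: dist_real_def abs_minus_commute)
  qed
  from tendsto_add[OF this 1] show "(\<lambda>n. Q_fun (u n) y) \<longlonglongrightarrow> Q_fun t y" by simp
qed

text \<open>\<open>t^2 * Q_fun t y\<close> is the integral of the squared deviation of the bridge
  from its mean. It vanishes only for a constant bridge, and the constant is 0 since the bridge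
  starts at 0.\<close>

lemma Q_fun_eq_0_iff:
  assumes y: "continuous_on {0..c} y" "y 0 = 0" and t: "0 < t" "t \<le> c"
  shows "Q_fun t y = 0 \<longleftrightarrow> (\<forall>u\<in>{0..t}. y u = u / t * y t)"
proof -
  define g where "g u = y u - u / t * y t" for u
  have gc: "continuous_on {0..t} g"
    unfolding g_def using t by (intro continuous_intros continuous_on_subset[OF y(1)]) auto
  have Q: "Q_fun t y = 1 / t^2 * (integral {0..t} (\<lambda>u. g u ^ 2) - 1 / t * (integral {0..t} g)^2)"
    using Q_fun_eq_integral[of t y] continuous_on_subset[OF y(1), of "{0..t}"] t
    unfolding g_def by auto
  define a where "a = integral {0..t} g / t"
  have gi: "g integrable_on {0..t}" "(\<lambda>u. g u ^ 2) integrable_on {0..t}"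
    using gc by (auto intro!: integrable_continuous_real continuous_intros)
  have "integral {0..t} (\<lambda>u. (g u - a) ^ 2) = integral {0..t} (\<lambda>u. g u ^ 2 - (2 * a * g u - a ^ 2))"
    by (simp add: power2_eq_square algebra_simps)
  also have "\<dots> = integral {0..t} (\<lambda>u. g u ^ 2) - (2 * a * integral {0..t} g - a ^ 2 * t)"
    using gi t by (simp add: Henstock_Kurzweil_Integration.integral_diff integrable_diff
        integrable_on_mult_right integrable_const_ivl)
  also have "\<dots> = t ^ 2 * Q_fun t y"
    unfolding Q a_def using t by (simp add: field_simps power2_eq_square)
  finally have var: "integral {0..t} (\<lambda>u. (g u - a) ^ 2) = t ^ 2 * Q_fun t y" .
  have "Q_fun t y = 0 \<longleftrightarrow> (\<forall>u\<in>{0..t}. (g u - a) ^ 2 = 0)"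
  proof -
    have "continuous_on {0..t} (\<lambda>u. (g u - a) ^ 2)" by (intro continuous_intros gc)
    from integral_eq_0_iff[OF this t(1)] show ?thesis unfolding var using t by simp
  qed
  also have "\<dots> \<longleftrightarrow> (\<forall>u\<in>{0..t}. g u = a)" by simp
  also have "\<dots> \<longleftrightarrow> (\<forall>u\<in>{0..t}. g u = 0)"
  proof
    assume g: "\<forall>u\<in>{0..t}. g u = a"
    have "g 0 = 0" using y by (simp add: g_def)
    then have "a = 0" using bspec[OF g, of 0] t by simp
    with g show "\<forall>u\<in>{0..t}. g u = 0" by simp
  next
    assume g: "\<forall>u\<in>{0..t}. g u = 0"
    then have "integral {0..t} g = integral {0..t} (\<lambda>_. 0)"
      by (intro Henstock_Kurzweil_Integration.integral_cong) simp
    then have "a = 0" by (simp add: a_def)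
    with g show "\<forall>u\<in>{0..t}. g u = a" by simp
  qed
  finally show ?thesis by (simp add: g_def)
qed

text \<open>A path that is linear up to \<open>t\<close> is linear up to every earlier time. Almost
  sure positivity at the left end of an interval thus gives positivity on all of it outside one null
  set.\<close>

lemma Q_fun_pos_mono:
  assumes y: "continuous_on {0..c} y" "y 0 = 0" and st: "0 < s" "s \<le> t" "t \<le> c" and pos: "0 < Q_fun s y"
  shows "0 < Q_fun t y"
proof (rule ccontr)
  assume "\<not> ?thesis"
  then have "Q_fun t y = 0" using Q_fun_nonneg[of c y t] y st by simp
  moreover have "0 < t" using st by linarith
  ultimately have lin: "\<forall>u\<in>{0..t}. y u = u / t * y t" using Q_fun_eq_0_iff[OF y] st(3) by blast
  have "y u = u / s * y s" if u: "u \<in> {0..s}" for u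
  proof -
    have 1: "y u = u / t * y t" by (rule bspec[OF lin]) (use u st in simp)
    have 2: "y s = s / t * y t" by (rule bspec[OF lin]) (use st in simp)
    have "u / t * y t = u / s * (s / t * y t)" using st by simp
    then show ?thesis unfolding 1[symmetric] 2[symmetric] .
  qed
  moreover have "s \<le> c" using st by linarith
  ultimately have "Q_fun s y = 0" using Q_fun_eq_0_iff[OF y st(1)] by blast
  with pos show False by simp
qed

subsection \<open>The space \<open>D[a,b]\<close>\<close>

lemma mspace_D_metric:
  "x \<in> mspace (D_metric a b) \<longleftrightarrow> cadlag_on a b x \<and> x \<in> extensional {a..b} \<and> bounded (x ` {a..b})"
  by (auto simp: D_metric_def Met_TC.fspace_def)

lemma mdist_D_metric:
  assumes "x \<in> mspace (D_metric a b)" "y \<in> mspace (D_metric a b)" "a \<le> b"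
  shows "mdist (D_metric a b) x y = (SUP t\<in>{a..b}. \<bar>x t - y t\<bar>)"
  using assms by (simp add: D_metric_def Met_TC.fdist_def dist_real_def)

lemma abs_diff_le_mdist_D:
  assumes x: "x \<in> mspace (D_metric a b)" and y: "y \<in> mspace (D_metric a b)" and t: "t \<in> {a..b}"
  shows "\<bar>x t - y t\<bar> \<le> mdist (D_metric a b) x y"
proof -
  have ab: "a \<le> b" using t by simp
  obtain B B' where B: "\<forall>v\<in>x ` {a..b}. norm v \<le> B" and B': "\<forall>v\<in>y ` {a..b}. norm v \<le> B'"
    using x y unfolding mspace_D_metric bounded_iff by blast
  have "\<bar>x t - y t\<bar> \<le> B + B'" if "t \<in> {a..b}" for t
  proof -
    have "\<bar>x t\<bar> \<le> B" "\<bar>y t\<bar> \<le> B'" using B B' that by auto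
    then show ?thesis by linarith
  qed
  then show ?thesis unfolding mdist_D_metric[OF x y ab]
    by (intro cSUP_upper t bdd_aboveI2) auto
qed

lemma mdist_D_le:
  assumes "x \<in> mspace (D_metric a b)" "y \<in> mspace (D_metric a b)" "a \<le> b"
    and "\<And>t. t \<in> {a..b} \<Longrightarrow> \<bar>x t - y t\<bar> \<le> e"
  shows "mdist (D_metric a b) x y \<le> e"
  unfolding mdist_D_metric[OF assms(1-3)] using assms(3,4) by (intro cSUP_least) auto

lemma cadlag_on_rightD: "cadlag_on a b x \<Longrightarrow> t \<in> {a..<b} \<Longrightarrow> (x \<longlongrightarrow> x t) (at_right t)"
  by (simp add: cadlag_on_def)

lemma cadlag_on_leftE:
  assumes "cadlag_on a b x" "t \<in> {a<..b}"
  obtains l where "(x \<longlongrightarrow> l) (at_left t)"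
  using assms unfolding cadlag_on_def by blast

lemma cadlag_on_cong:
  assumes "\<And>t. t \<in> {a..b} \<Longrightarrow> x t = y t" and x: "cadlag_on a b x"
  shows "cadlag_on a b y"
  unfolding cadlag_on_def
proof (intro conjI ballI)
  fix t assume t: "t \<in> {a..<b}"
  have "eventually (\<lambda>s. s \<in> {t<..<b}) (at_right t)" using t by (intro eventually_at_right_real) simp
  then have "eventually (\<lambda>s. x s = y s) (at_right t)" by eventually_elim (use assms t in simp)
  moreover have "(x \<longlongrightarrow> x t) (at_right t)" using x t by (auto simp: cadlag_on_def)
  ultimately have "(y \<longlongrightarrow> x t) (at_right t)" by (rule Lim_transform_eventually[rotated])
  then show "(y \<longlongrightarrow> y t) (at_right t)" using assms t by simp
next
  fix t assume t: "t \<in> {a<..b}"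
  have "eventually (\<lambda>s. s \<in> {a<..<t}) (at_left t)" using t by (intro eventually_at_left_real) simp
  then have "eventually (\<lambda>s. x s = y s) (at_left t)" by eventually_elim (use assms t in simp)
  moreover obtain l where "(x \<longlongrightarrow> l) (at_left t)" using cadlag_on_leftE[OF x t] .
  ultimately show "\<exists>l. (y \<longlongrightarrow> l) (at_left t)" by (intro exI[of _ l]) (rule Lim_transform_eventually[rotated])
qed

lemma restrict_in_D:
  assumes "cadlag_on a b x" "bounded (x ` {a..b})"
  shows "restrict x {a..b} \<in> mspace (D_metric a b)"
proof -
  have "restrict x {a..b} ` {a..b} = x ` {a..b}" by auto
  then show ?thesis unfolding mspace_D_metric using assms
    by (auto intro: cadlag_on_cong[of a b x])
qed

lemma continuous_on_imp_cadlag_on: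
  assumes x: "continuous_on {a..b} x"
  shows "cadlag_on a b x"
  unfolding cadlag_on_def
proof (intro conjI ballI)
  fix t assume t: "t \<in> {a..<b}"
  have "(x \<longlongrightarrow> x t) (at t within {a..b})" using x t by (auto simp: continuous_on_def)
  then have "(x \<longlongrightarrow> x t) (at t within {t..b})" by (rule tendsto_within_subset) (use t in auto)
  then show "(x \<longlongrightarrow> x t) (at_right t)" using t by (simp add: at_within_Icc_at_right)
next
  fix t assume t: "t \<in> {a<..b}"
  have "(x \<longlongrightarrow> x t) (at t within {a..b})" using x t by (auto simp: continuous_on_def)
  then have "(x \<longlongrightarrow> x t) (at t within {a..t})" by (rule tendsto_within_subset) (use t in auto)
  then show "\<exists>l. (x \<longlongrightarrow> l) (at_left t)" using t by (intro exI[of _ "x t"]) (simp add: at_within_Icc_at_left)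
qed

lemma continuous_restrict_in_D:
  assumes "continuous_on {a..b} x"
  shows "restrict x {a..b} \<in> mspace (D_metric a b)"
  by (intro restrict_in_D continuous_on_imp_cadlag_on assms compact_imp_bounded
      compact_continuous_image compact_Icc)

text \<open>At \<open>p\<close> itself the switch already takes the second branch, which is what
  right-continuity needs.\<close>

lemma cadlag_on_if_less:
  assumes f: "cadlag_on a b f" and g: "cadlag_on a b g"
  shows "cadlag_on a b (\<lambda>s. if s < p then f s else g s)"
  unfolding cadlag_on_def
proof (intro conjI ballI)
  fix t assume t: "t \<in> {a..<b}"
  have fg: "(f \<longlongrightarrow> f t) (at_right t)" "(g \<longlongrightarrow> g t) (at_right t)"
    using f g t by (auto simp: cadlag_on_def)
  show "((\<lambda>s. if s < p then f s else g s) \<longlongrightarrow> (if t < p then f t else g t)) (at_right t)"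
  proof (cases "t < p")
    case True
    then have "eventually (\<lambda>s. s \<in> {t<..<p}) (at_right t)" by (rule eventually_at_right_real)
    then have "eventually (\<lambda>s. f s = (if s < p then f s else g s)) (at_right t)" by eventually_elim simp
    from Lim_transform_eventually[OF fg(1) this] show ?thesis using True by simp
  next
    case False
    have "eventually (\<lambda>s. s \<in> {t<..<t + 1}) (at_right t)" by (rule eventually_at_right_real) simp
    then have "eventually (\<lambda>s. g s = (if s < p then f s else g s)) (at_right t)"
      by eventually_elim (use False in simp)
    from Lim_transform_eventually[OF fg(2) this] show ?thesis using False by simp
  qed
next
  fix t assume t: "t \<in> {a<..b}"
  obtain l l' where fg: "(f \<longlongrightarrow> l) (at_left t)" "(g \<longlongrightarrow> l') (at_left t)"
    using cadlag_on_leftE[OF f t] cadlag_on_leftE[OF g t] by metis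
  show "\<exists>l. ((\<lambda>s. if s < p then f s else g s) \<longlongrightarrow> l) (at_left t)"
  proof (cases "p < t")
    case True
    then have "eventually (\<lambda>s. s \<in> {p<..<t}) (at_left t)" by (rule eventually_at_left_real)
    then have "eventually (\<lambda>s. g s = (if s < p then f s else g s)) (at_left t)" by eventually_elim simp
    from Lim_transform_eventually[OF fg(2) this] show ?thesis by blast
  next
    case False
    have "eventually (\<lambda>s. s \<in> {t - 1<..<t}) (at_left t)" by (rule eventually_at_left_real) simp
    then have "eventually (\<lambda>s. f s = (if s < p then f s else g s)) (at_left t)"
      by eventually_elim (use False in simp)
    from Lim_transform_eventually[OF fg(1) this] show ?thesis by blast
  qed
qed

lemma fl_eq_iff:
  assumes "0 \<le> real n * \<tau>"
  shows "fl n \<tau> = k \<longleftrightarrow> real k \<le> real n * \<tau> \<and> real n * \<tau> < real k + 1"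
proof -
  have "0 \<le> \<lfloor>real n * \<tau>\<rfloor>" using assms by simp
  then have "fl n \<tau> = k \<longleftrightarrow> \<lfloor>real n * \<tau>\<rfloor> = int k" by (auto simp: fl_def)
  then show ?thesis by (simp add: floor_eq_iff)
qed

lemma fl_eventually_at_right:
  assumes "0 \<le> t"
  shows "eventually (\<lambda>s. fl n s = fl n t) (at_right t)"
proof (cases "n = 0")
  case False
  let ?u = "(real (fl n t) + 1) / real n"
  have t: "real (fl n t) \<le> real n * t" "real n * t < real (fl n t) + 1"
    using fl_le[OF assms, of n] fl_gt[of n t] by linarith+
  then have "t < ?u" using False by (simp add: field_simps)
  then have "eventually (\<lambda>s. s \<in> {t<..<?u}) (at_right t)" by (rule eventually_at_right_real)
  then show ?thesis
  proof eventually_elim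
    case (elim s)
    have "real n * t \<le> real n * s" using elim by (intro mult_left_mono) auto
    moreover have "real n * s < real (fl n t) + 1" using elim False by (simp add: field_simps)
    moreover have "0 \<le> real n * s" using elim assms by simp
    ultimately show ?case using t by (subst fl_eq_iff) auto
  qed
qed (simp add: fl_def)

lemma fl_eventually_at_left:
  assumes "0 < t"
  shows "\<exists>k. eventually (\<lambda>s. fl n s = k) (at_left t)"
proof (cases "n = 0")
  case False
  define c where "c = \<lceil>real n * t\<rceil> - 1"
  have c: "of_int c < real n * t" "real n * t \<le> of_int c + 1" unfolding c_def by linarith+
  have c0: "0 \<le> c" using assms False unfolding c_def by (simp add: one_le_ceiling)
  have "of_int c / real n < t" using c False by (simp add: field_simps)
  then have "eventually (\<lambda>s. s \<in> {of_int c / real n<..<t}) (at_left t)" by (rule eventually_at_left_real)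
  then have "eventually (\<lambda>s. fl n s = nat c) (at_left t)"
  proof eventually_elim
    case (elim s)
    have 1: "of_int c < real n * s" using elim False by (simp add: field_simps)
    have 2: "real n * s < real n * t" using elim False by simp
    have 3: "0 \<le> real n * s" using 1 c0 by linarith
    have 4: "real (nat c) = of_int c" using c0 by simp
    show ?case unfolding fl_eq_iff[OF 3] 4 using 1 2 c by linarith
  qed
  then show ?thesis by blast
qed (simp add: fl_def)

lemma cadlag_on_fl:
  assumes "0 \<le> a"
  shows "cadlag_on a b (\<lambda>\<tau>. g (fl n \<tau>))"
  unfolding cadlag_on_def
proof (intro conjI ballI)
  fix t assume "t \<in> {a..<b}"
  then have "eventually (\<lambda>s. fl n s = fl n t) (at_right t)" using assms by (intro fl_eventually_at_right) simp
  then have "eventually (\<lambda>s. g (fl n s) = g (fl n t)) (at_right t)" by eventually_elim simp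
  then show "((\<lambda>\<tau>. g (fl n \<tau>)) \<longlongrightarrow> g (fl n t)) (at_right t)" by (rule tendsto_eventually)
next
  fix t assume "t \<in> {a<..b}"
  then obtain k where "eventually (\<lambda>s. fl n s = k) (at_left t)" using assms fl_eventually_at_left[of t n] by auto
  then have "eventually (\<lambda>s. g (fl n s) = g k) (at_left t)" by eventually_elim simp
  then show "\<exists>l. ((\<lambda>\<tau>. g (fl n \<tau>)) \<longlongrightarrow> l) (at_left t)" by (intro exI tendsto_eventually)
qed

lemma fl_image_subset: "fl n ` {a..b} \<subseteq> {..fl n b}"
  by (auto intro: fl_mono)

lemma finite_image_fl: "finite ((\<lambda>\<tau>. g (fl n \<tau>)) ` {a..b})"
proof -
  have "(\<lambda>\<tau>. g (fl n \<tau>)) ` {a..b} = g ` fl n ` {a..b}" by (simp add: image_image)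
  then show ?thesis using finite_subset[OF fl_image_subset] by simp
qed

lemma step_in_D:
  assumes "0 \<le> a"
  shows "restrict (\<lambda>\<tau>. g (fl n \<tau>)) {a..b} \<in> mspace (D_metric a b)"
  by (intro restrict_in_D cadlag_on_fl assms finite_imp_bounded finite_image_fl)

subsection \<open>The ball \<open>\<sigma>\<close>-field and the coordinate projections\<close>

text \<open>A larger value at \<open>t\<close> would persist on an interval to the right of
  \<open>t\<close>, which contains a rational. The end point \<open>b\<close> has no such interval
  inside the domain and is added by hand.\<close>

lemma cadlag_abs_le_dense:
  assumes z: "cadlag_on a b z" and S: "\<And>q. q \<in> {a..b} \<Longrightarrow> q \<in> \<rat> \<union> {b} \<Longrightarrow> \<bar>z q\<bar> \<le> S" and t: "t \<in> {a..b}"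
  shows "\<bar>z t\<bar> \<le> S"
proof (cases "t = b")
  case True
  then show ?thesis using S t by simp
next
  case False
  then have tb: "t < b" using t by simp
  show ?thesis
  proof (rule ccontr)
    assume "\<not> \<bar>z t\<bar> \<le> S"
    then have less: "S < \<bar>z t\<bar>" by simp
    have "((\<lambda>s. \<bar>z s\<bar>) \<longlongrightarrow> \<bar>z t\<bar>) (at_right t)"
      using z t tb by (intro tendsto_rabs) (auto simp: cadlag_on_def)
    then have "eventually (\<lambda>s. S < \<bar>z s\<bar>) (at_right t)" using less by (rule order_tendstoD)
    then obtain u where u: "t < u" "\<And>s. t < s \<Longrightarrow> s < u \<Longrightarrow> S < \<bar>z s\<bar>"
      unfolding eventually_at_right_field by blast
    obtain q where q: "q \<in> \<rat>" "t < q" "q < min u b" using Rats_dense_in_real[of t "min u b"] u tb by auto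
    then have "S < \<bar>z q\<bar>" using u by simp
    moreover have "\<bar>z q\<bar> \<le> S" using S q t by simp
    ultimately show False by simp
  qed
qed

lemma cadlag_on_diff:
  assumes "cadlag_on a b x" "cadlag_on a b y"
  shows "cadlag_on a b (\<lambda>t. x t - y t)"
  unfolding cadlag_on_def
proof (intro conjI ballI)
  fix t assume "t \<in> {a..<b}"
  then show "((\<lambda>t. x t - y t) \<longlongrightarrow> x t - y t) (at_right t)"
    by (intro tendsto_diff assms[THEN cadlag_on_rightD])
next
  fix t assume t: "t \<in> {a<..b}"
  obtain l l' where "(x \<longlongrightarrow> l) (at_left t)" "(y \<longlongrightarrow> l') (at_left t)"
    using cadlag_on_leftE[OF assms(1) t] cadlag_on_leftE[OF assms(2) t] by metis
  then show "\<exists>l. ((\<lambda>t. x t - y t) \<longlongrightarrow> l) (at_left t)" by (intro exI[of _ "l - l'"] tendsto_diff)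
qed

text \<open>By right-continuity the supremum defining the distance may be taken over a countable set
  of times.\<close>

lemma mdist_D_measurable:
  assumes ab: "a \<le> b" and x: "x \<in> mspace (D_metric a b)"
    and F: "\<And>\<omega>. \<omega> \<in> space M \<Longrightarrow> F \<omega> \<in> mspace (D_metric a b)"
    and meas: "\<And>t. t \<in> {a..b} \<Longrightarrow> (\<lambda>\<omega>. F \<omega> t) \<in> borel_measurable M"
  shows "(\<lambda>\<omega>. mdist (D_metric a b) x (F \<omega>)) \<in> borel_measurable M"
proof -
  let ?Q = "{a..b} \<inter> (\<rat> \<union> {b})"
  have ne: "?Q \<noteq> {}" using ab by auto
  have Qc: "countable ?Q" by (intro countable_Int2) (simp add: countable_rat)
  have bdd: "bdd_above ((\<lambda>t. \<bar>x t - F \<omega> t\<bar>) ` ?Q)" if "\<omega> \<in> space M" for \<omega>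
    by (rule bdd_aboveI2) (rule abs_diff_le_mdist_D[OF x F[OF that]], simp)
  have "mdist (D_metric a b) x (F \<omega>) = (SUP t\<in>?Q. \<bar>x t - F \<omega> t\<bar>)" if \<omega>: "\<omega> \<in> space M" for \<omega>
  proof (rule antisym)
    have cad: "cadlag_on a b (\<lambda>t. x t - F \<omega> t)"
      using x F[OF \<omega>] by (intro cadlag_on_diff) (simp_all add: mspace_D_metric)
    show "mdist (D_metric a b) x (F \<omega>) \<le> (SUP t\<in>?Q. \<bar>x t - F \<omega> t\<bar>)"
    proof (rule mdist_D_le[OF x F[OF \<omega>] ab])
      fix t assume "t \<in> {a..b}"
      then show "\<bar>x t - F \<omega> t\<bar> \<le> (SUP t\<in>?Q. \<bar>x t - F \<omega> t\<bar>)"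
        by (rule cadlag_abs_le_dense[OF cad, rotated]) (rule cSUP_upper[OF _ bdd[OF \<omega>]], simp)
    qed
    show "(SUP t\<in>?Q. \<bar>x t - F \<omega> t\<bar>) \<le> mdist (D_metric a b) x (F \<omega>)"
      by (intro cSUP_least ne) (use abs_diff_le_mdist_D[OF x F[OF \<omega>]] in auto)
  qed
  moreover have "(\<lambda>\<omega>. SUP t\<in>?Q. \<bar>x t - F \<omega> t\<bar>) \<in> borel_measurable M"
    using bdd by (intro borel_measurable_cSUP Qc borel_measurable_abs borel_measurable_diff
        borel_measurable_const meas) auto
  ultimately show ?thesis by (simp cong: measurable_cong)
qed

abbreviation DD_metric where
  "DD_metric a1 b1 a2 b2 \<equiv> max_metric (D_metric a1 b1) (D_metric a2 b2)"

text \<open>The \<sigma>-field is generated by balls, so it is enough that distances to fixed points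
  are measurable, and these reduce to coordinates.\<close>

lemma measurable_ball_sigma_DD:
  assumes ab: "a1 \<le> b1" "a2 \<le> b2"
    and F: "\<And>\<omega>. \<omega> \<in> space M \<Longrightarrow> F \<omega> \<in> mspace (DD_metric a1 b1 a2 b2)"
    and m1: "\<And>t. t \<in> {a1..b1} \<Longrightarrow> (\<lambda>\<omega>. fst (F \<omega>) t) \<in> borel_measurable M"
    and m2: "\<And>t. t \<in> {a2..b2} \<Longrightarrow> (\<lambda>\<omega>. snd (F \<omega>) t) \<in> borel_measurable M"
  shows "F \<in> M \<rightarrow>\<^sub>M ball_sigma (DD_metric a1 b1 a2 b2)"
  unfolding ball_sigma_def
proof (rule measurable_measure_of)
  let ?m = "DD_metric a1 b1 a2 b2"
  interpret Metric_space "mspace ?m" "mdist ?m" by (rule Metric_space_mspace_mdist)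
  show "{mball x r |x r. x \<in> mspace ?m} \<subseteq> Pow (mspace ?m)" using mball_subset_mspace by blast
  show "F \<in> space M \<rightarrow> mspace ?m" using F by blast
  fix A assume "A \<in> {mball x r |x r. x \<in> mspace ?m}"
  then obtain x r where A: "A = mball x r" and x: "x \<in> mspace ?m" by blast
  have [measurable]: "(\<lambda>\<omega>. mdist (D_metric a1 b1) (fst x) (fst (F \<omega>))) \<in> borel_measurable M"
    "(\<lambda>\<omega>. mdist (D_metric a2 b2) (snd x) (snd (F \<omega>))) \<in> borel_measurable M"
    using x F by (auto intro!: mdist_D_measurable ab m1 m2 simp: mem_Times_iff)
  have "(\<lambda>\<omega>. mdist ?m x (F \<omega>)) \<in> borel_measurable M"
    unfolding mdist_max_metric by measurable
  then have "{\<omega> \<in> space M. mdist ?m x (F \<omega>) < r} \<in> sets M"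
    by (simp add: borel_measurable_iff_less)
  moreover have "A = {y \<in> mspace ?m. mdist ?m x y < r}" using x unfolding A mball_def by blast
  then have "F -` A \<inter> space M = {\<omega> \<in> space M. mdist ?m x (F \<omega>) < r}" using F by blast
  ultimately show "F -` A \<inter> space M \<in> sets M" by simp
qed

text \<open>
  A path exceeds \<open>\<alpha>\<close> at \<open>t\<close> iff it lies within \<open>n\<close> of the spike of height
  \<open>\<alpha> + n + 1/n\<close> on \<open>[t, t + 1/n)\<close> for some \<open>n\<close>; right-continuity is used for the
  forward direction.
\<close>

definition spike :: "real \<Rightarrow> real \<Rightarrow> nat \<Rightarrow> real \<Rightarrow> real" where
  "spike \<alpha> t n s = (if s < t then 0 else if s < t + 1 / real n then \<alpha> + real n + 1 / real n else 0)"

lemma spike_in_D: "restrict (spike \<alpha> t n) {a..b} \<in> mspace (D_metric a b)"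
proof (rule restrict_in_D)
  show "cadlag_on a b (spike \<alpha> t n)"
    unfolding spike_def by (intro cadlag_on_if_less continuous_on_imp_cadlag_on continuous_on_const)
  have "spike \<alpha> t n ` {a..b} \<subseteq> {0, \<alpha> + real n + 1 / real n}" by (auto simp: spike_def)
  then show "bounded (spike \<alpha> t n ` {a..b})" using finite_imp_bounded finite_subset by blast
qed

lemma exceeds_iff_near_spike:
  assumes y: "y \<in> mspace (D_metric a b)" and t: "t \<in> {a..b}"
  shows "\<alpha> < y t \<Longrightarrow> eventually (\<lambda>n. mdist (D_metric a b) (restrict (spike \<alpha> t n) {a..b}) y \<le> real n) sequentially"
    and "0 < n \<Longrightarrow> mdist (D_metric a b) (restrict (spike \<alpha> t n) {a..b}) y \<le> real n \<Longrightarrow> \<alpha> < y t"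
proof -
  have ab: "a \<le> b" using t by simp
  obtain B where B: "\<And>s. s \<in> {a..b} \<Longrightarrow> \<bar>y s\<bar> \<le> B"
  proof -
    obtain B where "\<forall>v\<in>y ` {a..b}. norm v \<le> B" using y unfolding mspace_D_metric bounded_iff by blast
    then show ?thesis by (intro that[of B]) simp
  qed
  show "eventually (\<lambda>n. mdist (D_metric a b) (restrict (spike \<alpha> t n) {a..b}) y \<le> real n) sequentially"
    if \<alpha>: "\<alpha> < y t"
  proof -
    \<comment> \<open>Half the excess of \<open>y t\<close> over \<alpha>. On a window where
      \<open>y\<close> exceeds \<open>\<alpha> + \<kappa>\<close>, a spike of height
      \<open>\<alpha> + n + 1/n\<close> with \<open>1/n\<close> below \<kappa> is still within
      \<open>n\<close> of the path.\<close>
    define \<kappa> where "\<kappa> = (y t - \<alpha>) / 2"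
    have \<kappa>: "0 < \<kappa>" "\<alpha> + \<kappa> < y t" using \<alpha> by (simp_all add: \<kappa>_def field_simps)
    obtain \<delta> where \<delta>: "0 < \<delta>" "\<And>s. s \<in> {a..b} \<Longrightarrow> t \<le> s \<Longrightarrow> s < t + \<delta> \<Longrightarrow> \<alpha> + \<kappa> < y s"
    proof (cases "t = b")
      case True
      then show ?thesis using \<kappa> by (intro that[of 1]) auto
    next
      case False
      then have "(y \<longlongrightarrow> y t) (at_right t)" using y t by (auto simp: mspace_D_metric cadlag_on_def)
      then have "eventually (\<lambda>s. \<alpha> + \<kappa> < y s) (at_right t)" using \<kappa> by (intro order_tendstoD)
      then obtain u where u: "t < u" "\<And>s. t < s \<Longrightarrow> s < u \<Longrightarrow> \<alpha> + \<kappa> < y s"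
        unfolding eventually_at_right_field by blast
      show ?thesis
      proof (rule that[of "u - t"])
        show "0 < u - t" using u by simp
        show "\<alpha> + \<kappa> < y s" if "t \<le> s" "s < t + (u - t)" for s
          using that u \<kappa> by (cases "s = t") auto
      qed
    qed
    have "eventually (\<lambda>n. 1 / real n < min \<delta> \<kappa>) sequentially"
      by (rule order_tendstoD[OF lim_1_over_n]) (use \<delta> \<kappa> in simp)
    moreover have "eventually (\<lambda>n. B + \<bar>\<alpha>\<bar> \<le> real n) sequentially"
      using filterlim_real_sequentially by (simp add: filterlim_at_top)
    ultimately show ?thesis
    proof eventually_elim
      case (elim n)
      have n1: "1 / real n < \<delta>" "1 / real n < \<kappa>" "0 \<le> 1 / real n" using elim by simp_all
      have "\<bar>restrict (spike \<alpha> t n) {a..b} s - y s\<bar> \<le> real n" if s: "s \<in> {a..b}" for s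
      proof (cases "t \<le> s \<and> s < t + 1 / real n")
        case True
        then have "\<alpha> + \<kappa> < y s" using n1 s by (intro \<delta>(2)) auto
        moreover have "spike \<alpha> t n s = \<alpha> + real n + 1 / real n" using True by (simp add: spike_def)
        moreover note B[OF s] n1 elim(2)
        ultimately show ?thesis using s by (simp only: restrict_apply' if_True; linarith)
      next
        case False
        then have "spike \<alpha> t n s = 0" by (auto simp: spike_def)
        then show ?thesis using B[OF s] elim(2) s by simp
      qed
      then show ?case by (intro mdist_D_le spike_in_D y ab)
    qed
  qed
  show "\<alpha> < y t" if n: "0 < n" and le: "mdist (D_metric a b) (restrict (spike \<alpha> t n) {a..b}) y \<le> real n"
  proof -
    have "\<bar>restrict (spike \<alpha> t n) {a..b} t - y t\<bar> \<le> real n"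
      using abs_diff_le_mdist_D[OF spike_in_D y t] le by (rule order_trans)
    moreover have "spike \<alpha> t n t = \<alpha> + real n + 1 / real n" using n by (simp add: spike_def)
    moreover have "0 < 1 / real n" using n by simp
    ultimately show ?thesis using t by (simp only: restrict_apply' if_True; linarith)
  qed
qed

lemma zero_in_D: "restrict (\<lambda>_. 0) {a..b} \<in> mspace (D_metric a b)"
  by (intro continuous_restrict_in_D continuous_on_const)

lemma eventually_mdist_le_real: "eventually (\<lambda>n. mdist m x y \<le> real n) sequentially"
  using filterlim_real_sequentially by (simp add: filterlim_at_top)

text \<open>The other coordinate is compared with the zero path. Members of the space are bounded,
  so for large \<open>n\<close> it is within \<open>n\<close> of zero and does not interfere in the
  maximum metric: product balls see each coordinate separately.\<close>

lemma coordinate_measurable_DD: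
  assumes Y: "Y \<in> N \<rightarrow>\<^sub>M ball_sigma (DD_metric a1 b1 a2 b2)"
  shows "t \<in> {a1..b1} \<Longrightarrow> (\<lambda>\<omega>. fst (Y \<omega>) t) \<in> borel_measurable N"
    and "t \<in> {a2..b2} \<Longrightarrow> (\<lambda>\<omega>. snd (Y \<omega>) t) \<in> borel_measurable N"
proof -
  let ?m = "DD_metric a1 b1 a2 b2"
  have Yin: "fst (Y \<omega>) \<in> mspace (D_metric a1 b1)" "snd (Y \<omega>) \<in> mspace (D_metric a2 b2)"
    if "\<omega> \<in> space N" for \<omega>
    using measurable_space[OF Y that] by (simp_all add: mem_Times_iff)
  have near: "{\<omega> \<in> space N. mdist ?m x (Y \<omega>) \<le> r} \<in> sets N" if "x \<in> mspace ?m" for x r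
  proof -
    have "(\<lambda>\<omega>. mdist ?m x (Y \<omega>)) \<in> borel_measurable N"
      using measurable_compose[OF Y mdist_ball_measurable[OF that]] by simp
    then show ?thesis by (simp add: borel_measurable_iff_le)
  qed
  show "(\<lambda>\<omega>. fst (Y \<omega>) t) \<in> borel_measurable N" if t: "t \<in> {a1..b1}"
    unfolding borel_measurable_iff_greater
  proof
    fix \<alpha>
    let ?x = "\<lambda>n. (restrict (spike \<alpha> t n) {a1..b1}, restrict (\<lambda>_. 0) {a2..b2})"
    have "{\<omega> \<in> space N. \<alpha> < fst (Y \<omega>) t} = (\<Union>n\<in>{0<..}. {\<omega> \<in> space N. mdist ?m (?x n) (Y \<omega>) \<le> real n})"
    proof (intro set_eqI iffI)
      fix \<omega> assume "\<omega> \<in> {\<omega> \<in> space N. \<alpha> < fst (Y \<omega>) t}"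
      then have \<omega>: "\<omega> \<in> space N" "\<alpha> < fst (Y \<omega>) t" by auto
      have "eventually (\<lambda>n. mdist ?m (?x n) (Y \<omega>) \<le> real n \<and> 0 < n) sequentially"
        using exceeds_iff_near_spike(1)[OF Yin(1)[OF \<omega>(1)] t \<omega>(2)] eventually_gt_at_top[of 0]
          eventually_mdist_le_real[of "D_metric a2 b2" "restrict (\<lambda>_. 0) {a2..b2}" "snd (Y \<omega>)"]
        by eventually_elim (simp add: mdist_max_metric)
      then obtain n where "mdist ?m (?x n) (Y \<omega>) \<le> real n" "0 < n"
        unfolding eventually_sequentially by blast
      then show "\<omega> \<in> (\<Union>n\<in>{0<..}. {\<omega> \<in> space N. mdist ?m (?x n) (Y \<omega>) \<le> real n})" using \<omega> by auto
    next
      fix \<omega> assume "\<omega> \<in> (\<Union>n\<in>{0<..}. {\<omega> \<in> space N. mdist ?m (?x n) (Y \<omega>) \<le> real n})"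
      then obtain n where n: "0 < n" "\<omega> \<in> space N" "mdist ?m (?x n) (Y \<omega>) \<le> real n" by auto
      then have "mdist (D_metric a1 b1) (restrict (spike \<alpha> t n) {a1..b1}) (fst (Y \<omega>)) \<le> real n"
        by (simp add: mdist_max_metric)
      from exceeds_iff_near_spike(2)[OF Yin(1)[OF n(2)] t n(1) this] n(2)
      show "\<omega> \<in> {\<omega> \<in> space N. \<alpha> < fst (Y \<omega>) t}" by simp
    qed
    also have "\<dots> \<in> sets N"
      by (rule sets.countable_UN''[OF _ near]) (simp_all add: spike_in_D zero_in_D)
    finally show "{\<omega> \<in> space N. \<alpha> < fst (Y \<omega>) t} \<in> sets N" .
  qed
  show "(\<lambda>\<omega>. snd (Y \<omega>) t) \<in> borel_measurable N" if t: "t \<in> {a2..b2}"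
    unfolding borel_measurable_iff_greater
  proof
    fix \<alpha>
    let ?x = "\<lambda>n. (restrict (\<lambda>_. 0) {a1..b1}, restrict (spike \<alpha> t n) {a2..b2})"
    have "{\<omega> \<in> space N. \<alpha> < snd (Y \<omega>) t} = (\<Union>n\<in>{0<..}. {\<omega> \<in> space N. mdist ?m (?x n) (Y \<omega>) \<le> real n})"
    proof (intro set_eqI iffI)
      fix \<omega> assume "\<omega> \<in> {\<omega> \<in> space N. \<alpha> < snd (Y \<omega>) t}"
      then have \<omega>: "\<omega> \<in> space N" "\<alpha> < snd (Y \<omega>) t" by auto
      have "eventually (\<lambda>n. mdist ?m (?x n) (Y \<omega>) \<le> real n \<and> 0 < n) sequentially"
        using exceeds_iff_near_spike(1)[OF Yin(2)[OF \<omega>(1)] t \<omega>(2)] eventually_gt_at_top[of 0]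
          eventually_mdist_le_real[of "D_metric a1 b1" "restrict (\<lambda>_. 0) {a1..b1}" "fst (Y \<omega>)"]
        by eventually_elim (simp add: mdist_max_metric)
      then obtain n where "mdist ?m (?x n) (Y \<omega>) \<le> real n" "0 < n"
        unfolding eventually_sequentially by blast
      then show "\<omega> \<in> (\<Union>n\<in>{0<..}. {\<omega> \<in> space N. mdist ?m (?x n) (Y \<omega>) \<le> real n})" using \<omega> by auto
    next
      fix \<omega> assume "\<omega> \<in> (\<Union>n\<in>{0<..}. {\<omega> \<in> space N. mdist ?m (?x n) (Y \<omega>) \<le> real n})"
      then obtain n where n: "0 < n" "\<omega> \<in> space N" "mdist ?m (?x n) (Y \<omega>) \<le> real n" by auto
      then have "mdist (D_metric a2 b2) (restrict (spike \<alpha> t n) {a2..b2}) (snd (Y \<omega>)) \<le> real n"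
        by (simp add: mdist_max_metric)
      from exceeds_iff_near_spike(2)[OF Yin(2)[OF n(2)] t n(1) this] n(2)
      show "\<omega> \<in> {\<omega> \<in> space N. \<alpha> < snd (Y \<omega>) t}" by simp
    qed
    also have "\<dots> \<in> sets N"
      by (rule sets.countable_UN''[OF _ near]) (simp_all add: spike_in_D zero_in_D)
    finally show "{\<omega> \<in> space N. \<alpha> < snd (Y \<omega>) t} \<in> sets N" .
  qed
qed

subsection \<open>Step functions on rational grids\<close>

text \<open>Lists of rationals make the set of these steps countable. The value on the first cell is
  fixed to 0, as for partial sums; this is what later forces the limit to start at 0.\<close>

definition grid_step :: "real \<Rightarrow> nat \<Rightarrow> rat list \<Rightarrow> real \<Rightarrow> real" where
  "grid_step b n q = restrict (\<lambda>\<tau>. if fl n \<tau> = 0 then 0 else real_of_rat (q ! (fl n \<tau> - 1))) {0..b}"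

definition grid_steps :: "real \<Rightarrow> nat set \<Rightarrow> (real \<Rightarrow> real) set" where
  "grid_steps b I = (\<lambda>(n, q). grid_step b n q) ` (I \<times> UNIV)"

lemma countable_grid_steps: "countable (grid_steps b I)"
  unfolding grid_steps_def by (intro countable_image countable_SIGMA) auto

lemma grid_step_in_D: "grid_step b n q \<in> mspace (D_metric 0 b)"
  unfolding grid_step_def by (rule step_in_D) simp

lemma grid_steps_subset: "grid_steps b I \<subseteq> mspace (D_metric 0 b)"
  by (auto simp: grid_steps_def grid_step_in_D)

lemma grid_steps_dense:
  assumes g: "g 0 = 0" and n: "n \<in> I" and e: "0 < e" and b: "0 \<le> b"
  shows "\<exists>c\<in>grid_steps b I. mdist (D_metric 0 b) c (restrict (\<lambda>\<tau>. g (fl n \<tau>)) {0..b}) < e"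
proof -
  have "\<exists>r. \<bar>real_of_rat r - g (Suc i)\<bar> < e / 2" for i
  proof -
    obtain r where "g (Suc i) - e / 2 < real_of_rat r" "real_of_rat r < g (Suc i) + e / 2"
      using of_rat_dense[of "g (Suc i) - e / 2" "g (Suc i) + e / 2"] e by auto
    then have "\<bar>real_of_rat r - g (Suc i)\<bar> < e / 2" by linarith
    then show ?thesis by (rule exI)
  qed
  then have "\<exists>r. \<forall>i. \<bar>real_of_rat (r i) - g (Suc i)\<bar> < e / 2" by (intro choice allI)
  then obtain r where r: "\<And>i. \<bar>real_of_rat (r i) - g (Suc i)\<bar> < e / 2" by blast
  define q where "q = map r [0..<fl n b]"
  have "mdist (D_metric 0 b) (grid_step b n q) (restrict (\<lambda>\<tau>. g (fl n \<tau>)) {0..b}) \<le> e / 2"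
  proof (rule mdist_D_le[OF grid_step_in_D step_in_D b])
    fix t assume t: "t \<in> {0..b}"
    show "\<bar>grid_step b n q t - restrict (\<lambda>\<tau>. g (fl n \<tau>)) {0..b} t\<bar> \<le> e / 2"
    proof (cases "fl n t = 0")
      case True
      then show ?thesis using t g e by (simp add: grid_step_def)
    next
      case False
      then have "fl n t - 1 < fl n b" using fl_mono[of t b n] t by auto
      then have "grid_step b n q t = real_of_rat (r (fl n t - 1))"
        using t False by (simp add: grid_step_def q_def)
      moreover have "g (Suc (fl n t - 1)) = g (fl n t)" using False by simp
      ultimately show ?thesis using r[of "fl n t - 1"] t by simp
    qed
  qed simp
  moreover have "grid_step b n q \<in> grid_steps b I" using n by (auto simp: grid_steps_def)
  ultimately show ?thesis using e by (intro bexI[of _ "grid_step b n q"]) auto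
qed

lemma fl_eventually_at:
  assumes "0 \<le> t" "real n * t \<notin> \<int>"
  shows "eventually (\<lambda>s. fl n s = fl n t) (at t within A)"
proof -
  have "0 < real n * t" using assms by (cases "real n * t = 0") auto
  then have t0: "0 < t" by (simp add: zero_less_mult_iff)
  have "real (fl n t) \<noteq> real n * t" using assms(2) by (metis Ints_of_nat)
  then have t: "real (fl n t) < real n * t" "real n * t < real (fl n t) + 1"
    using fl_le[OF assms(1), of n] fl_gt[of n t] by linarith+
  have lim: "((\<lambda>s. real n * s) \<longlongrightarrow> real n * t) (at t within A)" by (intro tendsto_intros)
  have "eventually (\<lambda>s. real (fl n t) < real n * s) (at t within A)"
    by (rule order_tendstoD(1)[OF lim t(1)])
  moreover have "eventually (\<lambda>s. real n * s < real (fl n t) + 1) (at t within A)"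
    by (rule order_tendstoD(2)[OF lim t(2)])
  ultimately show ?thesis
  proof eventually_elim
    case (elim s)
    have "0 \<le> real n * s" using elim(1) of_nat_0_le_iff[of "fl n t"] by linarith
    then show ?case using elim by (simp add: fl_eq_iff)
  qed
qed

text \<open>A step on the grid of a single \<open>n\<close> is constant near \<open>t\<close> when
  \<open>n * t\<close> is not an integer, and \<open>y\<close> is a uniform limit of such
  steps.\<close>

lemma continuous_off_grid:
  assumes y: "y \<in> mspace (D_metric 0 b)"
    and cl: "\<And>e. 0 < e \<Longrightarrow> \<exists>c\<in>grid_steps b I. mdist (D_metric 0 b) c y < e"
    and t: "t \<in> {0..b}" and nt: "\<And>n. n \<in> I \<Longrightarrow> real n * t \<notin> \<int>"
  shows "(y \<longlongrightarrow> y t) (at t within {0..b})"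
proof (rule tendstoI)
  fix e :: real assume e: "0 < e"
  obtain c where c: "c \<in> grid_steps b I" "mdist (D_metric 0 b) c y < e / 2"
    using cl[of "e / 2"] e by auto
  then obtain n q where n: "n \<in> I" and cq: "c = grid_step b n q" by (auto simp: grid_steps_def)
  have cin: "c \<in> mspace (D_metric 0 b)" using cq grid_step_in_D by simp
  have "eventually (\<lambda>s. fl n s = fl n t) (at t within {0..b})"
    using t nt[OF n] by (intro fl_eventually_at) auto
  moreover have "eventually (\<lambda>s. s \<in> {0..b}) (at t within {0..b})"
    unfolding eventually_at_filter by simp
  ultimately show "eventually (\<lambda>s. dist (y s) (y t) < e) (at t within {0..b})"
  proof eventually_elim
    case (elim s)
    have "c s = c t" using elim t by (simp add: cq grid_step_def)
    then show ?case
      using abs_diff_le_mdist_D[OF cin y t] abs_diff_le_mdist_D[OF cin y elim(2)] c(2)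
      unfolding dist_real_def by linarith
  qed
qed

text \<open>By Bezout \<open>t\<close> is an integer combination of \<open>2^i * t\<close> and
  \<open>3^j * t\<close>, hence itself an integer.\<close>

lemma dyadic_triadic_disjoint:
  assumes "0 < t" "t < 1" "real (2 ^ i) * t \<in> \<int>" "real (3 ^ j) * t \<in> \<int>"
  shows False
proof -
  have "coprime (2 ^ i :: int) (3 ^ j)" by simp
  then obtain u v where uv: "u * 2 ^ i + v * 3 ^ j = (1::int)"
    using bezout_int[of "2 ^ i" "3 ^ j"] by (auto simp: coprime_iff_gcd_eq_1)
  have "t = of_int (u * 2 ^ i + v * 3 ^ j) * t" unfolding uv by simp
  also have "\<dots> = of_int u * (real (2 ^ i) * t) + of_int v * (real (3 ^ j) * t)"
    by (simp add: algebra_simps)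
  also have "\<dots> \<in> \<int>" by (intro Ints_add Ints_mult assms Ints_of_int)
  finally obtain z where "t = of_int z" by (auto elim: Ints_cases)
  with assms show False by auto
qed

text \<open>An interior time is off all dyadic or off all triadic grids. Time 0 is covered by
  right-continuity of cadlag paths; time 1 lies on every grid and has to be assumed.\<close>

lemma continuous_two_grids:
  assumes y: "y \<in> mspace (D_metric 0 b)" and b: "0 < b" "b \<le> 1"
    and cl2: "\<And>e. 0 < e \<Longrightarrow> \<exists>c\<in>grid_steps b (range (\<lambda>k. 2 ^ k)). mdist (D_metric 0 b) c y < e"
    and cl3: "\<And>e. 0 < e \<Longrightarrow> \<exists>c\<in>grid_steps b (range (\<lambda>k. 3 ^ k)). mdist (D_metric 0 b) c y < e"
    and one: "b = 1 \<Longrightarrow> (y \<longlongrightarrow> y 1) (at 1 within {0..1})"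
  shows "continuous_on {0..b} y" and "y 0 = 0"
proof -
  show "continuous_on {0..b} y"
    unfolding continuous_on_def
  proof
    fix t assume t: "t \<in> {0..b}"
    consider "t = 0" | "t = 1" | "0 < t" "t < 1" using t b by fastforce
    then show "(y \<longlongrightarrow> y t) (at t within {0..b})"
    proof cases
      case 1
      have "(y \<longlongrightarrow> y 0) (at_right 0)" using y b by (auto simp: mspace_D_metric cadlag_on_def)
      moreover have "at 0 within {0..b} = at_right 0" using b by (intro at_within_Icc_at_right)
      ultimately show ?thesis using 1 by simp
    next
      case 2
      then show ?thesis using one t b by auto
    next
      case 3
      show ?thesis
      proof (cases "\<exists>i. real (2 ^ i) * t \<in> \<int>")
        case False
        then show ?thesis by (intro continuous_off_grid[OF y cl2 t]) auto
      next
        case True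
        then show ?thesis using dyadic_triadic_disjoint[OF 3] by (intro continuous_off_grid[OF y cl3 t]) blast+
      qed
    qed
  qed
  have "\<bar>y 0\<bar> \<le> 0 + e" if e: "0 < e" for e
  proof -
    obtain c where c: "c \<in> grid_steps b (range (\<lambda>k. 2 ^ k))" "mdist (D_metric 0 b) c y < e"
      using cl2[OF e] by blast
    moreover have "c 0 = 0" using c(1) b by (auto simp: grid_steps_def grid_step_def)
    moreover have "\<bar>c 0 - y 0\<bar> \<le> mdist (D_metric 0 b) c y"
      using b c(1) grid_steps_subset by (intro abs_diff_le_mdist_D y) auto
    ultimately show ?thesis by simp
  qed
  then have "\<bar>y 0\<bar> \<le> 0" by (rule field_le_epsilon)
  then show "y 0 = 0" by simp
qed

section \<open>Probabilities and truncated expectations\<close>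

lemma (in prob_space) exists_in_Int:
  assumes "A \<in> sets M" "B \<in> sets M" "1 < prob A + prob B"
  shows "\<exists>\<omega>\<in>space M. \<omega> \<in> A \<and> \<omega> \<in> B"
proof (rule ccontr)
  assume "\<not> ?thesis"
  then have "A \<inter> B = {}" using sets.sets_into_space[OF assms(1)] by blast
  then have "prob (A \<union> B) = prob A + prob B" using assms by (intro finite_measure_Union)
  with assms(3) show False using prob_le_1[of "A \<union> B"] by simp
qed

text \<open>Markov's inequality. Together with \<open>expectation_min_le\<close> it shows that
  truncated expectations measure convergence to 0 in probability; they are preferred because the
  mapping theorem yields limits of expectations.\<close>

lemma (in prob_space) prob_gt_le_expectation_min:
  fixes a :: "'a \<Rightarrow> real"
  assumes [measurable]: "a \<in> borel_measurable M" and d: "0 < d" "d \<le> 1"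
  shows "d * prob {\<omega> \<in> space M. \<bar>a \<omega>\<bar> > d} \<le> expectation (\<lambda>\<omega>. min 1 \<bar>a \<omega>\<bar>)"
proof -
  let ?A = "{\<omega> \<in> space M. \<bar>a \<omega>\<bar> > d}"
  have A: "?A \<in> sets M" by measurable
  have "d * prob ?A = expectation (\<lambda>\<omega>. d * indicator ?A \<omega>)"
    using sets.sets_into_space[OF A] by (simp add: Int_absorb2)
  also have "\<dots> \<le> expectation (\<lambda>\<omega>. min 1 \<bar>a \<omega>\<bar>)"
  proof (rule integral_mono)
    show "integrable M (\<lambda>\<omega>. d * indicator ?A \<omega> :: real)"
      using A by (intro integrable_mult_right integrable_real_indicator) (simp_all add: emeasure_eq_measure)
    show "integrable M (\<lambda>\<omega>. min 1 \<bar>a \<omega>\<bar>)"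
      by (intro integrable_const_bound[of _ 1]) auto
    show "d * indicator ?A \<omega> \<le> min 1 \<bar>a \<omega>\<bar>" for \<omega>
      using d by (auto simp: indicator_def)
  qed
  finally show ?thesis .
qed

lemma (in prob_space) expectation_min_le:
  fixes a :: "'a \<Rightarrow> real"
  assumes [measurable]: "a \<in> borel_measurable M" and d: "0 < d"
  shows "expectation (\<lambda>\<omega>. min 1 \<bar>a \<omega>\<bar>) \<le> d + prob {\<omega> \<in> space M. \<bar>a \<omega>\<bar> > d}"
proof -
  let ?A = "{\<omega> \<in> space M. \<bar>a \<omega>\<bar> > d}"
  have A: "?A \<in> sets M" by measurable
  have iA: "integrable M (indicator ?A :: _ \<Rightarrow> real)"
    using A by (intro integrable_real_indicator) (simp_all add: emeasure_eq_measure)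
  have "expectation (\<lambda>\<omega>. min 1 \<bar>a \<omega>\<bar>) \<le> expectation (\<lambda>\<omega>. d + indicator ?A \<omega>)"
  proof (rule integral_mono)
    show "integrable M (\<lambda>\<omega>. d + indicator ?A \<omega> :: real)" using iA by simp
    show "integrable M (\<lambda>\<omega>. min 1 \<bar>a \<omega>\<bar>)"
      by (intro integrable_const_bound[of _ 1]) auto
    show "min 1 \<bar>a \<omega>\<bar> \<le> d + indicator ?A \<omega>" if "\<omega> \<in> space M" for \<omega>
      using d that by (auto simp: indicator_def)
  qed
  also have "\<dots> = d + expectation (indicator ?A :: _ \<Rightarrow> real)"
    using iA by (simp add: prob_space)
  also have "expectation (indicator ?A :: _ \<Rightarrow> real) = prob ?A"
    using sets.sets_into_space[OF A] by (simp add: Int_absorb2)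
  finally show ?thesis .
qed

lemma (in prob_space) prob_small_of_expectation_min:
  fixes a :: "nat \<Rightarrow> 'a \<Rightarrow> real"
  assumes a: "\<And>n. a n \<in> borel_measurable M" and lim: "(\<lambda>n. expectation (\<lambda>\<omega>. min 1 \<bar>a n \<omega>\<bar>)) \<longlonglongrightarrow> 0"
    and d: "0 < d"
  shows "(\<lambda>n. prob {\<omega> \<in> space M. \<bar>a n \<omega>\<bar> > d}) \<longlonglongrightarrow> 0"
proof -
  let ?d = "min 1 d"
  have d': "0 < ?d" "?d \<le> 1" using d by auto
  have "(\<lambda>n. expectation (\<lambda>\<omega>. min 1 \<bar>a n \<omega>\<bar>) / ?d) \<longlonglongrightarrow> 0 / ?d"
    using d' by (intro tendsto_divide lim tendsto_const) simp
  then have bound: "(\<lambda>n. expectation (\<lambda>\<omega>. min 1 \<bar>a n \<omega>\<bar>) / ?d) \<longlonglongrightarrow> 0" by simp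
  show ?thesis
  proof (rule Lim_null_comparison[OF always_eventually bound], intro allI)
    fix n
    note [measurable] = a[of n]
    have "prob {\<omega> \<in> space M. \<bar>a n \<omega>\<bar> > d} \<le> prob {\<omega> \<in> space M. \<bar>a n \<omega>\<bar> > ?d}"
      by (intro finite_measure_mono) auto
    also have "\<dots> \<le> expectation (\<lambda>\<omega>. min 1 \<bar>a n \<omega>\<bar>) / ?d"
      using prob_gt_le_expectation_min[OF a d'] d'(1) by (simp only: pos_le_divide_eq mult.commute)
    finally show "norm (prob {\<omega> \<in> space M. \<bar>a n \<omega>\<bar> > d}) \<le> expectation (\<lambda>\<omega>. min 1 \<bar>a n \<omega>\<bar>) / ?d"
      by (simp only: real_norm_def abs_of_nonneg measure_nonneg)
  qed
qed

lemma tends_to_zero_in_prob_zero: "tends_to_zero_in_prob M (\<lambda>_ _. 0)"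
  by (simp add: tends_to_zero_in_prob_def)

context separable_weak_limit
begin

text \<open>The number \<open>L\<close> decides from the sample alone whether
  \<open>g (Y \<omega>)\<close> vanishes almost surely. It is not written as an expectation of
  \<open>g (Y \<omega>)\<close>, which is only known to agree almost everywhere with something
  measurable.\<close>

lemma expectation_min_tendsto:
  fixes a :: "nat \<Rightarrow> 'a \<Rightarrow> real" and g :: "'s \<Rightarrow> real"
  assumes a: "\<And>n. a n \<in> borel_measurable M" and G: "AE \<omega> in N. Y \<omega> \<in> G"
    and lim: "\<And>y n w. y \<in> G \<Longrightarrow> y \<in> mspace m \<Longrightarrow> filterlim n at_top sequentially \<Longrightarrow>
       (\<And>i. w i \<in> space M) \<Longrightarrow> (\<lambda>i. mdist m (Xs (n i) (w i)) y) \<longlonglongrightarrow> 0 \<Longrightarrow>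
       (\<lambda>i::nat. a (n i) (w i)) \<longlonglongrightarrow> g y"
  obtains L where "(\<lambda>n. \<integral>\<omega>. min 1 \<bar>a n \<omega>\<bar> \<partial>M) \<longlonglongrightarrow> L" "0 \<le> L" "L = 0 \<longleftrightarrow> (AE \<omega> in N. g (Y \<omega>) = 0)"
proof -
  note [measurable] = a
  obtain F where F: "F \<in> borel_measurable N" "AE \<omega> in N. min 1 \<bar>g (Y \<omega>)\<bar> = F \<omega>"
    "(\<lambda>n. \<integral>\<omega>. min 1 \<bar>a n \<omega>\<bar> \<partial>M) \<longlonglongrightarrow> (\<integral>\<omega>. F \<omega> \<partial>N)"
  proof (rule extended_continuous_mapping[of "\<lambda>n \<omega>. min 1 \<bar>a n \<omega>\<bar>" 1 "\<lambda>_ _. 0" G "\<lambda>y. min 1 \<bar>g y\<bar>"])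
    show "(\<lambda>i. min 1 \<bar>a (n i) (w i)\<bar>) \<longlonglongrightarrow> min 1 \<bar>g y\<bar>"
      if "y \<in> G" "y \<in> mspace m" "filterlim n at_top sequentially" "\<And>i. w i \<in> space M"
        "(\<lambda>i. mdist m (Xs (n i) (w i)) y) \<longlonglongrightarrow> 0" for y n w
      by (intro tendsto_min tendsto_const tendsto_rabs lim that)
  qed (simp_all add: tends_to_zero_in_prob_zero G)
  have F01: "AE \<omega> in N. 0 \<le> F \<omega>" "AE \<omega> in N. \<bar>F \<omega>\<bar> \<le> 1"
    using F(2) by (eventually_elim, subst (asm) eq_commute, simp)+
  have iF: "integrable N F" using F01(2) by (intro N.integrable_const_bound[of _ 1] F(1)) simp
  show ?thesis
  proof (rule that[OF F(3)])
    show "0 \<le> (\<integral>\<omega>. F \<omega> \<partial>N)" by (rule integral_nonneg_AE[OF F01(1)])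
    have "(\<integral>\<omega>. F \<omega> \<partial>N) = 0 \<longleftrightarrow> (AE \<omega> in N. F \<omega> = 0)"
      by (rule integral_nonneg_eq_0_iff_AE[OF iF F01(1)])
    also have "\<dots> \<longleftrightarrow> (AE \<omega> in N. g (Y \<omega>) = 0)"
    proof
      assume "AE \<omega> in N. F \<omega> = 0"
      with F(2) show "AE \<omega> in N. g (Y \<omega>) = 0"
      proof eventually_elim
        case (elim \<omega>)
        then have "min 1 \<bar>g (Y \<omega>)\<bar> = 0" by simp
        then show ?case by (simp add: min_def split: if_splits)
      qed
    next
      assume "AE \<omega> in N. g (Y \<omega>) = 0"
      with F(2) show "AE \<omega> in N. F \<omega> = 0" by eventually_elim simp
    qed
    finally show "(\<integral>\<omega>. F \<omega> \<partial>N) = 0 \<longleftrightarrow> (AE \<omega> in N. g (Y \<omega>) = 0)" .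
  qed
qed

text \<open>The truncated distance to \<open>z\<close>, divided by a large constant, has small
  expectation under the limit and is a Lipschitz test function, so the same holds for large
  \<open>n\<close>. Tightness means boundedness in probability here, not concentration on compact
  sets.\<close>

lemma tight:
  assumes z: "z \<in> mspace m" and \<epsilon>: "0 < \<epsilon>"
  obtains K where "0 < K" "eventually (\<lambda>n. measure M {\<omega> \<in> space M. K < mdist m z (Xs n \<omega>)} < \<epsilon>) sequentially"
proof -
  note [measurable] = mdist_Xs_measurable[OF z] mdist_Y_measurable[OF z]
  have "(\<lambda>k. \<integral>\<omega>. min 1 \<bar>mdist m z (Y \<omega>) / real (Suc k)\<bar> \<partial>N) \<longlonglongrightarrow> (\<integral>\<omega>. 0 \<partial>N)"
  proof (rule integral_dominated_convergence[where w="\<lambda>_. 1"])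
    show "AE \<omega> in N. (\<lambda>k. min 1 \<bar>mdist m z (Y \<omega>) / real (Suc k)\<bar>) \<longlonglongrightarrow> 0"
    proof (rule AE_I2)
      fix \<omega>
      have "(\<lambda>k. mdist m z (Y \<omega>) / real (Suc k)) \<longlonglongrightarrow> 0"
        using tendsto_mult[OF tendsto_const[of "mdist m z (Y \<omega>)"] LIMSEQ_Suc[OF lim_1_over_n[where 'a=real]]] by simp
      from tendsto_min[OF tendsto_const[of 1] tendsto_rabs[OF this]]
      show "(\<lambda>k. min 1 \<bar>mdist m z (Y \<omega>) / real (Suc k)\<bar>) \<longlonglongrightarrow> 0" by simp
    qed
  qed auto
  then have "eventually (\<lambda>k. (\<integral>\<omega>. min 1 \<bar>mdist m z (Y \<omega>) / real (Suc k)\<bar> \<partial>N) < \<epsilon>) sequentially"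
    using \<epsilon> by (intro order_tendstoD(2)) simp_all
  then obtain k where k: "(\<integral>\<omega>. min 1 \<bar>mdist m z (Y \<omega>) / real (Suc k)\<bar> \<partial>N) < \<epsilon>"
    unfolding eventually_sequentially by blast
  define K where "K = real (Suc k)"
  have K: "0 < K" by (simp add: K_def)
  let ?f = "\<lambda>y. min 1 \<bar>mdist m z y / K\<bar>"
  have "(\<lambda>n. \<integral>\<omega>. ?f (Xs n \<omega>) \<partial>M) \<longlonglongrightarrow> (\<integral>\<omega>. ?f (Y \<omega>) \<partial>N)"
  proof (rule test)
    note [measurable] = mdist_ball_measurable[OF z]
    show "?f \<in> borel_measurable (ball_sigma m)" by measurable
    have "dist (?f x) (?f y) \<le> 1 / K * mdist m x y" if "x \<in> mspace m" "y \<in> mspace m" for x y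
    proof -
      have *: "\<bar>min 1 \<bar>a\<bar> - min 1 \<bar>b\<bar>\<bar> \<le> \<bar>a - b\<bar>" for a b :: real by linarith
      have "\<bar>mdist m z x - mdist m z y\<bar> \<le> mdist m x y"
        using mdist_triangle[OF z that] mdist_triangle[OF z that(2,1)] by (simp add: mdist_commute)
      then have "\<bar>mdist m z x / K - mdist m z y / K\<bar> \<le> 1 / K * mdist m x y"
        using K by (simp add: diff_divide_distrib[symmetric] divide_right_mono)
      then show ?thesis unfolding dist_real_def using *[of "mdist m z x / K" "mdist m z y / K"] by linarith
    qed
    then have "Lipschitz_continuous_map m euclidean_metric ?f"
      unfolding Lipschitz_continuous_map_def by (intro conjI exI[of _ "1 / K"] ballI) auto
    from Lipschitz_continuous_imp_continuous_map[OF this]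
    show "continuous_map (mtopology_of m) euclideanreal ?f" by simp
    show "bounded (?f ` mspace m)" by (auto simp: bounded_iff intro!: exI[of _ 1])
  qed
  then have "eventually (\<lambda>n. (\<integral>\<omega>. ?f (Xs n \<omega>) \<partial>M) < \<epsilon>) sequentially"
    by (rule order_tendstoD) (use k in \<open>simp only: K_def\<close>)
  then have "eventually (\<lambda>n. measure M {\<omega> \<in> space M. K < mdist m z (Xs n \<omega>)} < \<epsilon>) sequentially"
  proof eventually_elim
    case (elim n)
    have "measure M {\<omega> \<in> space M. K < mdist m z (Xs n \<omega>)} = measure M {\<omega> \<in> space M. 1 < mdist m z (Xs n \<omega>) / K}"
      using K by simp
    also have "\<dots> \<le> measure M {\<omega> \<in> space M. 1 \<le> min 1 \<bar>mdist m z (Xs n \<omega>) / K\<bar>}"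
      using K by (intro M.finite_measure_mono) auto
    also have "\<dots> \<le> (\<integral>\<omega>. ?f (Xs n \<omega>) \<partial>M) / 1"
      by (intro integral_Markov_inequality_measure[where A="{}"] M.integrable_const_bound[of _ 1]) auto
    finally show ?case using elim by simp
  qed
  then show ?thesis by (rule that[OF K])
qed

end

text \<open>Common setting for the forward and the backward coordinate: \<open>pr\<close> selects
  the component, \<open>P\<close> holds the normalized sums, \<open>c\<close> is the length of the
  time interval. The zero path \<open>z\<close> turns distances into bounds for
  \<open>P\<close>.\<close>

locale component = separable_weak_limit m M N Xs Y C
  for m :: "'s metric" and M :: "'a measure" and N :: "'b measure" and Xs Y C +
  fixes c :: real and P :: "nat \<Rightarrow> 'a \<Rightarrow> nat \<Rightarrow> real" and pr :: "'s \<Rightarrow> real \<Rightarrow> real" and z :: 's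
  assumes c: "0 < c"
    and P_measurable: "\<And>n k. (\<lambda>\<omega>. P n \<omega> k) \<in> borel_measurable M"
    and near: "\<And>\<omega> y n k. \<omega> \<in> space M \<Longrightarrow> y \<in> mspace m \<Longrightarrow> 0 < n \<Longrightarrow> real k \<le> real n * c \<Longrightarrow>
      \<bar>P n \<omega> k - pr y (real k / real n)\<bar> \<le> mdist m (Xs n \<omega>) y"
    and Y_continuous: "AE \<omega> in N. continuous_on {0..c} (pr (Y \<omega>))"
    and z: "z \<in> mspace m" "\<And>u. u \<in> {0..c} \<Longrightarrow> pr z u = 0"
begin

definition continuous_paths :: "'s set" where
  "continuous_paths = {y. continuous_on {0..c} (pr y)}"

lemma AE_continuous_paths: "AE \<omega> in N. Y \<omega> \<in> continuous_paths"
  using Y_continuous by (simp add: continuous_paths_def)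

lemma P_le: "\<omega> \<in> space M \<Longrightarrow> 0 < n \<Longrightarrow> real k \<le> real n * c \<Longrightarrow> \<bar>P n \<omega> k\<bar> \<le> mdist m z (Xs n \<omega>)"
  using near[of \<omega> z n k] z by (simp add: mdist_commute divide_le_eq mult.commute)

lemma P_tendsto:
  assumes y: "y \<in> continuous_paths" "y \<in> mspace m" and n: "filterlim n at_top sequentially"
    and w: "\<And>i. w i \<in> space M" and d: "(\<lambda>i. mdist m (Xs (n i) (w i)) y) \<longlonglongrightarrow> 0"
    and k: "eventually (\<lambda>i. real (k i) \<le> real (n i) * c) sequentially"
    and kt: "(\<lambda>i. real (k i) / real (n i)) \<longlonglongrightarrow> t"
  shows "(\<lambda>i::nat. P (n i) (w i) (k i)) \<longlonglongrightarrow> pr y t"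
proof -
  have pos: "eventually (\<lambda>i. 0 < n i) sequentially"
    using eventually_compose_filterlim[OF eventually_gt_at_top[of 0] n] .
  have in_c: "eventually (\<lambda>i. real (k i) / real (n i) \<in> {0..c}) sequentially"
    using k pos by eventually_elim (simp add: divide_le_eq mult.commute)
  have t: "t \<in> {0..c}"
    using Lim_in_closed_set[OF closed_atLeastAtMost in_c sequentially_bot kt] .
  have 1: "(\<lambda>i. pr y (real (k i) / real (n i))) \<longlonglongrightarrow> pr y t"
    using y(1) in_c t by (intro continuous_on_tendsto_compose[OF _ kt]) (auto simp: continuous_paths_def)
  have 2: "(\<lambda>i. P (n i) (w i) (k i) - pr y (real (k i) / real (n i))) \<longlonglongrightarrow> 0"
  proof (rule Lim_null_comparison[OF _ d])
    show "\<forall>\<^sub>F i in sequentially. norm (P (n i) (w i) (k i) - pr y (real (k i) / real (n i))) \<le> mdist m (Xs (n i) (w i)) y"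
      using k pos by eventually_elim (use near[OF w y(2)] in simp)
  qed
  from tendsto_add[OF 2 1] show ?thesis by simp
qed

text \<open>Rational pairs keep the exceptional null sets countable in number. The end point
  \<open>c\<close> stays out of the hypothesis, as sample sizes will be compared strictly below it,
  and is recovered by letting \<open>s\<close> tend to \<open>c\<close>.\<close>

lemma linear_if_linear_at_interior_points:
  assumes *: "\<And>\<tau> s. 0 < \<tau> \<Longrightarrow> \<tau> < s \<Longrightarrow> s < c \<Longrightarrow> AE \<omega> in N. pr (Y \<omega>) \<tau> = \<tau> / s * pr (Y \<omega>) s"
    and Y_0: "AE \<omega> in N. pr (Y \<omega>) 0 = 0"
  shows "AE \<omega> in N. \<forall>\<tau>\<in>{0..c}. pr (Y \<omega>) \<tau> = \<tau> / c * pr (Y \<omega>) c"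
proof -
  have "AE \<omega> in N. \<forall>\<tau>\<in>\<rat>. \<forall>s\<in>\<rat>. 0 < \<tau> \<longrightarrow> \<tau> < s \<longrightarrow> s < c \<longrightarrow> pr (Y \<omega>) \<tau> = \<tau> / s * pr (Y \<omega>) s"
    by (intro AE_ball_countable' countable_rat AE_impI *)
  with Y_continuous Y_0 show ?thesis
  proof eventually_elim
    case (elim \<omega>)
    define f where "f = pr (Y \<omega>)"
    have fc: "continuous_on {0..c} f" and f0: "f 0 = 0" using elim by (simp_all add: f_def)
    have lin: "f \<tau> = \<tau> / s * f s" if "\<tau> \<in> \<rat>" "s \<in> \<rat>" "0 < \<tau>" "\<tau> < s" "s < c" for \<tau> s
      using elim(3) that unfolding f_def by blast
    have rat: "f \<tau> = \<tau> / c * f c" if \<tau>: "\<tau> \<in> \<rat>" "0 < \<tau>" "\<tau> < c" for \<tau>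
    proof (rule ccontr)
      assume ne: "f \<tau> \<noteq> \<tau> / c * f c"
      have "(f \<longlongrightarrow> f c) (at c within {0..c})" using fc c by (auto simp: continuous_on_def)
      then have "(f \<longlongrightarrow> f c) (at_left c)" using c by (simp add: at_within_Icc_at_left)
      moreover have "((\<lambda>s. \<tau> / s) \<longlongrightarrow> \<tau> / c) (at_left c)"
        using c by (intro tendsto_divide tendsto_const tendsto_ident_at) simp
      ultimately have "((\<lambda>s. \<bar>f \<tau> - \<tau> / s * f s\<bar>) \<longlongrightarrow> \<bar>f \<tau> - \<tau> / c * f c\<bar>) (at_left c)"
        by (intro tendsto_rabs tendsto_diff tendsto_const tendsto_mult)
      then have "eventually (\<lambda>s. 0 < \<bar>f \<tau> - \<tau> / s * f s\<bar>) (at_left c)"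
        by (rule order_tendstoD) (use ne in simp)
      then obtain u where u: "u < c" "\<And>s. u < s \<Longrightarrow> s < c \<Longrightarrow> 0 < \<bar>f \<tau> - \<tau> / s * f s\<bar>"
        unfolding eventually_at_left_field by blast
      obtain q where q: "q \<in> \<rat>" "max u \<tau> < q" "q < c"
        using Rats_dense_in_real[of "max u \<tau>" c] u(1) \<tau> by auto
      have "f \<tau> = \<tau> / q * f q" using q \<tau> by (intro lin) auto
      moreover have "0 < \<bar>f \<tau> - \<tau> / q * f q\<bar>" using q by (intro u(2)) auto
      ultimately show False by simp
    qed
    define h where "h t = f t - t / c * f c" for t
    have "continuous_on {0..c} h" unfolding h_def by (intro continuous_intros fc) (use c in auto)
    then have hc: "cadlag_on 0 c h" by (rule continuous_on_imp_cadlag_on)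
    have "\<bar>h t\<bar> \<le> 0" if "t \<in> {0..c}" for t
    proof (rule cadlag_abs_le_dense[OF hc _ that])
      fix q assume q: "q \<in> {0..c}" "q \<in> \<rat> \<union> {c}"
      then consider "q = 0" | "q = c" | "q \<in> \<rat>" "0 < q" "q < c" by fastforce
      then have "h q = 0"
      proof cases
        case 3
        from rat[OF this] show ?thesis unfolding h_def by linarith
      qed (use f0 c in \<open>simp_all add: h_def\<close>)
      then show "\<bar>h q\<bar> \<le> 0" by simp
    qed
    then have h0: "h t = 0" if "t \<in> {0..c}" for t using that by (metis abs_le_zero_iff)
    show ?case unfolding f_def[symmetric]
    proof
      show "f t = t / c * f c" if "t \<in> {0..c}" for t using h0[OF that] unfolding h_def by linarith
    qed
  qed
qed

text \<open>
  Convergence of types: tightness bounds the right-hand side of \<open>dom\<close>, while paths close to a nonlinear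
  limit cannot be brought near 0 by subtracting a linear function.
\<close>

theorem types_bounded:
  assumes nonlin: "\<not> (AE \<omega> in N. \<forall>\<tau>\<in>{0..c}. pr (Y \<omega>) \<tau> = \<tau> / c * pr (Y \<omega>) c)"
    and Y_0: "AE \<omega> in N. pr (Y \<omega>) 0 = 0"
    and p: "filterlim p at_top sequentially"
    and dom: "\<And>s. 0 < s \<Longrightarrow> s < c \<Longrightarrow> eventually (\<lambda>n. \<forall>\<omega>\<in>space M. \<forall>k. real k \<le> real n * s \<longrightarrow>
      \<bar>\<alpha> n * P n \<omega> k + real k * \<beta> n\<bar> \<le> 2 * mdist m z (Xs (p n) \<omega>)) sequentially"
  obtains K where "0 < K" "eventually (\<lambda>n. \<bar>\<alpha> n\<bar> \<le> K \<and> \<bar>real n * \<beta> n\<bar> \<le> K) sequentially"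
proof -
  note [measurable] = P_measurable mdist_Xs_measurable[OF z(1)]
  obtain \<tau> s where \<tau>s: "0 < \<tau>" "\<tau> < s" "s < c" and ne: "\<not> (AE \<omega> in N. pr (Y \<omega>) \<tau> = \<tau> / s * pr (Y \<omega>) s)"
    using linear_if_linear_at_interior_points[OF _ Y_0] nonlin by blast
  \<comment> \<open>The weight makes \<open>a n\<close> blind to linear terms:
    \<open>\<alpha> n * a n\<close> is the same combination of the affinely changed sums, with
    \<open>\<beta> n\<close> cancelled. Its limit is a deviation from linearity that is not almost
    surely 0.\<close>
  define a where "a n \<omega> = P n \<omega> (fl n \<tau>) - (real (fl n \<tau>) / real n) / (real (fl n s) / real n) * P n \<omega> (fl n s)" for n \<omega>
  have am [measurable]: "a n \<in> borel_measurable M" for n unfolding a_def by measurable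
  have fl_c: "real (fl n u) \<le> real n * c" if "0 < u" "u < c" for n u
  proof -
    have "real n * u \<le> real n * c" using that by (intro mult_left_mono) auto
    then show ?thesis using fl_le[of u n] that by linarith
  qed
  obtain L where L: "(\<lambda>n. \<integral>\<omega>. min 1 \<bar>a n \<omega>\<bar> \<partial>M) \<longlonglongrightarrow> L" "0 \<le> L"
    "L = 0 \<longleftrightarrow> (AE \<omega> in N. pr (Y \<omega>) \<tau> - \<tau> / s * pr (Y \<omega>) s = 0)"
  proof (rule expectation_min_tendsto[of a continuous_paths "\<lambda>y. pr y \<tau> - \<tau> / s * pr y s"])
    fix y n w assume *: "y \<in> continuous_paths" "y \<in> mspace m" "filterlim n at_top sequentially"
      "\<And>i. w i \<in> space M" "(\<lambda>i. mdist m (Xs (n i) (w i)) y) \<longlonglongrightarrow> 0"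
    have fl_lim: "(\<lambda>i. real (fl (n i) u) / real (n i)) \<longlonglongrightarrow> u" if "0 < u" for u
      by (rule fl_tendsto[OF *(3) tendsto_const]) (use that in simp)
    show "(\<lambda>i. a (n i) (w i)) \<longlonglongrightarrow> pr y \<tau> - \<tau> / s * pr y s"
    proof -
      have s: "0 < s" "\<tau> < c" using \<tau>s by simp_all
      have P: "(\<lambda>i. P (n i) (w i) (fl (n i) u)) \<longlonglongrightarrow> pr y u" if "0 < u" "u < c" for u
        by (rule P_tendsto[OF * always_eventually fl_lim]) (simp_all add: fl_c that)
      show ?thesis unfolding a_def
        by (intro tendsto_diff[OF P[OF \<tau>s(1) s(2)] tendsto_mult[OF tendsto_divide[OF fl_lim[OF \<tau>s(1)]
              fl_lim[OF s(1)]] P[OF s(1) \<tau>s(3)]]]) (use s in simp)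
    qed
  qed (auto intro: AE_continuous_paths am)
  have L0: "0 < L" using L(2,3) ne by (cases "L = 0") auto
  \<comment> \<open>An exceptional probability below \<open>L / 4\<close> lets the tightness event
    meet the event that \<open>a n\<close> exceeds \<open>L / 4\<close> in absolute value; one below
    1/2 lets two tightness events meet.\<close>
  obtain K1 where K1: "0 < K1" "eventually (\<lambda>n. measure M {\<omega> \<in> space M. K1 < mdist m z (Xs n \<omega>)} < min (1/2) (L / 4)) sequentially"
    using tight[OF z(1), of "min (1/2) (L / 4)"] L0 by auto
  have Kp: "eventually (\<lambda>n. measure M {\<omega> \<in> space M. K1 < mdist m z (Xs (p n) \<omega>)} < min (1/2) (L / 4)) sequentially"
    by (rule eventually_compose_filterlim[OF K1(2) p])
  have domv: "eventually (\<lambda>n. \<forall>\<omega>\<in>space M. \<forall>k. real k \<le> real n * s \<longrightarrow>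
      \<bar>\<alpha> n * P n \<omega> k + real k * \<beta> n\<bar> \<le> 2 * mdist m z (Xs (p n) \<omega>)) sequentially"
    by (rule dom) (use \<tau>s in auto)
  have Lev: "eventually (\<lambda>n. L / 2 < (\<integral>\<omega>. min 1 \<bar>a n \<omega>\<bar> \<partial>M)) sequentially"
    by (rule order_tendstoD[OF L(1)]) (use L0 in simp)
  have fl_pos: "eventually (\<lambda>n. \<tau> / 2 < real (fl n \<tau>) / real n) sequentially"
    by (rule order_tendstoD[OF fl_tendsto[OF filterlim_ident tendsto_const]]) (use \<tau>s in auto)
  \<comment> \<open>At a common sample point the two changed sums are at most \<open>2 * K1\<close>
    each, and \<open>a n\<close> is at least \<open>L / 4\<close> in absolute value.\<close>
  define K2 where "K2 = 4 * K1 / (L / 4)"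
  have K2: "0 < K2" using K1 L0 by (simp add: K2_def)
  \<comment> \<open>With \<open>\<alpha> n\<close> bounded, \<open>\<beta> n\<close> is read off at
    the index \<open>fl n \<tau>\<close>, which exceeds \<open>\<tau> / 2 * n\<close>.\<close>
  define K3 where "K3 = (2 * K1 + K2 * K1) / (\<tau> / 2)"
  have K3: "0 < K3" unfolding K3_def using K1 K2 \<tau>s by (intro divide_pos_pos add_pos_pos) auto
  have "eventually (\<lambda>n. \<bar>\<alpha> n\<bar> \<le> K2 \<and> \<bar>real n * \<beta> n\<bar> \<le> K3) sequentially"
    using domv Lev fl_pos Kp K1(2) eventually_gt_at_top[of 0]
  proof eventually_elim
    case (elim n)
    let ?k = "fl n \<tau>" and ?l = "fl n s"
    let ?E = "{\<omega> \<in> space M. mdist m z (Xs (p n) \<omega>) \<le> K1}" and ?E' = "{\<omega> \<in> space M. mdist m z (Xs n \<omega>) \<le> K1}"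
    have comp: "measure M {\<omega> \<in> space M. mdist m z (Xs n \<omega>) \<le> K1} = 1 - measure M {\<omega> \<in> space M. K1 < mdist m z (Xs n \<omega>)}" for n
    proof -
      have "{\<omega> \<in> space M. mdist m z (Xs n \<omega>) \<le> K1} = space M - {\<omega> \<in> space M. K1 < mdist m z (Xs n \<omega>)}" by auto
      then show ?thesis by (simp add: M.prob_compl)
    qed
    have kn: "\<tau> / 2 * real n < real ?k" using elim(3,6) by (simp add: pos_less_divide_eq)
    have kpos: "0 < ?k"
    proof -
      have "0 \<le> \<tau> / 2 * real n" using \<tau>s by simp
      with kn show ?thesis by linarith
    qed
    have kl: "?k \<le> ?l" using \<tau>s by (intro fl_mono) simp
    have ks: "real ?k \<le> real n * s" "real ?l \<le> real n * s"
      using fl_le[of s n] kl \<tau>s by linarith+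
    have \<alpha>: "\<bar>\<alpha> n\<bar> \<le> K2"
    proof -
      have "L / 2 < L / 4 + measure M {\<omega> \<in> space M. \<bar>a n \<omega>\<bar> > L / 4}"
        using M.expectation_min_le[OF am, of "L / 4" n] elim(2) L0 by linarith
      then have "L / 4 < measure M {\<omega> \<in> space M. \<bar>a n \<omega>\<bar> > L / 4}" by linarith
      moreover have "1 - L / 4 < measure M ?E" unfolding comp using elim(4) by linarith
      ultimately have "1 < measure M {\<omega> \<in> space M. \<bar>a n \<omega>\<bar> > L / 4} + measure M ?E" by linarith
      then have "\<exists>\<omega>\<in>space M. \<omega> \<in> {\<omega> \<in> space M. \<bar>a n \<omega>\<bar> > L / 4} \<and> \<omega> \<in> ?E"
        by (intro M.exists_in_Int) auto
      then obtain \<omega> where \<omega>: "\<omega> \<in> space M" "L / 4 < \<bar>a n \<omega>\<bar>" "mdist m z (Xs (p n) \<omega>) \<le> K1" by blast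
      define x y where "x = \<alpha> n * P n \<omega> ?k + real ?k * \<beta> n" and "y = \<alpha> n * P n \<omega> ?l + real ?l * \<beta> n"
      have xy: "\<bar>x\<bar> \<le> 2 * K1" "\<bar>y\<bar> \<le> 2 * K1"
        using elim(1) \<omega> ks unfolding x_def y_def by fastforce+
      define r where "r = real ?k / real ?l"
      have r: "0 \<le> r" "r \<le> 1" using kl kpos by (simp_all add: r_def)
      have an: "a n \<omega> = P n \<omega> ?k - r * P n \<omega> ?l" using elim(6) by (simp add: a_def r_def)
      have "r * real ?l = real ?k" using kl kpos by (simp add: r_def)
      then have "\<alpha> n * a n \<omega> = x - r * y"
        unfolding an x_def y_def by (simp add: algebra_simps)
      then have "\<bar>\<alpha> n * a n \<omega>\<bar> \<le> \<bar>x\<bar> + r * \<bar>y\<bar>"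
        using abs_triangle_ineq4[of x "r * y"] r by (simp add: abs_mult)
      also have "r * \<bar>y\<bar> \<le> 1 * (2 * K1)" using r xy K1 by (intro mult_mono) auto
      finally have "\<bar>\<alpha> n\<bar> * \<bar>a n \<omega>\<bar> \<le> 4 * K1" using xy by (simp add: abs_mult)
      moreover have "\<bar>\<alpha> n\<bar> * (L / 4) \<le> \<bar>\<alpha> n\<bar> * \<bar>a n \<omega>\<bar>" using \<omega> by (intro mult_left_mono) auto
      ultimately have "\<bar>\<alpha> n\<bar> * (L / 4) \<le> 4 * K1" by linarith
      then show ?thesis unfolding K2_def using L0 by (subst pos_le_divide_eq) auto
    qed
    have "\<bar>real n * \<beta> n\<bar> \<le> K3"
    proof -
      have "1 < measure M ?E + measure M ?E'" unfolding comp using elim(4,5) by linarith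
      then have "\<exists>\<omega>\<in>space M. \<omega> \<in> ?E \<and> \<omega> \<in> ?E'" by (intro M.exists_in_Int) auto
      then obtain \<omega> where \<omega>: "\<omega> \<in> space M" "mdist m z (Xs (p n) \<omega>) \<le> K1" "mdist m z (Xs n \<omega>) \<le> K1" by blast
      have 1: "\<bar>\<alpha> n * P n \<omega> ?k + real ?k * \<beta> n\<bar> \<le> 2 * K1"
        using elim(1) \<omega> ks by fastforce
      have "\<bar>P n \<omega> ?k\<bar> \<le> K1" using P_le[OF \<omega>(1) elim(6) fl_c[of \<tau> n]] \<tau>s \<omega>(3) by linarith
      then have "\<bar>\<alpha> n * P n \<omega> ?k\<bar> \<le> K2 * K1" unfolding abs_mult using \<alpha> K2 by (intro mult_mono) auto
      with 1 have "\<bar>real ?k * \<beta> n\<bar> \<le> 2 * K1 + K2 * K1" by linarith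
      moreover have "\<tau> / 2 * real n * \<bar>\<beta> n\<bar> \<le> real ?k * \<bar>\<beta> n\<bar>" using kn by (intro mult_right_mono) auto
      ultimately have "\<bar>real n * \<beta> n\<bar> * (\<tau> / 2) \<le> 2 * K1 + K2 * K1"
        by (simp add: abs_mult mult.commute mult.left_commute)
      then show ?thesis unfolding K3_def using \<tau>s by (subst pos_le_divide_eq) auto
    qed
    with \<alpha> show ?case by blast
  qed
  then have "eventually (\<lambda>n. \<bar>\<alpha> n\<bar> \<le> max K2 K3 \<and> \<bar>real n * \<beta> n\<bar> \<le> max K2 K3) sequentially"
    by eventually_elim auto
  then show ?thesis using K2 by (intro that[of "max K2 K3"]) auto
qed

end

subsection \<open>The statistics as functionals of the normalized partial sums\<close>

definition fwd :: "(nat \<Rightarrow> 'a \<Rightarrow> real) \<Rightarrow> (nat \<Rightarrow> real) \<Rightarrow> (nat \<Rightarrow> real) \<Rightarrow> nat \<Rightarrow> 'a \<Rightarrow> nat \<Rightarrow> real" where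
  "fwd X A g n \<omega> k = (psum (\<lambda>j. X j \<omega>) k - real k * A n) / g n"

definition bwd :: "(nat \<Rightarrow> 'a \<Rightarrow> real) \<Rightarrow> (nat \<Rightarrow> real) \<Rightarrow> (nat \<Rightarrow> real) \<Rightarrow> nat \<Rightarrow> 'a \<Rightarrow> nat \<Rightarrow> real" where
  "bwd X A g n \<omega> k = (psum_star n (\<lambda>j. X j \<omega>) k - real k * A n) / g n"

definition path :: "real \<Rightarrow> nat \<Rightarrow> (nat \<Rightarrow> real) \<Rightarrow> real \<Rightarrow> real" where
  "path b n S = restrict (\<lambda>\<tau>. S (fl n \<tau>)) {0..b}"

lemma path_in_D: "path b n S \<in> mspace (D_metric 0 b)"
  unfolding path_def by (rule step_in_D) simp

lemma path_grid: "0 < n \<Longrightarrow> real k \<le> real n * b \<Longrightarrow> path b n S (real k / real n) = S k"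
  by (simp add: path_def fl_divide divide_le_eq mult.commute)

lemma fwd_0 [simp]: "fwd X A g n \<omega> 0 = 0" by (simp add: fwd_def psum_def)

lemma bwd_0 [simp]: "bwd X A g n \<omega> 0 = 0" by (simp add: bwd_def psum_star_def)

lemma fwd_measurable:
  assumes "\<And>j. 1 \<le> j \<Longrightarrow> X j \<in> borel_measurable M"
  shows "(\<lambda>\<omega>. fwd X A g n \<omega> k) \<in> borel_measurable M"
  unfolding fwd_def psum_def using assms
  by (intro borel_measurable_divide borel_measurable_diff borel_measurable_sum borel_measurable_const) auto

lemma bwd_measurable:
  assumes "\<And>j. 1 \<le> j \<Longrightarrow> X j \<in> borel_measurable M"
  shows "(\<lambda>\<omega>. bwd X A g n \<omega> k) \<in> borel_measurable M"
  unfolding bwd_def psum_star_def using assms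
  by (intro borel_measurable_divide borel_measurable_diff borel_measurable_sum borel_measurable_const) auto

lemma quad_stat_measurable:
  assumes "\<And>k. (\<lambda>\<omega>. S \<omega> k) \<in> borel_measurable M"
  shows "(\<lambda>\<omega>. quad_stat n (S \<omega>) k) \<in> borel_measurable M"
  unfolding quad_stat_def using assms by measurable

text \<open>The bridge cancels the centring by \<open>real j * A\<close>, so the statistics do not
  depend on the centring constants, and the scale comes out as a square. The power
  \<open>3/2\<close> squared is the cube in \<open>quad_stat\<close>.\<close>

lemma quad_stat_affine:
  "quad_stat n (\<lambda>j. (s j - real j * A) / g) k =
   real n / g ^ 2 * (1 / real k ^ 2 * (\<Sum>j=1..k. (s j - real j / real k * s k) ^ 2)
     - (1 / real k powr (3/2) * (\<Sum>j=1..k. s j - real j / real k * s k)) ^ 2)"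
proof (cases "k = 0")
  case False
  have 1: "(s j - real j * A) / g - real j / real k * ((s k - real k * A) / g)
      = (s j - real j / real k * s k) / g" for j
  proof -
    have "real j / real k * ((s k - real k * A) / g) = (real j / real k * s k - real j * A) / g"
      using False by (simp add: right_diff_distrib)
    then show ?thesis by (simp add: diff_divide_distrib[symmetric])
  qed
  have 2: "(real k powr (3/2)) ^ 2 = real k ^ 3"
  proof -
    have "(real k powr (3/2)) ^ 2 = real k powr (3/2 + 3/2)" by (simp only: power2_eq_square powr_add)
    also have "\<dots> = real k powr (real 3)" by simp
    also have "\<dots> = real k ^ 3" using False by (subst powr_realpow) auto
    finally show ?thesis .
  qed
  show ?thesis
    unfolding quad_stat_def 1 power_mult_distrib power_divide 2 sum_divide_distrib[symmetric]
    by (simp add: algebra_simps)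
qed (simp add: quad_stat_def)

lemma V_stat_eq: "real n / (g n)^2 * V_stat (\<lambda>j. X j \<omega>) k = quad_stat n (fwd X A g n \<omega>) k"
  unfolding fwd_def quad_stat_affine V_stat_def ..

lemma V_star_stat_reindex:
  fixes k n :: nat
  assumes "k \<le> n"
  shows "(\<Sum>j=n-k+1..n. F (n - j + 1)) = (\<Sum>j=1..k. F j :: real)"
  by (rule sum.reindex_bij_witness[of _ "\<lambda>j. n - j + 1" "\<lambda>j. n - j + 1"]) (use assms in auto)

text \<open>Counting observations from the end, the starred statistic is the same functional applied
  to backward sums.\<close>

lemma V_star_stat_eq:
  assumes "k \<le> n"
  shows "real n / (g n)^2 * V_star_stat n (\<lambda>j. X j \<omega>) k = quad_stat n (bwd X A g n \<omega>) k"
  unfolding bwd_def quad_stat_affine V_star_stat_def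
    V_star_stat_reindex[OF assms, of "\<lambda>i. (psum_star n (\<lambda>j. X j \<omega>) i - real i / real k * psum_star n (\<lambda>j. X j \<omega>) k) ^ 2"]
    V_star_stat_reindex[OF assms, of "\<lambda>i. psum_star n (\<lambda>j. X j \<omega>) i - real i / real k * psum_star n (\<lambda>j. X j \<omega>) k"] ..

text \<open>By compactness a sequence of bad points would have a convergent subsequence along which
  \<open>lim\<close> fails. The subsequence \<open>r\<close> is needed in \<open>lim\<close> because
  bad points may exist for some indices only.\<close>

lemma uniform_limit_if_continuous_convergence:
  fixes f :: "nat \<Rightarrow> real \<Rightarrow> real"
  assumes K: "compact K" and h: "continuous_on K h"
    and lim: "\<And>r \<tau> t. strict_mono r \<Longrightarrow> (\<And>i. \<tau> i \<in> K) \<Longrightarrow> t \<in> K \<Longrightarrow> \<tau> \<longlonglongrightarrow> t \<Longrightarrow>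
      (\<lambda>i. f (r i) (\<tau> i)) \<longlonglongrightarrow> h t"
  shows "uniform_limit K f h sequentially"
proof (rule uniform_limitI, rule ccontr)
  fix e :: real assume e: "0 < e" and "\<not> (\<forall>\<^sub>F n in sequentially. \<forall>x\<in>K. dist (f n x) (h x) < e)"
  then have "\<exists>\<^sub>F n in sequentially. \<exists>x\<in>K. e \<le> dist (f n x) (h x)"
    by (simp add: frequently_def not_le)
  then have inf: "infinite {n. \<exists>x\<in>K. e \<le> dist (f n x) (h x)}"
    by (metis INFM_iff_infinite cofinite_eq_sequentially)
  obtain r :: "nat \<Rightarrow> nat" where r: "strict_mono r" "\<And>i. r i \<in> {n. \<exists>x\<in>K. e \<le> dist (f n x) (h x)}"
    using infinite_enumerate[OF inf] by blast
  then have "\<forall>i. \<exists>x. x \<in> K \<and> e \<le> dist (f (r i) x) (h x)" by blast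
  then obtain x where x: "\<And>i. x i \<in> K" "\<And>i. e \<le> dist (f (r i) (x i)) (h (x i))" by metis
  obtain t q where t: "t \<in> K" "strict_mono q" "(x \<circ> q) \<longlonglongrightarrow> t"
    using K x(1) unfolding compact_def by metis
  have 1: "(\<lambda>i. f (r (q i)) (x (q i))) \<longlonglongrightarrow> h t"
    using lim[of "r \<circ> q" "x \<circ> q" t] t x(1) r(1) by (simp add: strict_mono_o)
  have 2: "(\<lambda>i. h (x (q i))) \<longlonglongrightarrow> h t"
    using t x(1) by (intro continuous_on_tendsto_compose[OF h]) (auto simp: o_def)
  have "(\<lambda>i. dist (f (r (q i)) (x (q i))) (h (x (q i)))) \<longlonglongrightarrow> dist (h t) (h t)"
    by (rule tendsto_dist[OF 1 2])
  then have "eventually (\<lambda>i. dist (f (r (q i)) (x (q i))) (h (x (q i))) < e) sequentially"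
    using e by (intro order_tendstoD(2)) simp_all
  then obtain i where "dist (f (r (q i)) (x (q i))) (h (x (q i))) < e"
    unfolding eventually_sequentially by blast
  with x(2)[of "q i"] show False by linarith
qed

locale partial_sum_limit =
  fixes M :: "'a measure" and N :: "'b measure" and X :: "nat \<Rightarrow> 'a \<Rightarrow> real"
    and \<gamma>1 \<gamma>2 A1 A2 :: "nat \<Rightarrow> real" and \<upsilon>0 \<upsilon>1 :: real
    and Y :: "'b \<Rightarrow> (real \<Rightarrow> real) \<times> (real \<Rightarrow> real)"
  assumes X: "\<And>j. 1 \<le> j \<Longrightarrow> X j \<in> borel_measurable M"
    and \<upsilon>: "0 \<le> \<upsilon>0" "\<upsilon>0 < \<upsilon>1" "\<upsilon>1 \<le> 1"
    and \<gamma>1: "filterlim \<gamma>1 at_top sequentially" and \<gamma>2: "filterlim \<gamma>2 at_top sequentially"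
    and weak: "weak_limit (DD_metric 0 \<upsilon>1 0 (1 - \<upsilon>0)) M N
      (\<lambda>n \<omega>. (path \<upsilon>1 n (fwd X A1 \<gamma>1 n \<omega>), path (1 - \<upsilon>0) n (bwd X A2 \<gamma>2 n \<omega>))) Y"
    and cont: "AE \<omega> in N. continuous_on {\<upsilon>0..\<upsilon>1} (fst (Y \<omega>)) \<and> continuous_on {1 - \<upsilon>1..1 - \<upsilon>0} (snd (Y \<omega>))"
begin

abbreviation "S1 \<equiv> fwd X A1 \<gamma>1"
abbreviation "S2 \<equiv> bwd X A2 \<gamma>2"
abbreviation "Xs \<equiv> \<lambda>n \<omega>. (path \<upsilon>1 n (S1 n \<omega>), path (1 - \<upsilon>0) n (S2 n \<omega>))"
abbreviation "m \<equiv> DD_metric 0 \<upsilon>1 0 (1 - \<upsilon>0)"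
abbreviation "grids I \<equiv> grid_steps \<upsilon>1 I \<times> grid_steps (1 - \<upsilon>0) I"
abbreviation "z0 \<equiv> (restrict (\<lambda>_. 0) {0..\<upsilon>1} :: real \<Rightarrow> real, restrict (\<lambda>_. 0) {0..1 - \<upsilon>0} :: real \<Rightarrow> real)"

lemma grids: "countable (grids I)" "grids I \<subseteq> mspace m"
  using grid_steps_subset by (auto intro!: countable_SIGMA countable_grid_steps)

lemma grids_dense:
  assumes "n \<in> I" "0 < e"
  shows "\<exists>c\<in>grids I. mdist m c (Xs n \<omega>) < e"
proof -
  obtain c1 where "c1 \<in> grid_steps \<upsilon>1 I" "mdist (D_metric 0 \<upsilon>1) c1 (path \<upsilon>1 n (S1 n \<omega>)) < e"
    using grid_steps_dense[of "S1 n \<omega>" n I e \<upsilon>1] assms \<upsilon> unfolding path_def by auto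
  moreover obtain c2 where "c2 \<in> grid_steps (1 - \<upsilon>0) I" "mdist (D_metric 0 (1 - \<upsilon>0)) c2 (path (1 - \<upsilon>0) n (S2 n \<omega>)) < e"
    using grid_steps_dense[of "S2 n \<omega>" n I e "1 - \<upsilon>0"] assms \<upsilon> unfolding path_def by auto
  ultimately show ?thesis by (intro bexI[of _ "(c1, c2)"]) (auto simp: mdist_max_metric)
qed

sublocale separable_weak_limit m M N Xs Y "grids UNIV"
  by (intro separable_weak_limit.intro weak separable_weak_limit_axioms.intro grids grids_dense) auto

lemma Y_in': "\<omega> \<in> space N \<Longrightarrow> fst (Y \<omega>) \<in> mspace (D_metric 0 \<upsilon>1)"
  "\<omega> \<in> space N \<Longrightarrow> snd (Y \<omega>) \<in> mspace (D_metric 0 (1 - \<upsilon>0))"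
  using Y_in[of \<omega>] by (auto simp: mem_Times_iff)

text \<open>The sample sizes \<open>p^k\<close> form a subsequence, and their paths are approximated
  by steps on their own grids alone.\<close>

lemma AE_in_grid_closure:
  assumes "(2::nat) \<le> p"
  shows "AE \<omega> in N. (\<forall>e>0. \<exists>c\<in>grid_steps \<upsilon>1 (range (\<lambda>k. p ^ k)). mdist (D_metric 0 \<upsilon>1) c (fst (Y \<omega>)) < e) \<and>
    (\<forall>e>0. \<exists>c\<in>grid_steps (1 - \<upsilon>0) (range (\<lambda>k. p ^ k)). mdist (D_metric 0 (1 - \<upsilon>0)) c (snd (Y \<omega>)) < e)"
proof -
  have "strict_mono (\<lambda>k. p ^ k)" using assms by (intro strict_monoI power_strict_increasing) auto
  then have "AE \<omega> in N. \<forall>e>0. \<exists>c\<in>grids (range (\<lambda>k. p ^ k)). mdist m c (Y \<omega>) < e"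
    by (intro limit_in_closure[of _ "\<lambda>k. p ^ k"] grids grids_dense) auto
  then show ?thesis
  proof eventually_elim
    case (elim \<omega>)
    show ?case
    proof (intro conjI allI impI)
      fix e :: real assume "0 < e"
      then obtain c where "c \<in> grids (range (\<lambda>k. p ^ k))" "mdist m c (Y \<omega>) < e" using elim by blast
      then show "\<exists>c\<in>grid_steps \<upsilon>1 (range (\<lambda>k. p ^ k)). mdist (D_metric 0 \<upsilon>1) c (fst (Y \<omega>)) < e"
        by (intro bexI[of _ "fst c"]) (auto simp: mdist_max_metric)
    next
      fix e :: real assume "0 < e"
      then obtain c where "c \<in> grids (range (\<lambda>k. p ^ k))" "mdist m c (Y \<omega>) < e" using elim by blast
      then show "\<exists>c\<in>grid_steps (1 - \<upsilon>0) (range (\<lambda>k. p ^ k)). mdist (D_metric 0 (1 - \<upsilon>0)) c (snd (Y \<omega>)) < e"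
        by (intro bexI[of _ "snd c"]) (auto simp: mdist_max_metric)
    qed
  qed
qed

text \<open>
  Along \<open>n = 2\<^sup>k\<close> the paths jump at dyadic times only and along \<open>n = 3\<^sup>k\<close> at triadic times only,
  so the limit can jump only at time 1, where \<open>cont\<close> applies.
\<close>

lemma Y_continuous_paths:
  "AE \<omega> in N. continuous_on {0..\<upsilon>1} (fst (Y \<omega>)) \<and> fst (Y \<omega>) 0 = 0 \<and>
     continuous_on {0..1 - \<upsilon>0} (snd (Y \<omega>)) \<and> snd (Y \<omega>) 0 = 0"
proof -
  have "(2::nat) \<le> 3" by simp
  from AE_in_grid_closure[OF order_refl] AE_in_grid_closure[OF this] cont AE_space show ?thesis
proof eventually_elim
  case (elim \<omega>)
  have left: "(y \<longlongrightarrow> y 1) (at 1 within {0..1})" if "continuous_on {a..1} y" "a < 1" for y :: "real \<Rightarrow> real" and a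
  proof -
    have "(y \<longlongrightarrow> y 1) (at 1 within {a..1})" using that by (auto simp: continuous_on_def)
    then show ?thesis using that by (simp add: at_within_Icc_at_left)
  qed
  have 1: "\<upsilon>1 = 1 \<Longrightarrow> (fst (Y \<omega>) \<longlongrightarrow> fst (Y \<omega>) 1) (at 1 within {0..1})"
    using elim(3) \<upsilon> by (intro left[of \<upsilon>0]) auto
  have 2: "1 - \<upsilon>0 = 1 \<Longrightarrow> (snd (Y \<omega>) \<longlongrightarrow> snd (Y \<omega>) 1) (at 1 within {0..1})"
    using elim(3) \<upsilon> by (intro left[of "1 - \<upsilon>1"]) auto
  have "0 < \<upsilon>1" "0 < 1 - \<upsilon>0" "1 - \<upsilon>0 \<le> 1" using \<upsilon> by auto
  note c1 = continuous_two_grids[OF Y_in'(1)[OF elim(4)] \<open>0 < \<upsilon>1\<close> \<upsilon>(3) _ _ 1]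
  note c2 = continuous_two_grids[OF Y_in'(2)[OF elim(4)] \<open>0 < 1 - \<upsilon>0\<close> \<open>1 - \<upsilon>0 \<le> 1\<close> _ _ 2]
  show ?case using c1 c2 elim(1,2) by blast
qed
qed

lemma near_fst:
  assumes "\<omega> \<in> space M" "y \<in> mspace m" "0 < n" "real k \<le> real n * \<upsilon>1"
  shows "\<bar>S1 n \<omega> k - fst y (real k / real n)\<bar> \<le> mdist m (Xs n \<omega>) y"
proof -
  have "real k / real n \<in> {0..\<upsilon>1}" using assms by (simp add: divide_le_eq mult.commute)
  then have "\<bar>path \<upsilon>1 n (S1 n \<omega>) (real k / real n) - fst y (real k / real n)\<bar>
      \<le> mdist (D_metric 0 \<upsilon>1) (path \<upsilon>1 n (S1 n \<omega>)) (fst y)"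
    using assms(2) by (intro abs_diff_le_mdist_D path_in_D) (auto simp: mem_Times_iff)
  then show ?thesis using path_grid[OF assms(3,4)] by (simp add: mdist_max_metric)
qed

lemma near_snd:
  assumes "\<omega> \<in> space M" "y \<in> mspace m" "0 < n" "real k \<le> real n * (1 - \<upsilon>0)"
  shows "\<bar>S2 n \<omega> k - snd y (real k / real n)\<bar> \<le> mdist m (Xs n \<omega>) y"
proof -
  have "real k / real n \<in> {0..1 - \<upsilon>0}" using assms(3,4) by (simp add: divide_le_eq mult.commute)
  then have "\<bar>path (1 - \<upsilon>0) n (S2 n \<omega>) (real k / real n) - snd y (real k / real n)\<bar>
      \<le> mdist (D_metric 0 (1 - \<upsilon>0)) (path (1 - \<upsilon>0) n (S2 n \<omega>)) (snd y)"
    using assms(2) by (intro abs_diff_le_mdist_D path_in_D) (auto simp: mem_Times_iff)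
  then show ?thesis using path_grid[OF assms(3,4)] by (simp add: mdist_max_metric)
qed

sublocale fwd: component m M N Xs Y "grids UNIV" \<upsilon>1 S1 fst z0
proof (unfold_locales, goal_cases)
  case 4
  show ?case using Y_continuous_paths by eventually_elim blast
qed (use \<upsilon> near_fst in \<open>auto intro: fwd_measurable X simp: zero_in_D\<close>)

sublocale bwd: component m M N Xs Y "grids UNIV" "1 - \<upsilon>0" S2 snd z0
proof (unfold_locales, goal_cases)
  case 4
  show ?case using Y_continuous_paths by eventually_elim blast
qed (use \<upsilon> near_snd in \<open>auto intro: bwd_measurable X simp: zero_in_D\<close>)

text \<open>From index \<open>n - fl n \<upsilon>0 - 1\<close> to the next the backward sum gains
  the observation number \<open>fl n \<upsilon>0 + 1\<close>, and this gain may leave the range of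
  the path. For \<open>\<upsilon>0 = 0\<close> the range is the whole sample.\<close>

definition edge :: "nat \<Rightarrow> 'a \<Rightarrow> real" where
  "edge n \<omega> = (if 0 < \<upsilon>0 then (X (fl n \<upsilon>0 + 1) \<omega> - A2 n) / \<gamma>2 n else 0)"

lemma bwd_Suc:
  assumes "k < n"
  shows "bwd X A g n \<omega> (Suc k) = bwd X A g n \<omega> k + (X (n - k) \<omega> - A n) / g n"
proof -
  have "{n - Suc k + 1..n} = insert (n - k) {n - k + 1..n}" using assms by auto
  then have "psum_star n (\<lambda>j. X j \<omega>) (Suc k) = X (n - k) \<omega> + psum_star n (\<lambda>j. X j \<omega>) k"
    by (simp add: psum_star_def)
  then show ?thesis
    by (simp add: bwd_def add_divide_distrib[symmetric] algebra_simps)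
qed

text \<open>The forward index never leaves the range of the path, so the distance to
  \<open>y\<close> controls all samples at once.\<close>

lemma fwd_quad_tendsto:
  assumes y: "y \<in> mspace m" "continuous_on {0..\<upsilon>1} (fst y)" and n: "filterlim n at_top sequentially"
    and w: "\<And>i. w i \<in> space M" and d: "(\<lambda>i. mdist m (Xs (n i) (w i)) y) \<longlonglongrightarrow> 0"
    and \<tau>: "\<And>i. \<tau> i \<in> {0..\<upsilon>1}" "\<tau> \<longlonglongrightarrow> t" and t: "0 < t"
  shows "(\<lambda>i. quad_stat (n i) (S1 (n i) (w i)) (fl (n i) (\<tau> i))) \<longlonglongrightarrow> Q_fun t (fst y)"
proof (rule quad_stat_tendsto[OF y(2) t _ n])
  show "t \<le> \<upsilon>1" by (rule LIMSEQ_le_const2[OF \<tau>(2)]) (use \<tau>(1) in auto)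
  show "(\<lambda>i. real (fl (n i) (\<tau> i)) / real (n i)) \<longlonglongrightarrow> t"
    by (rule fl_tendsto[OF n \<tau>(2)]) (use \<tau>(1) in auto)
  fix e :: real assume "0 < e"
  then have "eventually (\<lambda>i. mdist m (Xs (n i) (w i)) y < e) sequentially" by (intro order_tendstoD(2)[OF d])
  moreover have "eventually (\<lambda>i. 0 < n i) sequentially"
    using eventually_compose_filterlim[OF eventually_gt_at_top[of 0] n] .
  ultimately show "\<forall>\<^sub>F i in sequentially. \<forall>j\<in>{1..fl (n i) (\<tau> i)}.
      \<bar>S1 (n i) (w i) j - fst y (min \<upsilon>1 (real j / real (n i)))\<bar> \<le> e"
  proof eventually_elim
    case (elim i)
    show ?case
    proof
      fix j assume j: "j \<in> {1..fl (n i) (\<tau> i)}"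
      have "real j \<le> real (n i) * \<tau> i" using j fl_le[of "\<tau> i" "n i"] \<tau>(1)[of i] by auto
      also have "\<dots> \<le> real (n i) * \<upsilon>1" using \<tau>(1)[of i] by (intro mult_left_mono) auto
      finally have jn: "real j \<le> real (n i) * \<upsilon>1" .
      then have "min \<upsilon>1 (real j / real (n i)) = real j / real (n i)"
        using elim(2) by (intro min_absorb2) (simp add: divide_le_eq mult.commute)
      then show "\<bar>S1 (n i) (w i) j - fst y (min \<upsilon>1 (real j / real (n i)))\<bar> \<le> e"
        using near_fst[OF w[of i] y(1) elim(2) jn] elim(1) by simp
    qed
  qed
qed

text \<open>The index \<open>n - fl n \<tau>\<close> can exceed
  \<open>n * (1 - \<upsilon>0)\<close>, but by less than 1. In that case the last sum is the
  previous one plus \<open>edge\<close>, while the comparison value is \<open>snd y\<close> at the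
  end point.\<close>

lemma bwd_quad_tendsto:
  assumes y: "y \<in> mspace m" "continuous_on {0..1 - \<upsilon>0} (snd y)" and n: "filterlim n at_top sequentially"
    and w: "\<And>i. w i \<in> space M" and d: "(\<lambda>i. mdist m (Xs (n i) (w i)) y) \<longlonglongrightarrow> 0"
    and edge: "(\<lambda>i. edge (n i) (w i)) \<longlonglongrightarrow> 0"
    and \<tau>: "\<And>i. \<upsilon>0 \<le> \<tau> i" "\<tau> \<longlonglongrightarrow> t" and t: "t < 1"
  shows "(\<lambda>i. quad_stat (n i) (S2 (n i) (w i)) (n i - fl (n i) (\<tau> i))) \<longlonglongrightarrow> Q_fun (1 - t) (snd y)"
proof (rule quad_stat_tendsto[OF y(2) _ _ n])
  have pos: "eventually (\<lambda>i. 0 < n i) sequentially"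
    using eventually_compose_filterlim[OF eventually_gt_at_top[of 0] n] .
  have \<tau>0: "0 \<le> \<tau> i" for i using \<tau>(1)[of i] \<upsilon> by simp
  show "0 < 1 - t" using t by simp
  show "1 - t \<le> 1 - \<upsilon>0" using LIMSEQ_le_const[OF \<tau>(2), of \<upsilon>0] \<tau>(1) by auto
  have "(\<lambda>i. 1 - real (fl (n i) (\<tau> i)) / real (n i)) \<longlonglongrightarrow> 1 - t"
    by (intro tendsto_diff tendsto_const fl_tendsto[OF n \<tau>(2)] \<tau>0)
  moreover have "eventually (\<lambda>i. \<tau> i < 1) sequentially" by (rule order_tendstoD(2)[OF \<tau>(2) t])
  then have "eventually (\<lambda>i. 1 - real (fl (n i) (\<tau> i)) / real (n i) = real (n i - fl (n i) (\<tau> i)) / real (n i)) sequentially"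
    using pos
  proof eventually_elim
    case (elim i)
    have "real (n i) * \<tau> i \<le> real (n i) * 1" using elim(1) by (intro mult_left_mono) auto
    then have "fl (n i) (\<tau> i) \<le> n i" using fl_le[OF \<tau>0, of "n i" i] by linarith
    then show ?case using elim(2) by (simp add: of_nat_diff diff_divide_distrib)
  qed
  ultimately show "(\<lambda>i. real (n i - fl (n i) (\<tau> i)) / real (n i)) \<longlonglongrightarrow> 1 - t"
    by (rule Lim_transform_eventually)
  fix e :: real assume e: "0 < e"
  define c where "c = 1 - \<upsilon>0"
  have c: "0 < c" using \<upsilon> by (simp add: c_def)
  have "(snd y \<longlongrightarrow> snd y c) (at c within {0..c})" using y(2) c by (auto simp: continuous_on_def c_def)
  then have "(snd y \<longlongrightarrow> snd y c) (at_left c)" using c by (simp add: at_within_Icc_at_left)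
  then have "eventually (\<lambda>s. dist (snd y s) (snd y c) < e / 3) (at_left c)" using e by (intro tendstoD) auto
  then obtain u where u: "u < c" "\<And>s. u < s \<Longrightarrow> s < c \<Longrightarrow> dist (snd y s) (snd y c) < e / 3"
    unfolding eventually_at_left_field by blast
  have "eventually (\<lambda>i. mdist m (Xs (n i) (w i)) y < e / 3) sequentially"
    using e by (intro order_tendstoD(2)[OF d]) simp
  moreover have "eventually (\<lambda>i. dist (edge (n i) (w i)) 0 < e / 3) sequentially"
    using e by (intro tendstoD[OF edge]) simp
  moreover have "eventually (\<lambda>i. 1 / real (n i) < c - u) sequentially"
    using u by (intro order_tendstoD(2)[OF tendsto_inverse_of_nat[OF n]]) simp
  ultimately show "\<forall>\<^sub>F i in sequentially. \<forall>j\<in>{1..n i - fl (n i) (\<tau> i)}.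
      \<bar>S2 (n i) (w i) j - snd y (min (1 - \<upsilon>0) (real j / real (n i)))\<bar> \<le> e"
    using pos
  proof eventually_elim
    case (elim i)
    show ?case unfolding c_def[symmetric]
    proof
      fix j assume j: "j \<in> {1..n i - fl (n i) (\<tau> i)}"
      show "\<bar>S2 (n i) (w i) j - snd y (min c (real j / real (n i)))\<bar> \<le> e"
      proof (cases "real j \<le> real (n i) * c")
        case True
        then have "min c (real j / real (n i)) = real j / real (n i)"
          using elim(4) by (intro min_absorb2) (simp add: divide_le_eq mult.commute)
        then show ?thesis using near_snd[OF w y(1) elim(4), of j i] True elim(1) e by (simp add: c_def)
      next
        case False
        \<comment> \<open>Overshoot: \<open>j\<close> can only be the largest possible index
          \<open>n i - fl (n i) \<upsilon>0\<close>, and its predecessor is back in range.\<close>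
        define k where "k = j - 1"
        have jk: "j = Suc k" using j by (simp add: k_def)
        have jle: "j \<le> n i - fl (n i) \<upsilon>0" using j fl_mono[OF \<tau>(1)[of i], of "n i"] by auto
        have gt: "real (n i) * (1 - \<upsilon>0) < real j" using False by (simp add: c_def)
        have "real (n i) * \<upsilon>0 - 1 < real (fl (n i) \<upsilon>0)" by (rule fl_gt)
        moreover have fle: "fl (n i) \<upsilon>0 < n i" using jle jk by linarith
        then have "real (n i - fl (n i) \<upsilon>0) = real (n i) - real (fl (n i) \<upsilon>0)" by (simp add: of_nat_diff)
        ultimately have jeq: "j = n i - fl (n i) \<upsilon>0" and kle: "real k \<le> real (n i) * c"
          using jle gt jk by (auto simp: c_def algebra_simps)
        have pos0: "0 < \<upsilon>0"
        proof (rule ccontr)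
          assume "\<not> 0 < \<upsilon>0"
          then have "real (n i) < real j" using gt \<upsilon> by simp
          then show False using jle by linarith
        qed
        have "n i - k = fl (n i) \<upsilon>0 + 1" using jeq jk fle by linarith
        then have jS: "S2 (n i) (w i) j = S2 (n i) (w i) k + edge (n i) (w i)"
          unfolding jk using bwd_Suc[of k "n i"] jk jle pos0 by (simp add: edge_def)
        have near_k: "\<bar>S2 (n i) (w i) k - snd y (real k / real (n i))\<bar> < e / 3"
          using near_snd[OF w y(1) elim(4), of k i] kle elim(1) by (simp add: c_def)
        have near_c: "\<bar>snd y (real k / real (n i)) - snd y c\<bar> < e / 3"
        proof -
          have 1: "real k / real (n i) \<le> c" using kle elim(4) by (simp add: divide_le_eq mult.commute)
          have "c < real j / real (n i)" using False elim(4) by (simp add: less_divide_eq mult.commute)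
          moreover have "real j / real (n i) = real k / real (n i) + 1 / real (n i)"
            unfolding jk by (simp add: add_divide_distrib)
          ultimately have "u < real k / real (n i)" using elim(3) by linarith
          then show ?thesis using 1 u(2)[of "real k / real (n i)"] e
            by (cases "real k / real (n i) = c") (auto simp: dist_real_def)
        qed
        have min: "min c (real j / real (n i)) = c"
          using False elim(4) by (intro min_absorb1) (simp add: le_divide_eq mult.commute)
        from elim(2) have "\<bar>edge (n i) (w i)\<bar> < e / 3" by (simp only: dist_real_def diff_0_right)
        then show ?thesis unfolding min jS using near_k near_c by linarith
      qed
    qed
  qed
qed

definition good_paths where
  "good_paths = {y \<in> mspace m. continuous_on {0..\<upsilon>1} (fst y) \<and> fst y 0 = 0 \<and>
     continuous_on {0..1 - \<upsilon>0} (snd y) \<and> snd y 0 = 0}"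

lemma AE_good_paths: "AE \<omega> in N. Y \<omega> \<in> good_paths"
  using Y_continuous_paths AE_space by eventually_elim (use Y_in in \<open>simp add: good_paths_def\<close>)

lemma fwd_quad_uniform:
  assumes y: "y \<in> good_paths" and n: "filterlim n at_top sequentially"
    and w: "\<And>i. w i \<in> space M" and d: "(\<lambda>i. mdist m (Xs (n i) (w i)) y) \<longlonglongrightarrow> 0"
    and u: "0 < u"
  shows "uniform_limit {u..\<upsilon>1} (\<lambda>i \<tau>. quad_stat (n i) (S1 (n i) (w i)) (fl (n i) \<tau>))
    (\<lambda>\<tau>. Q_fun \<tau> (fst y)) sequentially"
proof (rule uniform_limit_if_continuous_convergence)
  show "continuous_on {u..\<upsilon>1} (\<lambda>\<tau>. Q_fun \<tau> (fst y))"
    using y u by (intro continuous_on_subset[OF continuous_on_Q_fun]) (auto simp: good_paths_def)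
  fix r :: "nat \<Rightarrow> nat" and \<tau> t assume *: "strict_mono r" "\<And>i. \<tau> i \<in> {u..\<upsilon>1}" "t \<in> {u..\<upsilon>1}" "\<tau> \<longlonglongrightarrow> t"
  have r: "filterlim r at_top sequentially" by (rule filterlim_subseq[OF *(1)])
  show "(\<lambda>i. quad_stat (n (r i)) (S1 (n (r i)) (w (r i))) (fl (n (r i)) (\<tau> i))) \<longlonglongrightarrow> Q_fun t (fst y)"
  proof (rule fwd_quad_tendsto[where n = "\<lambda>i. n (r i)" and w = "\<lambda>i. w (r i)"])
    show "filterlim (\<lambda>i. n (r i)) at_top sequentially" by (rule filterlim_compose[OF n r])
    show "(\<lambda>i. mdist m (Xs (n (r i)) (w (r i))) y) \<longlonglongrightarrow> 0" by (rule filterlim_compose[OF d r])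
    show "\<tau> i \<in> {0..\<upsilon>1}" for i using *(2)[of i] u by auto
  qed (use y w * u in \<open>auto simp: good_paths_def\<close>)
qed simp

lemma bwd_quad_uniform:
  assumes y: "y \<in> good_paths" and n: "filterlim n at_top sequentially"
    and w: "\<And>i. w i \<in> space M" and d: "(\<lambda>i. mdist m (Xs (n i) (w i)) y) \<longlonglongrightarrow> 0"
    and edge: "(\<lambda>i. edge (n i) (w i)) \<longlonglongrightarrow> 0" and u: "u < 1"
  shows "uniform_limit {\<upsilon>0..u} (\<lambda>i \<tau>. quad_stat (n i) (S2 (n i) (w i)) (n i - fl (n i) \<tau>))
    (\<lambda>\<tau>. Q_fun (1 - \<tau>) (snd y)) sequentially"
proof (rule uniform_limit_if_continuous_convergence)
  have "continuous_on {0<..1 - \<upsilon>0} (\<lambda>t. Q_fun t (snd y))"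
    using y by (intro continuous_on_Q_fun) (auto simp: good_paths_def)
  then show "continuous_on {\<upsilon>0..u} (\<lambda>\<tau>. Q_fun (1 - \<tau>) (snd y))"
    by (rule continuous_on_compose2) (use u in \<open>auto intro!: continuous_intros\<close>)
  fix r :: "nat \<Rightarrow> nat" and \<tau> t assume *: "strict_mono r" "\<And>i. \<tau> i \<in> {\<upsilon>0..u}" "t \<in> {\<upsilon>0..u}" "\<tau> \<longlonglongrightarrow> t"
  have r: "filterlim r at_top sequentially" by (rule filterlim_subseq[OF *(1)])
  show "(\<lambda>i. quad_stat (n (r i)) (S2 (n (r i)) (w (r i))) (n (r i) - fl (n (r i)) (\<tau> i))) \<longlonglongrightarrow> Q_fun (1 - t) (snd y)"
  proof (rule bwd_quad_tendsto[where n = "\<lambda>i. n (r i)" and w = "\<lambda>i. w (r i)"])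
    show "filterlim (\<lambda>i. n (r i)) at_top sequentially" by (rule filterlim_compose[OF n r])
    show "(\<lambda>i. mdist m (Xs (n (r i)) (w (r i))) y) \<longlonglongrightarrow> 0" by (rule filterlim_compose[OF d r])
    show "(\<lambda>i. edge (n (r i)) (w (r i))) \<longlonglongrightarrow> 0" by (rule filterlim_compose[OF edge r])
    show "\<upsilon>0 \<le> \<tau> i" for i using *(2)[of i] by auto
  qed (use y w * u in \<open>auto simp: good_paths_def\<close>)
qed simp

end

section \<open>Comparison of different sample sizes\<close>

lemma (in separable_weak_limit) reindex:
  assumes p: "filterlim p at_top sequentially"
  shows "separable_weak_limit m M N (\<lambda>n. Xs (p n)) Y C"
proof unfold_locales
  fix f :: "'s \<Rightarrow> real"
  assume "f \<in> borel_measurable (ball_sigma m)" "continuous_map (mtopology_of m) euclideanreal f" "bounded (f ` mspace m)"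
  from filterlim_compose[OF test[OF this] p]
  show "(\<lambda>n. \<integral>\<omega>. f (Xs (p n) \<omega>) \<partial>M) \<longlonglongrightarrow> (\<integral>\<omega>. f (Y \<omega>) \<partial>N)" .
qed (fact Xs Y C closure_C)+

text \<open>As soon as \<open>e n\<close> is below \<open>d / 2\<close>, the variable
  \<open>b n\<close> can exceed \<open>d\<close> only where \<open>a n\<close> exceeds
  \<open>d / (2 * K)\<close>, both in absolute value.\<close>

lemma (in prob_space) prob_small_affine:
  fixes a b :: "nat \<Rightarrow> 'a \<Rightarrow> real" and e :: "nat \<Rightarrow> real"
  assumes a: "\<And>n. a n \<in> borel_measurable M" and b: "\<And>n. b n \<in> borel_measurable M"
    and lim: "(\<lambda>n. expectation (\<lambda>\<omega>. min 1 \<bar>a n \<omega>\<bar>)) \<longlonglongrightarrow> 0" and K: "0 < K" and e: "e \<longlonglongrightarrow> 0"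
    and le: "eventually (\<lambda>n. \<forall>\<omega>\<in>space M. \<bar>b n \<omega>\<bar> \<le> K * \<bar>a n \<omega>\<bar> + e n) sequentially" and d: "0 < d"
  shows "(\<lambda>n. prob {\<omega> \<in> space M. d < \<bar>b n \<omega>\<bar>}) \<longlonglongrightarrow> 0"
proof (rule Lim_null_comparison)
  note [measurable] = a b
  show "(\<lambda>n. prob {\<omega> \<in> space M. \<bar>a n \<omega>\<bar> > d / (2 * K)}) \<longlonglongrightarrow> 0"
    by (rule prob_small_of_expectation_min[OF a lim]) (use d K in simp)
  have "eventually (\<lambda>n. e n < d / 2) sequentially" by (rule order_tendstoD(2)[OF e]) (use d in simp)
  then show "\<forall>\<^sub>F n in sequentially. norm (prob {\<omega> \<in> space M. d < \<bar>b n \<omega>\<bar>}) \<le> prob {\<omega> \<in> space M. \<bar>a n \<omega>\<bar> > d / (2 * K)}"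
    using le
  proof eventually_elim
    case (elim n)
    have "{\<omega> \<in> space M. d < \<bar>b n \<omega>\<bar>} \<subseteq> {\<omega> \<in> space M. \<bar>a n \<omega>\<bar> > d / (2 * K)}"
    proof safe
      fix \<omega> assume \<omega>: "\<omega> \<in> space M" "d < \<bar>b n \<omega>\<bar>"
      then have "d < K * \<bar>a n \<omega>\<bar> + e n" using elim(2) by fastforce
      then have "d < 2 * (K * \<bar>a n \<omega>\<bar>)" using elim(1) by linarith
      also have "\<dots> = \<bar>a n \<omega>\<bar> * (2 * K)" by simp
      finally have "d < \<bar>a n \<omega>\<bar> * (2 * K)" .
      then show "d / (2 * K) < \<bar>a n \<omega>\<bar>" using K by (subst pos_divide_less_eq) auto
    qed
    then show ?case by (simp add: finite_measure_mono)
  qed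
qed

lemma eventually_real_ge: "eventually (\<lambda>n. B \<le> real n) sequentially"
  using filterlim_real_sequentially by (simp add: filterlim_at_top)

context partial_sum_limit
begin

text \<open>The observation is the same random variable at both sample sizes; at size
  \<open>n\<close> it is an increment of the backward sums, and only the normalization has to be
  changed.\<close>

lemma edge_eq:
  assumes "0 < \<upsilon>0" "fl (n + l) \<upsilon>0 < n" "\<gamma>2 n \<noteq> 0"
  shows "edge (n + l) \<omega> = \<gamma>2 n / \<gamma>2 (n + l) *
      (S2 n \<omega> (n - fl (n + l) \<upsilon>0) - S2 n \<omega> (n - fl (n + l) \<upsilon>0 - 1)) + (A2 n - A2 (n + l)) / \<gamma>2 (n + l)"
proof -
  define k where "k = n - fl (n + l) \<upsilon>0 - 1"
  have k: "n - fl (n + l) \<upsilon>0 = Suc k" "n - k = fl (n + l) \<upsilon>0 + 1" "k < n" using assms(2) by (auto simp: k_def)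
  have "S2 n \<omega> (Suc k) - S2 n \<omega> k = (X (fl (n + l) \<upsilon>0 + 1) \<omega> - A2 n) / \<gamma>2 n"
    using bwd_Suc[OF k(3)] k(2) by simp
  then show ?thesis
    using assms by (simp add: edge_def k(1) add_divide_distrib[symmetric])
qed

text \<open>Removing the last \<open>l\<close> observations from the last \<open>k + l\<close> of
  \<open>n + l\<close> leaves the last \<open>k\<close> of \<open>n\<close>. Backward sums of size
  \<open>n\<close>, renormalized for \<open>n + l\<close>, are thus differences of backward sums of
  the larger sample.\<close>

lemma bwd_shift:
  assumes "k \<le> n" "\<gamma>2 n \<noteq> 0"
  shows "\<gamma>2 n / \<gamma>2 (n + l) * S2 n \<omega> k + real k * ((A2 n - A2 (n + l)) / \<gamma>2 (n + l))
    = S2 (n + l) \<omega> (k + l) - S2 (n + l) \<omega> l"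
proof -
  have "psum_star (n + l) (\<lambda>j. X j \<omega>) (k + l) = psum_star n (\<lambda>j. X j \<omega>) k + psum_star (n + l) (\<lambda>j. X j \<omega>) l"
    using sum.ub_add_nat[of "n - k + 1" n "\<lambda>j. X j \<omega>" l] assms by (simp add: psum_star_def)
  then have "S2 (n + l) \<omega> (k + l) - S2 (n + l) \<omega> l = (psum_star n (\<lambda>j. X j \<omega>) k - real k * A2 (n + l)) / \<gamma>2 (n + l)"
    by (simp add: bwd_def diff_divide_distrib[symmetric] algebra_simps)
  also have "\<dots> = (psum_star n (\<lambda>j. X j \<omega>) k - real k * A2 n) / \<gamma>2 (n + l) + real k * (A2 n - A2 (n + l)) / \<gamma>2 (n + l)"
    by (simp add: add_divide_distrib[symmetric] algebra_simps)
  also have "(psum_star n (\<lambda>j. X j \<omega>) k - real k * A2 n) / \<gamma>2 (n + l) = \<gamma>2 n / \<gamma>2 (n + l) * S2 n \<omega> k"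
    using assms(2) by (simp add: bwd_def)
  finally show ?thesis by simp
qed

text \<open>
  The observation just outside the range covered by the backward path at sample size \<open>n + l\<close> lies
  inside the range covered at sample size \<open>n\<close>, where its contribution is a vanishing jump.
\<close>

lemma edge_tends_to_zero_nonlinear:
  assumes \<upsilon>0: "0 < \<upsilon>0"
    and nonlin: "\<not> (AE \<omega> in N. \<forall>\<tau>\<in>{0..1 - \<upsilon>0}. snd (Y \<omega>) \<tau> = \<tau> / (1 - \<upsilon>0) * snd (Y \<omega>) (1 - \<upsilon>0))"
  shows "tends_to_zero_in_prob M edge"
proof -
  define c where "c = 1 - \<upsilon>0"
  have c: "0 < c" "c < 1" using \<upsilon> \<upsilon>0 by (auto simp: c_def)
  \<comment> \<open>Chosen so that \<open>l * \<upsilon>0\<close> is at least 1: then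
    \<open>fl (n + l) \<upsilon>0\<close> is at least \<open>n * \<upsilon>0\<close>, and the index
    \<open>n - fl (n + l) \<upsilon>0\<close> is in range at size \<open>n\<close>.\<close>
  define l where "l = nat \<lceil>1 / \<upsilon>0\<rceil>"
  have "1 / \<upsilon>0 \<le> real l" unfolding l_def by linarith
  then have l: "1 \<le> real l * \<upsilon>0" using \<upsilon>0 by (simp add: divide_le_eq)
  have p: "filterlim (\<lambda>n. n + l) at_top sequentially" by (rule filterlim_add_const_nat_at_top)
  have \<gamma>: "eventually (\<lambda>n. 0 < \<gamma>2 n) sequentially" using \<gamma>2 by (simp add: filterlim_at_top_dense)
  have Y0: "AE \<omega> in N. snd (Y \<omega>) 0 = 0" using Y_continuous_paths by eventually_elim simp
  obtain K where K: "0 < K" "eventually (\<lambda>n. \<bar>\<gamma>2 n / \<gamma>2 (n + l)\<bar> \<le> K \<and>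
      \<bar>real n * ((A2 n - A2 (n + l)) / \<gamma>2 (n + l))\<bar> \<le> K) sequentially"
  proof (rule bwd.types_bounded[OF nonlin Y0 p])
    fix s assume s: "0 < s" "s < 1 - \<upsilon>0"
    show "\<forall>\<^sub>F n in sequentially. \<forall>\<omega>\<in>space M. \<forall>k. real k \<le> real n * s \<longrightarrow>
      \<bar>\<gamma>2 n / \<gamma>2 (n + l) * S2 n \<omega> k + real k * ((A2 n - A2 (n + l)) / \<gamma>2 (n + l))\<bar> \<le> 2 * mdist m z0 (Xs (n + l) \<omega>)"
      \<comment> \<open>For \<open>n\<close> at least \<open>l / (c - s)\<close> the shifted index
        \<open>k + l\<close> is in range at size \<open>n + l\<close>.\<close>
      using \<gamma> eventually_gt_at_top[of 0] eventually_real_ge[of "real l / (c - s)"]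
    proof eventually_elim
      case (elim n)
      show ?case
      proof (intro ballI allI impI)
        fix \<omega> k assume \<omega>: "\<omega> \<in> space M" and k: "real k \<le> real n * s"
        have "real n * s \<le> real n * 1" using s \<upsilon> by (intro mult_left_mono) auto
        then have kn: "k \<le> n" using k by linarith
        have "real l \<le> real n * (c - s)" using elim(3) s by (simp add: c_def divide_le_eq)
        then have 1: "real n * s + real l \<le> real n * c" by (simp add: right_diff_distrib)
        have 2: "real n * c \<le> real (n + l) * c" using c by (intro mult_right_mono) auto
        have 3: "0 \<le> real n * s" using s by simp
        have "real (k + l) \<le> real (n + l) * c" "real l \<le> real (n + l) * c"
          using 1 2 3 k by simp_all
        then have "\<bar>S2 (n + l) \<omega> (k + l)\<bar> \<le> mdist m z0 (Xs (n + l) \<omega>)" "\<bar>S2 (n + l) \<omega> l\<bar> \<le> mdist m z0 (Xs (n + l) \<omega>)"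
          using elim(2) by (auto intro!: bwd.P_le \<omega> simp: c_def)
        then show "\<bar>\<gamma>2 n / \<gamma>2 (n + l) * S2 n \<omega> k + real k * ((A2 n - A2 (n + l)) / \<gamma>2 (n + l))\<bar> \<le> 2 * mdist m z0 (Xs (n + l) \<omega>)"
          using elim(1) by (subst bwd_shift[OF kn]) linarith+
      qed
    qed
  qed blast
  define k where "k n = n - fl (n + l) \<upsilon>0" for n
  have fl_lim: "(\<lambda>n. real (fl (n + l) \<upsilon>0) / real n) \<longlonglongrightarrow> \<upsilon>0"
  proof (rule tendsto_sandwich)
    show "\<forall>\<^sub>F n in sequentially. \<upsilon>0 \<le> real (fl (n + l) \<upsilon>0) / real n"
      using eventually_gt_at_top[of 0]
    proof eventually_elim
      case (elim n)
      have "real n * \<upsilon>0 \<le> real (fl (n + l) \<upsilon>0)"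
        using fl_gt[of "n + l" \<upsilon>0] l by (simp add: distrib_right)
      then show ?case using elim by (simp add: le_divide_eq mult.commute)
    qed
    show "\<forall>\<^sub>F n in sequentially. real (fl (n + l) \<upsilon>0) / real n \<le> \<upsilon>0 + real l * \<upsilon>0 * (1 / real n)"
      using eventually_gt_at_top[of 0]
    proof eventually_elim
      case (elim n)
      have "real (fl (n + l) \<upsilon>0) / real n \<le> (real n * \<upsilon>0 + real l * \<upsilon>0) / real n"
        using fl_le[of \<upsilon>0 "n + l"] \<upsilon>0 by (intro divide_right_mono) (simp_all add: distrib_right)
      also have "\<dots> = \<upsilon>0 + real l * \<upsilon>0 * (1 / real n)" using elim by (simp add: add_divide_distrib)
      finally show ?case .
    qed
    show "(\<lambda>n. \<upsilon>0 + real l * \<upsilon>0 * (1 / real n)) \<longlonglongrightarrow> \<upsilon>0"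
      using tendsto_add[OF tendsto_const tendsto_mult[OF tendsto_const lim_1_over_n], of \<upsilon>0 "real l * \<upsilon>0"] by simp
  qed simp
  have fl_less: "eventually (\<lambda>n. fl (n + l) \<upsilon>0 < n) sequentially"
  proof -
    have "eventually (\<lambda>n. real (fl (n + l) \<upsilon>0) / real n < 1) sequentially"
      by (rule order_tendstoD(2)[OF fl_lim]) (use \<upsilon> in simp)
    then show ?thesis using eventually_gt_at_top[of 0] by eventually_elim (simp add: divide_less_eq)
  qed
  have k_le: "real (k n) \<le> real n * c" for n
  proof (cases "fl (n + l) \<upsilon>0 \<le> n")
    case True
    have "real n * \<upsilon>0 \<le> real (fl (n + l) \<upsilon>0)"
      using fl_gt[of "n + l" \<upsilon>0] l by (simp add: distrib_right)
    then show ?thesis using True by (simp add: k_def c_def of_nat_diff right_diff_distrib)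
  qed (use c in \<open>simp add: k_def\<close>)
  have "(\<lambda>n. 1 - real (fl (n + l) \<upsilon>0) / real n) \<longlonglongrightarrow> 1 - \<upsilon>0"
    by (intro tendsto_diff tendsto_const fl_lim)
  then have k_lim: "(\<lambda>n. real (k n) / real n) \<longlonglongrightarrow> c"
    unfolding c_def
  proof (rule Lim_transform_eventually)
    show "\<forall>\<^sub>F n in sequentially. 1 - real (fl (n + l) \<upsilon>0) / real n = real (k n) / real n"
      using fl_less eventually_gt_at_top[of 0]
      by eventually_elim (simp add: k_def of_nat_diff diff_divide_distrib)
  qed
  have "(\<lambda>n. real (k n) / real n - 1 / real n) \<longlonglongrightarrow> c - 0"
    by (intro tendsto_diff k_lim lim_1_over_n)
  then have "(\<lambda>n. real (k n - 1) / real n) \<longlonglongrightarrow> c - 0"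
  proof (rule Lim_transform_eventually)
    show "\<forall>\<^sub>F n in sequentially. real (k n) / real n - 1 / real n = real (k n - 1) / real n"
      using fl_less
    proof eventually_elim
      case (elim n)
      then have "1 \<le> k n" by (simp add: k_def)
      then show ?case by (simp add: of_nat_diff diff_divide_distrib)
    qed
  qed
  then have k1_lim: "(\<lambda>n. real (k n - 1) / real n) \<longlonglongrightarrow> c" by simp
  have k1_le: "real (k n - 1) \<le> real n * c" for n using k_le[of n] by linarith
  \<comment> \<open>Both indices divided by \<open>n\<close> tend to \<open>c\<close>, so by
    continuity of the limit path this increment vanishes in the limit.\<close>
  define J where "J n \<omega> = S2 n \<omega> (k n) - S2 n \<omega> (k n - 1)" for n \<omega>
  have J_meas [measurable]: "J n \<in> borel_measurable M" for n
    unfolding J_def by (intro borel_measurable_diff bwd.P_measurable)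
  obtain L where L: "(\<lambda>n. \<integral>\<omega>. min 1 \<bar>J n \<omega>\<bar> \<partial>M) \<longlonglongrightarrow> L" "0 \<le> L" "L = 0 \<longleftrightarrow> (AE \<omega> in N. (0::real) = 0)"
  proof (rule expectation_min_tendsto[of J bwd.continuous_paths "\<lambda>_. 0"])
    fix y n w assume *: "y \<in> bwd.continuous_paths" "y \<in> mspace m" "filterlim n at_top sequentially"
      "\<And>i. w i \<in> space M" "(\<lambda>i. mdist m (Xs (n i) (w i)) y) \<longlonglongrightarrow> 0"
    have "(\<lambda>i. S2 (n i) (w i) (k (n i))) \<longlonglongrightarrow> snd y c"
      by (rule bwd.P_tendsto[OF *]) (use k_le filterlim_compose[OF k_lim *(3)] in \<open>simp_all add: c_def\<close>)
    moreover have "(\<lambda>i. S2 (n i) (w i) (k (n i) - 1)) \<longlonglongrightarrow> snd y c"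
      by (rule bwd.P_tendsto[OF *]) (use k1_le filterlim_compose[OF k1_lim *(3)] in \<open>simp_all add: c_def\<close>)
    ultimately have "(\<lambda>i. J (n i) (w i)) \<longlonglongrightarrow> snd y c - snd y c" unfolding J_def by (rule tendsto_diff)
    then show "(\<lambda>i. J (n i) (w i)) \<longlonglongrightarrow> 0" by simp
  qed (use bwd.AE_continuous_paths in auto)
  then have J_lim: "(\<lambda>n. \<integral>\<omega>. min 1 \<bar>J n \<omega>\<bar> \<partial>M) \<longlonglongrightarrow> 0" by simp
  have edge_meas: "edge n \<in> borel_measurable M" for n
    unfolding edge_def using X by (cases "0 < \<upsilon>0") simp_all
  have "(\<lambda>n. K * (1 / real n)) \<longlonglongrightarrow> K * 0" by (intro tendsto_mult tendsto_const lim_1_over_n)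
  then have Kn: "(\<lambda>n. K * (1 / real n)) \<longlonglongrightarrow> 0" by simp
  have le: "eventually (\<lambda>n. \<forall>\<omega>\<in>space M. \<bar>edge (n + l) \<omega>\<bar> \<le> K * \<bar>J n \<omega>\<bar> + K * (1 / real n)) sequentially"
    using K(2) fl_less \<gamma> eventually_gt_at_top[of 0]
  proof eventually_elim
    case (elim n)
    define \<alpha> \<beta> where "\<alpha> = \<gamma>2 n / \<gamma>2 (n + l)" and "\<beta> = (A2 n - A2 (n + l)) / \<gamma>2 (n + l)"
    have \<alpha>: "\<bar>\<alpha>\<bar> \<le> K" and "\<bar>real n * \<beta>\<bar> \<le> K" using elim(1) by (auto simp: \<alpha>_def \<beta>_def)
    \<comment> \<open>The change of centring is bounded over the whole sample, so a single
      observation feels it only to the order \<open>1/n\<close>.\<close>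
    then have "\<bar>\<beta>\<bar> * real n \<le> K" by (simp add: abs_mult mult.commute)
    then have \<beta>: "\<bar>\<beta>\<bar> \<le> K * (1 / real n)" using elim(4) by (simp add: le_divide_eq)
    show ?case
    proof
      fix \<omega>
      have "edge (n + l) \<omega> = \<alpha> * J n \<omega> + \<beta>"
        using edge_eq[OF \<upsilon>0 elim(2)] elim(3) by (simp add: \<alpha>_def \<beta>_def J_def k_def)
      then have "\<bar>edge (n + l) \<omega>\<bar> \<le> \<bar>\<alpha>\<bar> * \<bar>J n \<omega>\<bar> + \<bar>\<beta>\<bar>"
        using abs_triangle_ineq[of "\<alpha> * J n \<omega>" \<beta>] by (simp add: abs_mult)
      moreover have "\<bar>\<alpha>\<bar> * \<bar>J n \<omega>\<bar> \<le> K * \<bar>J n \<omega>\<bar>" using \<alpha> by (intro mult_right_mono) auto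
      ultimately show "\<bar>edge (n + l) \<omega>\<bar> \<le> K * \<bar>J n \<omega>\<bar> + K * (1 / real n)" using \<beta> by linarith
    qed
  qed
  show ?thesis
    unfolding tends_to_zero_in_prob_def
  proof (intro conjI allI impI edge_meas)
    fix \<epsilon> :: real assume \<epsilon>: "0 < \<epsilon>"
    have "(\<lambda>n. measure M {\<omega> \<in> space M. \<epsilon> < \<bar>edge (n + l) \<omega>\<bar>}) \<longlonglongrightarrow> 0"
      by (rule M.prob_small_affine[OF J_meas edge_meas J_lim K(1) Kn le \<epsilon>])
    then show "(\<lambda>n. measure M {\<omega> \<in> space M. \<epsilon> < \<bar>edge n \<omega>\<bar>}) \<longlonglongrightarrow> 0" by (rule LIMSEQ_offset)
  qed
qed

text \<open>For \<open>\<upsilon>0 = 0\<close> the variable is identically 0; otherwise convergence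
  of types settles nonlinear limits, and the assumption is consulted for linear ones.\<close>

lemma edge_tends_to_zero:
  assumes "0 < \<upsilon>0 \<Longrightarrow> AE \<omega> in N. \<forall>\<tau>\<in>{0..1 - \<upsilon>0}. snd (Y \<omega>) \<tau> = \<tau> / (1 - \<upsilon>0) * snd (Y \<omega>) (1 - \<upsilon>0) \<Longrightarrow>
    tends_to_zero_in_prob M (\<lambda>n \<omega>. (X (fl n \<upsilon>0 + 1) \<omega> - A2 n) / \<gamma>2 n)"
  shows "tends_to_zero_in_prob M edge"
proof (cases "0 < \<upsilon>0")
  case True
  then have "edge = (\<lambda>n \<omega>. (X (fl n \<upsilon>0 + 1) \<omega> - A2 n) / \<gamma>2 n)" by (intro ext) (simp add: edge_def)
  then show ?thesis using assms[OF True] edge_tends_to_zero_nonlinear[OF True] by metis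
next
  case False
  then have "edge = (\<lambda>_ _. 0)" by (intro ext) (simp add: edge_def)
  then show ?thesis by (simp add: tends_to_zero_in_prob_zero)
qed

text \<open>A forward sum of given index does not depend on the sample size; only its normalization
  does.\<close>

lemma fwd_rescale:
  assumes "\<gamma>1 n \<noteq> 0"
  shows "\<gamma>1 n / \<gamma>1 n' * S1 n \<omega> k + real k * ((A1 n - A1 n') / \<gamma>1 n') = S1 n' \<omega> k"
proof -
  have "\<gamma>1 n / \<gamma>1 n' * S1 n \<omega> k = (psum (\<lambda>j. X j \<omega>) k - real k * A1 n) / \<gamma>1 n'"
    using assms by (simp add: fwd_def)
  then show ?thesis
    by (simp add: fwd_def add_divide_distrib[symmetric] algebra_simps)
qed

text \<open>
  Sample sizes \<open>n\<close> and \<open>n / q\<close> see the same partial sums up to a change of time by the factor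
  \<open>q\<close>, and the two normalizations are comparable by convergence of types.
\<close>

lemma fwd_zero_step:
  assumes nonlin: "\<not> (AE \<omega> in N. \<forall>\<tau>\<in>{0..\<upsilon>1}. fst (Y \<omega>) \<tau> = \<tau> / \<upsilon>1 * fst (Y \<omega>) \<upsilon>1)"
    and zero: "AE \<omega> in N. \<forall>\<tau>\<in>{a..u}. fst (Y \<omega>) \<tau> = 0"
    and a: "0 < a" "a < q * u" and u: "u \<le> \<upsilon>1" and q: "0 < q" "q < 1"
  shows "AE \<omega> in N. \<forall>\<tau>\<in>{q * a..u}. fst (Y \<omega>) \<tau> = 0"
proof -
  have u0: "0 < u" using a q by (smt (verit) mult_nonneg_nonpos)
  have qu: "q * u < u" using q u0 by simp
  have \<upsilon>1: "0 < \<upsilon>1" using \<upsilon> by linarith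
  \<comment> \<open>Rounding up gives \<open>n \<le> q * p n\<close>, so the indices in range at
    size \<open>n\<close> stay in range at size \<open>p n\<close>, with the ratio of sizes tending
    to \<open>q\<close>.\<close>
  define p where "p n = nat \<lceil>real n / q\<rceil>" for n
  have p_ge: "real n / q \<le> real (p n)" for n unfolding p_def by linarith
  have p_le: "real (p n) \<le> real n / q + 1" for n
  proof -
    have "0 \<le> real n / q" using q by simp
    then show ?thesis unfolding p_def by linarith
  qed
  have n_le: "real n \<le> q * real (p n)" for n using p_ge[of n] q by (simp add: divide_le_eq mult.commute)
  have n_le_p: "real n \<le> real (p n)" for n
  proof -
    have "q * real (p n) \<le> 1 * real (p n)" using q by (intro mult_right_mono) auto
    then show ?thesis using n_le[of n] by linarith
  qed
  have p: "filterlim p at_top sequentially"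
    by (rule filterlim_at_top_mono[OF filterlim_ident]) (use n_le_p in simp)
  have np_lim: "(\<lambda>n. real n / real (p n)) \<longlonglongrightarrow> q"
  proof (rule tendsto_sandwich)
    show "\<forall>\<^sub>F n in sequentially. q - q * (1 / real n) \<le> real n / real (p n)"
      using eventually_gt_at_top[of 0]
    proof eventually_elim
      case (elim n)
      have "q * real (p n) \<le> real n + q" using p_le[of n] q by (simp add: field_simps)
      moreover have "q * (1 / real n) * real n \<le> q * (1 / real n) * real (p n)"
        using q n_le_p by (intro mult_left_mono) auto
      ultimately have "(q - q * (1 / real n)) * real (p n) \<le> real n"
        using elim by (simp add: left_diff_distrib)
      moreover have "0 < real (p n)" using elim n_le_p[of n] by simp
      ultimately show ?case by (simp only: pos_le_divide_eq)
    qed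
    show "\<forall>\<^sub>F n in sequentially. real n / real (p n) \<le> q"
      using eventually_gt_at_top[of 0]
    proof eventually_elim
      case (elim n)
      then have "0 < real (p n)" using n_le_p[of n] by simp
      then show ?case using n_le by (simp only: pos_divide_le_eq)
    qed
    show "(\<lambda>n. q - q * (1 / real n)) \<longlonglongrightarrow> q"
      using tendsto_diff[OF tendsto_const tendsto_mult[OF tendsto_const lim_1_over_n], of q q] by simp
  qed simp
  have \<gamma>: "eventually (\<lambda>n. 0 < \<gamma>1 n) sequentially" using \<gamma>1 by (simp add: filterlim_at_top_dense)
  have Y0: "AE \<omega> in N. fst (Y \<omega>) 0 = 0" using Y_continuous_paths by eventually_elim simp
  define \<alpha> \<beta> where "\<alpha> n = \<gamma>1 n / \<gamma>1 (p n)" and "\<beta> n = (A1 n - A1 (p n)) / \<gamma>1 (p n)" for n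
  have resc: "eventually (\<lambda>n. \<forall>\<omega> k. \<alpha> n * S1 n \<omega> k + real k * \<beta> n = S1 (p n) \<omega> k) sequentially"
    using \<gamma>
  proof eventually_elim
    case (elim n)
    then have "\<gamma>1 n \<noteq> 0" by simp
    then show ?case unfolding \<alpha>_def \<beta>_def by (intro allI fwd_rescale)
  qed
  obtain K where K: "0 < K" "eventually (\<lambda>n. \<bar>\<alpha> n\<bar> \<le> K \<and> \<bar>real n * \<beta> n\<bar> \<le> K) sequentially"
  proof (rule fwd.types_bounded[OF nonlin Y0 p])
    fix s assume s: "0 < s" "s < \<upsilon>1"
    show "\<forall>\<^sub>F n in sequentially. \<forall>\<omega>\<in>space M. \<forall>k. real k \<le> real n * s \<longrightarrow>
      \<bar>\<alpha> n * S1 n \<omega> k + real k * \<beta> n\<bar> \<le> 2 * mdist m z0 (Xs (p n) \<omega>)"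
      using resc eventually_gt_at_top[of 0]
    proof eventually_elim
      case (elim n)
      have pn: "0 < p n" using elim(2) n_le_p[of n] by simp
      show ?case
      proof (intro ballI allI impI)
        fix \<omega> k assume \<omega>: "\<omega> \<in> space M" and k: "real k \<le> real n * s"
        have "real n * s \<le> real (p n) * \<upsilon>1" using s n_le_p by (intro mult_mono) auto
        then have "\<bar>S1 (p n) \<omega> k\<bar> \<le> mdist m z0 (Xs (p n) \<omega>)"
          using k by (intro fwd.P_le \<omega> pn) linarith
        moreover have "0 \<le> mdist m z0 (Xs (p n) \<omega>)" by (rule mdist_nonneg)
        ultimately show "\<bar>\<alpha> n * S1 n \<omega> k + real k * \<beta> n\<bar> \<le> 2 * mdist m z0 (Xs (p n) \<omega>)"
          using elim(1) by (simp only:; linarith)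
      qed
    qed
  qed blast
  interpret p: separable_weak_limit m M N "\<lambda>n. Xs (p n)" Y "grids UNIV" by (rule reindex[OF p])
  have fl_c: "real (fl n t) \<le> real n * \<upsilon>1" if "0 < t" "t \<le> u" for n t
  proof -
    have "real n * t \<le> real n * \<upsilon>1" using that u by (intro mult_left_mono) auto
    then show ?thesis using fl_le[of t n] that by linarith
  qed
  have fl_c': "real (fl n t) \<le> real (p n) * \<upsilon>1" if "0 < t" "t \<le> u" for n t
  proof -
    have "real n * \<upsilon>1 \<le> real (p n) * \<upsilon>1" using n_le_p \<upsilon>1 by (intro mult_right_mono) auto
    then show ?thesis using fl_c[OF that, of n] by linarith
  qed
  have own: "(\<lambda>n. \<integral>\<omega>. min 1 \<bar>S1 n \<omega> (fl n t)\<bar> \<partial>M) \<longlonglongrightarrow> 0" if t: "a \<le> t" "t \<le> u" for t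
  proof -
    have t0: "0 < t" using t a by linarith
    obtain L where L: "(\<lambda>n. \<integral>\<omega>. min 1 \<bar>S1 n \<omega> (fl n t)\<bar> \<partial>M) \<longlonglongrightarrow> L" "L = 0 \<longleftrightarrow> (AE \<omega> in N. fst (Y \<omega>) t = 0)"
    proof (rule expectation_min_tendsto[of "\<lambda>n \<omega>. S1 n \<omega> (fl n t)" fwd.continuous_paths "\<lambda>y. fst y t"])
      fix y n w assume *: "y \<in> fwd.continuous_paths" "y \<in> mspace m" "filterlim n at_top sequentially"
        "\<And>i. w i \<in> space M" "(\<lambda>i. mdist m (Xs (n i) (w i)) y) \<longlonglongrightarrow> 0"
      show "(\<lambda>i. S1 (n i) (w i) (fl (n i) t)) \<longlonglongrightarrow> fst y t"
        by (rule fwd.P_tendsto[OF * always_eventually fl_tendsto[OF *(3) tendsto_const]])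
           (use fl_c[OF t0 t(2)] t0 in simp_all)
    qed (use fwd.AE_continuous_paths fwd.P_measurable in auto)
    have "AE \<omega> in N. fst (Y \<omega>) t = 0" using zero by eventually_elim (use t in simp)
    with L show ?thesis by simp
  qed
  \<comment> \<open>The index \<open>fl n t\<close>, which at size \<open>n\<close> sees the limit
    at time \<open>t\<close>, sees it at time \<open>q * t\<close> when the sample size is
    \<open>p n\<close>.\<close>
  have other: "\<exists>L. (\<lambda>n. \<integral>\<omega>. min 1 \<bar>S1 (p n) \<omega> (fl n t)\<bar> \<partial>M) \<longlonglongrightarrow> L \<and> 0 \<le> L \<and> (L = 0 \<longleftrightarrow> (AE \<omega> in N. fst (Y \<omega>) (q * t) = 0))"
    if t: "a \<le> t" "t \<le> u" for t
  proof -
    have t0: "0 < t" using t a by linarith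
    obtain L where L: "(\<lambda>n. \<integral>\<omega>. min 1 \<bar>S1 (p n) \<omega> (fl n t)\<bar> \<partial>M) \<longlonglongrightarrow> L" "0 \<le> L"
      "L = 0 \<longleftrightarrow> (AE \<omega> in N. fst (Y \<omega>) (q * t) = 0)"
    proof (rule p.expectation_min_tendsto[of "\<lambda>n \<omega>. S1 (p n) \<omega> (fl n t)" fwd.continuous_paths "\<lambda>y. fst y (q * t)"])
      fix y n w assume *: "y \<in> fwd.continuous_paths" "y \<in> mspace m" "filterlim n at_top sequentially"
        "\<And>i. w i \<in> space M" "(\<lambda>i. mdist m (Xs (p (n i)) (w i)) y) \<longlonglongrightarrow> 0"
      have pn: "filterlim (\<lambda>i. p (n i)) at_top sequentially" by (rule filterlim_compose[OF p *(3)])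
      have "(\<lambda>i. real (n i) / real (p (n i)) * (real (fl (n i) t) / real (n i))) \<longlonglongrightarrow> q * t"
        by (intro tendsto_mult filterlim_compose[OF np_lim *(3)] fl_tendsto[OF *(3) tendsto_const])
           (use t0 in simp)
      then have lim: "(\<lambda>i. real (fl (n i) t) / real (p (n i))) \<longlonglongrightarrow> q * t"
      proof (rule Lim_transform_eventually)
        show "\<forall>\<^sub>F i in sequentially. real (n i) / real (p (n i)) * (real (fl (n i) t) / real (n i))
            = real (fl (n i) t) / real (p (n i))"
          using eventually_compose_filterlim[OF eventually_gt_at_top[of 0] *(3)] by eventually_elim simp
      qed
      show "(\<lambda>i. S1 (p (n i)) (w i) (fl (n i) t)) \<longlonglongrightarrow> fst y (q * t)"
        by (rule fwd.P_tendsto[OF *(1,2) pn *(4,5) always_eventually lim]) (use fl_c'[OF t0 t(2)] in simp)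
    qed (use fwd.AE_continuous_paths fwd.P_measurable in auto)
    then show ?thesis by blast
  qed
  have au: "a \<le> u" using a qu by linarith
  \<comment> \<open>At index \<open>fl n u\<close> both normalized sums vanish in the limit, because
    \<open>q * u\<close> still lies in \<open>{a..u}\<close>. As \<open>\<alpha> n\<close> is
    bounded, no room is left for the linear term.\<close>
  have n\<beta>: "(\<lambda>n. real n * \<beta> n) \<longlonglongrightarrow> 0"
  proof (rule tendstoI)
    fix e :: real assume e: "0 < e"
    \<comment> \<open>Chosen so that \<open>(1 + K) * d\<close> is \<open>u / 2 * (e / 2)\<close>,
      where \<open>u / 2\<close> bounds \<open>fl n u / n\<close> from below.\<close>
    define d where "d = e * u / 4 / (1 + K)"
    have "1 + K \<noteq> 0" using K by linarith
    then have Kd: "(1 + K) * d = e * u / 4"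
      unfolding d_def by (subst times_divide_eq_right) (rule nonzero_mult_div_cancel_left)
    have d: "0 < d" using e u0 K by (simp add: d_def)
    obtain L where L: "(\<lambda>n. \<integral>\<omega>. min 1 \<bar>S1 (p n) \<omega> (fl n u)\<bar> \<partial>M) \<longlonglongrightarrow> L" "L = 0 \<longleftrightarrow> (AE \<omega> in N. fst (Y \<omega>) (q * u) = 0)"
      using other[OF _ order_refl] au by blast
    have "AE \<omega> in N. fst (Y \<omega>) (q * u) = 0" using zero
    proof eventually_elim
      case (elim \<omega>)
      show ?case by (rule bspec[OF elim]) (use a qu in \<open>simp only: atLeastAtMost_iff; linarith\<close>)
    qed
    with L have L0: "(\<lambda>n. \<integral>\<omega>. min 1 \<bar>S1 (p n) \<omega> (fl n u)\<bar> \<partial>M) \<longlonglongrightarrow> 0" by simp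
    have "(\<lambda>n. measure M {\<omega> \<in> space M. \<bar>S1 (p n) \<omega> (fl n u)\<bar> > d}) \<longlonglongrightarrow> 0"
      by (rule M.prob_small_of_expectation_min[OF fwd.P_measurable L0 d])
    then have ev1: "eventually (\<lambda>n. measure M {\<omega> \<in> space M. \<bar>S1 (p n) \<omega> (fl n u)\<bar> > d} < 1 / 2) sequentially"
      by (rule order_tendstoD) simp
    have "(\<lambda>n. measure M {\<omega> \<in> space M. \<bar>S1 n \<omega> (fl n u)\<bar> > d}) \<longlonglongrightarrow> 0"
      by (rule M.prob_small_of_expectation_min[OF fwd.P_measurable own[OF au order_refl] d])
    then have ev2: "eventually (\<lambda>n. measure M {\<omega> \<in> space M. \<bar>S1 n \<omega> (fl n u)\<bar> > d} < 1 / 2) sequentially"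
      by (rule order_tendstoD) simp
    have ev3: "eventually (\<lambda>n. u / 2 < real (fl n u) / real n) sequentially"
      by (rule order_tendstoD(1)[OF fl_tendsto[OF filterlim_ident tendsto_const]]) (use u0 in auto)
    show "eventually (\<lambda>n. dist (real n * \<beta> n) 0 < e) sequentially"
      using ev1 ev2 ev3 K(2) resc eventually_gt_at_top[of 0]
    proof eventually_elim
      case (elim n)
      let ?E = "{\<omega> \<in> space M. \<bar>S1 (p n) \<omega> (fl n u)\<bar> \<le> d}" and ?E' = "{\<omega> \<in> space M. \<bar>S1 n \<omega> (fl n u)\<bar> \<le> d}"
      note [measurable] = fwd.P_measurable
      have "?E = space M - {\<omega> \<in> space M. \<bar>S1 (p n) \<omega> (fl n u)\<bar> > d}" by auto
      then have 1: "measure M ?E = 1 - measure M {\<omega> \<in> space M. \<bar>S1 (p n) \<omega> (fl n u)\<bar> > d}" by (simp add: M.prob_compl)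
      have "?E' = space M - {\<omega> \<in> space M. \<bar>S1 n \<omega> (fl n u)\<bar> > d}" by auto
      then have 2: "measure M ?E' = 1 - measure M {\<omega> \<in> space M. \<bar>S1 n \<omega> (fl n u)\<bar> > d}" by (simp add: M.prob_compl)
      have "\<exists>\<omega>\<in>space M. \<omega> \<in> ?E \<and> \<omega> \<in> ?E'"
      proof (rule M.exists_in_Int)
        show "?E \<in> sets M" "?E' \<in> sets M" by measurable
        show "1 < measure M ?E + measure M ?E'" unfolding 1 2 using elim(1,2) by linarith
      qed
      then obtain \<omega> where \<omega>: "\<bar>S1 (p n) \<omega> (fl n u)\<bar> \<le> d" "\<bar>S1 n \<omega> (fl n u)\<bar> \<le> d" by blast
      have eq: "\<alpha> n * S1 n \<omega> (fl n u) + real (fl n u) * \<beta> n = S1 (p n) \<omega> (fl n u)" using elim(5) by blast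
      have "\<bar>\<alpha> n * S1 n \<omega> (fl n u)\<bar> \<le> K * d"
        unfolding abs_mult using \<omega> elim(4) K(1) by (intro mult_mono) auto
      then have "\<bar>real (fl n u) * \<beta> n\<bar> \<le> (1 + K) * d"
        unfolding distrib_right using eq \<omega>(1) by linarith
      moreover have "u / 2 * real n < real (fl n u)" using elim(3,6) by (simp only: of_nat_0_less_iff pos_less_divide_eq)
      then have "u / 2 * real n * \<bar>\<beta> n\<bar> \<le> real (fl n u) * \<bar>\<beta> n\<bar>" by (intro mult_right_mono) auto
      ultimately have "u / 2 * (real n * \<bar>\<beta> n\<bar>) \<le> (1 + K) * d"
        unfolding abs_mult mult.assoc abs_of_nat by linarith
      moreover have "(1 + K) * d = u / 2 * (e / 2)" using Kd by simp
      ultimately have "u / 2 * (real n * \<bar>\<beta> n\<bar>) \<le> u / 2 * (e / 2)" by simp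
      moreover have "0 < u / 2" using u0 by simp
      ultimately have "real n * \<bar>\<beta> n\<bar> \<le> e / 2" by (rule mult_left_le_imp_le)
      then show ?case using e by (simp add: dist_real_def abs_mult)
    qed
  qed
  \<comment> \<open>For \<sigma> between \<open>q * a\<close> and \<open>a\<close> the time
    \<open>\<sigma> / q\<close> lies in \<open>{a..u}\<close>, where the sums at size
    \<open>n\<close> vanish in the limit; the affine relation carries this over to time \<sigma> at
    size \<open>p n\<close>.\<close>
  have pt: "AE \<omega> in N. fst (Y \<omega>) \<sigma> = 0" if \<sigma>: "q * a \<le> \<sigma>" "\<sigma> \<le> a" for \<sigma>
  proof -
    define t where "t = \<sigma> / q"
    have qt: "q * t = \<sigma>" using q by (simp add: t_def)
    have t: "a \<le> t" "t \<le> u"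
    proof -
      show "a \<le> t" using \<sigma>(1) q by (simp add: t_def le_divide_eq mult.commute)
      have "\<sigma> \<le> u * q" using \<sigma>(2) a by (simp add: mult.commute)
      then show "t \<le> u" using q by (simp add: t_def divide_le_eq)
    qed
    obtain L where L: "(\<lambda>n. \<integral>\<omega>. min 1 \<bar>S1 (p n) \<omega> (fl n t)\<bar> \<partial>M) \<longlonglongrightarrow> L" "0 \<le> L"
      "L = 0 \<longleftrightarrow> (AE \<omega> in N. fst (Y \<omega>) (q * t) = 0)"
      using other[OF t] by blast
    have e0: "(\<lambda>n. \<bar>real n * \<beta> n\<bar> * u) \<longlonglongrightarrow> 0"
      using tendsto_mult[OF tendsto_rabs[OF n\<beta>] tendsto_const[of u]] by simp
    have le: "eventually (\<lambda>n. \<forall>\<omega>\<in>space M. \<bar>S1 (p n) \<omega> (fl n t)\<bar> \<le> K * \<bar>S1 n \<omega> (fl n t)\<bar> + \<bar>real n * \<beta> n\<bar> * u) sequentially"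
      using K(2) resc
    proof eventually_elim
      case (elim n)
      show ?case
      proof
        fix \<omega>
        have eq: "\<alpha> n * S1 n \<omega> (fl n t) + real (fl n t) * \<beta> n = S1 (p n) \<omega> (fl n t)" using elim(2) by blast
        have "\<bar>\<alpha> n * S1 n \<omega> (fl n t)\<bar> \<le> K * \<bar>S1 n \<omega> (fl n t)\<bar>"
          unfolding abs_mult using elim(1) by (intro mult_right_mono) auto
        moreover have "\<bar>real (fl n t) * \<beta> n\<bar> \<le> \<bar>real n * \<beta> n\<bar> * u"
        proof -
          have "real (fl n t) \<le> real n * t" using t a by (intro fl_le) linarith
          also have "\<dots> \<le> real n * u" using t by (intro mult_left_mono) auto
          finally have "real (fl n t) * \<bar>\<beta> n\<bar> \<le> real n * u * \<bar>\<beta> n\<bar>" by (intro mult_right_mono) auto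
          then show ?thesis by (simp add: abs_mult mult.commute mult.left_commute)
        qed
        ultimately show "\<bar>S1 (p n) \<omega> (fl n t)\<bar> \<le> K * \<bar>S1 n \<omega> (fl n t)\<bar> + \<bar>real n * \<beta> n\<bar> * u"
          unfolding eq[symmetric] by linarith
      qed
    qed
    have "L \<le> 0 + d" if d: "0 < d" for d
    proof -
      have "(\<lambda>n. measure M {\<omega> \<in> space M. d < \<bar>S1 (p n) \<omega> (fl n t)\<bar>}) \<longlonglongrightarrow> 0"
        by (rule M.prob_small_affine[OF fwd.P_measurable fwd.P_measurable own[OF t] K(1) e0 le d])
      then have "(\<lambda>n. d + measure M {\<omega> \<in> space M. d < \<bar>S1 (p n) \<omega> (fl n t)\<bar>}) \<longlonglongrightarrow> d + 0"
        by (intro tendsto_add tendsto_const)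
      then show ?thesis
        using LIMSEQ_le[OF L(1)] M.expectation_min_le[OF fwd.P_measurable d] by fastforce
    qed
    then have "L \<le> 0" by (rule field_le_epsilon)
    with L qt show ?thesis by simp
  qed
  have "AE \<omega> in N. \<forall>\<sigma>\<in>{q * a..a} \<inter> \<rat>. fst (Y \<omega>) \<sigma> = 0"
    by (intro AE_ball_countable' countable_Int2 countable_rat pt) auto
  with zero Y_continuous_paths show ?thesis
  proof eventually_elim
    case (elim \<omega>)
    have qa: "0 \<le> q * a" using q a by simp
    have au: "a \<le> \<upsilon>1" "a \<le> u" using au u by linarith+
    have "continuous_on {q * a..a} (fst (Y \<omega>))"
      by (rule continuous_on_subset[OF conjunct1[OF elim(2)]]) (use qa au in auto)
    then have cad: "cadlag_on (q * a) a (fst (Y \<omega>))" by (rule continuous_on_imp_cadlag_on)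
    show ?case
    proof
      fix \<tau> assume \<tau>: "\<tau> \<in> {q * a..u}"
      show "fst (Y \<omega>) \<tau> = 0"
      proof (cases "\<tau> \<le> a")
        case True
        have "\<bar>fst (Y \<omega>) \<tau>\<bar> \<le> 0"
        proof (rule cadlag_abs_le_dense[OF cad])
          fix r assume "r \<in> {q * a..a}" "r \<in> \<rat> \<union> {a}"
          then have "r = a \<or> r \<in> {q * a..a} \<inter> \<rat>" by blast
          moreover have "fst (Y \<omega>) a = 0" by (rule bspec[OF elim(1)]) (use au in simp)
          ultimately have "fst (Y \<omega>) r = 0" using bspec[OF elim(3)] by blast
          then show "\<bar>fst (Y \<omega>) r\<bar> \<le> 0" by simp
        qed (use \<tau> True in simp)
        then show ?thesis by simp
      next
        case False
        then show ?thesis by (intro bspec[OF elim(1)]) (use \<tau> in simp)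
      qed
    qed
  qed
qed

text \<open>A linear limit that vanishes at \<open>a\<close> vanishes altogether. Otherwise the
  interval of zeros is extended towards 0 by a fixed factor again and again; its left ends
  \<open>q^k * a\<close> tend to 0, and at time 0 the limit is 0 in any case.\<close>

lemma fwd_zero:
  assumes zero: "AE \<omega> in N. \<forall>\<tau>\<in>{a..u}. fst (Y \<omega>) \<tau> = 0" and a: "0 < a" "a < u" and u: "u \<le> \<upsilon>1"
  shows "AE \<omega> in N. \<forall>\<tau>\<in>{0..u}. fst (Y \<omega>) \<tau> = 0"
proof (cases "AE \<omega> in N. \<forall>\<tau>\<in>{0..\<upsilon>1}. fst (Y \<omega>) \<tau> = \<tau> / \<upsilon>1 * fst (Y \<omega>) \<upsilon>1")
  case True
  with zero show ?thesis
  proof eventually_elim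
    case (elim \<omega>)
    have "fst (Y \<omega>) a = a / \<upsilon>1 * fst (Y \<omega>) \<upsilon>1" using elim(2) a u by (intro bspec[OF elim(2)]) auto
    moreover have "fst (Y \<omega>) a = 0" using elim(1) a by auto
    moreover have "a / \<upsilon>1 \<noteq> 0" using a u by auto
    ultimately have "fst (Y \<omega>) \<upsilon>1 = 0" by simp
    then show ?case using elim(2) u by auto
  qed
next
  case nonlin: False
  \<comment> \<open>The midpoint of \<open>a / u\<close> and 1: a factor below 1 whose product with
    \<open>u\<close> still exceeds \<open>a\<close>, as the extension step requires. The later left
    ends are smaller, so the same factor keeps working.\<close>
  define q where "q = (a / u + 1) / 2"
  have x: "a / u < 1" "0 < a / u" using a by simp_all
  have "x < (x + 1) / 2 \<and> 0 < (x + 1) / 2 \<and> (x + 1) / 2 < 1" if "x < 1" "0 < x" for x :: real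
    using that by auto
  from this[OF x] have q: "a / u < q" "0 < q" "q < 1" unfolding q_def by blast+
  then have aqu: "a < q * u" using a by (simp add: divide_less_eq)
  have step: "AE \<omega> in N. \<forall>\<tau>\<in>{q ^ k * a..u}. fst (Y \<omega>) \<tau> = 0" for k
  proof (induction k)
    case 0
    then show ?case using zero by simp
  next
    case (Suc k)
    have "q ^ k * a \<le> 1 * a" using q a by (intro mult_right_mono power_le_one) auto
    then have "q ^ k * a < q * u" using aqu by linarith
    then have "AE \<omega> in N. \<forall>\<tau>\<in>{q * (q ^ k * a)..u}. fst (Y \<omega>) \<tau> = 0"
      using q a by (intro fwd_zero_step[OF nonlin Suc.IH _ _ u]) auto
    then show ?case by (simp add: mult.assoc)
  qed
  then have "AE \<omega> in N. \<forall>k. \<forall>\<tau>\<in>{q ^ k * a..u}. fst (Y \<omega>) \<tau> = 0"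
    unfolding AE_all_countable by (rule allI)
  with Y_continuous_paths show ?thesis
  proof eventually_elim
    case (elim \<omega>)
    show ?case
    proof
      fix \<tau> assume \<tau>: "\<tau> \<in> {0..u}"
      show "fst (Y \<omega>) \<tau> = 0"
      proof (cases "\<tau> = 0")
        case True
        then show ?thesis using elim by simp
      next
        case False
        then have "0 < \<tau> / a" using \<tau> a by simp
        then obtain k where "q ^ k < \<tau> / a" using real_arch_pow_inv[OF _ q(3)] by blast
        then have "q ^ k * a \<le> \<tau>" using a by (simp add: less_divide_eq)
        then show ?thesis using elim(2) \<tau> by auto
      qed
    qed
  qed
qed

end

section \<open>Convergence in law and divergence in probability of functionals\<close>

lemma tends_to_zero_in_prob_abs_add:
  assumes M: "prob_space M" and a: "tends_to_zero_in_prob M a" and b: "tends_to_zero_in_prob M b"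
  shows "tends_to_zero_in_prob M (\<lambda>n \<omega>. \<bar>a n \<omega>\<bar> + \<bar>b n \<omega>\<bar>)"
  unfolding tends_to_zero_in_prob_def
proof (intro conjI allI impI)
  interpret prob_space M by (rule M)
  have [measurable]: "a n \<in> borel_measurable M" "b n \<in> borel_measurable M" for n
    using a b by (simp_all add: tends_to_zero_in_prob_def)
  show "(\<lambda>\<omega>. \<bar>a n \<omega>\<bar> + \<bar>b n \<omega>\<bar>) \<in> borel_measurable M" for n by measurable
  fix e :: real assume e: "0 < e"
  then have e2: "0 < e / 2" by simp
  have "(\<lambda>n. prob {\<omega> \<in> space M. \<bar>a n \<omega>\<bar> > e / 2}) \<longlonglongrightarrow> 0"
    using conjunct2[OF a[unfolded tends_to_zero_in_prob_def]] e2 by blast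
  moreover have "(\<lambda>n. prob {\<omega> \<in> space M. \<bar>b n \<omega>\<bar> > e / 2}) \<longlonglongrightarrow> 0"
    using conjunct2[OF b[unfolded tends_to_zero_in_prob_def]] e2 by blast
  ultimately have "(\<lambda>n. prob {\<omega> \<in> space M. \<bar>a n \<omega>\<bar> > e / 2} + prob {\<omega> \<in> space M. \<bar>b n \<omega>\<bar> > e / 2}) \<longlonglongrightarrow> 0 + 0"
    by (rule tendsto_add)
  then have lim: "(\<lambda>n. prob {\<omega> \<in> space M. \<bar>a n \<omega>\<bar> > e / 2} + prob {\<omega> \<in> space M. \<bar>b n \<omega>\<bar> > e / 2}) \<longlonglongrightarrow> 0" by simp
  show "(\<lambda>n. prob {\<omega> \<in> space M. \<bar>\<bar>a n \<omega>\<bar> + \<bar>b n \<omega>\<bar>\<bar> > e}) \<longlonglongrightarrow> 0"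
  proof (rule Lim_null_comparison[OF always_eventually lim], intro allI)
    fix n
    have "prob {\<omega> \<in> space M. \<bar>\<bar>a n \<omega>\<bar> + \<bar>b n \<omega>\<bar>\<bar> > e}
        \<le> prob ({\<omega> \<in> space M. \<bar>a n \<omega>\<bar> > e / 2} \<union> {\<omega> \<in> space M. \<bar>b n \<omega>\<bar> > e / 2})"
      by (intro finite_measure_mono) auto
    also have "\<dots> \<le> prob {\<omega> \<in> space M. \<bar>a n \<omega>\<bar> > e / 2} + prob {\<omega> \<in> space M. \<bar>b n \<omega>\<bar> > e / 2}"
      by (intro measure_Un_le) measurable
    finally show "norm (prob {\<omega> \<in> space M. \<bar>\<bar>a n \<omega>\<bar> + \<bar>b n \<omega>\<bar>\<bar> > e})
        \<le> prob {\<omega> \<in> space M. \<bar>a n \<omega>\<bar> > e / 2} + prob {\<omega> \<in> space M. \<bar>b n \<omega>\<bar> > e / 2}"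
      by (simp only: real_norm_def abs_of_nonneg measure_nonneg)
  qed
qed

context separable_weak_limit
begin

text \<open>Each bounded continuous function of \<open>R\<close> is covered by the mapping theorem.
  The limit itself may be unbounded, so its measurable version is obtained through
  \<open>arctan\<close>, which is bounded, continuous and invertible.\<close>

lemma converges_in_law_mapping:
  fixes R :: "nat \<Rightarrow> 'a \<Rightarrow> real" and f :: "'s \<Rightarrow> real"
  assumes R: "\<And>n. R n \<in> borel_measurable M" and \<eta>: "tends_to_zero_in_prob M \<eta>"
    and G: "AE \<omega> in N. Y \<omega> \<in> G"
    and lim: "\<And>y n w. y \<in> G \<Longrightarrow> y \<in> mspace m \<Longrightarrow> filterlim n at_top sequentially \<Longrightarrow>
       (\<And>i. w i \<in> space M) \<Longrightarrow> (\<lambda>i. mdist m (Xs (n i) (w i)) y) \<longlonglongrightarrow> 0 \<Longrightarrow>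
       (\<lambda>i. \<eta> (n i) (w i)) \<longlonglongrightarrow> 0 \<Longrightarrow> (\<lambda>i::nat. R (n i) (w i)) \<longlonglongrightarrow> f y"
  shows "converges_in_law M R N (\<lambda>\<omega>. f (Y \<omega>))"
proof -
  note [measurable] = R
  have test: "\<exists>F. F \<in> borel_measurable N \<and> (AE \<omega> in N. h (f (Y \<omega>)) = F \<omega>) \<and>
      (\<lambda>n. \<integral>\<omega>. h (R n \<omega>) \<partial>M) \<longlonglongrightarrow> (\<integral>\<omega>. F \<omega> \<partial>N)"
    if h: "\<And>x. isCont h x" "\<And>x. \<bar>h x\<bar> \<le> B" for h :: "real \<Rightarrow> real" and B
  proof -
    have "continuous_on UNIV h" using h(1) by (simp add: continuous_at_imp_continuous_on)
    then have [measurable]: "h \<in> borel_measurable borel" by (rule borel_measurable_continuous_onI)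
    obtain F where "F \<in> borel_measurable N" "AE \<omega> in N. h (f (Y \<omega>)) = F \<omega>"
      "(\<lambda>n. \<integral>\<omega>. h (R n \<omega>) \<partial>M) \<longlonglongrightarrow> (\<integral>\<omega>. F \<omega> \<partial>N)"
    proof (rule extended_continuous_mapping[of "\<lambda>n \<omega>. h (R n \<omega>)" B \<eta> G "\<lambda>y. h (f y)"])
      show "(\<lambda>i. h (R (n i) (w i))) \<longlonglongrightarrow> h (f y)"
        if "y \<in> G" "y \<in> mspace m" "filterlim n at_top sequentially" "\<And>i. w i \<in> space M"
          "(\<lambda>i. mdist m (Xs (n i) (w i)) y) \<longlonglongrightarrow> 0" "(\<lambda>i. \<eta> (n i) (w i)) \<longlonglongrightarrow> 0" for y n w
        by (rule isCont_tendsto_compose[OF h(1) lim[OF that]])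
    qed (simp_all add: \<eta> G h)
    then show ?thesis by blast
  qed
  have "\<bar>arctan x\<bar> \<le> pi / 2" for x
    using arctan_lbound[of x] arctan_ubound[of x] by linarith
  then obtain F where F: "F \<in> borel_measurable N" "AE \<omega> in N. arctan (f (Y \<omega>)) = F \<omega>"
    using test[of arctan "pi / 2", OF isCont_arctan] by blast
  \<comment> \<open>The tangent of \<open>F\<close>, written as a quotient so that its measurability
    is evident.\<close>
  define Y' where "Y' \<omega> = sin (F \<omega>) / cos (F \<omega>)" for \<omega>
  have Y' [measurable]: "Y' \<in> borel_measurable N" unfolding Y'_def using F(1) by measurable
  have Y'_eq: "AE \<omega> in N. f (Y \<omega>) = Y' \<omega>"
    using F(2)
  proof eventually_elim
    case (elim \<omega>)
    have "f (Y \<omega>) = tan (arctan (f (Y \<omega>)))" by (simp add: tan_arctan)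
    then show ?case unfolding elim by (simp add: Y'_def tan_def)
  qed
  have "weak_conv_m (\<lambda>n. distr M borel (R n)) (distr N borel Y')"
  proof (rule integral_bdd_continuous_conv_imp_weak_conv)
    show "real_distribution (distr M borel (R n))" for n by (rule M.real_distribution_distr[OF R])
    show "real_distribution (distr N borel Y')" by (rule N.real_distribution_distr[OF Y'])
    fix h :: "real \<Rightarrow> real" assume h: "\<And>x. isCont h x" "\<And>x. \<bar>h x\<bar> \<le> 1"
    have "continuous_on UNIV h" using h(1) by (simp add: continuous_at_imp_continuous_on)
    then have [measurable]: "h \<in> borel_measurable borel" by (rule borel_measurable_continuous_onI)
    obtain F where F: "F \<in> borel_measurable N" "AE \<omega> in N. h (f (Y \<omega>)) = F \<omega>"
      "(\<lambda>n. \<integral>\<omega>. h (R n \<omega>) \<partial>M) \<longlonglongrightarrow> (\<integral>\<omega>. F \<omega> \<partial>N)"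
      using test[OF h] by blast
    have "(\<integral>\<omega>. F \<omega> \<partial>N) = (\<integral>\<omega>. h (Y' \<omega>) \<partial>N)"
    proof (rule integral_cong_AE[OF F(1)])
      show "AE \<omega> in N. F \<omega> = h (Y' \<omega>)" using F(2) Y'_eq by eventually_elim simp
    qed measurable
    then show "(\<lambda>n. \<integral>x. h x \<partial>distr M borel (R n)) \<longlonglongrightarrow> (\<integral>x. h x \<partial>distr N borel Y')"
      using F(3) by (simp add: integral_distr)
  qed
  then show ?thesis
    unfolding converges_in_law_def using R Y' Y'_eq by blast
qed

text \<open>A continuous ramp from 0 to 1 between \<open>K\<close> and \<open>K + 1\<close> is
  eventually 1 along every convergent sequence of paths, and it lies below the indicator of
  exceeding \<open>K\<close>.\<close>

lemma tends_to_infinity_mapping: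
  fixes R :: "nat \<Rightarrow> 'a \<Rightarrow> real"
  assumes R: "\<And>n. R n \<in> borel_measurable M" and \<eta>: "tends_to_zero_in_prob M \<eta>"
    and G: "AE \<omega> in N. Y \<omega> \<in> G"
    and lim: "\<And>y n w K. y \<in> G \<Longrightarrow> y \<in> mspace m \<Longrightarrow> filterlim n at_top sequentially \<Longrightarrow>
       (\<And>i. w i \<in> space M) \<Longrightarrow> (\<lambda>i. mdist m (Xs (n i) (w i)) y) \<longlonglongrightarrow> 0 \<Longrightarrow>
       (\<lambda>i. \<eta> (n i) (w i)) \<longlonglongrightarrow> 0 \<Longrightarrow> eventually (\<lambda>i::nat. K < R (n i) (w i)) sequentially"
  shows "tends_to_infinity_in_prob M R"
  unfolding tends_to_infinity_in_prob_def
proof (intro conjI allI R)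
  fix K
  note [measurable] = R
  let ?h = "\<lambda>x::real. min 1 (max 0 (x - K))"
  obtain F where F: "F \<in> borel_measurable N" "AE \<omega> in N. 1 = F \<omega>"
    "(\<lambda>n. \<integral>\<omega>. ?h (R n \<omega>) \<partial>M) \<longlonglongrightarrow> (\<integral>\<omega>. F \<omega> \<partial>N)"
  proof (rule extended_continuous_mapping[of "\<lambda>n \<omega>. ?h (R n \<omega>)" 1 \<eta> G "\<lambda>_. 1"])
    fix y n w assume *: "y \<in> G" "y \<in> mspace m" "filterlim n at_top sequentially" "\<And>i. w i \<in> space M"
      "(\<lambda>i. mdist m (Xs (n i) (w i)) y) \<longlonglongrightarrow> 0" "(\<lambda>i. \<eta> (n i) (w i)) \<longlonglongrightarrow> 0"
    have "eventually (\<lambda>i. ?h (R (n i) (w i)) = 1) sequentially"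
      using lim[OF *, of "K + 1"] by eventually_elim simp
    then show "(\<lambda>i. ?h (R (n i) (w i))) \<longlonglongrightarrow> 1" by (rule tendsto_eventually)
  qed (simp_all add: \<eta> G)
  have "(\<integral>\<omega>. F \<omega> \<partial>N) = (\<integral>\<omega>. 1 \<partial>N)"
    by (rule integral_cong_AE[OF F(1)]) (use F(2) in \<open>auto elim: eventually_mono\<close>)
  then have lim1: "(\<lambda>n. \<integral>\<omega>. ?h (R n \<omega>) \<partial>M) \<longlonglongrightarrow> 1" using F(3) by (simp add: N.prob_space)
  show "(\<lambda>n. measure M {\<omega> \<in> space M. R n \<omega> > K}) \<longlonglongrightarrow> 1"
  proof (rule tendsto_sandwich[OF always_eventually always_eventually lim1 tendsto_const]; intro allI)
    fix n
    let ?A = "{\<omega> \<in> space M. R n \<omega> > K}"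
    have A: "?A \<in> sets M" by measurable
    have "(\<integral>\<omega>. ?h (R n \<omega>) \<partial>M) \<le> (\<integral>\<omega>. indicator ?A \<omega> \<partial>M)"
    proof (rule integral_mono)
      show "integrable M (\<lambda>\<omega>. ?h (R n \<omega>))" by (intro M.integrable_const_bound[of _ 1]) auto
      show "integrable M (indicator ?A :: _ \<Rightarrow> real)"
        using A by (intro integrable_real_indicator) (simp_all add: M.emeasure_eq_measure)
      show "?h (R n \<omega>) \<le> indicator ?A \<omega>" if "\<omega> \<in> space M" for \<omega>
        using that by (auto simp: indicator_def)
    qed
    also have "\<dots> = measure M ?A" using sets.sets_into_space[OF A] by (simp add: Int_absorb2)
    finally show "(\<integral>\<omega>. ?h (R n \<omega>) \<partial>M) \<le> measure M ?A" .
    show "measure M ?A \<le> 1" by (rule M.prob_le_1)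
  qed
qed

end

subsection \<open>Suprema, infima and integrals under uniform convergence\<close>

lemma real_SUP_mult_left:
  fixes f :: "'i \<Rightarrow> real"
  assumes "T \<noteq> {}" "bdd_above (f ` T)" "0 < a"
  shows "(SUP t\<in>T. a * f t) = a * (SUP t\<in>T. f t)"
proof (rule antisym)
  have *: "a * f t \<le> a * (SUP t\<in>T. f t)" if "t \<in> T" for t
    using assms that by (intro mult_left_mono cSUP_upper) auto
  then show "(SUP t\<in>T. a * f t) \<le> a * (SUP t\<in>T. f t)" by (intro cSUP_least assms)
  have bdd: "bdd_above ((\<lambda>t. a * f t) ` T)" by (rule bdd_aboveI2) (rule *)
  have "(SUP t\<in>T. f t) \<le> (SUP t\<in>T. a * f t) / a"
  proof (rule cSUP_least[OF assms(1)])
    fix t assume "t \<in> T"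
    then have "a * f t \<le> (SUP t\<in>T. a * f t)" by (intro cSUP_upper bdd)
    then show "f t \<le> (SUP t\<in>T. a * f t) / a" using assms(3) by (simp add: le_divide_eq mult.commute)
  qed
  then show "a * (SUP t\<in>T. f t) \<le> (SUP t\<in>T. a * f t)" using assms(3) by (simp add: le_divide_eq mult.commute)
qed

lemma real_INF_mult_left:
  fixes f :: "'i \<Rightarrow> real"
  assumes "T \<noteq> {}" "bdd_below (f ` T)" "0 < a"
  shows "(INF t\<in>T. a * f t) = a * (INF t\<in>T. f t)"
proof (rule antisym)
  have *: "a * (INF t\<in>T. f t) \<le> a * f t" if "t \<in> T" for t
    using assms that by (intro mult_left_mono cINF_lower) auto
  then show "a * (INF t\<in>T. f t) \<le> (INF t\<in>T. a * f t)" by (intro cINF_greatest assms)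
  have bdd: "bdd_below ((\<lambda>t. a * f t) ` T)" by (rule bdd_belowI2) (rule *)
  have "(INF t\<in>T. a * f t) / a \<le> (INF t\<in>T. f t)"
  proof (rule cINF_greatest[OF assms(1)])
    fix t assume "t \<in> T"
    then have "(INF t\<in>T. a * f t) \<le> a * f t" by (intro cINF_lower bdd)
    then show "(INF t\<in>T. a * f t) / a \<le> f t" using assms(3) by (simp add: divide_le_eq mult.commute)
  qed
  then show "(INF t\<in>T. a * f t) \<le> a * (INF t\<in>T. f t)" using assms(3) by (simp add: divide_le_eq mult.commute)
qed

lemma SUP_diff_le:
  fixes f g :: "'i \<Rightarrow> real"
  assumes "T \<noteq> {}" "bdd_above (f ` T)" "bdd_above (g ` T)" "\<And>t. t \<in> T \<Longrightarrow> \<bar>f t - g t\<bar> \<le> e"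
  shows "\<bar>(SUP t\<in>T. f t) - (SUP t\<in>T. g t)\<bar> \<le> e"
proof -
  have "(SUP t\<in>T. f t) \<le> (SUP t\<in>T. g t) + e"
  proof (rule cSUP_least[OF assms(1)])
    fix t assume t: "t \<in> T"
    have "g t \<le> (SUP t\<in>T. g t)" using t by (intro cSUP_upper assms)
    then show "f t \<le> (SUP t\<in>T. g t) + e" using assms(4)[OF t] by linarith
  qed
  moreover have "(SUP t\<in>T. g t) \<le> (SUP t\<in>T. f t) + e"
  proof (rule cSUP_least[OF assms(1)])
    fix t assume t: "t \<in> T"
    have "f t \<le> (SUP t\<in>T. f t)" using t by (intro cSUP_upper assms)
    then show "g t \<le> (SUP t\<in>T. f t) + e" using assms(4)[OF t] by linarith
  qed
  ultimately show ?thesis by linarith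
qed

lemma INF_diff_le:
  fixes f g :: "'i \<Rightarrow> real"
  assumes "T \<noteq> {}" "bdd_below (f ` T)" "bdd_below (g ` T)" "\<And>t. t \<in> T \<Longrightarrow> \<bar>f t - g t\<bar> \<le> e"
  shows "\<bar>(INF t\<in>T. f t) - (INF t\<in>T. g t)\<bar> \<le> e"
proof -
  have "(INF t\<in>T. g t) - e \<le> (INF t\<in>T. f t)"
  proof (rule cINF_greatest[OF assms(1)])
    fix t assume t: "t \<in> T"
    have "(INF t\<in>T. g t) \<le> g t" using t by (intro cINF_lower assms)
    then show "(INF t\<in>T. g t) - e \<le> f t" using assms(4)[OF t] by linarith
  qed
  moreover have "(INF t\<in>T. f t) - e \<le> (INF t\<in>T. g t)"
  proof (rule cINF_greatest[OF assms(1)])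
    fix t assume t: "t \<in> T"
    have "(INF t\<in>T. f t) \<le> f t" using t by (intro cINF_lower assms)
    then show "(INF t\<in>T. f t) - e \<le> g t" using assms(4)[OF t] by linarith
  qed
  ultimately show ?thesis by linarith
qed

lemma uniform_limit_eventually_le:
  fixes f :: "nat \<Rightarrow> real \<Rightarrow> real"
  assumes "uniform_limit T f g sequentially" "0 < e"
  shows "eventually (\<lambda>i. \<forall>t\<in>T. \<bar>f i t - g t\<bar> \<le> e) sequentially"
  using uniform_limitD[OF assms] by eventually_elim (auto simp: dist_real_def intro: less_imp_le)

lemma uniform_limit_SUP:
  fixes f :: "nat \<Rightarrow> real \<Rightarrow> real"
  assumes lim: "uniform_limit T f g sequentially" and T: "T \<noteq> {}"
    and bdd: "\<And>i. bdd_above (f i ` T)" "bdd_above (g ` T)"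
  shows "(\<lambda>i. SUP t\<in>T. f i t) \<longlonglongrightarrow> (SUP t\<in>T. g t)"
proof (rule tendstoI)
  fix e :: real assume e: "0 < e"
  then have "0 < e / 2" by simp
  from uniform_limit_eventually_le[OF lim this]
  show "eventually (\<lambda>i. dist (SUP t\<in>T. f i t) (SUP t\<in>T. g t) < e) sequentially"
  proof eventually_elim
    case (elim i)
    have "\<bar>(SUP t\<in>T. f i t) - (SUP t\<in>T. g t)\<bar> \<le> e / 2"
      by (rule SUP_diff_le[OF T bdd]) (use elim in blast)
    then show ?case using e by (simp add: dist_real_def)
  qed
qed

lemma uniform_limit_INF:
  fixes f :: "nat \<Rightarrow> real \<Rightarrow> real"
  assumes lim: "uniform_limit T f g sequentially" and T: "T \<noteq> {}"
    and bdd: "\<And>i. bdd_below (f i ` T)" "bdd_below (g ` T)"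
  shows "(\<lambda>i. INF t\<in>T. f i t) \<longlonglongrightarrow> (INF t\<in>T. g t)"
proof (rule tendstoI)
  fix e :: real assume e: "0 < e"
  then have "0 < e / 2" by simp
  from uniform_limit_eventually_le[OF lim this]
  show "eventually (\<lambda>i. dist (INF t\<in>T. f i t) (INF t\<in>T. g t) < e) sequentially"
  proof eventually_elim
    case (elim i)
    have "\<bar>(INF t\<in>T. f i t) - (INF t\<in>T. g t)\<bar> \<le> e / 2"
      by (rule INF_diff_le[OF T bdd]) (use elim in blast)
    then show ?case using e by (simp add: dist_real_def)
  qed
qed

lemma set_integral_const_Icc: "a \<le> b \<Longrightarrow> (LBINT t:{a..b}. (c::real)) = c * (b - a)"
  by (simp add: set_integral_const)

lemma uniform_limit_set_integral:
  fixes f :: "nat \<Rightarrow> real \<Rightarrow> real"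
  assumes lim: "uniform_limit {a..b} f g sequentially" and ab: "a < b"
    and int: "\<And>i. set_integrable lborel {a..b} (f i)" "set_integrable lborel {a..b} g"
  shows "(\<lambda>i. LBINT t:{a..b}. f i t) \<longlonglongrightarrow> (LBINT t:{a..b}. g t)"
proof (rule tendstoI)
  fix e :: real assume e: "0 < e"
  define d where "d = e / 2 / (b - a)"
  have "b - a \<noteq> 0" using ab by simp
  then have "d * (b - a) = e / 2"
    unfolding d_def by (subst times_divide_eq_left) (rule nonzero_mult_div_cancel_right)
  moreover have "0 < d" using e ab by (simp add: d_def)
  ultimately have d: "0 < d" "d * (b - a) = e / 2" by simp_all
  have const: "set_integrable lborel {a..b} (\<lambda>_. d)"
    by (rule borel_integrable_atLeastAtMost') (rule continuous_on_const)
  from uniform_limit_eventually_le[OF lim d(1)]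
  show "eventually (\<lambda>i. dist (LBINT t:{a..b}. f i t) (LBINT t:{a..b}. g t) < e) sequentially"
  proof eventually_elim
    case (elim i)
    have di: "set_integrable lborel {a..b} (\<lambda>t. f i t - g t)" "set_integrable lborel {a..b} (\<lambda>t. g t - f i t)"
      using int by (auto intro: set_integral_diff)
    have "(LBINT t:{a..b}. f i t - g t) \<le> (LBINT t:{a..b}. d)"
      by (rule set_integral_mono[OF di(1) const]) (use elim in \<open>auto simp: abs_le_iff\<close>)
    moreover have "(LBINT t:{a..b}. g t - f i t) \<le> (LBINT t:{a..b}. d)"
      by (rule set_integral_mono[OF di(2) const]) (use elim in \<open>auto simp: abs_le_iff\<close>)
    moreover have "(LBINT t:{a..b}. d) = e / 2" using ab d by (simp add: set_integral_const_Icc)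
    ultimately show ?case using e set_integral_diff(2)[OF int(1)[of i] int(2)] set_integral_diff(2)[OF int(2) int(1)[of i]]
      unfolding dist_real_def by linarith
  qed
qed

subsection \<open>Functionals of step functions\<close>

lemma fl_measurable: "fl n \<in> borel \<rightarrow>\<^sub>M count_space UNIV"
  unfolding fl_def by measurable

lemma step_measurable: "(\<lambda>\<tau>. h (fl n \<tau>) :: real) \<in> borel_measurable borel"
  by (rule measurable_compose_countable[OF measurable_const fl_measurable]) simp

lemma step_set_integrable: "set_integrable lborel {a..b} (\<lambda>\<tau>. h (fl n \<tau>) :: real)"
proof -
  have "bounded ((\<lambda>\<tau>. h (fl n \<tau>)) ` {a..b})"
    by (rule finite_imp_bounded[OF finite_image_fl])
  then obtain B where B: "\<forall>x\<in>(\<lambda>\<tau>. h (fl n \<tau>)) ` {a..b}. norm x \<le> B"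
    unfolding bounded_iff by (rule exE)
  show ?thesis
  proof (rule set_integrable_bound)
    show "set_integrable lborel {a..b} (\<lambda>_. B)"
      by (rule borel_integrable_atLeastAtMost') (rule continuous_on_const)
    show "set_borel_measurable lborel {a..b} (\<lambda>\<tau>. h (fl n \<tau>))"
      unfolding set_borel_measurable_def
      by (intro borel_measurable_scaleR borel_measurable_indicator) (simp_all add: step_measurable)
    show "AE x in lborel. x \<in> {a..b} \<longrightarrow> norm (h (fl n x)) \<le> norm B"
    proof (intro AE_I2 impI)
      fix x assume "x \<in> {a..b}"
      then have "norm (h (fl n x)) \<le> B" by (intro bspec[OF B] imageI)
      then show "norm (h (fl n x)) \<le> norm B" by simp
    qed
  qed
qed

lemma finite_fl_image: "finite (fl n ` {a..b})"
  using finite_subset[OF fl_image_subset] by blast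

lemma step_SUP_measurable:
  assumes h: "\<And>k. (\<lambda>\<omega>. h \<omega> k :: real) \<in> borel_measurable M"
  shows "(\<lambda>\<omega>. SUP \<tau>\<in>{a..b}. h \<omega> (fl n \<tau>)) \<in> borel_measurable M"
proof -
  have "(\<lambda>\<omega>. SUP k\<in>fl n ` {a..b}. h \<omega> k) \<in> borel_measurable M"
  proof (rule borel_measurable_cSUP)
    show "countable (fl n ` {a..b})" by (rule countable_finite[OF finite_fl_image])
    show "bdd_above ((\<lambda>k. h \<omega> k) ` fl n ` {a..b})" for \<omega>
      by (rule bdd_above_finite[OF finite_imageI[OF finite_fl_image]])
  qed (rule h)
  then show ?thesis by (simp only: image_image)
qed

lemma step_INF_measurable:
  assumes h: "\<And>k. (\<lambda>\<omega>. h \<omega> k :: real) \<in> borel_measurable M"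
  shows "(\<lambda>\<omega>. INF \<tau>\<in>{a..b}. h \<omega> (fl n \<tau>)) \<in> borel_measurable M"
proof -
  have "(\<lambda>\<omega>. INF k\<in>fl n ` {a..b}. h \<omega> k) \<in> borel_measurable M"
  proof (rule borel_measurable_cINF)
    show "countable (fl n ` {a..b})" by (rule countable_finite[OF finite_fl_image])
    show "bdd_below ((\<lambda>k. h \<omega> k) ` fl n ` {a..b})" for \<omega>
      by (rule bdd_below_finite[OF finite_imageI[OF finite_fl_image]])
  qed (rule h)
  then show ?thesis by (simp only: image_image)
qed

text \<open>Joint measurability in sample point and time is obtained piecewise, as
  \<open>fl n\<close> takes countably many values; the parametrized integral is then
  measurable.\<close>

lemma step_integral_measurable:
  assumes h: "\<And>k. (\<lambda>\<omega>. h \<omega> k :: real) \<in> borel_measurable M"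
  shows "(\<lambda>\<omega>. LBINT \<tau>:{a..b}. h \<omega> (fl n \<tau>)) \<in> borel_measurable M"
proof -
  have "(\<lambda>p. h (fst p) (fl n (snd p))) \<in> borel_measurable (M \<Otimes>\<^sub>M lborel)"
  proof (rule measurable_compose_countable[of "\<lambda>k p. h (fst p) k"])
    show "(\<lambda>p. h (fst p) k) \<in> borel_measurable (M \<Otimes>\<^sub>M lborel)" for k
      by (rule measurable_compose[OF measurable_fst h])
    have "fl n \<in> lborel \<rightarrow>\<^sub>M count_space UNIV" using fl_measurable by simp
    from measurable_compose[OF measurable_snd this]
    show "(\<lambda>p. fl n (snd p)) \<in> M \<Otimes>\<^sub>M lborel \<rightarrow>\<^sub>M count_space UNIV" .
  qed
  then have [measurable]: "(\<lambda>(\<omega>, \<tau>). h \<omega> (fl n \<tau>)) \<in> borel_measurable (M \<Otimes>\<^sub>M lborel)"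
    by (simp add: split_beta)
  have "(\<lambda>(\<omega>, \<tau>). indicator {a..b} \<tau> *\<^sub>R h \<omega> (fl n \<tau>)) \<in> borel_measurable (M \<Otimes>\<^sub>M lborel)"
    by measurable
  from lborel.borel_measurable_lebesgue_integral[OF this]
  show ?thesis by (simp add: set_lebesgue_integral_def)
qed

subsection \<open>Convergence of the processes\<close>

context partial_sum_limit
begin

definition Qpair :: "real \<Rightarrow> real \<Rightarrow> (real \<Rightarrow> real) \<times> (real \<Rightarrow> real) \<Rightarrow> (real \<Rightarrow> real) \<times> (real \<Rightarrow> real)" where
  "Qpair u u' y = (restrict (\<lambda>\<tau>. Q_fun \<tau> (fst y)) {u..\<upsilon>1}, restrict (\<lambda>\<tau>. Q_fun (1 - \<tau>) (snd y)) {\<upsilon>0..u'})"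

definition Vpair :: "real \<Rightarrow> real \<Rightarrow> nat \<Rightarrow> 'a \<Rightarrow> (real \<Rightarrow> real) \<times> (real \<Rightarrow> real)" where
  "Vpair u u' n \<omega> = (restrict (\<lambda>\<tau>. quad_stat n (S1 n \<omega>) (fl n \<tau>)) {u..\<upsilon>1},
     restrict (\<lambda>\<tau>. quad_stat n (S2 n \<omega>) (n - fl n \<tau>)) {\<upsilon>0..u'})"

lemma Q_continuous:
  assumes "y \<in> good_paths"
  shows "0 < u \<Longrightarrow> continuous_on {u..\<upsilon>1} (\<lambda>\<tau>. Q_fun \<tau> (fst y))"
    and "u' < 1 \<Longrightarrow> continuous_on {\<upsilon>0..u'} (\<lambda>\<tau>. Q_fun (1 - \<tau>) (snd y))"
proof -
  show "continuous_on {u..\<upsilon>1} (\<lambda>\<tau>. Q_fun \<tau> (fst y))" if "0 < u"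
    using assms that by (intro continuous_on_subset[OF continuous_on_Q_fun]) (auto simp: good_paths_def)
  show "continuous_on {\<upsilon>0..u'} (\<lambda>\<tau>. Q_fun (1 - \<tau>) (snd y))" if u': "u' < 1"
  proof -
    have "continuous_on {0<..1 - \<upsilon>0} (\<lambda>t. Q_fun t (snd y))"
      using assms by (intro continuous_on_Q_fun) (auto simp: good_paths_def)
    then show ?thesis by (rule continuous_on_compose2) (use u' in \<open>auto intro!: continuous_intros\<close>)
  qed
qed

lemma Qpair_in_D:
  assumes "y \<in> good_paths" "0 < u" "u' < 1"
  shows "Qpair u u' y \<in> mspace (DD_metric u \<upsilon>1 \<upsilon>0 u')"
  using assms by (simp add: Qpair_def continuous_restrict_in_D Q_continuous)

lemma Vpair_in_D:
  assumes "0 \<le> u"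
  shows "Vpair u u' n \<omega> \<in> mspace (DD_metric u \<upsilon>1 \<upsilon>0 u')"
  using assms \<upsilon> step_in_D[of u "quad_stat n (S1 n \<omega>)"] step_in_D[of \<upsilon>0 "\<lambda>k. quad_stat n (S2 n \<omega>) (n - k)"]
  by (simp add: Vpair_def)

lemma Vpair_measurable:
  assumes "0 \<le> u" "u \<le> \<upsilon>1" "\<upsilon>0 \<le> u'"
  shows "Vpair u u' n \<in> M \<rightarrow>\<^sub>M ball_sigma (DD_metric u \<upsilon>1 \<upsilon>0 u')"
proof (rule measurable_ball_sigma_DD[OF assms(2,3)])
  show "Vpair u u' n \<omega> \<in> mspace (DD_metric u \<upsilon>1 \<upsilon>0 u')" for \<omega> by (rule Vpair_in_D[OF assms(1)])
  have "(\<lambda>\<omega>. quad_stat n (S1 n \<omega>) k) \<in> borel_measurable M" "(\<lambda>\<omega>. quad_stat n (S2 n \<omega>) k) \<in> borel_measurable M" for k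
    by (intro quad_stat_measurable fwd.P_measurable bwd.P_measurable)+
  then show "t \<in> {u..\<upsilon>1} \<Longrightarrow> (\<lambda>\<omega>. fst (Vpair u u' n \<omega>) t) \<in> borel_measurable M"
    "t \<in> {\<upsilon>0..u'} \<Longrightarrow> (\<lambda>\<omega>. snd (Vpair u u' n \<omega>) t) \<in> borel_measurable M" for t
    by (simp_all add: Vpair_def)
qed

text \<open>Uniform convergence of the two discrete functionals on compact time intervals is
  convergence in the uniform metric of the product.\<close>

lemma Vpair_tendsto:
  assumes y: "y \<in> good_paths" and n: "filterlim n at_top sequentially" and w: "\<And>i. w i \<in> space M"
    and d: "(\<lambda>i. mdist m (Xs (n i) (w i)) y) \<longlonglongrightarrow> 0" and edge: "(\<lambda>i. edge (n i) (w i)) \<longlonglongrightarrow> 0"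
    and u: "0 < u" "u \<le> \<upsilon>1" "\<upsilon>0 \<le> u'" "u' < 1"
  shows "(\<lambda>i. mdist (DD_metric u \<upsilon>1 \<upsilon>0 u') (Vpair u u' (n i) (w i)) (Qpair u u' y)) \<longlonglongrightarrow> 0"
proof (rule tendstoI)
  fix e :: real assume e: "0 < e"
  then have e2: "0 < e / 2" by simp
  show "eventually (\<lambda>i. dist (mdist (DD_metric u \<upsilon>1 \<upsilon>0 u') (Vpair u u' (n i) (w i)) (Qpair u u' y)) 0 < e) sequentially"
    using uniform_limit_eventually_le[OF fwd_quad_uniform[OF y n w d u(1)] e2]
      uniform_limit_eventually_le[OF bwd_quad_uniform[OF y n w d edge u(4)] e2]
  proof eventually_elim
    case (elim i)
    have V: "Vpair u u' (n i) (w i) \<in> mspace (DD_metric u \<upsilon>1 \<upsilon>0 u')" using u by (intro Vpair_in_D) simp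
    have Q: "Qpair u u' y \<in> mspace (DD_metric u \<upsilon>1 \<upsilon>0 u')" by (rule Qpair_in_D[OF y u(1,4)])
    have "mdist (D_metric u \<upsilon>1) (fst (Vpair u u' (n i) (w i))) (fst (Qpair u u' y)) \<le> e / 2"
      using V Q elim(1) by (intro mdist_D_le u) (auto simp: mem_Times_iff Vpair_def Qpair_def)
    moreover have "mdist (D_metric \<upsilon>0 u') (snd (Vpair u u' (n i) (w i))) (snd (Qpair u u' y)) \<le> e / 2"
      using V Q elim(2) by (intro mdist_D_le u) (auto simp: mem_Times_iff Vpair_def Qpair_def)
    ultimately have "mdist (DD_metric u \<upsilon>1 \<upsilon>0 u') (Vpair u u' (n i) (w i)) (Qpair u u' y) \<le> e / 2"
      by (simp add: mdist_max_metric)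
    moreover have "0 \<le> mdist (DD_metric u \<upsilon>1 \<upsilon>0 u') (Vpair u u' (n i) (w i)) (Qpair u u' y)" by (rule mdist_nonneg)
    ultimately show ?case using e unfolding dist_real_def by linarith
  qed
qed

text \<open>At a fixed time and for a continuous path \<open>Q_fun\<close> is a limit of functionals
  of finitely many coordinates, and coordinates are ball measurable. The value 0 is imposed on
  \<open>N0\<close>, off which the paths are good.\<close>

lemma Q_coordinate_measurable:
  assumes N0: "N0 \<in> sets N" and good: "\<And>\<omega>. \<omega> \<in> space N \<Longrightarrow> \<omega> \<notin> N0 \<Longrightarrow> Y \<omega> \<in> good_paths"
  shows "0 < t \<Longrightarrow> t \<le> \<upsilon>1 \<Longrightarrow> (\<lambda>\<omega>. if \<omega> \<in> N0 then 0 else Q_fun t (fst (Y \<omega>))) \<in> borel_measurable N"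
    and "0 < t \<Longrightarrow> t \<le> 1 - \<upsilon>0 \<Longrightarrow> (\<lambda>\<omega>. if \<omega> \<in> N0 then 0 else Q_fun t (snd (Y \<omega>))) \<in> borel_measurable N"
proof -
  note [measurable] = N0
  show "(\<lambda>\<omega>. if \<omega> \<in> N0 then 0 else Q_fun t (fst (Y \<omega>))) \<in> borel_measurable N" if t: "0 < t" "t \<le> \<upsilon>1"
  proof (rule borel_measurable_LIMSEQ_real)
    fix \<omega> assume \<omega>: "\<omega> \<in> space N"
    show "(\<lambda>n. if \<omega> \<in> N0 then 0 else quad_stat n (\<lambda>j. fst (Y \<omega>) (min \<upsilon>1 (real j / real n))) (fl n t))
        \<longlonglongrightarrow> (if \<omega> \<in> N0 then 0 else Q_fun t (fst (Y \<omega>)))"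
    proof (cases "\<omega> \<in> N0")
      case False
      have "(\<lambda>n. quad_stat n (\<lambda>j. fst (Y \<omega>) (min \<upsilon>1 (real j / real n))) (fl n t)) \<longlonglongrightarrow> Q_fun t (fst (Y \<omega>))"
        using good[OF \<omega> False] t
        by (intro quad_stat_tendsto[OF _ t filterlim_ident] fl_tendsto filterlim_ident tendsto_const)
           (simp_all add: good_paths_def)
      with False show ?thesis by simp
    qed simp
  next
    fix n
    have [measurable]: "(\<lambda>\<omega>. fst (Y \<omega>) (min \<upsilon>1 (real j / real n))) \<in> borel_measurable N" for j
      using \<upsilon> by (intro coordinate_measurable_DD[OF Y]) auto
    have [measurable]: "(\<lambda>\<omega>. quad_stat n (\<lambda>j. fst (Y \<omega>) (min \<upsilon>1 (real j / real n))) (fl n t)) \<in> borel_measurable N"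
      by (rule quad_stat_measurable) measurable
    show "(\<lambda>\<omega>. if \<omega> \<in> N0 then 0 else quad_stat n (\<lambda>j. fst (Y \<omega>) (min \<upsilon>1 (real j / real n))) (fl n t)) \<in> borel_measurable N"
      by measurable
  qed
  show "(\<lambda>\<omega>. if \<omega> \<in> N0 then 0 else Q_fun t (snd (Y \<omega>))) \<in> borel_measurable N" if t: "0 < t" "t \<le> 1 - \<upsilon>0"
  proof (rule borel_measurable_LIMSEQ_real)
    fix \<omega> assume \<omega>: "\<omega> \<in> space N"
    show "(\<lambda>n. if \<omega> \<in> N0 then 0 else quad_stat n (\<lambda>j. snd (Y \<omega>) (min (1 - \<upsilon>0) (real j / real n))) (fl n t))
        \<longlonglongrightarrow> (if \<omega> \<in> N0 then 0 else Q_fun t (snd (Y \<omega>)))"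
    proof (cases "\<omega> \<in> N0")
      case False
      have "(\<lambda>n. quad_stat n (\<lambda>j. snd (Y \<omega>) (min (1 - \<upsilon>0) (real j / real n))) (fl n t)) \<longlonglongrightarrow> Q_fun t (snd (Y \<omega>))"
        using good[OF \<omega> False] t
        by (intro quad_stat_tendsto[OF _ t filterlim_ident] fl_tendsto filterlim_ident tendsto_const)
           (simp_all add: good_paths_def)
      with False show ?thesis by simp
    qed simp
  next
    fix n
    have [measurable]: "(\<lambda>\<omega>. snd (Y \<omega>) (min (1 - \<upsilon>0) (real j / real n))) \<in> borel_measurable N" for j
      using \<upsilon> by (intro coordinate_measurable_DD[OF Y]) auto
    have [measurable]: "(\<lambda>\<omega>. quad_stat n (\<lambda>j. snd (Y \<omega>) (min (1 - \<upsilon>0) (real j / real n))) (fl n t)) \<in> borel_measurable N"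
      by (rule quad_stat_measurable) measurable
    show "(\<lambda>\<omega>. if \<omega> \<in> N0 then 0 else quad_stat n (\<lambda>j. snd (Y \<omega>) (min (1 - \<upsilon>0) (real j / real n))) (fl n t)) \<in> borel_measurable N"
      by measurable
  qed
qed

text \<open>For each admissible test function the mapping theorem is applied to its composition with
  the pair of discrete functionals, with \<open>edge\<close> as the disturbance. The limit is made
  measurable by the zero pair on a null set.\<close>

theorem Vpair_converges_weakly:
  assumes edge: "tends_to_zero_in_prob M edge" and u: "0 < u" "u < \<upsilon>1" "\<upsilon>0 < u'" "u' < 1"
  shows "converges_weakly (DD_metric u \<upsilon>1 \<upsilon>0 u') M (Vpair u u') N (\<lambda>\<omega>. Qpair u u' (Y \<omega>))"
proof -
  let ?m = "DD_metric u \<upsilon>1 \<upsilon>0 u'"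
  obtain N0 where N0: "{\<omega> \<in> space N. \<not> Y \<omega> \<in> good_paths} \<subseteq> N0" "emeasure N N0 = 0" "N0 \<in> sets N"
    using AE_E[OF AE_good_paths] by blast
  have good: "Y \<omega> \<in> good_paths" if "\<omega> \<in> space N" "\<omega> \<notin> N0" for \<omega> using N0(1) that by blast
  define z where "z = (restrict (\<lambda>_. 0) {u..\<upsilon>1} :: real \<Rightarrow> real, restrict (\<lambda>_. 0) {\<upsilon>0..u'} :: real \<Rightarrow> real)"
  define Y' where "Y' \<omega> = (if \<omega> \<in> N0 then z else Qpair u u' (Y \<omega>))" for \<omega>
  have Y': "Y' \<in> N \<rightarrow>\<^sub>M ball_sigma ?m"
  proof (rule measurable_ball_sigma_DD)
    show "u \<le> \<upsilon>1" "\<upsilon>0 \<le> u'" using u by simp_all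
    show "Y' \<omega> \<in> mspace ?m" if "\<omega> \<in> space N" for \<omega>
      using Qpair_in_D[OF good[OF that] u(1,4)] by (auto simp: Y'_def z_def zero_in_D)
    fix t
    show "(\<lambda>\<omega>. fst (Y' \<omega>) t) \<in> borel_measurable N" if t: "t \<in> {u..\<upsilon>1}"
    proof -
      have "(\<lambda>\<omega>. if \<omega> \<in> N0 then 0 else Q_fun t (fst (Y \<omega>))) \<in> borel_measurable N"
        using t u by (intro Q_coordinate_measurable(1)[OF N0(3) good]) auto
      moreover have "fst (Y' \<omega>) t = (if \<omega> \<in> N0 then 0 else Q_fun t (fst (Y \<omega>)))" for \<omega>
        using t by (simp add: Y'_def z_def Qpair_def)
      ultimately show ?thesis by simp
    qed
    show "(\<lambda>\<omega>. snd (Y' \<omega>) t) \<in> borel_measurable N" if t: "t \<in> {\<upsilon>0..u'}"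
    proof -
      have "(\<lambda>\<omega>. if \<omega> \<in> N0 then 0 else Q_fun (1 - t) (snd (Y \<omega>))) \<in> borel_measurable N"
        using t u by (intro Q_coordinate_measurable(2)[OF N0(3) good]) auto
      moreover have "snd (Y' \<omega>) t = (if \<omega> \<in> N0 then 0 else Q_fun (1 - t) (snd (Y \<omega>)))" for \<omega>
        using t by (simp add: Y'_def z_def Qpair_def)
      ultimately show ?thesis by simp
    qed
  qed
  have "AE \<omega> in N. \<omega> \<notin> N0" using N0 by (intro AE_not_in null_setsI)
  then have Y'_eq: "AE \<omega> in N. Qpair u u' (Y \<omega>) = Y' \<omega>" by eventually_elim (simp add: Y'_def)
  show ?thesis
    unfolding converges_weakly_def
  proof (intro conjI allI exI[of _ Y'] impI Y' Y'_eq)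
    show V: "Vpair u u' n \<in> M \<rightarrow>\<^sub>M ball_sigma ?m" for n
      using u by (intro Vpair_measurable) simp_all
    fix \<phi> :: "_ \<Rightarrow> real"
    assume *: "\<phi> \<in> borel_measurable (ball_sigma ?m) \<and> continuous_map (mtopology_of ?m) euclideanreal \<phi> \<and>
      bounded (\<phi> ` mspace ?m)"
    then have \<phi>: "\<phi> \<in> borel_measurable (ball_sigma ?m)" "continuous_map (mtopology_of ?m) euclideanreal \<phi>" by blast+
    from * obtain B where "\<forall>x\<in>\<phi> ` mspace ?m. norm x \<le> B" unfolding bounded_iff by blast
    then have B: "\<bar>\<phi> x\<bar> \<le> B" if "x \<in> mspace ?m" for x using that by (metis image_eqI real_norm_def)
    obtain F where F: "F \<in> borel_measurable N" "AE \<omega> in N. \<phi> (Qpair u u' (Y \<omega>)) = F \<omega>"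
      "(\<lambda>n. \<integral>\<omega>. \<phi> (Vpair u u' n \<omega>) \<partial>M) \<longlonglongrightarrow> (\<integral>\<omega>. F \<omega> \<partial>N)"
    proof (rule extended_continuous_mapping[of "\<lambda>n \<omega>. \<phi> (Vpair u u' n \<omega>)" B edge good_paths "\<lambda>y. \<phi> (Qpair u u' y)"])
      show "(\<lambda>\<omega>. \<phi> (Vpair u u' n \<omega>)) \<in> borel_measurable M" for n by (rule measurable_compose[OF V \<phi>(1)])
      show "\<bar>\<phi> (Vpair u u' n \<omega>)\<bar> \<le> B" for n \<omega> using u by (intro B Vpair_in_D) simp
      show "\<bar>\<phi> (Qpair u u' y)\<bar> \<le> B" if "y \<in> good_paths" for y by (rule B[OF Qpair_in_D[OF that u(1,4)]])
      fix y n w assume y: "y \<in> good_paths" and nw: "filterlim n at_top sequentially" "\<And>i. w i \<in> space M"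
        "(\<lambda>i. mdist m (Xs (n i) (w i)) y) \<longlonglongrightarrow> 0" "(\<lambda>i. edge (n i) (w i)) \<longlonglongrightarrow> 0"
      interpret D: Metric_space "mspace ?m" "mdist ?m" by (rule Metric_space_mspace_mdist)
      have "(\<lambda>i. mdist ?m (Vpair u u' (n i) (w i)) (Qpair u u' y)) \<longlonglongrightarrow> 0"
        by (rule Vpair_tendsto[OF y nw u(1) less_imp_le[OF u(2)] less_imp_le[OF u(3)] u(4)])
      moreover have "Qpair u u' y \<in> mspace ?m" by (rule Qpair_in_D[OF y u(1,4)])
      moreover have "eventually (\<lambda>i. Vpair u u' (n i) (w i) \<in> mspace ?m) sequentially"
        by (intro always_eventually allI Vpair_in_D less_imp_le u)
      ultimately have "limitin D.mtopology (\<lambda>i. Vpair u u' (n i) (w i)) (Qpair u u' y) sequentially"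
        unfolding D.limitin_metric_dist_null by blast
      then have "limitin (mtopology_of ?m) (\<lambda>i. Vpair u u' (n i) (w i)) (Qpair u u' y) sequentially"
        by (simp only: mtopology_of_def)
      from continuous_map_limit[OF \<phi>(2) this]
      show "(\<lambda>i. \<phi> (Vpair u u' (n i) (w i))) \<longlonglongrightarrow> \<phi> (Qpair u u' y)" by (simp add: o_def)
    qed (rule edge AE_good_paths)+
    have "(\<integral>\<omega>. F \<omega> \<partial>N) = (\<integral>\<omega>. \<phi> (Y' \<omega>) \<partial>N)"
    proof (rule integral_cong_AE[OF F(1) measurable_compose[OF Y' \<phi>(1)]])
      show "AE \<omega> in N. F \<omega> = \<phi> (Y' \<omega>)" using F(2) Y'_eq by eventually_elim simp
    qed
    with F(3) show "(\<lambda>n. \<integral>\<omega>. \<phi> (Vpair u u' n \<omega>) \<partial>M) \<longlonglongrightarrow> (\<integral>\<omega>. \<phi> (Y' \<omega>) \<partial>N)" by simp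
  qed
qed

end

section \<open>Vanishing of the discrete functional, and measurability of the statistics\<close>

lemma quad_stat_eq_0D:
  assumes "quad_stat n S k = 0" "0 < n" "0 < k" "j \<in> {1..k}"
  shows "S j = real j / real k * S k"
proof -
  define b where "b j = S j - real j / real k * S k" for j
  \<comment> \<open>Up to a factor the functional is the sum of squared deviations of
    \<open>b\<close> from its mean \<open>c\<close>. It vanishes only if \<open>b\<close> is
    constant, and \<open>b k = 0\<close> identifies the constant.\<close>
  define c where "c = (\<Sum>j=1..k. b j) / real k"
  have "(\<Sum>j=1..k. (b j - c) ^ 2) = (\<Sum>j=1..k. b j ^ 2 - (2 * c * b j - c ^ 2))"
    by (intro sum.cong) (simp_all add: power2_eq_square algebra_simps)
  also have "\<dots> = (\<Sum>j=1..k. b j ^ 2) - (2 * c * (\<Sum>j=1..k. b j) - real k * c ^ 2)"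
    by (simp add: sum_subtractf sum_distrib_left)
  also have "(\<Sum>j=1..k. b j) = real k * c" using assms by (simp add: c_def)
  finally have 1: "(\<Sum>j=1..k. (b j - c) ^ 2) = (\<Sum>j=1..k. b j ^ 2) - real k * c ^ 2"
    by (simp add: power2_eq_square algebra_simps)
  have 2: "(\<Sum>j=1..k. b j) = real k * c" using assms by (simp add: c_def)
  have "quad_stat n S k = real n / real k ^ 2 * ((\<Sum>j=1..k. b j ^ 2) - real k * c ^ 2)"
    unfolding quad_stat_def b_def[symmetric] 2
    using assms by (simp add: right_diff_distrib power2_eq_square power3_eq_cube)
  then have "(\<Sum>j=1..k. b j ^ 2) - real k * c ^ 2 = 0" using assms by simp
  then have "(\<Sum>j=1..k. (b j - c) ^ 2) = 0" unfolding 1 .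
  then have "\<forall>i\<in>{1..k}. (b i - c) ^ 2 = 0" by (subst (asm) sum_nonneg_eq_0_iff) auto
  then have bc: "b i = c" if "i \<in> {1..k}" for i using that by simp
  have "b k = 0" using assms by (simp add: b_def)
  then have "c = 0" using bc[of k] assms by simp
  then have "b j = 0" using bc[OF assms(4)] by simp
  then show ?thesis by (simp add: b_def)
qed

lemma quad_stat_linear:
  assumes "\<And>j. j \<le> k \<Longrightarrow> S j = real j * x"
  shows "quad_stat n S k = 0"
proof (cases "k = 0")
  case False
  have b: "S j - real j / real k * S k = 0" if j: "j \<in> {1..k}" for j
  proof -
    have "S j = real j * x" "S k = real k * x" using j by (auto intro!: assms)
    then show ?thesis using False by simp
  qed
  have 1: "(\<Sum>j=1..k. (S j - real j / real k * S k) ^ 2) = 0"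
    by (intro sum.neutral ballI) (simp only: b zero_power2)
  have 2: "(\<Sum>j=1..k. S j - real j / real k * S k) = 0"
    by (intro sum.neutral ballI) (rule b)
  show ?thesis unfolding quad_stat_def 1 2 by simp
qed (simp add: quad_stat_def)

lemma V_stat_measurable:
  assumes X: "\<And>j. 1 \<le> j \<Longrightarrow> X j \<in> borel_measurable M"
  shows "(\<lambda>\<omega>. V_stat (\<lambda>j. X j \<omega>) k) \<in> borel_measurable M"
proof -
  have "V_stat (\<lambda>j. X j \<omega>) k = quad_stat 1 (fwd X (\<lambda>_. 0) (\<lambda>_. 1) 1 \<omega>) k" for \<omega>
    using V_stat_eq[of 1 "\<lambda>_. 1" X \<omega> k "\<lambda>_. 0"] by simp
  moreover have "(\<lambda>\<omega>. quad_stat 1 (fwd X (\<lambda>_. 0) (\<lambda>_. 1) 1 \<omega>) k) \<in> borel_measurable M"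
    by (intro quad_stat_measurable fwd_measurable X)
  ultimately show ?thesis by simp
qed

lemma V_star_stat_measurable:
  assumes X: "\<And>j. 1 \<le> j \<Longrightarrow> X j \<in> borel_measurable M"
  shows "(\<lambda>\<omega>. V_star_stat n (\<lambda>j. X j \<omega>) (n - k)) \<in> borel_measurable M"
proof (cases "n = 0")
  case True
  then show ?thesis by (simp add: V_star_stat_def)
next
  case False
  have "V_star_stat n (\<lambda>j. X j \<omega>) (n - k) = quad_stat n (bwd X (\<lambda>_. 0) (\<lambda>_. 1) n \<omega>) (n - k) / real n" for \<omega>
    using V_star_stat_eq[of "n - k" n "\<lambda>_. 1" X \<omega> "\<lambda>_. 0"] False
    by (simp add: eq_divide_eq mult.commute)
  moreover have "(\<lambda>\<omega>. quad_stat n (bwd X (\<lambda>_. 0) (\<lambda>_. 1) n \<omega>) (n - k) / real n) \<in> borel_measurable M"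
    by (intro borel_measurable_divide quad_stat_measurable bwd_measurable X borel_measurable_const)
  ultimately show ?thesis by simp
qed

lemma statistics_measurable:
  assumes X: "\<And>j. 1 \<le> j \<Longrightarrow> X j \<in> borel_measurable M"
  shows "(\<lambda>\<omega>. c * W_stat {a..b} n (\<lambda>j. X j \<omega>)) \<in> borel_measurable M"
    and "(\<lambda>\<omega>. c * I_stat {a..b} n (\<lambda>j. X j \<omega>)) \<in> borel_measurable M"
    and "(\<lambda>\<omega>. c * R_stat {a..b} n (\<lambda>j. X j \<omega>)) \<in> borel_measurable M"
proof -
  have L: "(\<lambda>\<omega>. V_star_stat n (\<lambda>j. X j \<omega>) (n - k) / V_stat (\<lambda>j. X j \<omega>) k) \<in> borel_measurable M" for k
    by (intro borel_measurable_divide V_star_stat_measurable V_stat_measurable X)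
  show "(\<lambda>\<omega>. c * W_stat {a..b} n (\<lambda>j. X j \<omega>)) \<in> borel_measurable M"
    unfolding W_stat_def L_ratio_def
    by (intro borel_measurable_times borel_measurable_const step_SUP_measurable[OF L])
  show "(\<lambda>\<omega>. c * I_stat {a..b} n (\<lambda>j. X j \<omega>)) \<in> borel_measurable M"
    unfolding I_stat_def L_ratio_def
    by (intro borel_measurable_times borel_measurable_const step_integral_measurable[OF L])
  show "(\<lambda>\<omega>. c * R_stat {a..b} n (\<lambda>j. X j \<omega>)) \<in> borel_measurable M"
    unfolding R_stat_def
    by (intro borel_measurable_times borel_measurable_const borel_measurable_divide
        step_INF_measurable[OF V_star_stat_measurable[OF X]] step_INF_measurable[OF V_stat_measurable[OF X]])
qed

section \<open>The three statistics: scaling and convergence in law\<close>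

context partial_sum_limit
begin

text \<open>The factor \<open>n\<close> is common to both normalizations and cancels. Where the
  denominator vanishes, both sides are 0.\<close>

lemma scaled_ratio:
  assumes "0 < n" "\<gamma>1 n \<noteq> 0" "\<gamma>2 n \<noteq> 0"
  shows "(\<gamma>1 n / \<gamma>2 n)^2 * L_ratio n (\<lambda>j. X j \<omega>) \<tau> =
    quad_stat n (S2 n \<omega>) (n - fl n \<tau>) / quad_stat n (S1 n \<omega>) (fl n \<tau>)"
  using assms unfolding L_ratio_def V_stat_eq[symmetric] V_star_stat_eq[OF diff_le_self, symmetric]
  by (simp add: power_divide)

lemma scaled_W:
  assumes "0 < n" "\<gamma>1 n \<noteq> 0" "\<gamma>2 n \<noteq> 0" "a \<le> b"
  shows "(\<gamma>1 n / \<gamma>2 n)^2 * W_stat {a..b} n (\<lambda>j. X j \<omega>) =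
    (SUP \<tau>\<in>{a..b}. quad_stat n (S2 n \<omega>) (n - fl n \<tau>) / quad_stat n (S1 n \<omega>) (fl n \<tau>))"
  unfolding W_stat_def scaled_ratio[OF assms(1-3), symmetric]
proof (rule real_SUP_mult_left[symmetric])
  show "bdd_above ((\<lambda>\<tau>. L_ratio n (\<lambda>j. X j \<omega>) \<tau>) ` {a..b})"
    unfolding L_ratio_def by (rule bdd_above_finite[OF finite_image_fl])
qed (use assms in auto)

lemma scaled_I:
  assumes "0 < n" "\<gamma>1 n \<noteq> 0" "\<gamma>2 n \<noteq> 0"
  shows "(\<gamma>1 n / \<gamma>2 n)^2 * I_stat {a..b} n (\<lambda>j. X j \<omega>) =
    (LBINT \<tau>:{a..b}. quad_stat n (S2 n \<omega>) (n - fl n \<tau>) / quad_stat n (S1 n \<omega>) (fl n \<tau>))"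
  unfolding I_stat_def scaled_ratio[OF assms(1-3), symmetric] by (rule set_integral_mult_right[symmetric])

lemma scaled_R:
  assumes "0 < n" "\<gamma>1 n \<noteq> 0" "\<gamma>2 n \<noteq> 0" "a \<le> b"
  shows "(\<gamma>1 n / \<gamma>2 n)^2 * R_stat {a..b} n (\<lambda>j. X j \<omega>) =
    (INF \<tau>\<in>{a..b}. quad_stat n (S2 n \<omega>) (n - fl n \<tau>)) / (INF \<tau>\<in>{a..b}. quad_stat n (S1 n \<omega>) (fl n \<tau>))"
proof -
  have "(INF \<tau>\<in>{a..b}. quad_stat n (S2 n \<omega>) (n - fl n \<tau>)) =
      real n / (\<gamma>2 n)^2 * (INF \<tau>\<in>{a..b}. V_star_stat n (\<lambda>j. X j \<omega>) (n - fl n \<tau>))"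
    unfolding V_star_stat_eq[OF diff_le_self, symmetric]
    by (rule real_INF_mult_left[OF _ bdd_below_finite[OF finite_image_fl]]) (use assms in auto)
  moreover have "(INF \<tau>\<in>{a..b}. quad_stat n (S1 n \<omega>) (fl n \<tau>)) =
      real n / (\<gamma>1 n)^2 * (INF \<tau>\<in>{a..b}. V_stat (\<lambda>j. X j \<omega>) (fl n \<tau>))"
    unfolding V_stat_eq[symmetric]
    by (rule real_INF_mult_left[OF _ bdd_below_finite[OF finite_image_fl]]) (use assms in auto)
  ultimately show ?thesis using assms(1-3) by (simp add: R_stat_def power_divide)
qed

lemma eventually_scaling:
  assumes n: "filterlim n at_top sequentially"
  shows "eventually (\<lambda>i. 0 < n i \<and> \<gamma>1 (n i) \<noteq> 0 \<and> \<gamma>2 (n i) \<noteq> 0) sequentially"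
proof -
  have "eventually (\<lambda>n. 0 < \<gamma>1 n) sequentially" "eventually (\<lambda>n. 0 < \<gamma>2 n) sequentially"
    using \<gamma>1 \<gamma>2 by (simp_all add: filterlim_at_top_dense)
  then have "eventually (\<lambda>n. 0 < n \<and> \<gamma>1 n \<noteq> 0 \<and> \<gamma>2 n \<noteq> 0) sequentially"
    using eventually_gt_at_top[of 0] by eventually_elim simp
  then show ?thesis by (rule eventually_compose_filterlim[OF _ n])
qed

context
  fixes a b :: real
  assumes edge_zero: "tends_to_zero_in_prob M edge"
    and ab: "0 < a" "a < b" "b < 1" "\<upsilon>0 \<le> a" "b \<le> \<upsilon>1"
begin

lemma Q_continuous_Icc:
  assumes "y \<in> good_paths"
  shows "continuous_on {a..b} (\<lambda>\<tau>. Q_fun \<tau> (fst y))" "continuous_on {a..b} (\<lambda>\<tau>. Q_fun (1 - \<tau>) (snd y))"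
  using continuous_on_subset[OF Q_continuous(1)[OF assms ab(1)], of "{a..b}"]
    continuous_on_subset[OF Q_continuous(2)[OF assms ab(3)], of "{a..b}"] ab by auto

lemma quad_uniform_Icc:
  assumes y: "y \<in> good_paths" and n: "filterlim n at_top sequentially" and w: "\<And>i. w i \<in> space M"
    and d: "(\<lambda>i. mdist m (Xs (n i) (w i)) y) \<longlonglongrightarrow> 0" and edge: "(\<lambda>i. edge (n i) (w i)) \<longlonglongrightarrow> 0"
  shows "uniform_limit {a..b} (\<lambda>i \<tau>. quad_stat (n i) (S1 (n i) (w i)) (fl (n i) \<tau>)) (\<lambda>\<tau>. Q_fun \<tau> (fst y)) sequentially"
    and "uniform_limit {a..b} (\<lambda>i \<tau>. quad_stat (n i) (S2 (n i) (w i)) (n i - fl (n i) \<tau>)) (\<lambda>\<tau>. Q_fun (1 - \<tau>) (snd y)) sequentially"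
proof -
  show "uniform_limit {a..b} (\<lambda>i \<tau>. quad_stat (n i) (S1 (n i) (w i)) (fl (n i) \<tau>)) (\<lambda>\<tau>. Q_fun \<tau> (fst y)) sequentially"
    by (rule uniform_limit_on_subset[OF fwd_quad_uniform[OF y n w d ab(1)]]) (use ab in auto)
  show "uniform_limit {a..b} (\<lambda>i \<tau>. quad_stat (n i) (S2 (n i) (w i)) (n i - fl (n i) \<tau>)) (\<lambda>\<tau>. Q_fun (1 - \<tau>) (snd y)) sequentially"
    by (rule uniform_limit_on_subset[OF bwd_quad_uniform[OF y n w d edge ab(3)]]) (use ab in auto)
qed

lemma bounded_continuous_Icc:
  fixes f :: "real \<Rightarrow> real"
  assumes "continuous_on {a..b} f"
  shows "bounded (f ` {a..b})" "bdd_above (f ` {a..b})" "bdd_below (f ` {a..b})"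
proof -
  show "bounded (f ` {a..b})" by (intro compact_imp_bounded compact_continuous_image assms compact_Icc)
  then show "bdd_above (f ` {a..b})" "bdd_below (f ` {a..b})"
    by (rule bounded_imp_bdd_above, rule bounded_imp_bdd_below)
qed

lemma positive_lower_bound_Icc:
  fixes f :: "real \<Rightarrow> real"
  assumes f: "continuous_on {a..b} f" "\<And>t. t \<in> {a..b} \<Longrightarrow> 0 < f t"
  shows "\<exists>c>0. \<forall>t\<in>{a..b}. c \<le> f t"
proof -
  have "{a..b} \<noteq> {}" using ab by simp
  from continuous_attains_inf[OF compact_Icc this f(1)]
  obtain t where t: "t \<in> {a..b}" "\<forall>s\<in>{a..b}. f t \<le> f s" by blast
  show ?thesis by (rule exI[of _ "f t"]) (use t f(2) in auto)
qed

text \<open>Positivity at \<open>a\<close> propagates to later times, so the limiting denominator is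
  continuous and positive on a compact interval, hence bounded below. The quotients then converge
  uniformly, and suprema, infima and integrals follow.\<close>

theorem statistics_converge_in_law:
  assumes pos: "AE \<omega> in N. 0 < Q_fun a (fst (Y \<omega>))"
  shows "converges_in_law M (\<lambda>n \<omega>. (\<gamma>1 n / \<gamma>2 n)^2 * W_stat {a..b} n (\<lambda>j. X j \<omega>))
      N (\<lambda>\<omega>. SUP \<tau>\<in>{a..b}. Q_fun (1 - \<tau>) (snd (Y \<omega>)) / Q_fun \<tau> (fst (Y \<omega>)))" (is ?W)
    and "converges_in_law M (\<lambda>n \<omega>. (\<gamma>1 n / \<gamma>2 n)^2 * I_stat {a..b} n (\<lambda>j. X j \<omega>))
      N (\<lambda>\<omega>. LBINT \<tau>:{a..b}. Q_fun (1 - \<tau>) (snd (Y \<omega>)) / Q_fun \<tau> (fst (Y \<omega>)))" (is ?I)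
    and "converges_in_law M (\<lambda>n \<omega>. (\<gamma>1 n / \<gamma>2 n)^2 * R_stat {a..b} n (\<lambda>j. X j \<omega>))
      N (\<lambda>\<omega>. (INF \<tau>\<in>{a..b}. Q_fun (1 - \<tau>) (snd (Y \<omega>))) / (INF \<tau>\<in>{a..b}. Q_fun \<tau> (fst (Y \<omega>))))" (is ?R)
proof -
  define G where "G = {y \<in> good_paths. 0 < Q_fun a (fst y)}"
  have G: "AE \<omega> in N. Y \<omega> \<in> G" using AE_good_paths pos by eventually_elim (simp add: G_def)
  have ne: "{a..b} \<noteq> {}" and ab': "a \<le> b" using ab by simp_all
  have good: "y \<in> good_paths" if "y \<in> G" for y using that by (simp add: G_def)
  have Qpos: "0 < Q_fun \<tau> (fst y)" if "y \<in> G" "\<tau> \<in> {a..b}" for y \<tau>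
    using that ab by (intro Q_fun_pos_mono[of \<upsilon>1 "fst y" a \<tau>]) (auto simp: G_def good_paths_def)
  have quot_cont: "continuous_on {a..b} (\<lambda>\<tau>. Q_fun (1 - \<tau>) (snd y) / Q_fun \<tau> (fst y))" if "y \<in> G" for y
  proof (intro continuous_on_divide Q_continuous_Icc good that ballI)
    show "Q_fun \<tau> (fst y) \<noteq> 0" if "\<tau> \<in> {a..b}" for \<tau> using Qpos[OF \<open>y \<in> G\<close> that] by simp
  qed
  have quot: "uniform_limit {a..b} (\<lambda>i \<tau>. quad_stat (n i) (S2 (n i) (w i)) (n i - fl (n i) \<tau>) /
      quad_stat (n i) (S1 (n i) (w i)) (fl (n i) \<tau>)) (\<lambda>\<tau>. Q_fun (1 - \<tau>) (snd y) / Q_fun \<tau> (fst y)) sequentially"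
    if yG: "y \<in> G" and "filterlim n at_top sequentially" "\<And>i. w i \<in> space M"
      "(\<lambda>i. mdist m (Xs (n i) (w i)) y) \<longlonglongrightarrow> 0" "(\<lambda>i. edge (n i) (w i)) \<longlonglongrightarrow> 0" for y n w
  proof -
    note y = good[OF that(1)]
    obtain c where c: "0 < c" "\<And>t. t \<in> {a..b} \<Longrightarrow> c \<le> Q_fun t (fst y)"
      using positive_lower_bound_Icc[OF Q_continuous_Icc(1)[OF y]] Qpos[OF yG] by blast
    show ?thesis
    proof (rule uniform_lim_divide[OF quad_uniform_Icc(2)[OF y that(2-5)] quad_uniform_Icc(1)[OF y that(2-5)]])
      show "bounded ((\<lambda>\<tau>. Q_fun (1 - \<tau>) (snd y)) ` {a..b})"
        by (rule bounded_continuous_Icc[OF Q_continuous_Icc(2)[OF y]])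
      show "c \<le> norm (Q_fun t (fst y))" if "t \<in> {a..b}" for t using c(2)[OF that] c(1) by simp
    qed (rule c(1))
  qed
  show ?W
  proof (rule converges_in_law_mapping[OF statistics_measurable(1)[OF X] edge_zero G])
    fix y n w assume *: "y \<in> G" "y \<in> mspace m" "filterlim n at_top sequentially" "\<And>i. w i \<in> space M"
      "(\<lambda>i. mdist m (Xs (n i) (w i)) y) \<longlonglongrightarrow> 0" "(\<lambda>i. edge (n i) (w i)) \<longlonglongrightarrow> 0"
    have "(\<lambda>i. SUP \<tau>\<in>{a..b}. quad_stat (n i) (S2 (n i) (w i)) (n i - fl (n i) \<tau>) / quad_stat (n i) (S1 (n i) (w i)) (fl (n i) \<tau>))
        \<longlonglongrightarrow> (SUP \<tau>\<in>{a..b}. Q_fun (1 - \<tau>) (snd y) / Q_fun \<tau> (fst y))"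
      by (rule uniform_limit_SUP[OF quot[OF *(1,3-6)] ne bdd_above_finite[OF finite_image_fl] bounded_continuous_Icc(2)[OF quot_cont[OF *(1)]]])
    then show "(\<lambda>i. (\<gamma>1 (n i) / \<gamma>2 (n i))^2 * W_stat {a..b} (n i) (\<lambda>j. X j (w i))) \<longlonglongrightarrow>
        (SUP \<tau>\<in>{a..b}. Q_fun (1 - \<tau>) (snd y) / Q_fun \<tau> (fst y))"
    proof (rule Lim_transform_eventually)
      show "\<forall>\<^sub>F i in sequentially. (SUP \<tau>\<in>{a..b}. quad_stat (n i) (S2 (n i) (w i)) (n i - fl (n i) \<tau>) / quad_stat (n i) (S1 (n i) (w i)) (fl (n i) \<tau>))
          = (\<gamma>1 (n i) / \<gamma>2 (n i))^2 * W_stat {a..b} (n i) (\<lambda>j. X j (w i))"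
        using eventually_scaling[OF *(3)] 
      proof eventually_elim
        case (elim i)
        show ?case by (rule scaled_W[OF conjunct1[OF elim] conjunct1[OF conjunct2[OF elim]] conjunct2[OF conjunct2[OF elim]] ab', symmetric])
      qed
    qed
  qed
  show ?I
  proof (rule converges_in_law_mapping[OF statistics_measurable(2)[OF X] edge_zero G])
    fix y n w assume *: "y \<in> G" "y \<in> mspace m" "filterlim n at_top sequentially" "\<And>i. w i \<in> space M"
      "(\<lambda>i. mdist m (Xs (n i) (w i)) y) \<longlonglongrightarrow> 0" "(\<lambda>i. edge (n i) (w i)) \<longlonglongrightarrow> 0"
    have "(\<lambda>i. LBINT \<tau>:{a..b}. quad_stat (n i) (S2 (n i) (w i)) (n i - fl (n i) \<tau>) / quad_stat (n i) (S1 (n i) (w i)) (fl (n i) \<tau>))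
        \<longlonglongrightarrow> (LBINT \<tau>:{a..b}. Q_fun (1 - \<tau>) (snd y) / Q_fun \<tau> (fst y))"
      by (rule uniform_limit_set_integral[OF quot[OF *(1,3-6)] ab(2) step_set_integrable
            borel_integrable_atLeastAtMost'[OF quot_cont[OF *(1)]]])
    then show "(\<lambda>i. (\<gamma>1 (n i) / \<gamma>2 (n i))^2 * I_stat {a..b} (n i) (\<lambda>j. X j (w i))) \<longlonglongrightarrow>
        (LBINT \<tau>:{a..b}. Q_fun (1 - \<tau>) (snd y) / Q_fun \<tau> (fst y))"
    proof (rule Lim_transform_eventually)
      show "\<forall>\<^sub>F i in sequentially. (LBINT \<tau>:{a..b}. quad_stat (n i) (S2 (n i) (w i)) (n i - fl (n i) \<tau>) / quad_stat (n i) (S1 (n i) (w i)) (fl (n i) \<tau>))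
          = (\<gamma>1 (n i) / \<gamma>2 (n i))^2 * I_stat {a..b} (n i) (\<lambda>j. X j (w i))"
        using eventually_scaling[OF *(3)] 
      proof eventually_elim
        case (elim i)
        show ?case by (rule scaled_I[OF conjunct1[OF elim] conjunct1[OF conjunct2[OF elim]] conjunct2[OF conjunct2[OF elim]], symmetric])
      qed
    qed
  qed
  show ?R
  proof (rule converges_in_law_mapping[OF statistics_measurable(3)[OF X] edge_zero G])
    fix y n w assume *: "y \<in> G" "y \<in> mspace m" "filterlim n at_top sequentially" "\<And>i. w i \<in> space M"
      "(\<lambda>i. mdist m (Xs (n i) (w i)) y) \<longlonglongrightarrow> 0" "(\<lambda>i. edge (n i) (w i)) \<longlonglongrightarrow> 0"
    note y = good[OF *(1)]
    obtain c where c: "0 < c" "\<And>t. t \<in> {a..b} \<Longrightarrow> c \<le> Q_fun t (fst y)"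
      using positive_lower_bound_Icc[OF Q_continuous_Icc(1)[OF y]] Qpos[OF *(1)] by blast
    have "c \<le> (INF \<tau>\<in>{a..b}. Q_fun \<tau> (fst y))" by (rule cINF_greatest[OF ne c(2)])
    with c(1) have "(INF \<tau>\<in>{a..b}. Q_fun \<tau> (fst y)) \<noteq> 0" by linarith
    then have "(\<lambda>i. (INF \<tau>\<in>{a..b}. quad_stat (n i) (S2 (n i) (w i)) (n i - fl (n i) \<tau>)) / (INF \<tau>\<in>{a..b}. quad_stat (n i) (S1 (n i) (w i)) (fl (n i) \<tau>)))
        \<longlonglongrightarrow> (INF \<tau>\<in>{a..b}. Q_fun (1 - \<tau>) (snd y)) / (INF \<tau>\<in>{a..b}. Q_fun \<tau> (fst y))"
      by (intro tendsto_divide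
          uniform_limit_INF[OF quad_uniform_Icc(1)[OF y *(3-6)] ne bdd_below_finite[OF finite_image_fl] bounded_continuous_Icc(3)[OF Q_continuous_Icc(1)[OF y]]]
          uniform_limit_INF[OF quad_uniform_Icc(2)[OF y *(3-6)] ne bdd_below_finite[OF finite_image_fl] bounded_continuous_Icc(3)[OF Q_continuous_Icc(2)[OF y]]])
    then show "(\<lambda>i. (\<gamma>1 (n i) / \<gamma>2 (n i))^2 * R_stat {a..b} (n i) (\<lambda>j. X j (w i))) \<longlonglongrightarrow>
        (INF \<tau>\<in>{a..b}. Q_fun (1 - \<tau>) (snd y)) / (INF \<tau>\<in>{a..b}. Q_fun \<tau> (fst y))"
    proof (rule Lim_transform_eventually)
      show "\<forall>\<^sub>F i in sequentially. (INF \<tau>\<in>{a..b}. quad_stat (n i) (S2 (n i) (w i)) (n i - fl (n i) \<tau>)) / (INF \<tau>\<in>{a..b}. quad_stat (n i) (S1 (n i) (w i)) (fl (n i) \<tau>))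
          = (\<gamma>1 (n i) / \<gamma>2 (n i))^2 * R_stat {a..b} (n i) (\<lambda>j. X j (w i))"
        using eventually_scaling[OF *(3)] 
      proof eventually_elim
        case (elim i)
        show ?case by (rule scaled_R[OF conjunct1[OF elim] conjunct1[OF conjunct2[OF elim]] conjunct2[OF conjunct2[OF elim]] ab', symmetric])
      qed
    qed
  qed
qed

end

end

section \<open>Vanishing denominators and divergence of the statistics\<close>

context partial_sum_limit
begin

definition constant_upto :: "nat \<Rightarrow> 'a set" where
  "constant_upto k = {\<omega> \<in> space M. \<forall>j\<in>{1..k}. X j \<omega> = X 1 \<omega>}"

lemma constant_upto_measurable: "constant_upto k \<in> sets M"
proof -
  have "{\<omega> \<in> space M. \<forall>j\<in>{1..k}. X j \<omega> = X 1 \<omega>} \<in> sets M"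
  proof (rule sets.sets_Collect_finite_All)
    fix j assume "j \<in> {1..k}"
    then have [measurable]: "X j \<in> borel_measurable M" "X 1 \<in> borel_measurable M" by (auto intro: X)
    show "{\<omega> \<in> space M. X j \<omega> = X 1 \<omega>} \<in> sets M" by measurable
  qed simp
  then show ?thesis by (simp only: constant_upto_def)
qed

lemma constant_upto_antimono:
  assumes "k \<le> l"
  shows "constant_upto l \<subseteq> constant_upto k"
proof -
  have "{1..k} \<subseteq> {1..l}" using assms by simp
  then show ?thesis unfolding constant_upto_def by blast
qed

definition constant_forever :: "'a set" where
  "constant_forever = (\<Inter>k. constant_upto k)"

text \<open>Indicates a sample that is constant up to time \<open>t\<close> but not for ever. As an
  indicator it can serve as a disturbance in the mapping lemmas, although it is not a functional of
  the limit path.\<close>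

definition late_change :: "real \<Rightarrow> nat \<Rightarrow> 'a \<Rightarrow> real" where
  "late_change t n \<omega> = indicator (constant_upto (fl n t) - constant_forever) \<omega>"

text \<open>The events \<open>constant_upto k\<close> decrease to \<open>constant_forever\<close>,
  so the differences lose their probability by continuity from above.\<close>

lemma late_change_tends_to_zero:
  assumes t: "0 < t"
  shows "tends_to_zero_in_prob M (late_change t)"
proof -
  have forever: "constant_forever \<in> sets M"
    unfolding constant_forever_def using constant_upto_measurable by (intro sets.countable_INT) (blast | simp)+
  have fl: "filterlim (\<lambda>n. fl n t) at_top sequentially"
  proof -
    show ?thesis unfolding filterlim_at_top
    proof
      fix Z
      have "eventually (\<lambda>n. (real Z + 1) / t \<le> real n) sequentially" by (rule eventually_real_ge)
      then show "eventually (\<lambda>n. Z \<le> fl n t) sequentially"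
      proof eventually_elim
        case (elim n)
        then have "real Z + 1 \<le> real n * t" using t by (simp add: divide_le_eq)
        then have "real Z < real (fl n t)" using fl_gt[of n t] by linarith
        then show ?case by simp
      qed
    qed
  qed
  have dec: "decseq constant_upto"
    by (rule decseq_SucI) (rule constant_upto_antimono, simp)
  have "(\<lambda>k. measure M (constant_upto k)) \<longlonglongrightarrow> measure M (\<Inter>k. constant_upto k)"
    using constant_upto_measurable by (intro M.finite_Lim_measure_decseq[OF _ dec]) blast
  then have "(\<lambda>k. measure M (constant_upto k) - measure M constant_forever) \<longlonglongrightarrow> measure M constant_forever - measure M constant_forever"
    unfolding constant_forever_def by (intro tendsto_diff tendsto_const)
  then have "(\<lambda>k. measure M (constant_upto k) - measure M constant_forever) \<longlonglongrightarrow> 0" by simp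
  from filterlim_compose[OF this fl]
  have lim: "(\<lambda>n. measure M (constant_upto (fl n t)) - measure M constant_forever) \<longlonglongrightarrow> 0" .
  have diff: "measure M (constant_upto k - constant_forever) = measure M (constant_upto k) - measure M constant_forever" for k
    by (rule M.finite_measure_Diff[OF constant_upto_measurable forever]) (auto simp: constant_forever_def)
  show ?thesis
    unfolding tends_to_zero_in_prob_def
  proof (intro conjI allI impI)
    show "late_change t n \<in> borel_measurable M" for n
      unfolding late_change_def by (intro borel_measurable_indicator sets.Diff constant_upto_measurable forever)
    fix e :: real assume e: "0 < e"
    show "(\<lambda>n. measure M {\<omega> \<in> space M. \<bar>late_change t n \<omega>\<bar> > e}) \<longlonglongrightarrow> 0"
    proof (rule Lim_null_comparison[OF always_eventually lim], intro allI)
      fix n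
      have "measure M {\<omega> \<in> space M. \<bar>late_change t n \<omega>\<bar> > e} \<le> measure M (constant_upto (fl n t) - constant_forever)"
        using e by (intro M.finite_measure_mono sets.Diff constant_upto_measurable forever)
                   (auto simp: late_change_def indicator_def split: if_splits)
      then show "norm (measure M {\<omega> \<in> space M. \<bar>late_change t n \<omega>\<bar> > e})
          \<le> measure M (constant_upto (fl n t)) - measure M constant_forever"
        unfolding diff by (simp only: real_norm_def abs_of_nonneg measure_nonneg)
    qed
  qed
qed

text \<open>Equal observations make the backward sums linear in the index.\<close>

lemma bwd_constant:
  assumes \<omega>: "\<omega> \<in> constant_forever" and k: "k \<le> n"
  shows "quad_stat n (S2 n \<omega>) k = 0"
proof (rule quad_stat_linear)
  have const: "X j \<omega> = X 1 \<omega>" if "1 \<le> j" for j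
  proof -
    have "\<omega> \<in> constant_upto j" using \<omega> by (simp add: constant_forever_def)
    then have "\<forall>i\<in>{1..j}. X i \<omega> = X 1 \<omega>" unfolding constant_upto_def by blast
    then show ?thesis by (rule bspec) (use that in simp)
  qed
  fix j assume j: "j \<le> k"
  have "psum_star n (\<lambda>j. X j \<omega>) j = (\<Sum>i=n - j + 1..n. X 1 \<omega>)"
    unfolding psum_star_def by (intro sum.cong const) auto
  also have "\<dots> = real j * X 1 \<omega>" using j k by simp
  finally show "S2 n \<omega> j = real j * ((X 1 \<omega> - A2 n) / \<gamma>2 n)"
    by (simp add: bwd_def right_diff_distrib)
qed

text \<open>A vanishing functional makes the sums linear up to \<open>k\<close>; equal increments
  mean equal observations, provided the scale is not 0.\<close>

lemma constant_of_fwd_quad_0: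
  assumes \<omega>: "\<omega> \<in> space M" and 0: "quad_stat n (S1 n \<omega>) k = 0" and n: "0 < n" "0 < k" "\<gamma>1 n \<noteq> 0"
  shows "\<omega> \<in> constant_upto k"
proof -
  define s where "s = S1 n \<omega> k / real k"
  have lin: "S1 n \<omega> j = real j * s" if "j \<le> k" for j
    using quad_stat_eq_0D[OF 0 n(1,2), of j] that by (cases "j = 0") (simp_all add: s_def)
  have inc: "(X j \<omega> - A1 n) / \<gamma>1 n = s" if j: "j \<in> {1..k}" for j
  proof -
    obtain i where i: "j = Suc i" using j by (cases j) auto
    have "S1 n \<omega> (Suc i) - S1 n \<omega> i = (X (Suc i) \<omega> - A1 n) / \<gamma>1 n"
      by (simp add: fwd_def psum_def diff_divide_distrib[symmetric] algebra_simps)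
    moreover have "S1 n \<omega> (Suc i) - S1 n \<omega> i = s"
      using lin[of "Suc i"] lin[of i] j i by (simp add: distrib_right)
    ultimately show ?thesis using i by simp
  qed
  have "X j \<omega> = X 1 \<omega>" if j: "j \<in> {1..k}" for j
  proof -
    have "1 \<in> {1..k}" using n by simp
    then have "(X j \<omega> - A1 n) / \<gamma>1 n = (X 1 \<omega> - A1 n) / \<gamma>1 n" unfolding inc[OF j] by (rule inc[symmetric])
    then show ?thesis using n(3) by simp
  qed
  then show ?thesis using \<omega> unfolding constant_upto_def by blast
qed

context
  fixes a b :: real
  assumes edge_zero: "tends_to_zero_in_prob M edge"
    and ab: "0 < a" "a < b" "b < 1" "\<upsilon>0 \<le> a" "b \<le> \<upsilon>1"
    and zero: "AE \<omega> in N. \<forall>\<tau>\<in>{a..b}. fst (Y \<omega>) \<tau> = 0"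
    and nondeg: "AE \<omega> in N. \<exists>\<tau>\<in>{a..b}. Q_fun (1 - \<tau>) (snd (Y \<omega>)) \<noteq> 0"
begin

definition degenerate_paths where
  "degenerate_paths = {y \<in> good_paths. (\<forall>\<tau>\<in>{0..b}. fst y \<tau> = 0) \<and> 0 < Q_fun (1 - a) (snd y)}"

text \<open>Nondegeneracy gives a positive value at some \<tau> that depends on \<omega>. Since
  \<open>1 - a\<close> is the longest backward time, the value there is positive as well, which
  fixes a deterministic time.\<close>

lemma AE_degenerate_paths: "AE \<omega> in N. Y \<omega> \<in> degenerate_paths"
  using fwd_zero[OF zero ab(1,2,5)] nondeg AE_good_paths
proof eventually_elim
  case (elim \<omega>)
  obtain \<tau> where \<tau>: "\<tau> \<in> {a..b}" "Q_fun (1 - \<tau>) (snd (Y \<omega>)) \<noteq> 0" using elim(2) by blast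
  have y: "continuous_on {0..1 - \<upsilon>0} (snd (Y \<omega>))" "snd (Y \<omega>) 0 = 0" using elim(3) by (simp_all add: good_paths_def)
  have \<tau>': "0 < 1 - \<tau>" "1 - \<tau> \<le> 1 - a" "1 - a \<le> 1 - \<upsilon>0" using \<tau>(1) ab by auto
  have "0 \<le> Q_fun (1 - \<tau>) (snd (Y \<omega>))" by (rule Q_fun_nonneg[OF y(1) \<tau>'(1)]) (use \<tau>' in linarith)
  then have "0 < Q_fun (1 - \<tau>) (snd (Y \<omega>))" using \<tau>(2) by linarith
  then have "0 < Q_fun (1 - a) (snd (Y \<omega>))" by (rule Q_fun_pos_mono[OF y \<tau>'])
  then show ?case using elim by (simp add: degenerate_paths_def)
qed

text \<open>A sum of absolute values packs two disturbances into the single variable that the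
  mapping lemmas accept.\<close>

definition disturbance :: "nat \<Rightarrow> 'a \<Rightarrow> real" where
  "disturbance n \<omega> = \<bar>edge n \<omega>\<bar> + \<bar>late_change a n \<omega>\<bar>"

lemma disturbance_tends_to_zero: "tends_to_zero_in_prob M disturbance"
  using tends_to_zero_in_prob_abs_add[OF M edge_zero late_change_tends_to_zero[OF ab(1)]]
  unfolding disturbance_def .

text \<open>
  The forward statistic vanishes only if the observations are constant so far. The sample is a fixed
  sequence, so this event shrinks to that of an entirely constant sequence, on which the backward
  statistic vanishes as well; hence the quotients are not spoilt by division by zero.
\<close>

lemma degenerate_limits:
  assumes y: "y \<in> degenerate_paths" and n: "filterlim n at_top sequentially" and w: "\<And>i. w i \<in> space M"
    and d: "(\<lambda>i. mdist m (Xs (n i) (w i)) y) \<longlonglongrightarrow> 0" and dist: "(\<lambda>i. disturbance (n i) (w i)) \<longlonglongrightarrow> 0"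
    and e: "0 < e"
  shows "uniform_limit {a..b} (\<lambda>i \<tau>. quad_stat (n i) (S2 (n i) (w i)) (n i - fl (n i) \<tau>)) (\<lambda>\<tau>. Q_fun (1 - \<tau>) (snd y)) sequentially"
    and "eventually (\<lambda>i. \<forall>\<tau>\<in>{a..b}. 0 < quad_stat (n i) (S1 (n i) (w i)) (fl (n i) \<tau>) \<and>
      quad_stat (n i) (S1 (n i) (w i)) (fl (n i) \<tau>) \<le> e) sequentially"
proof -
  have good: "y \<in> good_paths" using y by (simp add: degenerate_paths_def)
  have edge: "(\<lambda>i. edge (n i) (w i)) \<longlonglongrightarrow> 0"
    by (rule Lim_null_comparison[OF always_eventually dist]) (simp add: disturbance_def)
  have late: "(\<lambda>i. late_change a (n i) (w i)) \<longlonglongrightarrow> 0"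
    by (rule Lim_null_comparison[OF always_eventually dist]) (simp add: disturbance_def)
  note u = quad_uniform_Icc[OF edge_zero ab good n w d edge]
  show "uniform_limit {a..b} (\<lambda>i \<tau>. quad_stat (n i) (S2 (n i) (w i)) (n i - fl (n i) \<tau>)) (\<lambda>\<tau>. Q_fun (1 - \<tau>) (snd y)) sequentially"
    by (rule u(2))
  have a_in: "a \<in> {a..b}" using ab by simp
  have "(\<lambda>i. quad_stat (n i) (S2 (n i) (w i)) (n i - fl (n i) a)) \<longlonglongrightarrow> Q_fun (1 - a) (snd y)"
    by (rule tendsto_uniform_limitI[OF u(2) a_in])
  then have "eventually (\<lambda>i. 0 < quad_stat (n i) (S2 (n i) (w i)) (n i - fl (n i) a)) sequentially"
    by (rule order_tendstoD(1)) (use y in \<open>simp add: degenerate_paths_def\<close>)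
  moreover have "eventually (\<lambda>i. late_change a (n i) (w i) < 1) sequentially"
    by (rule order_tendstoD(2)[OF late]) simp
  moreover have "eventually (\<lambda>i. 0 < real (fl (n i) a) / real (n i)) sequentially"
    by (rule order_tendstoD(1)[OF fl_tendsto[OF n tendsto_const]]) (use ab in auto)
  ultimately show "eventually (\<lambda>i. \<forall>\<tau>\<in>{a..b}. 0 < quad_stat (n i) (S1 (n i) (w i)) (fl (n i) \<tau>) \<and>
      quad_stat (n i) (S1 (n i) (w i)) (fl (n i) \<tau>) \<le> e) sequentially"
    using uniform_limit_eventually_le[OF u(1) e] eventually_scaling[OF n]
  proof eventually_elim
    case (elim i)
    \<comment> \<open>A sample constant for ever would have backward functional 0 at
      \<open>a\<close>, contrary to its positive limit; as \<open>late_change\<close> is below 1,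
      the sample is then not constant up to \<open>fl (n i) a\<close> either.\<close>
    have "w i \<notin> constant_forever" using bwd_constant[of "w i" "n i - fl (n i) a" "n i"] elim(1)
      by (metis diff_le_self less_irrefl)
    then have change: "w i \<notin> constant_upto (fl (n i) a)"
      using elim(2) by (auto simp: late_change_def indicator_def)
    have fl_pos: "0 < fl (n i) a" using elim(3) by (simp add: zero_less_divide_iff)
    show ?case
    proof
      fix \<tau> assume \<tau>: "\<tau> \<in> {a..b}"
      let ?q = "quad_stat (n i) (S1 (n i) (w i)) (fl (n i) \<tau>)"
      have le: "fl (n i) a \<le> fl (n i) \<tau>" using \<tau> by (intro fl_mono) simp
      have "constant_upto (fl (n i) \<tau>) \<subseteq> constant_upto (fl (n i) a)"
        by (rule constant_upto_antimono[OF le])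
      then have "w i \<notin> constant_upto (fl (n i) \<tau>)" using change by blast
      have "?q \<noteq> 0"
      proof
        assume "?q = 0"
        then have "w i \<in> constant_upto (fl (n i) \<tau>)"
          by (rule constant_of_fwd_quad_0[OF w]) (use elim(5) less_le_trans[OF fl_pos le] in simp_all)
        with \<open>w i \<notin> constant_upto (fl (n i) \<tau>)\<close> show False by contradiction
      qed
      moreover have "0 \<le> ?q" by (rule quad_stat_nonneg)
      \<comment> \<open>This uses the zeros of the path on all of \<open>{0..\<tau>}\<close>, which
        is why they had to be extended from \<open>{a..b}\<close> down to time 0.\<close>
      moreover have "Q_fun \<tau> (fst y) = 0"
      proof -
        have y1: "continuous_on {0..\<upsilon>1} (fst y)" "fst y 0 = 0" using good by (simp_all add: good_paths_def)
        have z: "fst y u = 0" if "u \<in> {0..\<tau>}" for u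
          using y that \<tau> unfolding degenerate_paths_def by auto
        have "\<forall>u\<in>{0..\<tau>}. fst y u = u / \<tau> * fst y \<tau>"
        proof
          fix u assume "u \<in> {0..\<tau>}"
          then have "fst y u = 0" "fst y \<tau> = 0" by (auto intro: z)
          then show "fst y u = u / \<tau> * fst y \<tau>" by simp
        qed
        moreover have "0 < \<tau>" "\<tau> \<le> \<upsilon>1" using \<tau> ab by auto
        ultimately show ?thesis using Q_fun_eq_0_iff[OF y1] by blast
      qed
      moreover have "\<bar>?q - Q_fun \<tau> (fst y)\<bar> \<le> e" using elim(4) \<tau> by blast
      ultimately show "0 < ?q \<and> ?q \<le> e" by linarith
    qed
  qed
qed

text \<open>\<open>L\<close> is a functional of the numerator with positive limit
  \<open>l y\<close>, and denominators of size at most \<open>e\<close> keep the statistic above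
  \<open>L i / e\<close>. Since \<open>e\<close> is arbitrary, every bound is exceeded; the three
  statistics differ only in the choice of \<open>L\<close>.\<close>

lemma tends_to_infinity_if_bounded_below:
  fixes R :: "nat \<Rightarrow> 'a \<Rightarrow> real" and l :: "_ \<Rightarrow> real"
  assumes R: "\<And>n. R n \<in> borel_measurable M" and G: "AE \<omega> in N. Y \<omega> \<in> G" "G \<subseteq> degenerate_paths"
    and l: "\<And>y. y \<in> G \<Longrightarrow> 0 < l y"
    and low: "\<And>y n w. y \<in> G \<Longrightarrow> filterlim n at_top sequentially \<Longrightarrow>
      uniform_limit {a..b} (\<lambda>i \<tau>. quad_stat (n i) (S2 (n i) (w i)) (n i - fl (n i) \<tau>)) (\<lambda>\<tau>. Q_fun (1 - \<tau>) (snd y)) sequentially \<Longrightarrow>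
      \<exists>L. (L \<longlonglongrightarrow> l y) \<and> (\<forall>e>0. \<forall>i::nat. 0 < n i \<longrightarrow> \<gamma>1 (n i) \<noteq> 0 \<longrightarrow> \<gamma>2 (n i) \<noteq> 0 \<longrightarrow>
        (\<forall>\<tau>\<in>{a..b}. 0 < quad_stat (n i) (S1 (n i) (w i)) (fl (n i) \<tau>) \<and> quad_stat (n i) (S1 (n i) (w i)) (fl (n i) \<tau>) \<le> e) \<longrightarrow>
        0 \<le> L i \<longrightarrow> L i / e \<le> R (n i) (w i))"
  shows "tends_to_infinity_in_prob M R"
proof (rule tends_to_infinity_mapping[OF R disturbance_tends_to_zero G(1)])
  fix y n w K
  assume *: "y \<in> G" "y \<in> mspace m" "filterlim n at_top sequentially" "\<And>i. w i \<in> space M"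
    "(\<lambda>i. mdist m (Xs (n i) (w i)) y) \<longlonglongrightarrow> 0" "(\<lambda>i. disturbance (n i) (w i)) \<longlonglongrightarrow> 0"
  have y: "y \<in> degenerate_paths" using * G(2) by blast
  \<comment> \<open>With this \<open>e\<close> a numerator of \<open>l y / 2\<close> already makes
    the quotient equal to \<open>\<bar>K\<bar> + 1\<close>.\<close>
  define e where "e = l y / 2 / (\<bar>K\<bar> + 1)"
  have e: "0 < e" using l[OF *(1)] by (simp add: e_def)
  note lim = degenerate_limits[OF y *(3-6) e]
  obtain L where L: "L \<longlonglongrightarrow> l y" "\<And>i. 0 < n i \<Longrightarrow> \<gamma>1 (n i) \<noteq> 0 \<Longrightarrow> \<gamma>2 (n i) \<noteq> 0 \<Longrightarrow>
      (\<forall>\<tau>\<in>{a..b}. 0 < quad_stat (n i) (S1 (n i) (w i)) (fl (n i) \<tau>) \<and> quad_stat (n i) (S1 (n i) (w i)) (fl (n i) \<tau>) \<le> e) \<Longrightarrow>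
      0 \<le> L i \<Longrightarrow> L i / e \<le> R (n i) (w i)"
    using low[OF *(1,3) lim(1)] e by blast
  have "eventually (\<lambda>i. l y / 2 < L i) sequentially"
    by (rule order_tendstoD(1)[OF L(1)]) (use l[OF *(1)] in simp)
  then show "eventually (\<lambda>i. K < R (n i) (w i)) sequentially"
    using lim(2) eventually_scaling[OF *(3)]
  proof eventually_elim
    case (elim i)
    have "0 \<le> L i" using elim(1) l[OF *(1)] by linarith
    then have "L i / e \<le> R (n i) (w i)" using elim by (intro L(2)) blast+
    moreover have "l y / 2 / e < L i / e" using elim(1) e by (intro divide_strict_right_mono)
    moreover have "l y / 2 / e = \<bar>K\<bar> + 1"
    proof -
      have "\<bar>K\<bar> + 1 \<noteq> 0" by linarith
      then have "(\<bar>K\<bar> + 1) * e = l y / 2"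
        unfolding e_def by (subst times_divide_eq_right) (rule nonzero_mult_div_cancel_left)
      then show ?thesis using e by (subst divide_eq_eq) simp
    qed
    ultimately show ?case by linarith
  qed
qed

lemma quotient_ge:
  assumes "\<forall>\<tau>\<in>{a..b}. 0 < quad_stat n S (fl n \<tau>) \<and> quad_stat n S (fl n \<tau>) \<le> e" "\<tau> \<in> {a..b}"
  shows "quad_stat n S' k / e \<le> quad_stat n S' k / quad_stat n S (fl n \<tau>)"
  using assms by (intro divide_left_mono quad_stat_nonneg) (auto intro!: mult_pos_pos intro: less_le_trans)

text \<open>\<open>L\<close> is the numerator at \<open>a\<close> for the supremum, its integral for
  the integral, and its infimum for \<open>R_stat\<close>. The last has a positive limit when the
  limiting numerator is positive at \<open>b\<close>, the shortest backward time, from where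
  positivity spreads over the interval.\<close>

theorem statistics_tend_to_infinity:
  shows "tends_to_infinity_in_prob M (\<lambda>n \<omega>. (\<gamma>1 n / \<gamma>2 n)^2 * W_stat {a..b} n (\<lambda>j. X j \<omega>))" (is ?W)
    and "tends_to_infinity_in_prob M (\<lambda>n \<omega>. (\<gamma>1 n / \<gamma>2 n)^2 * I_stat {a..b} n (\<lambda>j. X j \<omega>))" (is ?I)
    and "(AE \<omega> in N. 0 < Q_fun (1 - b) (snd (Y \<omega>))) \<Longrightarrow>
      tends_to_infinity_in_prob M (\<lambda>n \<omega>. (\<gamma>1 n / \<gamma>2 n)^2 * R_stat {a..b} n (\<lambda>j. X j \<omega>))" (is "_ \<Longrightarrow> ?R")
proof -
  have ab': "a \<le> b" and ne: "{a..b} \<noteq> {}" and a_in: "a \<in> {a..b}" using ab by simp_all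
  have good: "y \<in> good_paths" if "y \<in> degenerate_paths" for y using that by (simp add: degenerate_paths_def)
  note Qc = Q_continuous_Icc(2)[OF edge_zero ab good]
  have Qnn: "0 \<le> Q_fun (1 - \<tau>) (snd y)" if "y \<in> degenerate_paths" "\<tau> \<in> {a..b}" for y \<tau>
    using good[OF that(1)] that(2) ab by (intro Q_fun_nonneg[of "1 - \<upsilon>0"]) (auto simp: good_paths_def)
  show ?W
  proof (rule tends_to_infinity_if_bounded_below[OF statistics_measurable(1)[OF X] AE_degenerate_paths order_refl])
    show "0 < Q_fun (1 - a) (snd y)" if "y \<in> degenerate_paths" for y using that by (simp add: degenerate_paths_def)
    fix y n w
    assume u: "uniform_limit {a..b} (\<lambda>i \<tau>. quad_stat (n i) (S2 (n i) (w i)) (n i - fl (n i) \<tau>)) (\<lambda>\<tau>. Q_fun (1 - \<tau>) (snd y)) sequentially"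
    show "\<exists>L. (L \<longlonglongrightarrow> Q_fun (1 - a) (snd y)) \<and> (\<forall>e>0. \<forall>i. 0 < n i \<longrightarrow> \<gamma>1 (n i) \<noteq> 0 \<longrightarrow> \<gamma>2 (n i) \<noteq> 0 \<longrightarrow>
        (\<forall>\<tau>\<in>{a..b}. 0 < quad_stat (n i) (S1 (n i) (w i)) (fl (n i) \<tau>) \<and> quad_stat (n i) (S1 (n i) (w i)) (fl (n i) \<tau>) \<le> e) \<longrightarrow>
        0 \<le> L i \<longrightarrow> L i / e \<le> (\<gamma>1 (n i) / \<gamma>2 (n i))^2 * W_stat {a..b} (n i) (\<lambda>j. X j (w i)))"
    proof (intro exI conjI allI impI)
      show "(\<lambda>i. quad_stat (n i) (S2 (n i) (w i)) (n i - fl (n i) a)) \<longlonglongrightarrow> Q_fun (1 - a) (snd y)"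
        by (rule tendsto_uniform_limitI[OF u a_in])
      fix e :: real and i
      assume e: "0 < e" and n: "0 < n i" "\<gamma>1 (n i) \<noteq> 0" "\<gamma>2 (n i) \<noteq> 0"
        and q: "\<forall>\<tau>\<in>{a..b}. 0 < quad_stat (n i) (S1 (n i) (w i)) (fl (n i) \<tau>) \<and> quad_stat (n i) (S1 (n i) (w i)) (fl (n i) \<tau>) \<le> e"
      have "quad_stat (n i) (S2 (n i) (w i)) (n i - fl (n i) a) / e
          \<le> quad_stat (n i) (S2 (n i) (w i)) (n i - fl (n i) a) / quad_stat (n i) (S1 (n i) (w i)) (fl (n i) a)"
        by (rule quotient_ge[OF q a_in])
      also have "\<dots> \<le> (SUP \<tau>\<in>{a..b}. quad_stat (n i) (S2 (n i) (w i)) (n i - fl (n i) \<tau>) / quad_stat (n i) (S1 (n i) (w i)) (fl (n i) \<tau>))"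
        by (rule cSUP_upper[OF a_in bdd_above_finite[OF finite_image_fl]])
      also have "\<dots> = (\<gamma>1 (n i) / \<gamma>2 (n i))^2 * W_stat {a..b} (n i) (\<lambda>j. X j (w i))"
        by (rule scaled_W[OF n ab', symmetric])
      finally show "quad_stat (n i) (S2 (n i) (w i)) (n i - fl (n i) a) / e \<le> (\<gamma>1 (n i) / \<gamma>2 (n i))^2 * W_stat {a..b} (n i) (\<lambda>j. X j (w i))" .
    qed
  qed
  show ?I
  proof (rule tends_to_infinity_if_bounded_below[OF statistics_measurable(2)[OF X] AE_degenerate_paths order_refl])
    show "0 < (LBINT \<tau>:{a..b}. Q_fun (1 - \<tau>) (snd y))" if y: "y \<in> degenerate_paths" for y
    proof -
      have eq: "(LBINT \<tau>:{a..b}. Q_fun (1 - \<tau>) (snd y)) = integral {a..b} (\<lambda>\<tau>. Q_fun (1 - \<tau>) (snd y))"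
        by (rule set_borel_integral_eq_integral(2)[OF borel_integrable_atLeastAtMost'[OF Qc[OF y]]])
      have "integral {a..b} (\<lambda>\<tau>. Q_fun (1 - \<tau>) (snd y)) \<noteq> 0"
      proof
        assume "integral {a..b} (\<lambda>\<tau>. Q_fun (1 - \<tau>) (snd y)) = 0"
        then have "\<forall>\<tau>\<in>{a..b}. Q_fun (1 - \<tau>) (snd y) = 0"
          using integral_eq_0_iff[OF Qc[OF y] ab(2) Qnn[OF y]] by blast
        then have "Q_fun (1 - a) (snd y) = 0" using a_in by blast
        then show False using y by (simp add: degenerate_paths_def)
      qed
      moreover have "0 \<le> integral {a..b} (\<lambda>\<tau>. Q_fun (1 - \<tau>) (snd y))"
        by (rule Henstock_Kurzweil_Integration.integral_nonneg[OF integrable_continuous_real[OF Qc[OF y]] Qnn[OF y]])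
      ultimately show ?thesis unfolding eq by linarith
    qed
    fix y n w
    assume y: "y \<in> degenerate_paths" and u: "uniform_limit {a..b} (\<lambda>i \<tau>. quad_stat (n i) (S2 (n i) (w i)) (n i - fl (n i) \<tau>)) (\<lambda>\<tau>. Q_fun (1 - \<tau>) (snd y)) sequentially"
    show "\<exists>L. (L \<longlonglongrightarrow> (LBINT \<tau>:{a..b}. Q_fun (1 - \<tau>) (snd y))) \<and> (\<forall>e>0. \<forall>i. 0 < n i \<longrightarrow> \<gamma>1 (n i) \<noteq> 0 \<longrightarrow> \<gamma>2 (n i) \<noteq> 0 \<longrightarrow>
        (\<forall>\<tau>\<in>{a..b}. 0 < quad_stat (n i) (S1 (n i) (w i)) (fl (n i) \<tau>) \<and> quad_stat (n i) (S1 (n i) (w i)) (fl (n i) \<tau>) \<le> e) \<longrightarrow>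
        0 \<le> L i \<longrightarrow> L i / e \<le> (\<gamma>1 (n i) / \<gamma>2 (n i))^2 * I_stat {a..b} (n i) (\<lambda>j. X j (w i)))"
    proof (intro exI conjI allI impI)
      show "(\<lambda>i. LBINT \<tau>:{a..b}. quad_stat (n i) (S2 (n i) (w i)) (n i - fl (n i) \<tau>)) \<longlonglongrightarrow> (LBINT \<tau>:{a..b}. Q_fun (1 - \<tau>) (snd y))"
        by (rule uniform_limit_set_integral[OF u ab(2) step_set_integrable borel_integrable_atLeastAtMost'[OF Qc[OF y]]])
      fix e :: real and i
      assume e: "0 < e" and n: "0 < n i" "\<gamma>1 (n i) \<noteq> 0" "\<gamma>2 (n i) \<noteq> 0"
        and q: "\<forall>\<tau>\<in>{a..b}. 0 < quad_stat (n i) (S1 (n i) (w i)) (fl (n i) \<tau>) \<and> quad_stat (n i) (S1 (n i) (w i)) (fl (n i) \<tau>) \<le> e"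
      have "(LBINT \<tau>:{a..b}. quad_stat (n i) (S2 (n i) (w i)) (n i - fl (n i) \<tau>)) / e
          = (LBINT \<tau>:{a..b}. quad_stat (n i) (S2 (n i) (w i)) (n i - fl (n i) \<tau>) / e)"
        by (rule set_integral_divide_zero[symmetric])
      also have "\<dots> \<le> (LBINT \<tau>:{a..b}. quad_stat (n i) (S2 (n i) (w i)) (n i - fl (n i) \<tau>) / quad_stat (n i) (S1 (n i) (w i)) (fl (n i) \<tau>))"
        by (rule set_integral_mono[OF
            step_set_integrable[of a b "\<lambda>k. quad_stat (n i) (S2 (n i) (w i)) (n i - k) / e" "n i"]
            step_set_integrable[of a b "\<lambda>k. quad_stat (n i) (S2 (n i) (w i)) (n i - k) / quad_stat (n i) (S1 (n i) (w i)) k" "n i"]])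
           (rule quotient_ge[OF q])
      also have "\<dots> = (\<gamma>1 (n i) / \<gamma>2 (n i))^2 * I_stat {a..b} (n i) (\<lambda>j. X j (w i))"
        by (rule scaled_I[OF n, symmetric])
      finally show "(LBINT \<tau>:{a..b}. quad_stat (n i) (S2 (n i) (w i)) (n i - fl (n i) \<tau>)) / e
          \<le> (\<gamma>1 (n i) / \<gamma>2 (n i))^2 * I_stat {a..b} (n i) (\<lambda>j. X j (w i))" .
    qed
  qed
  show ?R if posb: "AE \<omega> in N. 0 < Q_fun (1 - b) (snd (Y \<omega>))"
  proof (rule tends_to_infinity_if_bounded_below[OF statistics_measurable(3)[OF X]])
    define G where "G = {y \<in> degenerate_paths. 0 < Q_fun (1 - b) (snd y)}"
    show "AE \<omega> in N. Y \<omega> \<in> G" using AE_degenerate_paths posb by eventually_elim (simp add: G_def)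
    show G: "G \<subseteq> degenerate_paths" by (auto simp: G_def)
    show "0 < (INF \<tau>\<in>{a..b}. Q_fun (1 - \<tau>) (snd y))" if y: "y \<in> G" for y
    proof -
      have yd: "y \<in> degenerate_paths" using y G by blast
      have gp: "continuous_on {0..1 - \<upsilon>0} (snd y)" "snd y 0 = 0" using good[OF yd] by (simp_all add: good_paths_def)
      have pos: "0 < Q_fun (1 - \<tau>) (snd y)" if "\<tau> \<in> {a..b}" for \<tau>
        using that ab y by (intro Q_fun_pos_mono[OF gp, of "1 - b" "1 - \<tau>"]) (auto simp: G_def)
      obtain c where c: "0 < c" "\<And>\<tau>. \<tau> \<in> {a..b} \<Longrightarrow> c \<le> Q_fun (1 - \<tau>) (snd y)"
        using positive_lower_bound_Icc[OF edge_zero ab Qc[OF yd]] pos by blast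
      have "c \<le> (INF \<tau>\<in>{a..b}. Q_fun (1 - \<tau>) (snd y))" by (rule cINF_greatest[OF ne c(2)])
      with c(1) show ?thesis by linarith
    qed
    fix y n w
    assume "y \<in> G" and u: "uniform_limit {a..b} (\<lambda>i \<tau>. quad_stat (n i) (S2 (n i) (w i)) (n i - fl (n i) \<tau>)) (\<lambda>\<tau>. Q_fun (1 - \<tau>) (snd y)) sequentially"
    then have y: "y \<in> degenerate_paths" using G by blast
    show "\<exists>L. (L \<longlonglongrightarrow> (INF \<tau>\<in>{a..b}. Q_fun (1 - \<tau>) (snd y))) \<and> (\<forall>e>0. \<forall>i. 0 < n i \<longrightarrow> \<gamma>1 (n i) \<noteq> 0 \<longrightarrow> \<gamma>2 (n i) \<noteq> 0 \<longrightarrow>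
        (\<forall>\<tau>\<in>{a..b}. 0 < quad_stat (n i) (S1 (n i) (w i)) (fl (n i) \<tau>) \<and> quad_stat (n i) (S1 (n i) (w i)) (fl (n i) \<tau>) \<le> e) \<longrightarrow>
        0 \<le> L i \<longrightarrow> L i / e \<le> (\<gamma>1 (n i) / \<gamma>2 (n i))^2 * R_stat {a..b} (n i) (\<lambda>j. X j (w i)))"
    proof (intro exI conjI allI impI)
      show "(\<lambda>i. INF \<tau>\<in>{a..b}. quad_stat (n i) (S2 (n i) (w i)) (n i - fl (n i) \<tau>)) \<longlonglongrightarrow> (INF \<tau>\<in>{a..b}. Q_fun (1 - \<tau>) (snd y))"
        by (rule uniform_limit_INF[OF u ne bdd_below_finite[OF finite_image_fl]
              bounded_continuous_Icc(3)[OF edge_zero ab Qc[OF y]]])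
      fix e :: real and i
      assume e: "0 < e" and n: "0 < n i" "\<gamma>1 (n i) \<noteq> 0" "\<gamma>2 (n i) \<noteq> 0"
        and q: "\<forall>\<tau>\<in>{a..b}. 0 < quad_stat (n i) (S1 (n i) (w i)) (fl (n i) \<tau>) \<and> quad_stat (n i) (S1 (n i) (w i)) (fl (n i) \<tau>) \<le> e"
        and nonneg: "0 \<le> (INF \<tau>\<in>{a..b}. quad_stat (n i) (S2 (n i) (w i)) (n i - fl (n i) \<tau>))"
      let ?D = "INF \<tau>\<in>{a..b}. quad_stat (n i) (S1 (n i) (w i)) (fl (n i) \<tau>)"
      \<comment> \<open>The infimum runs over finitely many values, so it is attained and inherits
        positivity.\<close>
      have "?D \<in> (\<lambda>\<tau>. quad_stat (n i) (S1 (n i) (w i)) (fl (n i) \<tau>)) ` {a..b}"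
        using finite_image_fl ne by (subst cInf_eq_Min) (auto intro!: Min_in finite_image_fl)
      then have D: "0 < ?D" "?D \<le> e" using q by auto
      have "(INF \<tau>\<in>{a..b}. quad_stat (n i) (S2 (n i) (w i)) (n i - fl (n i) \<tau>)) / e
          \<le> (INF \<tau>\<in>{a..b}. quad_stat (n i) (S2 (n i) (w i)) (n i - fl (n i) \<tau>)) / ?D"
        using D e nonneg by (intro divide_left_mono mult_pos_pos)
      also have "\<dots> = (\<gamma>1 (n i) / \<gamma>2 (n i))^2 * R_stat {a..b} (n i) (\<lambda>j. X j (w i))"
        by (rule scaled_R[OF n ab', symmetric])
      finally show "(INF \<tau>\<in>{a..b}. quad_stat (n i) (S2 (n i) (w i)) (n i - fl (n i) \<tau>)) / e
          \<le> (\<gamma>1 (n i) / \<gamma>2 (n i))^2 * R_stat {a..b} (n i) (\<lambda>j. X j (w i))" .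
    qed
  qed
qed

end

end

section \<open>From the measurable version back to the given limit process\<close>

lemma converges_weakly_cong_AE:
  assumes "converges_weakly m M Xs N Y" "AE \<omega> in N. Y' \<omega> = Y \<omega>"
  shows "converges_weakly m M Xs N Y'"
proof -
  obtain Z where Z: "Z \<in> N \<rightarrow>\<^sub>M ball_sigma m" "AE \<omega> in N. Y \<omega> = Z \<omega>"
    "\<forall>f. f \<in> borel_measurable (ball_sigma m) \<and> continuous_map (mtopology_of m) euclideanreal f \<and>
      bounded (f ` mspace m) \<longrightarrow> (\<lambda>n. \<integral>\<omega>. f (Xs n \<omega>) \<partial>M) \<longlonglongrightarrow> (\<integral>\<omega>. f (Z \<omega>) \<partial>N)"
    and X: "\<forall>n. Xs n \<in> M \<rightarrow>\<^sub>M ball_sigma m"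
    using assms(1) unfolding converges_weakly_def by blast
  have "AE \<omega> in N. Y' \<omega> = Z \<omega>" using assms(2) Z(2) by eventually_elim simp
  with Z(1,3) X show ?thesis unfolding converges_weakly_def by blast
qed

lemma converges_in_law_cong_AE:
  assumes "converges_in_law M T N Y" "AE \<omega> in N. Y' \<omega> = Y \<omega>"
  shows "converges_in_law M T N Y'"
proof -
  obtain Z where Z: "Z \<in> borel_measurable N" "AE \<omega> in N. Y \<omega> = Z \<omega>"
    "weak_conv_m (\<lambda>n. distr M borel (T n)) (distr N borel Z)" and T: "\<forall>n. T n \<in> borel_measurable M"
    using assms(1) unfolding converges_in_law_def by blast
  have "AE \<omega> in N. Y' \<omega> = Z \<omega>" using assms(2) Z(2) by eventually_elim simp
  with Z(1,3) T show ?thesis unfolding converges_in_law_def by blast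
qed

theorem proposition4p1:
  fixes M :: "'a measure" and N :: "'b measure"
    and X :: "nat \<Rightarrow> 'a \<Rightarrow> real"
    and Z1 Z2 :: "'b \<Rightarrow> real \<Rightarrow> real"
    and \<gamma>1 \<gamma>2 A1 A2 :: "nat \<Rightarrow> real"
    and \<upsilon>0 \<upsilon>1 \<tau>l \<tau>u :: real
    and T :: "real set"
  assumes "prob_space M" and "prob_space N"
    and "\<And>j. 1 \<le> j \<Longrightarrow> X j \<in> borel_measurable M"
    and "0 < \<tau>l" and "\<tau>l < \<tau>u" and "\<tau>u < 1" and "T = {\<tau>l..\<tau>u}"
    and "0 \<le> \<upsilon>0" and "\<upsilon>0 < \<upsilon>1" and "\<upsilon>1 \<le> 1"
    and "filterlim \<gamma>1 at_top sequentially" and "filterlim \<gamma>2 at_top sequentially"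
    and conv: "converges_weakly_D2 0 \<upsilon>1 0 (1 - \<upsilon>0)
      M (\<lambda>n \<omega> \<tau>. (psum (\<lambda>j. X j \<omega>) (fl n \<tau>) - real (fl n \<tau>) * A1 n) / \<gamma>1 n)
        (\<lambda>n \<omega> \<tau>. (psum_star n (\<lambda>j. X j \<omega>) (fl n \<tau>) - real (fl n \<tau>) * A2 n) / \<gamma>2 n)
      N Z1 Z2"
    and cont: "AE \<omega> in N. continuous_on {\<upsilon>0..\<upsilon>1} (Z1 \<omega>) \<and>
                         continuous_on {1 - \<upsilon>1..1 - \<upsilon>0} (Z2 \<omega>)"
    \<comment> \<open>Only relevant if \<open>\<upsilon>0 > 0\<close> and the limit \<open>Z2\<close> is a.s. linear: at \<open>\<tau> = \<upsilon>0\<close> the statistic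
        \<open>V\<^sup>*\<close> involves one observation that the range \<open>[0, 1 - \<upsilon>0]\<close> in \<open>conv\<close> may leave out.\<close>
    and edge: "\<lbrakk>0 < \<upsilon>0;
        AE \<omega> in N. \<forall>\<tau>\<in>{0..1 - \<upsilon>0}. Z2 \<omega> \<tau> = \<tau> / (1 - \<upsilon>0) * Z2 \<omega> (1 - \<upsilon>0)\<rbrakk>
      \<Longrightarrow> tends_to_zero_in_prob M (\<lambda>n \<omega>. (X (fl n \<upsilon>0 + 1) \<omega> - A2 n) / \<gamma>2 n)"
  shows
    \<comment> \<open>(i)\<close>
    "(\<forall>\<upsilon> \<upsilon>'. 0 < \<upsilon> \<and> \<upsilon> < \<upsilon>1 \<and> \<upsilon>0 < \<upsilon>' \<and> \<upsilon>' < 1 \<longrightarrow>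
        converges_weakly_D2 \<upsilon> \<upsilon>1 \<upsilon>0 \<upsilon>'
          M (\<lambda>n \<omega> \<tau>. real n / (\<gamma>1 n)^2 * V_stat (\<lambda>j. X j \<omega>) (fl n \<tau>))
            (\<lambda>n \<omega> \<tau>. real n / (\<gamma>2 n)^2 * V_star_stat n (\<lambda>j. X j \<omega>) (n - fl n \<tau>))
          N (\<lambda>\<omega> \<tau>. Q_fun \<tau> (Z1 \<omega>)) (\<lambda>\<omega> \<tau>. Q_fun (1 - \<tau>) (Z2 \<omega>)))
     \<and> (AE \<omega> in N. continuous_on {\<upsilon>0<..\<upsilon>1} (\<lambda>\<tau>. Q_fun \<tau> (Z1 \<omega>)) \<and>
                   continuous_on {\<upsilon>0..<\<upsilon>1} (\<lambda>\<tau>. Q_fun (1 - \<tau>) (Z2 \<omega>)))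
     \<comment> \<open>(ii)\<close>
     \<and> (T \<subseteq> {\<upsilon>0..\<upsilon>1} \<and> (\<forall>\<tau>\<in>T. AE \<omega> in N. Q_fun \<tau> (Z1 \<omega>) > 0) \<longrightarrow>
          converges_in_law M (\<lambda>n \<omega>. (\<gamma>1 n / \<gamma>2 n)^2 * W_stat T n (\<lambda>j. X j \<omega>))
            N (\<lambda>\<omega>. SUP \<tau>\<in>T. Q_fun (1 - \<tau>) (Z2 \<omega>) / Q_fun \<tau> (Z1 \<omega>))
        \<and> converges_in_law M (\<lambda>n \<omega>. (\<gamma>1 n / \<gamma>2 n)^2 * I_stat T n (\<lambda>j. X j \<omega>))
            N (\<lambda>\<omega>. LBINT \<tau>:T. Q_fun (1 - \<tau>) (Z2 \<omega>) / Q_fun \<tau> (Z1 \<omega>))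
        \<and> converges_in_law M (\<lambda>n \<omega>. (\<gamma>1 n / \<gamma>2 n)^2 * R_stat T n (\<lambda>j. X j \<omega>))
            N (\<lambda>\<omega>. (INF \<tau>\<in>T. Q_fun (1 - \<tau>) (Z2 \<omega>)) / (INF \<tau>\<in>T. Q_fun \<tau> (Z1 \<omega>))))
     \<comment> \<open>(iii); for \<open>R_stat\<close> the infimum of the limiting numerator must not vanish either\<close>
     \<and> (T \<subseteq> {\<upsilon>0..\<upsilon>1} \<and> (AE \<omega> in N. \<forall>\<tau>\<in>T. Z1 \<omega> \<tau> = 0) \<and>
        nondegenerate_on N T (\<lambda>\<omega> \<tau>. Q_fun (1 - \<tau>) (Z2 \<omega>)) \<longrightarrow>
          tends_to_infinity_in_prob M (\<lambda>n \<omega>. (\<gamma>1 n / \<gamma>2 n)^2 * W_stat T n (\<lambda>j. X j \<omega>))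
        \<and> tends_to_infinity_in_prob M (\<lambda>n \<omega>. (\<gamma>1 n / \<gamma>2 n)^2 * I_stat T n (\<lambda>j. X j \<omega>))
        \<and> ((\<forall>\<tau>\<in>T. AE \<omega> in N. Q_fun (1 - \<tau>) (Z2 \<omega>) > 0) \<longrightarrow>
            tends_to_infinity_in_prob M (\<lambda>n \<omega>. (\<gamma>1 n / \<gamma>2 n)^2 * R_stat T n (\<lambda>j. X j \<omega>))))"
proof -
  \<comment> \<open>\<open>Y\<close> is a ball-measurable version of the pair of restricted limit
    paths; the whole argument is carried out for it.\<close>
  obtain Y where Y: "Y \<in> N \<rightarrow>\<^sub>M ball_sigma (DD_metric 0 \<upsilon>1 0 (1 - \<upsilon>0))"
    and ZY: "AE \<omega> in N. (restrict (Z1 \<omega>) {0..\<upsilon>1}, restrict (Z2 \<omega>) {0..1 - \<upsilon>0}) = Y \<omega>"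
    and Xs: "\<And>n. (\<lambda>\<omega>. (path \<upsilon>1 n (fwd X A1 \<gamma>1 n \<omega>), path (1 - \<upsilon>0) n (bwd X A2 \<gamma>2 n \<omega>))) \<in>
      M \<rightarrow>\<^sub>M ball_sigma (DD_metric 0 \<upsilon>1 0 (1 - \<upsilon>0))"
    and test: "\<And>f :: _ \<Rightarrow> real. f \<in> borel_measurable (ball_sigma (DD_metric 0 \<upsilon>1 0 (1 - \<upsilon>0))) \<Longrightarrow>
      continuous_map (mtopology_of (DD_metric 0 \<upsilon>1 0 (1 - \<upsilon>0))) euclideanreal f \<Longrightarrow>
      bounded (f ` mspace (DD_metric 0 \<upsilon>1 0 (1 - \<upsilon>0))) \<Longrightarrow>
      (\<lambda>n. \<integral>\<omega>. f (path \<upsilon>1 n (fwd X A1 \<gamma>1 n \<omega>), path (1 - \<upsilon>0) n (bwd X A2 \<gamma>2 n \<omega>)) \<partial>M) \<longlonglongrightarrow> (\<integral>\<omega>. f (Y \<omega>) \<partial>N)"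
    using conv unfolding converges_weakly_D2_def converges_weakly_def path_def fwd_def bwd_def by blast
  have fst_eq: "AE \<omega> in N. \<forall>t\<in>{0..\<upsilon>1}. Z1 \<omega> t = fst (Y \<omega>) t"
    using ZY by eventually_elim (metis fst_conv restrict_apply')
  have snd_eq: "AE \<omega> in N. \<forall>t\<in>{0..1 - \<upsilon>0}. Z2 \<omega> t = snd (Y \<omega>) t"
    using ZY by eventually_elim (metis snd_conv restrict_apply')
  have wl: "weak_limit (DD_metric 0 \<upsilon>1 0 (1 - \<upsilon>0)) M N
      (\<lambda>n \<omega>. (path \<upsilon>1 n (fwd X A1 \<gamma>1 n \<omega>), path (1 - \<upsilon>0) n (bwd X A2 \<gamma>2 n \<omega>))) Y"
    by (rule weak_limit.intro[OF assms(1,2) Xs Y test])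
  have contY: "AE \<omega> in N. continuous_on {\<upsilon>0..\<upsilon>1} (fst (Y \<omega>)) \<and> continuous_on {1 - \<upsilon>1..1 - \<upsilon>0} (snd (Y \<omega>))"
    using cont fst_eq snd_eq
  proof eventually_elim
    case (elim \<omega>)
    have "continuous_on {\<upsilon>0..\<upsilon>1} (fst (Y \<omega>))"
      by (rule continuous_on_eq[OF conjunct1[OF elim(1)]], rule bspec[OF elim(2)]) (use \<open>0 \<le> \<upsilon>0\<close> in auto)
    moreover have "continuous_on {1 - \<upsilon>1..1 - \<upsilon>0} (snd (Y \<omega>))"
      by (rule continuous_on_eq[OF conjunct2[OF elim(1)]], rule bspec[OF elim(3)]) (use \<open>\<upsilon>1 \<le> 1\<close> in auto)
    ultimately show ?case by blast
  qed
  interpret partial_sum_limit M N X \<gamma>1 \<gamma>2 A1 A2 \<upsilon>0 \<upsilon>1 Y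
  proof (rule partial_sum_limit.intro)
    show "X j \<in> borel_measurable M" if "1 \<le> j" for j using that by (rule assms(3))
  qed (fact assms(8-12) wl contY)+
  have edge0: "tends_to_zero_in_prob M edge"
  proof (rule edge_tends_to_zero)
    assume pos: "0 < \<upsilon>0" and lin: "AE \<omega> in N. \<forall>\<tau>\<in>{0..1 - \<upsilon>0}. snd (Y \<omega>) \<tau> = \<tau> / (1 - \<upsilon>0) * snd (Y \<omega>) (1 - \<upsilon>0)"
    have "0 \<le> 1 - \<upsilon>0" using \<upsilon> by simp
    have "AE \<omega> in N. \<forall>\<tau>\<in>{0..1 - \<upsilon>0}. Z2 \<omega> \<tau> = \<tau> / (1 - \<upsilon>0) * Z2 \<omega> (1 - \<upsilon>0)"
      using lin snd_eq
    proof eventually_elim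
      case (elim \<omega>)
      have "Z2 \<omega> (1 - \<upsilon>0) = snd (Y \<omega>) (1 - \<upsilon>0)" by (rule bspec[OF elim(2)]) (use \<open>0 \<le> 1 - \<upsilon>0\<close> in simp)
      then show ?case using elim by metis
    qed
    then show "tends_to_zero_in_prob M (\<lambda>n \<omega>. (X (fl n \<upsilon>0 + 1) \<omega> - A2 n) / \<gamma>2 n)" by (rule edge[OF pos])
  qed
  \<comment> \<open>One null set serves all \<tau> at once, because \<open>Q_fun \<tau>\<close>
    depends on the path up to \<tau> only.\<close>
  have Q1: "AE \<omega> in N. \<forall>\<tau>\<in>{0<..\<upsilon>1}. Q_fun \<tau> (Z1 \<omega>) = Q_fun \<tau> (fst (Y \<omega>))"
    using fst_eq
  proof eventually_elim
    case (elim \<omega>)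
    show ?case by (intro ballI Q_fun_cong, rule bspec[OF elim]) auto
  qed
  have Q2: "AE \<omega> in N. \<forall>\<tau>\<in>{\<upsilon>0..<1}. Q_fun (1 - \<tau>) (Z2 \<omega>) = Q_fun (1 - \<tau>) (snd (Y \<omega>))"
    using snd_eq
  proof eventually_elim
    case (elim \<omega>)
    show ?case by (intro ballI Q_fun_cong, rule bspec[OF elim]) auto
  qed
  have i_weak: "converges_weakly_D2 u \<upsilon>1 \<upsilon>0 u'
      M (\<lambda>n \<omega> \<tau>. real n / (\<gamma>1 n)^2 * V_stat (\<lambda>j. X j \<omega>) (fl n \<tau>))
        (\<lambda>n \<omega> \<tau>. real n / (\<gamma>2 n)^2 * V_star_stat n (\<lambda>j. X j \<omega>) (n - fl n \<tau>))
      N (\<lambda>\<omega> \<tau>. Q_fun \<tau> (Z1 \<omega>)) (\<lambda>\<omega> \<tau>. Q_fun (1 - \<tau>) (Z2 \<omega>))"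
    if u: "0 < u" "u < \<upsilon>1" "\<upsilon>0 < u'" "u' < 1" for u u'
    unfolding converges_weakly_D2_def V_stat_eq[where A=A1] V_star_stat_eq[OF diff_le_self, where A=A2]
  proof (rule converges_weakly_cong_AE)
    show "converges_weakly (DD_metric u \<upsilon>1 \<upsilon>0 u') M
      (\<lambda>n \<omega>. (restrict (\<lambda>\<tau>. quad_stat n (S1 n \<omega>) (fl n \<tau>)) {u..\<upsilon>1}, restrict (\<lambda>\<tau>. quad_stat n (S2 n \<omega>) (n - fl n \<tau>)) {\<upsilon>0..u'}))
      N (\<lambda>\<omega>. Qpair u u' (Y \<omega>))"
      using Vpair_converges_weakly[OF edge0 u] unfolding Vpair_def[abs_def] .
    show "AE \<omega> in N. (restrict (\<lambda>\<tau>. Q_fun \<tau> (Z1 \<omega>)) {u..\<upsilon>1}, restrict (\<lambda>\<tau>. Q_fun (1 - \<tau>) (Z2 \<omega>)) {\<upsilon>0..u'})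
        = Qpair u u' (Y \<omega>)"
      using Q1 Q2
    proof eventually_elim
      case (elim \<omega>)
      have "restrict (\<lambda>\<tau>. Q_fun \<tau> (Z1 \<omega>)) {u..\<upsilon>1} = restrict (\<lambda>\<tau>. Q_fun \<tau> (fst (Y \<omega>))) {u..\<upsilon>1}"
        by (rule restrict_ext, rule bspec[OF elim(1)]) (use u in auto)
      moreover have "restrict (\<lambda>\<tau>. Q_fun (1 - \<tau>) (Z2 \<omega>)) {\<upsilon>0..u'} = restrict (\<lambda>\<tau>. Q_fun (1 - \<tau>) (snd (Y \<omega>))) {\<upsilon>0..u'}"
        by (rule restrict_ext, rule bspec[OF elim(2)]) (use u in auto)
      ultimately show ?case by (simp only: Qpair_def)
    qed
  qed
  have i_cont: "AE \<omega> in N. continuous_on {\<upsilon>0<..\<upsilon>1} (\<lambda>\<tau>. Q_fun \<tau> (Z1 \<omega>)) \<and>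
      continuous_on {\<upsilon>0..<\<upsilon>1} (\<lambda>\<tau>. Q_fun (1 - \<tau>) (Z2 \<omega>))"
    using AE_good_paths Q1 Q2
  proof eventually_elim
    case (elim \<omega>)
    have c1: "continuous_on {\<upsilon>0<..\<upsilon>1} (\<lambda>\<tau>. Q_fun \<tau> (fst (Y \<omega>)))"
      using elim(1) \<upsilon> by (intro continuous_on_subset[OF continuous_on_Q_fun[of \<upsilon>1]]) (auto simp: good_paths_def)
    have "continuous_on {0<..1 - \<upsilon>0} (\<lambda>t. Q_fun t (snd (Y \<omega>)))"
      using elim(1) by (intro continuous_on_Q_fun) (simp add: good_paths_def)
    then have c2: "continuous_on {\<upsilon>0..<\<upsilon>1} (\<lambda>\<tau>. Q_fun (1 - \<tau>) (snd (Y \<omega>)))"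
      by (rule continuous_on_compose2) (use \<upsilon> in \<open>auto intro!: continuous_intros\<close>)
    have "continuous_on {\<upsilon>0<..\<upsilon>1} (\<lambda>\<tau>. Q_fun \<tau> (Z1 \<omega>))"
      by (rule continuous_on_eq[OF c1], rule bspec[OF elim(2), symmetric]) (use \<upsilon> in auto)
    moreover have "continuous_on {\<upsilon>0..<\<upsilon>1} (\<lambda>\<tau>. Q_fun (1 - \<tau>) (Z2 \<omega>))"
      by (rule continuous_on_eq[OF c2], rule bspec[OF elim(3), symmetric]) (use \<upsilon> in auto)
    ultimately show ?case by blast
  qed
  have bounds: "\<upsilon>0 \<le> \<tau>l" "\<tau>u \<le> \<upsilon>1" if "T \<subseteq> {\<upsilon>0..\<upsilon>1}" using that assms(5,7) by auto
  have T1: "\<tau> \<in> {0<..\<upsilon>1}" and T2: "\<tau> \<in> {\<upsilon>0..<1}" if "T \<subseteq> {\<upsilon>0..\<upsilon>1}" "\<tau> \<in> T" for \<tau>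
    using bounds[OF that(1)] that(2) assms(4,6,7) by auto
  have Q1T: "AE \<omega> in N. \<forall>\<tau>\<in>T. Q_fun \<tau> (Z1 \<omega>) = Q_fun \<tau> (fst (Y \<omega>))" if "T \<subseteq> {\<upsilon>0..\<upsilon>1}"
    using Q1 by eventually_elim (use T1[OF that] in blast)
  have Q2T: "AE \<omega> in N. \<forall>\<tau>\<in>T. Q_fun (1 - \<tau>) (Z2 \<omega>) = Q_fun (1 - \<tau>) (snd (Y \<omega>))" if "T \<subseteq> {\<upsilon>0..\<upsilon>1}"
    using Q2 by eventually_elim (use T2[OF that] in blast)
  have l_in: "\<tau>l \<in> T" and u_in: "\<tau>u \<in> T" using assms(5,7) by auto
  have ii: "converges_in_law M (\<lambda>n \<omega>. (\<gamma>1 n / \<gamma>2 n)^2 * W_stat T n (\<lambda>j. X j \<omega>))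
        N (\<lambda>\<omega>. SUP \<tau>\<in>T. Q_fun (1 - \<tau>) (Z2 \<omega>) / Q_fun \<tau> (Z1 \<omega>))
      \<and> converges_in_law M (\<lambda>n \<omega>. (\<gamma>1 n / \<gamma>2 n)^2 * I_stat T n (\<lambda>j. X j \<omega>))
        N (\<lambda>\<omega>. LBINT \<tau>:T. Q_fun (1 - \<tau>) (Z2 \<omega>) / Q_fun \<tau> (Z1 \<omega>))
      \<and> converges_in_law M (\<lambda>n \<omega>. (\<gamma>1 n / \<gamma>2 n)^2 * R_stat T n (\<lambda>j. X j \<omega>))
        N (\<lambda>\<omega>. (INF \<tau>\<in>T. Q_fun (1 - \<tau>) (Z2 \<omega>)) / (INF \<tau>\<in>T. Q_fun \<tau> (Z1 \<omega>)))"
    if T: "T \<subseteq> {\<upsilon>0..\<upsilon>1}" and pos: "\<forall>\<tau>\<in>T. AE \<omega> in N. Q_fun \<tau> (Z1 \<omega>) > 0"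
  proof -
    have "AE \<omega> in N. 0 < Q_fun \<tau>l (fst (Y \<omega>))"
      using bspec[OF pos l_in] Q1T[OF T]
    proof eventually_elim
      case (elim \<omega>)
      show ?case using bspec[OF elim(2) l_in] elim(1) by (simp only:)
    qed
    note law = statistics_converge_in_law[OF edge0 assms(4-6) bounds[OF T] this, folded assms(7)]
    show ?thesis
    proof (intro conjI; rule converges_in_law_cong_AE)
      show "AE \<omega> in N. (SUP \<tau>\<in>T. Q_fun (1 - \<tau>) (Z2 \<omega>) / Q_fun \<tau> (Z1 \<omega>)) = (SUP \<tau>\<in>T. Q_fun (1 - \<tau>) (snd (Y \<omega>)) / Q_fun \<tau> (fst (Y \<omega>)))"
        using Q1T[OF T] Q2T[OF T] by eventually_elim (intro SUP_cong refl, simp)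
      show "AE \<omega> in N. (LBINT \<tau>:T. Q_fun (1 - \<tau>) (Z2 \<omega>) / Q_fun \<tau> (Z1 \<omega>)) = (LBINT \<tau>:T. Q_fun (1 - \<tau>) (snd (Y \<omega>)) / Q_fun \<tau> (fst (Y \<omega>)))"
        using Q1T[OF T] Q2T[OF T] by eventually_elim (rule set_lebesgue_integral_cong, simp_all add: assms(7))
      show "AE \<omega> in N. (INF \<tau>\<in>T. Q_fun (1 - \<tau>) (Z2 \<omega>)) / (INF \<tau>\<in>T. Q_fun \<tau> (Z1 \<omega>)) = (INF \<tau>\<in>T. Q_fun (1 - \<tau>) (snd (Y \<omega>))) / (INF \<tau>\<in>T. Q_fun \<tau> (fst (Y \<omega>)))"
        using Q1T[OF T] Q2T[OF T] by eventually_elim (intro arg_cong2[of _ _ _ _ "(/)"] INF_cong refl, simp_all)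
    qed (fact law)+
  qed
  have iii: "tends_to_infinity_in_prob M (\<lambda>n \<omega>. (\<gamma>1 n / \<gamma>2 n)^2 * W_stat T n (\<lambda>j. X j \<omega>))
      \<and> tends_to_infinity_in_prob M (\<lambda>n \<omega>. (\<gamma>1 n / \<gamma>2 n)^2 * I_stat T n (\<lambda>j. X j \<omega>))
      \<and> ((\<forall>\<tau>\<in>T. AE \<omega> in N. Q_fun (1 - \<tau>) (Z2 \<omega>) > 0) \<longrightarrow>
          tends_to_infinity_in_prob M (\<lambda>n \<omega>. (\<gamma>1 n / \<gamma>2 n)^2 * R_stat T n (\<lambda>j. X j \<omega>)))"
    if T: "T \<subseteq> {\<upsilon>0..\<upsilon>1}" and z: "AE \<omega> in N. \<forall>\<tau>\<in>T. Z1 \<omega> \<tau> = 0"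
      and nondeg: "nondegenerate_on N T (\<lambda>\<omega> \<tau>. Q_fun (1 - \<tau>) (Z2 \<omega>))"
  proof -
    have zY: "AE \<omega> in N. \<forall>\<tau>\<in>{\<tau>l..\<tau>u}. fst (Y \<omega>) \<tau> = 0"
      using z fst_eq
    proof eventually_elim
      case (elim \<omega>)
      show ?case unfolding assms(7)[symmetric]
      proof
        fix \<tau> assume \<tau>: "\<tau> \<in> T"
        then have "\<tau> \<in> {0..\<upsilon>1}" using T1[OF T \<tau>] by simp
        from bspec[OF elim(2) this] bspec[OF elim(1) \<tau>] show "fst (Y \<omega>) \<tau> = 0" by simp
      qed
    qed
    have ndY: "AE \<omega> in N. \<exists>\<tau>\<in>{\<tau>l..\<tau>u}. Q_fun (1 - \<tau>) (snd (Y \<omega>)) \<noteq> 0"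
      using nondeg[unfolded nondegenerate_on_def] Q2T[OF T]
    proof eventually_elim
      case (elim \<omega>)
      then obtain \<tau> where \<tau>: "\<tau> \<in> T" "Q_fun (1 - \<tau>) (Z2 \<omega>) \<noteq> 0" by blast
      then have "Q_fun (1 - \<tau>) (snd (Y \<omega>)) \<noteq> 0" using bspec[OF elim(2) \<tau>(1)] by simp
      then show ?case using \<tau>(1) unfolding assms(7) by blast
    qed
    note inf = statistics_tend_to_infinity[OF edge0 assms(4-6) bounds[OF T] zY ndY, folded assms(7)]
    have "AE \<omega> in N. 0 < Q_fun (1 - \<tau>u) (snd (Y \<omega>))" if pos: "\<forall>\<tau>\<in>T. AE \<omega> in N. Q_fun (1 - \<tau>) (Z2 \<omega>) > 0"
      using bspec[OF pos u_in] Q2T[OF T]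
    proof eventually_elim
      case (elim \<omega>)
      show ?case using bspec[OF elim(2) u_in] elim(1) by (simp only:)
    qed
    then show ?thesis using inf by blast
  qed
  show ?thesis using i_weak i_cont ii iii by blast
qed

end
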